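(* Let $f_0$ be a smooth function germ at the origin of $\mathbb{R}^2$ for which the surface $z=f_0(x,y)$ has a generic umbilic point at the origin, normalized as in the context. Consider a deformation $z=f(x,y;t)$ of the surface $z=f_0(x,y)$ depending on one parameter $t\in\mathbb{R}$, and assume that its projection on $T\approx\{\lambda,\mu\}$ is a curve $t\mapsto(\lambda(t),\mu(t))$ which at $\lambda=\mu=0$ (i.e. at $t=0$) is transversal to each of the lines $\mu=0$, $\mu=\sqrt{3}\,\lambda$, $\mu=-\sqrt{3}\,\lambda$. Label the branches of the unperturbed vertex set in such a way that for $t<0$ (small) the branch of the vertex set of $z=f(\cdot\,;t)$ not passing through the origin is a smooth $C^0$-small deformation of the two consecutive half-branches $C_1^+\cup C_2^+$ of the unperturbed vertex set. Then for $t>0$ (small) the branch of the vertex set of $z=f(\cdot\,;t)$ not passing through the origin is a smooth $C^0$-small deformation of the two opposite consecutive half-branches $C_1^-\cup C_2^-$.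
   Context: Surface. $f_0:\mathbb{R}^2\to\mathbb{R}$ is smooth with $f_0(0,0)=0$ and zero linear part at the origin, so the plane $z=0$ is the tangent plane of the surface $z=f_0(x,y)$ at the origin. The origin is a generic umbilic: the quadratic part $q_0$ of $f_0$ at the origin is a nonzero multiple of $x^2+y^2$, and $q_0$ does not divide the cubic part of $f_0$. The coordinates are chosen so that the cubic part is $ax^3+bx^2y+axy^2+cy^3$; genericity then means $b\neq c$. Deformation. A one-parameter deformation is $f(x,y;t)=f_0(x,y)+R(x,y;t)$ with $R:\mathbb{R}^2\times\mathbb{R}\to\mathbb{R}$ smooth, $R(\cdot\,;0)\equiv 0$, and, for all $t$, $R(0,0;t)=0$ and the linear part of $R(\cdot\,;t)$ at $(x,y)=(0,0)$ is zero. Projection on $T$. Let $Q$ be the $3$-dimensional space of quadratic forms on $\mathbb{R}^2$, with basis $x^2+y^2$, $x^2-y^2$, $2xy$, and let $T=q_0+\langle x^2-y^2,\,2xy\rangle_{\mathbb{R}}\subset Q$, an affine plane with coordinates $(\lambda,\mu)$ corresponding to $q_0+\lambda(x^2-y^2)+2\mu xy$. The projection of the deformation on $T$ is the curve sending $t$ to the natural projection on $T$ of the quadratic part of $f(\cdot\,;t)$ at the origin (projection along the line spanned by $x^2+y^2$, i.e. the coefficients $(\lambda(t),\mu(t))$ of $x^2-y^2$ and $2xy$). Transversality at $t=0$ to a line through the origin means that the velocity of the curve at $t=0$ does not lie in that line. Vertices and vertex set. A vertex of a smooth plane curve is a point where the osculating circle has tangency of order at least $3$ with the curve; equivalently, a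 critical point of the curvature. The vertex set of a surface $z=g(x,y)$ (with $g$ having zero $1$-jet at the origin) is the set traced out near the origin by all vertices of the level curves $g=k$ as $k$ varies, together with the origin. Vertex sets are considered in a fixed ball of small radius centered at $(x,y)=(0,0)$, with $t$ small relative to it. For such $t\neq0$ the vertex set is a union of two smooth branches through the origin and exactly one smooth branch not passing through the origin. Half-branches. The vertex set of the unperturbed surface $z=f_0$ at its generic umbilic point is (known) the union of three pairwise transverse smooth branches $C_1,C_2,C_3$ through the origin; each is the union $C_i=C_i^+\cup C_i^-$ of two half-branches issuing from the origin. Two half-branches are consecutive if they are adjacent in the cyclic order of the six half-branches around the origin. The labelling is such that this cyclic order is $C_1^+,C_2^+,C_3^+,C_1^-,C_2^-,C_3^-$. A $C^0$-small deformation of a union of two half-branches means a curve (depending on $t$) in the ball that is $C^0$-close to it, arbitrarily so as $t\to0$. *)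

theory Defs
  imports "HOL-Analysis.Analysis"
begin

text \<open>Smooth maps. Only used for open sets.\<close>

fun Ck_on :: "nat \<Rightarrow> 'a set \<Rightarrow> ('a::real_normed_vector \<Rightarrow> 'b::real_normed_vector) \<Rightarrow> bool" where
  "Ck_on 0 S f \<longleftrightarrow> continuous_on S f"
| "Ck_on (Suc k) S f \<longleftrightarrow>
     (\<forall>x\<in>S. f differentiable (at x)) \<and> (\<forall>v. Ck_on k S (\<lambda>x. frechet_derivative f (at x) v))"

definition smooth_on :: "'a set \<Rightarrow> ('a::real_normed_vector \<Rightarrow> 'b::real_normed_vector) \<Rightarrow> bool" where
  "smooth_on S f \<longleftrightarrow> (\<forall>k. Ck_on k S f)"

text \<open>The degree \<open>k\<close> homogeneous part of the Taylor expansion of \<open>g\<close> at the origin, as a form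
  on the plane: its value at \<open>v\<close> is the \<open>k\<close>-th iterated derivative of \<open>g\<close> along \<open>v\<close> at the
  origin, divided by \<open>k!\<close>.\<close>

definition hom_part :: "nat \<Rightarrow> (real \<times> real \<Rightarrow> real) \<Rightarrow> real \<times> real \<Rightarrow> real" where
  "hom_part k g v = ((\<lambda>h p. frechet_derivative h (at p) v) ^^ k) g 0 / fact k"

text \<open>If a quadratic form divides a cubic form, the quotient is a linear form.\<close>

definition generic_umbilic :: "(real \<times> real \<Rightarrow> real) \<Rightarrow> bool" where
  "generic_umbilic g \<longleftrightarrow>
     g 0 = 0 \<and> (\<forall>v. hom_part 1 g v = 0) \<and>
     (\<exists>\<rho>. \<rho> \<noteq> 0 \<and> (\<forall>x y. hom_part 2 g (x, y) = \<rho> * (x\<^sup>2 + y\<^sup>2))) \<and>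
     \<not> (\<exists>\<alpha> \<beta>. \<forall>x y. hom_part 3 g (x, y) = (\<alpha> * x + \<beta> * y) * hom_part 2 g (x, y))"

text \<open>\<open>(l, m)\<close> are the coordinates on \<open>q0 + \<langle>x\<^sup>2 - y\<^sup>2, 2 x y\<rangle>\<close> of the projection of \<open>q\<close> along
  the line spanned by \<open>x\<^sup>2 + y\<^sup>2\<close>.\<close>

definition projects_to ::
  "(real \<times> real \<Rightarrow> real) \<Rightarrow> (real \<times> real \<Rightarrow> real) \<Rightarrow> real \<times> real \<Rightarrow> bool" where
  "projects_to q0 q lm \<longleftrightarrow>
     (\<exists>s. \<forall>x y. q (x, y) =
        (q0 (x, y) + fst lm * (x\<^sup>2 - y\<^sup>2) + snd lm * (2 * x * y)) + s * (x\<^sup>2 + y\<^sup>2))"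

text \<open>For lines \<open>L\<close> through the origin, which are their own direction spaces.\<close>

definition transversal_at_0 :: "(real \<Rightarrow> real \<times> real) \<Rightarrow> (real \<times> real) set \<Rightarrow> bool" where
  "transversal_at_0 c L \<longleftrightarrow> (\<exists>v. (c has_vector_derivative v) (at 0) \<and> v \<notin> L)"

definition curvature :: "(real \<Rightarrow> real \<times> real) \<Rightarrow> real \<Rightarrow> real" where
  "curvature \<gamma> s =
     (let v = vector_derivative \<gamma> (at s);
          w = vector_derivative (\<lambda>u. vector_derivative \<gamma> (at u)) (at s)
      in (fst v * snd w - snd v * fst w) / norm v ^ 3)"

text \<open>\<open>p\<close> is a vertex of the level curve of \<open>g\<close> through \<open>p\<close>. Since \<open>p\<close> is required to be a regular
  point of \<open>g\<close>, any regular curve \<open>\<gamma>\<close> in the level set is a local parametrization of it at \<open>p\<close>.\<close>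

definition level_curve_vertex :: "(real \<times> real \<Rightarrow> real) \<Rightarrow> real \<times> real \<Rightarrow> bool" where
  "level_curve_vertex g p \<longleftrightarrow>
     g differentiable (at p) \<and> (\<exists>v. frechet_derivative g (at p) v \<noteq> 0) \<and>
     (\<exists>\<gamma> e. e > 0 \<and> smooth_on {-e<..<e} \<gamma> \<and> \<gamma> 0 = p \<and>
        (\<forall>s\<in>{-e<..<e}. vector_derivative \<gamma> (at s) \<noteq> 0 \<and> g (\<gamma> s) = g p) \<and>
        (curvature \<gamma> has_real_derivative 0) (at 0))"

definition vertex_set :: "(real \<times> real \<Rightarrow> real) \<Rightarrow> (real \<times> real) set" where
  "vertex_set g = insert 0 {p. level_curve_vertex g p}"

text \<open>Branches in the closed disc of radius \<open>r\<close> are smoothly embedded arcs with end points on the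
  boundary circle and otherwise contained in the open disc.\<close>

definition branch_param :: "real \<Rightarrow> (real \<Rightarrow> real \<times> real) \<Rightarrow> bool" where
  "branch_param r \<gamma> \<longleftrightarrow>
     (\<exists>S. open S \<and> {-1..1} \<subseteq> S \<and> smooth_on S \<gamma>) \<and>
     (\<forall>s\<in>{-1..1}. vector_derivative \<gamma> (at s) \<noteq> 0) \<and> inj_on \<gamma> {-1..1} \<and>
     norm (\<gamma> (-1)) = r \<and> norm (\<gamma> 1) = r \<and> (\<forall>s\<in>{-1<..<1}. norm (\<gamma> s) < r)"

definition smooth_branch :: "real \<Rightarrow> (real \<times> real) set \<Rightarrow> bool" where
  "smooth_branch r B \<longleftrightarrow> (\<exists>\<gamma>. branch_param r \<gamma> \<and> B = \<gamma> ` {-1..1})"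

definition half_pos :: "(real \<Rightarrow> real \<times> real) \<Rightarrow> (real \<times> real) set" where
  "half_pos \<gamma> = \<gamma> ` {0..1}"

definition half_neg :: "(real \<Rightarrow> real \<times> real) \<Rightarrow> (real \<times> real) set" where
  "half_neg \<gamma> = \<gamma> ` {-1..0}"

text \<open>The rays spanned by the given vectors are distinct and listed in counterclockwise order.\<close>

definition ccw_order :: "(real \<times> real) list \<Rightarrow> bool" where
  "ccw_order vs \<longleftrightarrow>
     (\<exists>\<theta>. length \<theta> = length vs \<and> sorted_wrt (<) \<theta> \<and>
        (\<forall>i<length vs. \<theta> ! i < \<theta> ! 0 + 2 * pi \<and> vs ! i \<noteq> 0 \<and>
           vs ! i = norm (vs ! i) *\<^sub>R (cos (\<theta> ! i), sin (\<theta> ! i))))"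

text \<open>The part of \<open>V\<close> in the disc of radius \<open>r\<close> is the union of three branches through the origin,
  parametrized so that the cyclic order (in one of the two orientations) of the half-branches is
  \<open>C\<^sub>1\<^sup>+, C\<^sub>2\<^sup>+, C\<^sub>3\<^sup>+, C\<^sub>1\<^sup>-, C\<^sub>2\<^sup>-, C\<^sub>3\<^sup>-\<close>. The order is read off from the outgoing tangent vectors;
  that the six tangent rays are distinct is the pairwise transversality of the branches.\<close>

definition labelled_branches ::
  "real \<Rightarrow> (real \<times> real) set \<Rightarrow> (real \<Rightarrow> real \<times> real) \<Rightarrow> (real \<Rightarrow> real \<times> real) \<Rightarrow>
   (real \<Rightarrow> real \<times> real) \<Rightarrow> bool" where
  "labelled_branches r V \<gamma>1 \<gamma>2 \<gamma>3 \<longleftrightarrow>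
     (\<forall>\<gamma>\<in>{\<gamma>1, \<gamma>2, \<gamma>3}. branch_param r \<gamma> \<and> \<gamma> 0 = 0) \<and>
     V \<inter> cball 0 r = \<gamma>1 ` {-1..1} \<union> \<gamma>2 ` {-1..1} \<union> \<gamma>3 ` {-1..1} \<and>
     (let v1 = vector_derivative \<gamma>1 (at 0);
          v2 = vector_derivative \<gamma>2 (at 0);
          v3 = vector_derivative \<gamma>3 (at 0);
          vs = [v1, v2, v3, - v1, - v2, - v3]
      in ccw_order vs \<or> ccw_order (rev vs))"

text \<open>The part of \<open>V\<close> in the disc is the union of two smooth branches through the origin and a
  smooth branch \<open>B\<close> not passing through it. By the disjointness condition, \<open>B\<close> is uniquely
  determined by \<open>V\<close>: it is the complement of the connected component of the origin.\<close>

definition nonorigin_branch :: "real \<Rightarrow> (real \<times> real) set \<Rightarrow> (real \<times> real) set \<Rightarrow> bool" where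
  "nonorigin_branch r V B \<longleftrightarrow>
     (\<exists>A1 A2. V \<inter> cball 0 r = A1 \<union> A2 \<union> B \<and> A1 \<noteq> A2 \<and>
        smooth_branch r A1 \<and> smooth_branch r A2 \<and> smooth_branch r B \<and>
        0 \<in> A1 \<and> 0 \<in> A2 \<and> 0 \<notin> B \<and> B \<inter> (A1 \<union> A2) = {})"

definition C0_close :: "real \<Rightarrow> (real \<times> real) set \<Rightarrow> (real \<times> real) set \<Rightarrow> bool" where
  "C0_close \<epsilon> \<Gamma> B \<longleftrightarrow> (\<exists>h k. homeomorphism \<Gamma> B h k \<and> (\<forall>p\<in>\<Gamma>. dist (h p) p < \<epsilon>))"

text \<open>Along the filter \<open>F\<close> of parameter values, the branch of \<open>V t\<close> not passing through the origin
  is a \<open>C\<^sup>0\<close>-small deformation of \<open>\<Gamma>\<close>.\<close>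

definition nonorigin_branch_deforms ::
  "real \<Rightarrow> (real \<Rightarrow> (real \<times> real) set) \<Rightarrow> real filter \<Rightarrow> (real \<times> real) set \<Rightarrow> bool" where
  "nonorigin_branch_deforms r V F \<Gamma> \<longleftrightarrow>
     (\<forall>\<epsilon>>0. \<forall>\<^sub>F t in F. \<exists>B. nonorigin_branch r (V t) B \<and> C0_close \<epsilon> \<Gamma> B)"

end

theory Submission
  imports Defs
begin

text \<open>The proof blows up the origin. A regular point of \<open>g\<close> is a vertex of its level curve if and only if a
  certain polynomial \<open>vertex_fun g\<close> in the derivatives of \<open>g\<close> of order at most three vanishes there
  (\<open>level_curve_vertex_iff\<close>). Because the gradient of every \<open>f t\<close> vanishes at the origin, it is \<open>r\<close> times a
  smooth field in polar coordinates, and by homogeneity \<open>vertex_fun (f t)\<close> is \<open>r\<^sup>4 W (r, \<theta>, t)\<close> with \<open>W\<close>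
  smooth also across \<open>r = 0\<close>; negative \<open>r\<close> are allowed. As \<open>f0\<close> is umbilic, \<open>W\<close> vanishes for \<open>r = t = 0\<close>,
  and two Hadamard divisions give \<open>W = r A (r, \<theta>) + t B (r, \<theta>, t)\<close>. Up to a common nonzero factor,
  \<open>A (0, \<theta>) = (b - c) cos (3 \<theta>)\<close> and \<open>B (0, \<theta>, 0) = \<mu>' cos (2 \<theta>) - \<lambda>' sin (2 \<theta>)\<close>, where
  \<open>(\<lambda>', \<mu>')\<close> is the velocity of the projection on \<open>T\<close> (\<open>W_split_ex\<close>). Genericity says that the first function is not
  zero, and the three transversality conditions say that the second does not vanish at the zeros of
  the first.

  For \<open>t = 0\<close> the vertex set is \<open>A = 0\<close>: three curves with the directions of the zeros of \<open>cos (3 \<theta>)\<close>. They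
  cut the blown-up disc, in which \<open>(r, \<theta>)\<close> and \<open>(- r, \<theta> + \<pi>)\<close> are the same point, into three double
  sectors. After a rotation by a multiple of \<open>\<pi> / 3\<close> and a division by a constant, \<open>A\<close> and \<open>B\<close> are both positive in the
  first one (\<open>rotation_ex\<close>), whereas \<open>B\<close> changes sign from one edge to the other in the two others. There
  \<open>B / A\<close> is monotone in \<open>\<theta>\<close>, so that \<open>r A + t B = 0\<close> has exactly one solution \<open>\<theta>\<close> for each \<open>r\<close>; these are the
  two branches through the origin (\<open>through_branch\<close>). In the first sector a solution has \<open>r\<close> and \<open>t\<close> of
  opposite sign. It satisfies \<open>\<bar>r\<bar> A / B = \<bar>t\<bar>\<close>, and in coordinates which open the sector to a half-plane
  \<open>v \<ge> 0\<close> the function on the left increases in \<open>v\<close> at a rate bounded below. Hence the solutions form the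
  graph of a function with values between \<open>0\<close> and a multiple of \<open>\<bar>t\<bar>\<close>, which is \<open>C\<^sup>0\<close>-close to the edge \<open>v = 0\<close>,
  the union of two half-branches (\<open>wedge_root\<close>, \<open>nonorigin_deform\<close>). When \<open>t\<close> changes sign, so does \<open>r\<close>, and the
  branch moves to the opposite sector. This is the assertion for one particular labelling.

  An arbitrary labelling reduces to this one: the branch off the origin is unique, so its \<open>C\<^sup>0\<close>-limit is
  too; any half of a parametrized branch of the unperturbed vertex set is one of the six half-branches
  by connectedness; and the other half is the opposite one, since it has the opposite tangent
  (\<open>branch_is_H\<close>).\<close>

section \<open>Calculus of smooth maps\<close>

lemma frechet_derivative_cong_open:
  assumes "open S" "x \<in> S" "\<And>y. y \<in> S \<Longrightarrow> f y = g y"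
  shows "frechet_derivative f (at x) = frechet_derivative g (at x)"
proof -
  have "(f has_derivative D) (at x) \<longleftrightarrow> (g has_derivative D) (at x)" for D
    using has_derivative_transform_within_open[OF _ assms(1,2)] assms(3) by metis
  then show ?thesis by (simp add: frechet_derivative_def)
qed

lemma differentiable_cong_open:
  assumes "open S" "x \<in> S" "\<And>y. y \<in> S \<Longrightarrow> f y = g y" "f differentiable (at x)"
  shows "g differentiable (at x)"
  using has_derivative_transform_within_open[OF _ assms(1,2)] assms(3,4)
  unfolding differentiable_def by metis

lemma Ck_on_cong:
  assumes "open S" "\<And>y. y \<in> S \<Longrightarrow> f y = g y" "Ck_on k S f"
  shows "Ck_on k S g"
  using assms(2,3)
proof (induction k arbitrary: f g)
  case 0
  then show ?case by (simp cong: continuous_on_cong)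
next
  case (Suc k)
  have "Ck_on k S (\<lambda>x. frechet_derivative g (at x) v)" for v
  proof (rule Suc.IH)
    show "frechet_derivative f (at y) v = frechet_derivative g (at y) v" if "y \<in> S" for y
      using frechet_derivative_cong_open[OF assms(1) that Suc.prems(1)] by simp
    show "Ck_on k S (\<lambda>x. frechet_derivative f (at x) v)" using Suc.prems(2) by simp
  qed
  moreover have "g differentiable (at x)" if "x \<in> S" for x
    using differentiable_cong_open[OF assms(1) that Suc.prems(1)] Suc.prems(2) that by simp
  ultimately show ?case by simp
qed

lemma smooth_on_cong:
  assumes "open S" "\<And>y. y \<in> S \<Longrightarrow> f y = g y" "smooth_on S f"
  shows "smooth_on S g"
  using Ck_on_cong[OF assms(1,2)] assms(3) by (auto simp: smooth_on_def)

lemma Ck_on_subset: "Ck_on k S f \<Longrightarrow> T \<subseteq> S \<Longrightarrow> Ck_on k T f"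
  by (induction k arbitrary: f) (auto intro: continuous_on_subset)

lemma smooth_on_subset: "smooth_on S f \<Longrightarrow> T \<subseteq> S \<Longrightarrow> smooth_on T f"
  unfolding smooth_on_def using Ck_on_subset by blast

lemma Ck_on_Suc_D: "Ck_on (Suc k) S f \<Longrightarrow> Ck_on k S f"
proof (induction k arbitrary: f)
  case 0
  then show ?case
    by (auto simp: continuous_on_eq_continuous_within differentiable_imp_continuous_within
        continuous_at_imp_continuous_at_within)
next
  case (Suc k)
  then show ?case by (metis Ck_on.simps(2))
qed

lemma smooth_on_continuous: "smooth_on S f \<Longrightarrow> continuous_on S f"
  unfolding smooth_on_def by (metis Ck_on.simps(1))

lemma smooth_on_differentiable: "smooth_on S f \<Longrightarrow> x \<in> S \<Longrightarrow> f differentiable (at x)"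
  unfolding smooth_on_def by (metis Ck_on.simps(2))

lemma smooth_on_frechet: "smooth_on S f \<Longrightarrow> smooth_on S (\<lambda>x. frechet_derivative f (at x) v)"
  unfolding smooth_on_def by (metis Ck_on.simps(2))

lemma smooth_on_has_derivative:
  "smooth_on S f \<Longrightarrow> x \<in> S \<Longrightarrow> (f has_derivative frechet_derivative f (at x)) (at x)"
  using smooth_on_differentiable frechet_derivative_works by blast

lemma Ck_on_SucI:
  assumes "open S" "\<And>x. x \<in> S \<Longrightarrow> (f has_derivative D x) (at x)" "\<And>v. Ck_on k S (\<lambda>x. D x v)"
  shows "Ck_on (Suc k) S f"
proof -
  have "Ck_on k S (\<lambda>x. frechet_derivative f (at x) v)" for v
    by (rule Ck_on_cong[OF assms(1) _ assms(3)[of v]])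
      (use assms(2) frechet_derivative_at in metis)
  then show ?thesis using assms(2) by (auto simp: differentiable_def)
qed

lemma smooth_on_derivI:
  assumes "open S" "\<And>x. x \<in> S \<Longrightarrow> (f has_derivative D x) (at x)" "\<And>v. smooth_on S (\<lambda>x. D x v)"
  shows "smooth_on S f"
proof -
  have "Ck_on k S f" for k
    using Ck_on_SucI[OF assms(1,2)] assms(3) Ck_on_Suc_D unfolding smooth_on_def by blast
  then show ?thesis by (simp add: smooth_on_def)
qed

lemma Ck_on_has_derivative:
  "Ck_on (Suc k) S f \<Longrightarrow> x \<in> S \<Longrightarrow> (f has_derivative frechet_derivative f (at x)) (at x)"
  using frechet_derivative_works by auto

lemma Ck_on_const: "open S \<Longrightarrow> Ck_on k S (\<lambda>x. c)"
  by (induction k arbitrary: c) auto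

lemma Ck_on_bounded_linear: "bounded_linear f \<Longrightarrow> open S \<Longrightarrow> Ck_on k S f"
proof (cases k)
  case 0
  then show "bounded_linear f \<Longrightarrow> Ck_on k S f"
    by (auto intro: linear_continuous_on)
next
  case (Suc n)
  assume "bounded_linear f" "open S"
  then show ?thesis unfolding Suc
    by (intro Ck_on_SucI[where D="\<lambda>_. f"]) (auto intro: bounded_linear_imp_has_derivative Ck_on_const)
qed

lemma Ck_on_linear_comp:
  assumes "bounded_linear L" "open S" "Ck_on k S f"
  shows "Ck_on k S (\<lambda>x. L (f x))"
  using assms(3)
proof (induction k arbitrary: f)
  case 0
  then show ?case using linear_continuous_on[OF assms(1)]
    by (auto intro: continuous_on_compose2)
next
  case (Suc k)
  show ?case
    by (rule Ck_on_SucI[OF assms(2), where D="\<lambda>x v. L (frechet_derivative f (at x) v)"])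
      (use Suc bounded_linear.has_derivative[OF assms(1) Ck_on_has_derivative[OF Suc.prems]] in \<open>auto\<close>)
qed

lemma Ck_on_add:
  assumes "open S" "Ck_on k S f" "Ck_on k S g"
  shows "Ck_on k S (\<lambda>x. f x + g x)"
  using assms(2,3)
proof (induction k arbitrary: f g)
  case 0
  then show ?case by (simp add: continuous_on_add)
next
  case (Suc k)
  show ?case
    by (rule Ck_on_SucI[OF assms(1), where D="\<lambda>x v. frechet_derivative f (at x) v + frechet_derivative g (at x) v"])
      (use Suc Ck_on_has_derivative[OF Suc.prems(1)] Ck_on_has_derivative[OF Suc.prems(2)]
        in \<open>auto intro!: has_derivative_add\<close>)
qed

lemma Ck_on_scaleR:
  assumes "open S" "Ck_on k S f" "Ck_on k S g"
  shows "Ck_on k S (\<lambda>x. f x *\<^sub>R g x)"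
  using assms(2,3)
proof (induction k arbitrary: f g)
  case 0
  then show ?case by (simp add: continuous_on_scaleR)
next
  case (Suc k)
  show ?case
    by (rule Ck_on_SucI[OF assms(1), where D="\<lambda>x v. f x *\<^sub>R frechet_derivative g (at x) v + frechet_derivative f (at x) v *\<^sub>R g x"])
      (use Suc Ck_on_has_derivative[OF Suc.prems(1)] Ck_on_has_derivative[OF Suc.prems(2)]
         Ck_on_Suc_D[OF Suc.prems(1)] Ck_on_Suc_D[OF Suc.prems(2)]
        in \<open>auto intro!: has_derivative_scaleR Ck_on_add assms(1)\<close>)
qed

lemma Ck_on_sum:
  assumes "open S" "\<And>i. i \<in> I \<Longrightarrow> Ck_on k S (f i)"
  shows "Ck_on k S (\<lambda>x. \<Sum>i\<in>I. f i x)"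
  using assms(2) by (induction I rule: infinite_finite_induct) (auto intro: Ck_on_const Ck_on_add assms(1))

text \<open>The chain rule expresses a derivative of the composition as a sum over a basis of products of
  compositions and derivatives, which has the regularity needed for the induction.\<close>

lemma Ck_on_compose:
  fixes f :: "'a::real_normed_vector \<Rightarrow> 'b::euclidean_space" and g :: "'b \<Rightarrow> 'c::real_normed_vector"
  assumes "open S" "open T" "f ` S \<subseteq> T" "Ck_on k S f" "Ck_on k T g"
  shows "Ck_on k S (\<lambda>x. g (f x))"
  using assms(4,5)
proof (induction k arbitrary: g)
  case 0
  then show ?case using assms(3) by (auto intro: continuous_on_compose2)
next
  case (Suc k)
  let ?D = "\<lambda>x v. \<Sum>b\<in>Basis. (frechet_derivative f (at x) v \<bullet> b) *\<^sub>R frechet_derivative g (at (f x)) b"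
  have 1: "((\<lambda>x. g (f x)) has_derivative ?D x) (at x)" if "x \<in> S" for x
  proof -
    have f: "(f has_derivative frechet_derivative f (at x)) (at x)"
      using Ck_on_has_derivative[OF Suc.prems(1) that] .
    have g: "(g has_derivative frechet_derivative g (at (f x))) (at (f x))"
      using Ck_on_has_derivative[OF Suc.prems(2)] that assms(3) by blast
    have rep: "frechet_derivative g (at (f x)) w = (\<Sum>b\<in>Basis. (w \<bullet> b) *\<^sub>R frechet_derivative g (at (f x)) b)" for w
    proof -
      have l: "linear (frechet_derivative g (at (f x)))" using g has_derivative_linear by blast
      have "frechet_derivative g (at (f x)) w = frechet_derivative g (at (f x)) (\<Sum>b\<in>Basis. (w \<bullet> b) *\<^sub>R b)"
        by (simp add: euclidean_representation)
      then show ?thesis by (simp add: linear_sum[OF l] linear_scale[OF l])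
    qed
    have "?D x = (\<lambda>v. frechet_derivative g (at (f x)) (frechet_derivative f (at x) v))"
      by (rule ext) (rule rep[symmetric])
    then show ?thesis using has_derivative_compose[OF f g] by simp
  qed
  have 2: "Ck_on k S (\<lambda>x. ?D x v)" for v
  proof (intro Ck_on_sum[OF assms(1)] Ck_on_scaleR[OF assms(1)])
    fix b :: 'b
    show "Ck_on k S (\<lambda>x. frechet_derivative f (at x) v \<bullet> b)"
      using Suc.prems(1) by (intro Ck_on_linear_comp[OF bounded_linear_inner_left assms(1)]) auto
    show "Ck_on k S (\<lambda>x. frechet_derivative g (at (f x)) b)"
      using Suc.prems Ck_on_Suc_D[OF Suc.prems(1)]
      by (intro Suc.IH[of "\<lambda>y. frechet_derivative g (at y) b"]) auto
  qed
  show ?case by (rule Ck_on_SucI[OF assms(1) 1 2])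
qed

lemma smooth_on_compose:
  fixes f :: "'a::real_normed_vector \<Rightarrow> 'b::euclidean_space" and g :: "'b \<Rightarrow> 'c::real_normed_vector"
  assumes "smooth_on T g" "open S" "open T" "smooth_on S f" "\<And>x. x \<in> S \<Longrightarrow> f x \<in> T"
  shows "smooth_on S (\<lambda>x. g (f x))"
proof -
  have "f ` S \<subseteq> T" using assms(5) by blast
  have "Ck_on k S (\<lambda>x. g (f x))" for k
    by (rule Ck_on_compose[OF assms(2,3) \<open>f ` S \<subseteq> T\<close>]) (use assms(1,4) in \<open>simp_all add: smooth_on_def\<close>)
  then show ?thesis by (simp add: smooth_on_def)
qed

named_theorems smooth_intros

lemma smooth_on_const [smooth_intros]: "open S \<Longrightarrow> smooth_on S (\<lambda>x. c)"
  by (simp add: smooth_on_def Ck_on_const)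

lemma smooth_on_bounded_linear: "bounded_linear f \<Longrightarrow> open S \<Longrightarrow> smooth_on S f"
  by (simp add: smooth_on_def Ck_on_bounded_linear)

lemma smooth_on_ident [smooth_intros]: "open S \<Longrightarrow> smooth_on S (\<lambda>x. x)"
  by (simp add: smooth_on_bounded_linear)

lemma smooth_on_linear_comp:
  assumes "bounded_linear L" "open S" "smooth_on S f"
  shows "smooth_on S (\<lambda>x. L (f x))"
  using Ck_on_linear_comp[OF assms(1,2)] assms(3) by (auto simp: smooth_on_def)

lemma smooth_on_fst [smooth_intros]: "open S \<Longrightarrow> smooth_on S f \<Longrightarrow> smooth_on S (\<lambda>x. fst (f x))"
  by (rule smooth_on_linear_comp[OF bounded_linear_fst])

lemma smooth_on_snd [smooth_intros]: "open S \<Longrightarrow> smooth_on S f \<Longrightarrow> smooth_on S (\<lambda>x. snd (f x))"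
  by (rule smooth_on_linear_comp[OF bounded_linear_snd])

lemma smooth_on_add [smooth_intros]:
  "open S \<Longrightarrow> smooth_on S f \<Longrightarrow> smooth_on S g \<Longrightarrow> smooth_on S (\<lambda>x. f x + g x)"
  by (simp add: smooth_on_def Ck_on_add)

lemma smooth_on_scaleR [smooth_intros]:
  "open S \<Longrightarrow> smooth_on S f \<Longrightarrow> smooth_on S g \<Longrightarrow> smooth_on S (\<lambda>x. f x *\<^sub>R g x)"
  by (simp add: smooth_on_def Ck_on_scaleR)

lemma smooth_on_mult [smooth_intros]:
  fixes f g :: "'a::real_normed_vector \<Rightarrow> real"
  shows "open S \<Longrightarrow> smooth_on S f \<Longrightarrow> smooth_on S g \<Longrightarrow> smooth_on S (\<lambda>x. f x * g x)"
  using smooth_on_scaleR[of S f g] by simp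

lemma smooth_on_minus [smooth_intros]: "open S \<Longrightarrow> smooth_on S f \<Longrightarrow> smooth_on S (\<lambda>x. - f x)"
  by (rule smooth_on_linear_comp[OF bounded_linear_minus[OF bounded_linear_ident]])

lemma smooth_on_diff [smooth_intros]:
  "open S \<Longrightarrow> smooth_on S f \<Longrightarrow> smooth_on S g \<Longrightarrow> smooth_on S (\<lambda>x. f x - g x)"
  using smooth_on_add[of S f "\<lambda>x. - g x"] smooth_on_minus[of S g] by simp

lemma smooth_on_power [smooth_intros]:
  fixes f :: "'a::real_normed_vector \<Rightarrow> real"
  shows "open S \<Longrightarrow> smooth_on S f \<Longrightarrow> smooth_on S (\<lambda>x. f x ^ n)"
  by (induction n) (auto intro: smooth_intros)

lemma smooth_on_Pair [smooth_intros]: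
  fixes f :: "'a::real_normed_vector \<Rightarrow> 'b::real_normed_vector" and g :: "'a \<Rightarrow> 'c::real_normed_vector"
  assumes "open S" "smooth_on S f" "smooth_on S g"
  shows "smooth_on S (\<lambda>x. (f x, g x))"
proof -
  have 1: "bounded_linear (\<lambda>y::'b. (y, 0::'c))"
    by (intro bounded_linear_Pair bounded_linear_ident bounded_linear_zero)
  have 2: "bounded_linear (\<lambda>y::'c. (0::'b, y))"
    by (intro bounded_linear_Pair bounded_linear_ident bounded_linear_zero)
  show ?thesis
    using smooth_on_add[OF assms(1) smooth_on_linear_comp[OF 1 assms(1,2)] smooth_on_linear_comp[OF 2 assms(1,3)]]
    by simp
qed

text \<open>For functions of one real variable, smoothness of a derivative is a statement about the
  usual derivative.\<close>

lemma smooth_on_real_derivI: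
  fixes f :: "real \<Rightarrow> real"
  assumes "open S" "\<And>x. x \<in> S \<Longrightarrow> (f has_real_derivative f' x) (at x)" "smooth_on S f'"
  shows "smooth_on S f"
  by (rule smooth_on_derivI[OF assms(1), where D="\<lambda>x v. f' x * v"])
    (use assms(2) in \<open>auto simp: has_field_derivative_def intro!: smooth_intros assms\<close>)

lemma Ck_on_real_SucI:
  fixes f :: "real \<Rightarrow> real"
  assumes "open S" "\<And>x. x \<in> S \<Longrightarrow> (f has_real_derivative f' x) (at x)" "Ck_on k S f'"
  shows "Ck_on (Suc k) S f"
proof (rule Ck_on_SucI[OF assms(1), where D="\<lambda>x v. f' x * v"])
  show "Ck_on k S (\<lambda>x. f' x * v)" for v
    using Ck_on_scaleR[OF assms(1) assms(3) Ck_on_const[OF assms(1), of _ v]] by simp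
qed (use assms(2) in \<open>auto simp: has_field_derivative_def\<close>)

lemma smooth_on_inverse_real: "smooth_on (- {0}) (inverse :: real \<Rightarrow> real)"
proof -
  have op: "open (- {0::real})" by (rule open_Compl) simp
  have "Ck_on k (- {0}) (inverse :: real \<Rightarrow> real)" for k
  proof (induction k)
    case 0
    then show ?case by (auto intro!: continuous_intros)
  next
    case (Suc k)
    have "Ck_on k (- {0}) (\<lambda>x::real. - 1 *\<^sub>R (inverse x *\<^sub>R inverse x))"
      by (intro Ck_on_scaleR op Suc Ck_on_const)
    moreover have "(inverse has_real_derivative - 1 *\<^sub>R (inverse x *\<^sub>R inverse x)) (at x)"
      if "x \<in> - {0}" for x :: real
      using DERIV_inverse[of x] that by (simp add: power2_eq_square)
    ultimately show ?case by (rule Ck_on_real_SucI[OF op, rotated])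
  qed
  then show ?thesis by (simp add: smooth_on_def)
qed

lemma smooth_on_inverse [smooth_intros]:
  fixes f :: "'a::real_normed_vector \<Rightarrow> real"
  assumes "open S" "smooth_on S f" "\<And>x. x \<in> S \<Longrightarrow> f x \<noteq> 0"
  shows "smooth_on S (\<lambda>x. inverse (f x))"
proof (rule smooth_on_compose[OF smooth_on_inverse_real assms(1) _ assms(2)])
  show "open (- {0::real})" by (rule open_Compl) simp
qed (use assms(3) in blast)

lemma smooth_on_divide [smooth_intros]:
  fixes f :: "'a::real_normed_vector \<Rightarrow> real"
  assumes "open S" "smooth_on S f" "smooth_on S g" "\<And>x. x \<in> S \<Longrightarrow> g x \<noteq> 0"
  shows "smooth_on S (\<lambda>x. f x / g x)"
  using smooth_on_mult[OF assms(1,2) smooth_on_inverse[OF assms(1,3,4)]] by (simp add: divide_inverse)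

lemma smooth_on_sin_cos_real: "smooth_on UNIV (sin :: real \<Rightarrow> real)" "smooth_on UNIV (cos :: real \<Rightarrow> real)"
proof -
  have "Ck_on k UNIV (sin :: real \<Rightarrow> real) \<and> Ck_on k UNIV (cos :: real \<Rightarrow> real)" for k
  proof (induction k)
    case 0
    then show ?case by (auto intro!: continuous_intros)
  next
    case (Suc k)
    have "Ck_on k UNIV (\<lambda>x::real. - 1 *\<^sub>R sin x)"
      using Suc by (intro Ck_on_scaleR Ck_on_const) auto
    then have "Ck_on (Suc k) UNIV (cos :: real \<Rightarrow> real)"
      by (rule Ck_on_real_SucI[rotated 2]) (use DERIV_cos in auto)
    moreover have "Ck_on (Suc k) UNIV (sin :: real \<Rightarrow> real)"
      by (rule Ck_on_real_SucI[where f'=cos]) (use DERIV_sin Suc in auto)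
    ultimately show ?case by blast
  qed
  then show "smooth_on UNIV (sin :: real \<Rightarrow> real)" "smooth_on UNIV (cos :: real \<Rightarrow> real)"
    by (auto simp: smooth_on_def)
qed

lemma smooth_on_sin [smooth_intros]:
  fixes f :: "'a::real_normed_vector \<Rightarrow> real"
  shows "open S \<Longrightarrow> smooth_on S f \<Longrightarrow> smooth_on S (\<lambda>x. sin (f x))"
  by (rule smooth_on_compose[OF smooth_on_sin_cos_real(1)]) auto

lemma smooth_on_cos [smooth_intros]:
  fixes f :: "'a::real_normed_vector \<Rightarrow> real"
  shows "open S \<Longrightarrow> smooth_on S f \<Longrightarrow> smooth_on S (\<lambda>x. cos (f x))"
  by (rule smooth_on_compose[OF smooth_on_sin_cos_real(2)]) auto

lemma smooth_on_sqrt_real: "smooth_on {0<..} sqrt"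
proof -
  have op: "open {0::real<..}" by simp
  have "Ck_on k {0<..} sqrt" for k
  proof (induction k)
    case 0
    then show ?case by (auto intro!: continuous_intros)
  next
    case (Suc k)
    have "Ck_on k {0<..} (\<lambda>x::real. inverse (sqrt x) *\<^sub>R (1/2::real))"
    proof (intro Ck_on_scaleR op Ck_on_const)
      show "Ck_on k {0<..} (\<lambda>x. inverse (sqrt x))"
        by (rule Ck_on_compose[where T="- {0}" and g=inverse, OF op _ _ Suc])
          (use smooth_on_inverse_real in \<open>auto simp: smooth_on_def\<close>)
    qed
    moreover have "(sqrt has_real_derivative inverse (sqrt x) *\<^sub>R (1/2::real)) (at x)"
      if "x \<in> {0<..}" for x
      using DERIV_real_sqrt[of x] that by simp
    ultimately show ?case by (rule Ck_on_real_SucI[OF op, rotated])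
  qed
  then show ?thesis by (simp add: smooth_on_def)
qed

lemma smooth_on_sqrt [smooth_intros]:
  fixes f :: "'a::real_normed_vector \<Rightarrow> real"
  assumes "open S" "smooth_on S f" "\<And>x. x \<in> S \<Longrightarrow> f x > 0"
  shows "smooth_on S (\<lambda>x. sqrt (f x))"
  by (rule smooth_on_compose[OF smooth_on_sqrt_real assms(1) _ assms(2)]) (simp_all add: assms(3))

lemma smooth_on_arcsin [smooth_intros]:
  fixes f :: "'a::real_normed_vector \<Rightarrow> real"
  assumes "open S" "smooth_on S f" "\<And>x. x \<in> S \<Longrightarrow> \<bar>f x\<bar> < 1"
  shows "smooth_on S (\<lambda>x. arcsin (f x))"
proof (rule smooth_on_compose[OF _ assms(1) _ assms(2)])
  show "smooth_on {-1<..<1} arcsin"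
  proof (rule smooth_on_real_derivI)
    show "(arcsin has_real_derivative inverse (sqrt (1 - x * x))) (at x)" if "x \<in> {-1<..<1}" for x
      using DERIV_arcsin[of x] that by (simp add: power2_eq_square)
    have pos: "0 < 1 - x * x" if "x \<in> {-1<..<1}" for x :: real
      using abs_square_less_1[of x] that by (simp add: power2_eq_square abs_less_iff)
    show "smooth_on {-1<..<1} (\<lambda>x::real. inverse (sqrt (1 - x * x)))"
      by (intro smooth_intros) (use pos in force)+
  qed auto
  show "f x \<in> {- 1<..<1}" if "x \<in> S" for x using assms(3)[OF that] by auto
qed auto

subsection \<open>Partial derivatives\<close>

text \<open>The partial derivative in direction \<open>v\<close>.\<close>

abbreviation dd :: "'a \<Rightarrow> ('a::real_normed_vector \<Rightarrow> 'b::real_normed_vector) \<Rightarrow> 'a \<Rightarrow> 'b" where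
  "dd v f \<equiv> \<lambda>x. frechet_derivative f (at x) v"

lemma smooth_on_line_deriv:
  fixes f :: "'a::euclidean_space \<Rightarrow> real"
  assumes "smooth_on S f" "x + s *\<^sub>R v \<in> S"
  shows "((\<lambda>s. f (x + s *\<^sub>R v)) has_real_derivative dd v f (x + s *\<^sub>R v)) (at s)"
proof -
  have 1: "(f has_derivative frechet_derivative f (at (x + s *\<^sub>R v))) (at (x + s *\<^sub>R v))"
    using smooth_on_has_derivative[OF assms] .
  have 2: "((\<lambda>s. x + s *\<^sub>R v) has_derivative (\<lambda>h. h *\<^sub>R v)) (at s)"
    by (auto intro!: derivative_eq_intros)
  have "((\<lambda>s. f (x + s *\<^sub>R v)) has_derivative (\<lambda>h. frechet_derivative f (at (x + s *\<^sub>R v)) (h *\<^sub>R v))) (at s)"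
    using has_derivative_compose[OF 2 1] .
  moreover have "frechet_derivative f (at (x + s *\<^sub>R v)) (h *\<^sub>R v) = dd v f (x + s *\<^sub>R v) * h" for h
    using 1 has_derivative_linear linear_scale by fastforce
  ultimately show ?thesis by (simp add: has_field_derivative_def)
qed

lemma smooth_on_chain_real:
  fixes f :: "'a::euclidean_space \<Rightarrow> real"
  assumes "smooth_on S f" "(\<gamma> has_vector_derivative v) (at s)" "\<gamma> s \<in> S"
  shows "((\<lambda>s. f (\<gamma> s)) has_real_derivative dd v f (\<gamma> s)) (at s)"
proof -
  have 1: "(f has_derivative frechet_derivative f (at (\<gamma> s))) (at (\<gamma> s))"
    using smooth_on_has_derivative[OF assms(1,3)] .
  have 2: "(\<gamma> has_derivative (\<lambda>h. h *\<^sub>R v)) (at s)" using assms(2) by (simp add: has_vector_derivative_def)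
  have "frechet_derivative f (at (\<gamma> s)) (h *\<^sub>R v) = dd v f (\<gamma> s) * h" for h
    using 1 has_derivative_linear linear_scale by fastforce
  then show ?thesis using has_derivative_compose[OF 2 1] by (simp add: has_field_derivative_def)
qed

lemma dd_add: "smooth_on S f \<Longrightarrow> x \<in> S \<Longrightarrow> dd (v + w) f x = dd v f x + dd w f x"
  using smooth_on_has_derivative has_derivative_linear linear_add by blast

lemma dd_scaleR: "smooth_on S f \<Longrightarrow> x \<in> S \<Longrightarrow> dd (c *\<^sub>R v) f x = c *\<^sub>R dd v f x"
  using smooth_on_has_derivative has_derivative_linear linear_scale by blast

text \<open>Both mixed derivatives are the limit of the same second difference quotient.\<close>

lemma second_difference:
  fixes f :: "'a::euclidean_space \<Rightarrow> real"
  assumes "open S" "smooth_on S f" "h > 0"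
    and seg: "\<And>s t. 0 \<le> s \<Longrightarrow> s \<le> h \<Longrightarrow> 0 \<le> t \<Longrightarrow> t \<le> h \<Longrightarrow> x + s *\<^sub>R v + t *\<^sub>R w \<in> S"
  shows "\<exists>s t. 0 < s \<and> s < h \<and> 0 < t \<and> t < h \<and>
    f (x + h *\<^sub>R v + h *\<^sub>R w) - f (x + h *\<^sub>R v) - f (x + h *\<^sub>R w) + f x
      = h * h * dd w (dd v f) (x + s *\<^sub>R v + t *\<^sub>R w)"
proof -
  define G where "G s = f (x + h *\<^sub>R w + s *\<^sub>R v) - f (x + s *\<^sub>R v)" for s
  have G: "(G has_real_derivative dd v f (x + h *\<^sub>R w + s *\<^sub>R v) - dd v f (x + s *\<^sub>R v)) (at s)"
    if "0 \<le> s" "s \<le> h" for s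
    unfolding G_def using seg[of s h] seg[of s 0] that assms(3)
    by (intro DERIV_diff smooth_on_line_deriv[OF assms(2)]) (auto simp: algebra_simps)
  obtain s where s: "0 < s" "s < h"
    "G h - G 0 = (h - 0) * (dd v f (x + h *\<^sub>R w + s *\<^sub>R v) - dd v f (x + s *\<^sub>R v))"
    using MVT2[OF assms(3) G] by blast
  have D: "((\<lambda>t. dd v f (x + s *\<^sub>R v + t *\<^sub>R w)) has_real_derivative
      dd w (dd v f) (x + s *\<^sub>R v + t *\<^sub>R w)) (at t)" if "0 \<le> t" "t \<le> h" for t
    using seg[of s t] s that
    by (intro smooth_on_line_deriv[OF smooth_on_frechet[OF assms(2)]]) auto
  obtain t where t: "0 < t" "t < h" "dd v f (x + s *\<^sub>R v + h *\<^sub>R w) - dd v f (x + s *\<^sub>R v + 0 *\<^sub>R w)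
      = (h - 0) * dd w (dd v f) (x + s *\<^sub>R v + t *\<^sub>R w)"
    using MVT2[OF assms(3) D] by blast
  have "G h - G 0 = h * (h * dd w (dd v f) (x + s *\<^sub>R v + t *\<^sub>R w))"
    using s t by (simp add: algebra_simps)
  then show ?thesis using s t unfolding G_def by (intro exI[of _ s] exI[of _ t]) (auto simp: algebra_simps)
qed

lemma dd_commute:
  fixes f :: "'a::euclidean_space \<Rightarrow> real"
  assumes "open S" "smooth_on S f" "x \<in> S"
  shows "dd v (dd w f) x = dd w (dd v f) x"
proof (rule ccontr)
  let ?P = "dd w (dd v f)" and ?Q = "dd v (dd w f)"
  assume ne: "?Q x \<noteq> ?P x"
  define e where "e = \<bar>?Q x - ?P x\<bar> / 2"
  have e: "e > 0" using ne by (simp add: e_def)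
  have c: "continuous_on S ?P" "continuous_on S ?Q"
    by (intro smooth_on_continuous smooth_on_frechet assms)+
  obtain d1 where d1: "d1 > 0" "ball x d1 \<subseteq> S" by (rule openE[OF assms(1,3)])
  have "isCont ?P x" "isCont ?Q x"
    using c assms(3) by (simp_all only: continuous_on_eq_continuous_at[OF assms(1)])
  then have ev: "\<forall>\<^sub>F y in at x. dist (?P y) (?P x) < e" "\<forall>\<^sub>F y in at x. dist (?Q y) (?Q x) < e"
    using e by (simp_all only: isCont_def tendsto_iff)
  obtain d2 where d2: "d2 > 0" "\<And>y. y \<noteq> x \<Longrightarrow> dist y x < d2 \<Longrightarrow> dist (?P y) (?P x) < e"
    using ev(1)[unfolded eventually_at] by auto
  obtain d3 where d3: "d3 > 0" "\<And>y. y \<noteq> x \<Longrightarrow> dist y x < d3 \<Longrightarrow> dist (?Q y) (?Q x) < e"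
    using ev(2)[unfolded eventually_at] by auto
  define d where "d = min d1 (min d2 d3)"
  have d: "d > 0" using d1 d2 d3 by (simp add: d_def)
  define N where "N = norm v + norm w + 1"
  define h where "h = d / 2 / N"
  have vw: "N > 0" by (smt (verit) N_def norm_ge_zero)
  have h: "h > 0" using d vw by (simp add: h_def)
  have close: "dist (x + s *\<^sub>R v + t *\<^sub>R w) x < d" if "0 \<le> s" "s \<le> h" "0 \<le> t" "t \<le> h" for s t
  proof -
    have "dist (x + s *\<^sub>R v + t *\<^sub>R w) x = norm (s *\<^sub>R v + t *\<^sub>R w)" by (simp add: dist_norm add.assoc)
    also have "\<dots> \<le> norm (s *\<^sub>R v) + norm (t *\<^sub>R w)" by (rule norm_triangle_ineq)
    also have "\<dots> \<le> h * norm v + h * norm w" using that by (auto intro!: add_mono mult_right_mono)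
    also have "\<dots> \<le> h * N" using h by (simp add: N_def algebra_simps)
    also have "\<dots> = d / 2" using vw by (simp add: h_def)
    finally show ?thesis using d by simp
  qed
  have in_S: "x + s *\<^sub>R v + t *\<^sub>R w \<in> S" if "0 \<le> s" "s \<le> h" "0 \<le> t" "t \<le> h" for s t
    using close[OF that] d1 unfolding d_def by (auto simp: dist_commute)
  have in_S': "x + s *\<^sub>R w + t *\<^sub>R v \<in> S" if "0 \<le> s" "s \<le> h" "0 \<le> t" "t \<le> h" for s t
    using in_S[OF that(3,4,1,2)] by (simp add: algebra_simps)
  obtain s t where st: "0 < s" "s < h" "0 < t" "t < h"
    "f (x + h *\<^sub>R v + h *\<^sub>R w) - f (x + h *\<^sub>R v) - f (x + h *\<^sub>R w) + f x = h * h * ?P (x + s *\<^sub>R v + t *\<^sub>R w)"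
    using second_difference[OF assms(1,2) h, of x v w] in_S by blast
  obtain s' t' where st': "0 < s'" "s' < h" "0 < t'" "t' < h"
    "f (x + h *\<^sub>R w + h *\<^sub>R v) - f (x + h *\<^sub>R w) - f (x + h *\<^sub>R v) + f x = h * h * ?Q (x + s' *\<^sub>R w + t' *\<^sub>R v)"
    using second_difference[OF assms(1,2) h, of x w v] in_S' by blast
  have "h * h * ?P (x + s *\<^sub>R v + t *\<^sub>R w) = h * h * ?Q (x + s' *\<^sub>R w + t' *\<^sub>R v)"
    using st(5) st'(5) by (simp add: algebra_simps)
  then have "?P (x + s *\<^sub>R v + t *\<^sub>R w) = ?Q (x + s' *\<^sub>R w + t' *\<^sub>R v)" using h by simp
  moreover have "dist (?P y) (?P x) < e" if "dist y x < d" for y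
    using d2(2)[of y] e that by (cases "y = x") (simp_all add: d_def)
  moreover have "dist (?Q y) (?Q x) < e" if "dist y x < d" for y
    using d3(2)[of y] e that by (cases "y = x") (simp_all add: d_def)
  moreover have "dist (x + s *\<^sub>R v + t *\<^sub>R w) x < d" using close[of s t] st by simp
  moreover have "dist (x + s' *\<^sub>R w + t' *\<^sub>R v) x < d"
    using close[of t' s'] st' by (simp add: add_ac)
  ultimately have "dist (?P (x + s *\<^sub>R v + t *\<^sub>R w)) (?P x) < e" "dist (?P (x + s *\<^sub>R v + t *\<^sub>R w)) (?Q x) < e"
    by metis+
  then show False unfolding e_def dist_real_def by argo
qed

lemma Ck_on_Pair:
  fixes f :: "'a::real_normed_vector \<Rightarrow> 'b::real_normed_vector" and g :: "'a \<Rightarrow> 'c::real_normed_vector"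
  assumes "open S" "Ck_on k S f" "Ck_on k S g"
  shows "Ck_on k S (\<lambda>x. (f x, g x))"
proof -
  have 1: "bounded_linear (\<lambda>y::'b. (y, 0::'c))"
    by (intro bounded_linear_Pair bounded_linear_ident bounded_linear_zero)
  have 2: "bounded_linear (\<lambda>y::'c. (0::'b, y))"
    by (intro bounded_linear_Pair bounded_linear_ident bounded_linear_zero)
  show ?thesis
    using Ck_on_add[OF assms(1) Ck_on_linear_comp[OF 1 assms(1,2)] Ck_on_linear_comp[OF 2 assms(1,3)]]
    by simp
qed

section \<open>Division by a coordinate\<close>

text \<open>The Leibniz rule for differentiating under the integral sign asks for convexity in the
  parameter; a ball suffices because the statement is local.\<close>

lemma has_derivative_integral_parameter:
  fixes g :: "real \<times> 'a::euclidean_space \<Rightarrow> real"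
  assumes "open S" "smooth_on S g" "open Y" "{0..1} \<times> Y \<subseteq> S" "y0 \<in> Y"
  shows "((\<lambda>y. integral {0..1} (\<lambda>\<sigma>. g (\<sigma>, y))) has_derivative
    (\<lambda>v. integral {0..1} (\<lambda>\<sigma>. dd (0, v) g (\<sigma>, y0)))) (at y0)"
proof -
  obtain e where e: "e > 0" "ball y0 e \<subseteq> Y" by (rule openE[OF assms(3,5)])
  define B where "B = ball y0 e"
  have B: "open B" "convex B" "y0 \<in> B" "B \<subseteq> Y" using e by (simp_all add: B_def)
  have inS: "(\<sigma>, y) \<in> S" if "\<sigma> \<in> {0..1}" "y \<in> B" for \<sigma> y using assms(4) B(4) that by blast
  define fx where "fx y \<sigma> = Blinfun (\<lambda>v. dd (0, v) g (\<sigma>, y))" for y \<sigma>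
  have D: "((\<lambda>y. g (\<sigma>, y)) has_derivative (\<lambda>v. dd (0, v) g (\<sigma>, y))) (at y)"
    if "\<sigma> \<in> {0..1}" "y \<in> B" for \<sigma> y
  proof -
    have "((\<lambda>y. (\<sigma>, y)) has_derivative (\<lambda>v. (0, v))) (at y)"
      by (intro has_derivative_Pair has_derivative_const has_derivative_ident)
    then show ?thesis
      by (rule has_derivative_compose) (rule smooth_on_has_derivative[OF assms(2) inS[OF that]])
  qed
  have ap: "blinfun_apply (fx y \<sigma>) = (\<lambda>v. dd (0, v) g (\<sigma>, y))" if "\<sigma> \<in> {0..1}" "y \<in> B" for \<sigma> y
    unfolding fx_def by (rule bounded_linear_Blinfun_apply) (rule has_derivative_bounded_linear[OF D[OF that]])
  have cdd: "continuous_on S (dd w g)" for w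
    by (intro smooth_on_continuous smooth_on_frechet assms)
  have c: "continuous_on (B \<times> cbox 0 1) (\<lambda>(y, \<sigma>). fx y \<sigma>)"
  proof (rule continuous_on_blinfun_componentwise)
    fix i :: 'a assume "i \<in> Basis"
    have "continuous_on (B \<times> cbox 0 1) (\<lambda>p. dd (0, i) g (snd p, fst p))"
      by (rule continuous_on_compose2[OF cdd]) (use inS in \<open>auto intro!: continuous_intros\<close>)
    then show "continuous_on (B \<times> cbox 0 1) (\<lambda>x. blinfun_apply (case x of (y, \<sigma>) \<Rightarrow> fx y \<sigma>) i)"
      by (rule continuous_on_eq) (auto simp: ap)
  qed
  have "((\<lambda>y. integral (cbox 0 1) (\<lambda>\<sigma>. g (\<sigma>, y))) has_derivative
      blinfun_apply (integral (cbox 0 1) (fx y0))) (at y0 within B)"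
  proof (rule leibniz_rule[OF _ _ c B(3,2)])
    show "((\<lambda>y. g (\<sigma>, y)) has_derivative blinfun_apply (fx y \<sigma>)) (at y within B)"
      if "y \<in> B" "\<sigma> \<in> cbox 0 1" for y \<sigma>
      using D[of \<sigma> y] that by (simp add: ap has_derivative_at_withinI)
    show "(\<lambda>\<sigma>. g (\<sigma>, y)) integrable_on cbox 0 1" if "y \<in> B" for y
      by (intro integrable_continuous continuous_on_compose2[OF smooth_on_continuous[OF assms(2)]])
        (use inS that in \<open>auto intro!: continuous_intros\<close>)
  qed
  moreover have "blinfun_apply (integral (cbox 0 1) (fx y0)) = (\<lambda>v. integral {0..1} (\<lambda>\<sigma>. dd (0, v) g (\<sigma>, y0)))"
  proof
    fix v
    have "continuous_on (cbox 0 1) (fx y0)"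
      using continuous_on_compose2[OF c, of "cbox 0 1" "\<lambda>\<sigma>. (y0, \<sigma>)"] B(3)
      by (auto simp: continuous_on_Pair continuous_on_const continuous_on_id)
    then have "fx y0 integrable_on cbox 0 1" by (rule integrable_continuous)
    then have "integral (cbox 0 1) ((\<lambda>F. blinfun_apply F v) \<circ> fx y0) = blinfun_apply (integral (cbox 0 1) (fx y0)) v"
      by (rule integral_linear) (rule blinfun.bounded_linear_left)
    moreover have "integral (cbox 0 1) ((\<lambda>F. blinfun_apply F v) \<circ> fx y0) = integral (cbox 0 1) (\<lambda>\<sigma>. dd (0, v) g (\<sigma>, y0))"
      by (rule integral_cong) (use ap B(3) in auto)
    ultimately show "blinfun_apply (integral (cbox 0 1) (fx y0)) v = integral {0..1} (\<lambda>\<sigma>. dd (0, v) g (\<sigma>, y0))"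
      by simp
  qed
  ultimately show ?thesis
    by (simp add: at_within_open[OF B(3,1)])
qed

lemma smooth_on_integral_parameter:
  fixes g :: "real \<times> 'a::euclidean_space \<Rightarrow> real"
  assumes "open S" "smooth_on S g" "open Y" "{0..1} \<times> Y \<subseteq> S"
  shows "smooth_on Y (\<lambda>y. integral {0..1} (\<lambda>\<sigma>. g (\<sigma>, y)))"
proof -
  have "Ck_on k Y (\<lambda>y. integral {0..1} (\<lambda>\<sigma>. g (\<sigma>, y)))" for k
    using assms(2)
  proof (induction k arbitrary: g)
    case 0
    have "continuous (at y) (\<lambda>y. integral {0..1} (\<lambda>\<sigma>. g (\<sigma>, y)))" if "y \<in> Y" for y
      by (rule has_derivative_continuous[OF has_derivative_integral_parameter[OF assms(1) 0 assms(3,4) that]])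
    then show ?case by (simp add: continuous_on_eq_continuous_at[OF assms(3)])
  next
    case (Suc k)
    show ?case
      by (rule Ck_on_SucI[OF assms(3) has_derivative_integral_parameter[OF assms(1) Suc.prems assms(3,4)]])
        (assumption, rule Suc.IH[OF smooth_on_frechet[OF Suc.prems]])
  qed
  then show ?thesis by (simp add: smooth_on_def)
qed

text \<open>The quotient is the mean value of the partial derivative over the segment joining the point to
  the hyperplane, and integration preserves smooth dependence on parameters.\<close>

lemma hadamard_division:
  fixes F :: "real \<times> 'a::euclidean_space \<Rightarrow> real"
  assumes "open Z" "smooth_on ({-R<..<R} \<times> Z) F" "\<And>z. z \<in> Z \<Longrightarrow> F (0, z) = 0"
  shows "\<exists>G. smooth_on ({-R<..<R} \<times> Z) G \<and> (\<forall>s z. \<bar>s\<bar> < R \<longrightarrow> z \<in> Z \<longrightarrow> F (s, z) = s * G (s, z))"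
proof -
  define S where "S = {x :: real \<times> real \<times> 'a. \<bar>fst x * fst (snd x)\<bar> < R} \<inter> (\<lambda>x. snd (snd x)) -` Z"
  define g where "g x = dd (1, 0) F (fst x * fst (snd x), snd (snd x))" for x :: "real \<times> real \<times> 'a"
  let ?Y = "{-R<..<R} \<times> Z"
  have Y: "open ?Y" using assms(1) by (simp add: open_Times)
  have S: "open S"
    unfolding S_def by (intro open_Int open_Collect_less open_vimage assms(1) continuous_intros)
  have sub: "{0..1} \<times> ?Y \<subseteq> S"
  proof
    fix x :: "real \<times> real \<times> 'a" assume "x \<in> {0..1} \<times> ?Y"
    then obtain \<sigma> s z where x: "x = (\<sigma>, s, z)" "0 \<le> \<sigma>" "\<sigma> \<le> 1" "\<bar>s\<bar> < R" "z \<in> Z" by (auto simp: abs_less_iff)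
    have "\<bar>\<sigma> * s\<bar> \<le> 1 * \<bar>s\<bar>" using x unfolding abs_mult by (intro mult_right_mono) auto
    then show "x \<in> S" using x by (simp add: S_def)
  qed
  have g: "smooth_on S g"
    unfolding g_def
  proof (rule smooth_on_compose[OF smooth_on_frechet[OF assms(2)] S Y])
    show "smooth_on S (\<lambda>x. (fst x * fst (snd x), snd (snd x)))" by (intro smooth_intros S)
  qed (auto simp: S_def abs_less_iff)
  define G where "G y = integral {0..1} (\<lambda>\<sigma>. g (\<sigma>, y))" for y
  have "smooth_on ?Y G" unfolding G_def by (rule smooth_on_integral_parameter[OF S g Y sub])
  moreover have "F (s, z) = s * G (s, z)" if "\<bar>s\<bar> < R" "z \<in> Z" for s z
  proof -
    have D: "((\<lambda>\<sigma>. F (\<sigma> * s, z)) has_vector_derivative s * g (\<sigma>, s, z)) (at \<sigma> within {0..1})"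
      if "\<sigma> \<in> {0..1}" for \<sigma> :: real
    proof -
      have "(\<sigma>, s, z) \<in> S" using sub that \<open>\<bar>s\<bar> < R\<close> \<open>z \<in> Z\<close> by (auto simp: abs_less_iff)
      then have in_Y: "(\<sigma> * s, z) \<in> ?Y" by (simp add: S_def abs_less_iff)
      have "((\<lambda>\<sigma>. (\<sigma> * s, z)) has_vector_derivative (s, 0)) (at \<sigma>)"
        by (intro has_vector_derivative_Pair has_vector_derivative_const)
          (auto intro!: derivative_eq_intros simp: has_real_derivative_iff_has_vector_derivative[symmetric])
      from smooth_on_chain_real[OF assms(2) this in_Y]
      have "((\<lambda>\<sigma>. F (\<sigma> * s, z)) has_real_derivative dd (s, 0) F (\<sigma> * s, z)) (at \<sigma>)" .
      moreover have "dd (s, 0) F (\<sigma> * s, z) = s * g (\<sigma>, s, z)"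
        using dd_scaleR[OF assms(2) in_Y, of s "(1, 0)"] by (simp add: g_def)
      ultimately show ?thesis
        by (simp add: has_real_derivative_iff_has_vector_derivative has_vector_derivative_at_within)
    qed
    have "((\<lambda>\<sigma>. s * g (\<sigma>, s, z)) has_integral F (1 * s, z) - F (0 * s, z)) {0..1}"
      by (rule fundamental_theorem_of_calculus[OF _ D]) auto
    from integral_unique[OF this] have "s * integral {0..1} (\<lambda>\<sigma>. g (\<sigma>, s, z)) = F (s, z)"
      using assms(3)[OF that(2)] by simp
    then show ?thesis by (simp add: G_def)
  qed
  ultimately show ?thesis by blast
qed

text \<open>The value of a Hadamard quotient on the hyperplane is all that is known about it explicitly.\<close>

lemma quotient_at_0:
  fixes g h :: "real \<Rightarrow> real"
  assumes "(h has_real_derivative D) (at 0)" "h 0 = 0" "R > 0"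
    "\<And>s. \<bar>s\<bar> < R \<Longrightarrow> h s = s * g s" "isCont g 0"
  shows "g 0 = D"
proof -
  have "((\<lambda>s. h s / s) \<longlongrightarrow> D) (at 0)"
    using assms(1,2) by (simp add: has_field_derivative_iff)
  moreover have "\<forall>\<^sub>F s in at 0. h s / s = g s"
    unfolding eventually_at using assms(3,4) by (intro exI[of _ R]) (auto simp: dist_real_def)
  ultimately have "(g \<longlongrightarrow> D) (at 0)" by (rule Lim_transform_eventually)
  moreover have "(g \<longlongrightarrow> g 0) (at 0)" using assms(5) by (simp add: isCont_def)
  ultimately show ?thesis using tendsto_unique trivial_limit_at by blast
qed

section \<open>Implicit functions of one variable\<close>

text \<open>A form of the mean value theorem that does not depend on the order of the two points.\<close>

lemma mvt_between:
  fixes f :: "real \<Rightarrow> real"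
  assumes "\<And>x. min a b \<le> x \<Longrightarrow> x \<le> max a b \<Longrightarrow> (f has_real_derivative f' x) (at x)"
  shows "\<exists>\<xi>. \<bar>\<xi> - a\<bar> \<le> \<bar>b - a\<bar> \<and> min a b \<le> \<xi> \<and> \<xi> \<le> max a b \<and> f b - f a = f' \<xi> * (b - a)"
proof -
  consider "a < b" | "a = b" | "b < a" by linarith
  then show ?thesis
  proof cases
    case 1
    obtain \<xi> where "a < \<xi>" "\<xi> < b" "f b - f a = (b - a) * f' \<xi>"
      using MVT2[OF 1, of f f'] assms 1 by auto
    then show ?thesis using 1 by (intro exI[of _ \<xi>]) (auto simp: mult.commute)
  next
    case 2
    then show ?thesis by auto
  next
    case 3
    obtain \<xi> where "b < \<xi>" "\<xi> < a" "f a - f b = (a - b) * f' \<xi>"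
      using MVT2[OF 3, of f f'] assms 3 by auto
    then show ?thesis using 3 by (intro exI[of _ \<xi>]) (auto simp: algebra_simps)
  qed
qed

text \<open>The set \<open>D\<close> is a domain in the plane with connected vertical sections, on which the function
  increases in the vertical direction.\<close>

text \<open>The setting of a global implicit function theorem: on each connected vertical section of \<open>D\<close> the
  function increases, so that a root is unique there and existing roots form a smooth graph.\<close>

locale vertical_increase =
  fixes D :: "(real \<times> real) set" and F :: "real \<times> real \<Rightarrow> real"
  assumes open_D: "open D" and smooth_F: "smooth_on D F"
    and sections: "(x, y1) \<in> D \<Longrightarrow> (x, y2) \<in> D \<Longrightarrow> y1 \<le> y \<Longrightarrow> y \<le> y2 \<Longrightarrow> (x, y) \<in> D"
    and increase: "p \<in> D \<Longrightarrow> dd (0, 1) F p > 0"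
begin

lemma deriv_y:
  assumes "(x, y) \<in> D"
  shows "((\<lambda>y. F (x, y)) has_real_derivative dd (0, 1) F (x, y)) (at y)"
proof -
  have "((\<lambda>y. (x, y)) has_vector_derivative (0, 1)) (at y)"
    by (intro has_vector_derivative_Pair has_vector_derivative_const has_vector_derivative_id)
  then show ?thesis by (rule smooth_on_chain_real[OF smooth_F]) (rule assms)
qed

lemma deriv_x:
  assumes "(x, y) \<in> D"
  shows "((\<lambda>x. F (x, y)) has_real_derivative dd (1, 0) F (x, y)) (at x)"
proof -
  have "((\<lambda>x. (x, y)) has_vector_derivative (1, 0)) (at x)"
    by (intro has_vector_derivative_Pair has_vector_derivative_const has_vector_derivative_id)
  then show ?thesis by (rule smooth_on_chain_real[OF smooth_F]) (rule assms)
qed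

lemma strict:
  assumes "(x, y1) \<in> D" "(x, y2) \<in> D" "y1 < y2"
  shows "F (x, y1) < F (x, y2)"
proof (rule DERIV_pos_imp_increasing[OF assms(3)])
  fix y assume "y1 \<le> y" "y \<le> y2"
  then have "(x, y) \<in> D" using sections[OF assms(1,2)] by blast
  then show "\<exists>d. ((\<lambda>y. F (x, y)) has_real_derivative d) (at y) \<and> d > 0"
    using deriv_y increase by blast
qed

lemma root_unique:
  assumes "(x, y1) \<in> D" "(x, y2) \<in> D" "F (x, y1) = 0" "F (x, y2) = 0"
  shows "y1 = y2"
  using strict[OF assms(1,2)] strict[OF assms(2,1)] assms(3,4) by (cases y1 y2 rule: linorder_cases) auto

lemma root_isCont:
  assumes "open I" "x0 \<in> I" "\<And>x. x \<in> I \<Longrightarrow> (x, Y x) \<in> D \<and> F (x, Y x) = 0"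
  shows "isCont Y x0"
proof -
  have "(x0, Y x0) \<in> D" using assms by blast
  then obtain A B where AB: "open A" "open B" "(x0, Y x0) \<in> A \<times> B" "A \<times> B \<subseteq> D"
    by (rule open_prod_elim[OF open_D])
  then obtain \<delta> where \<delta>: "\<delta> > 0" "ball (Y x0) \<delta> \<subseteq> B" using openE[of B "Y x0"] by auto
  have box: "(x, y) \<in> D" if "x \<in> A" "\<bar>y - Y x0\<bar> < \<delta>" for x y
    using that \<delta>(2) AB(4) by (auto simp: dist_real_def abs_minus_commute subset_iff)
  have "\<forall>\<^sub>F x in at x0. dist (Y x) (Y x0) < e" if "e > 0" for e
  proof -
    define e' where "e' = min e \<delta> / 2"
    have e': "e' > 0" "e' < e" "e' < \<delta>" using \<open>e > 0\<close> \<delta>(1) by (auto simp: e'_def)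
    have x0A: "x0 \<in> A" using AB(3) by simp
    have D0: "(x0, Y x0 - e') \<in> D" "(x0, Y x0 + e') \<in> D" using box[OF x0A] e' by auto
    have "F (x0, Y x0 - e') < 0" "F (x0, Y x0 + e') > 0"
      using strict[OF D0(1), of "Y x0"] strict[OF _ D0(2), of "Y x0"] assms(2,3) e' by fastforce+
    moreover have "((\<lambda>x. F (x, Y x0 - e')) \<longlongrightarrow> F (x0, Y x0 - e')) (at x0)"
      "((\<lambda>x. F (x, Y x0 + e')) \<longlongrightarrow> F (x0, Y x0 + e')) (at x0)"
      using DERIV_isCont[OF deriv_x[OF D0(1)]] DERIV_isCont[OF deriv_x[OF D0(2)]] by (simp_all add: isCont_def)
    ultimately have "\<forall>\<^sub>F x in at x0. F (x, Y x0 - e') < 0" "\<forall>\<^sub>F x in at x0. F (x, Y x0 + e') > 0"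
      using order_tendstoD by blast+
    moreover have "\<forall>\<^sub>F x in at x0. x \<in> A" "\<forall>\<^sub>F x in at x0. x \<in> I"
      using AB(1) x0A assms(1,2) by (auto intro: eventually_at_in_open')
    ultimately show ?thesis
    proof eventually_elim
      case (elim x)
      have D1: "(x, Y x0 - e') \<in> D" "(x, Y x0 + e') \<in> D" "(x, Y x) \<in> D" "F (x, Y x) = 0"
        using box[OF elim(3)] e' assms(3)[OF elim(4)] by auto
      have "Y x > Y x0 - e'"
        using strict[OF D1(3,1)] D1(4) elim(1) by (cases "Y x = Y x0 - e'") force+
      moreover have "Y x < Y x0 + e'"
        using strict[OF D1(2,3)] D1(4) elim(2) by (cases "Y x = Y x0 + e'") force+
      ultimately show ?case using e' by (auto simp: dist_real_def)
    qed
  qed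
  then show ?thesis by (simp add: isCont_def tendsto_iff)
qed

lemma root_deriv:
  assumes "open I" "x0 \<in> I" "\<And>x. x \<in> I \<Longrightarrow> (x, Y x) \<in> D \<and> F (x, Y x) = 0"
  shows "(Y has_real_derivative - dd (1, 0) F (x0, Y x0) / dd (0, 1) F (x0, Y x0)) (at x0)"
proof -
  let ?a = "dd (1, 0) F" and ?b = "dd (0, 1) F"
  have p0: "(x0, Y x0) \<in> D" using assms by blast
  then obtain A B where AB: "open A" "open B" "(x0, Y x0) \<in> A \<times> B" "A \<times> B \<subseteq> D"
    by (rule open_prod_elim[OF open_D])
  obtain \<delta>1 where \<delta>1: "\<delta>1 > 0" "ball (Y x0) \<delta>1 \<subseteq> B" using openE[of B "Y x0"] AB by auto
  obtain \<delta>2 where \<delta>2: "\<delta>2 > 0" "ball x0 \<delta>2 \<subseteq> A" using openE[of A x0] AB by auto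
  have box: "(x, y) \<in> D" if "\<bar>x - x0\<bar> < \<delta>2" "\<bar>y - Y x0\<bar> < \<delta>1" for x y
    using that \<delta>1(2) \<delta>2(2) AB(4) by (auto simp: dist_real_def abs_minus_commute subset_iff)
  have ct: "isCont Y x0" by (rule root_isCont[OF assms])
  then have Yt: "(Y \<longlongrightarrow> Y x0) (at x0)" by (simp add: isCont_def)
  have evY: "\<forall>\<^sub>F x in at x0. \<bar>Y x - Y x0\<bar> < \<delta>1"
    using Yt \<delta>1(1) by (simp add: tendsto_iff dist_real_def)
  have evx: "\<forall>\<^sub>F x in at x0. \<bar>x - x0\<bar> < \<delta>2"
    unfolding eventually_at using \<delta>2(1) by (intro exI[of _ \<delta>2]) (auto simp: dist_real_def)
  have evI: "\<forall>\<^sub>F x in at x0. x \<in> I" using assms(1,2) by (auto intro: eventually_at_in_open')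
  define good where "good x \<xi> \<eta> \<longleftrightarrow> \<bar>\<xi> - x0\<bar> \<le> \<bar>x - x0\<bar> \<and> \<bar>\<eta> - Y x0\<bar> \<le> \<bar>Y x - Y x0\<bar> \<and>
      ?a (\<xi>, Y x0) * (x - x0) + ?b (x, \<eta>) * (Y x - Y x0) = 0 \<and> ?b (x, \<eta>) > 0" for x \<xi> \<eta>
  have ex: "\<exists>\<xi> \<eta>. good x \<xi> \<eta>" if x: "\<bar>x - x0\<bar> < \<delta>2" "\<bar>Y x - Y x0\<bar> < \<delta>1" "x \<in> I" for x
  proof -
    have "\<exists>\<xi>. \<bar>\<xi> - x0\<bar> \<le> \<bar>x - x0\<bar> \<and> min x0 x \<le> \<xi> \<and> \<xi> \<le> max x0 x \<and>
        F (x, Y x0) - F (x0, Y x0) = ?a (\<xi>, Y x0) * (x - x0)"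
      using x(1) \<delta>1(1) by (intro mvt_between[where f="\<lambda>x. F (x, Y x0)"] deriv_x box) auto
    then obtain \<xi> where \<xi>: "\<bar>\<xi> - x0\<bar> \<le> \<bar>x - x0\<bar>" "F (x, Y x0) - F (x0, Y x0) = ?a (\<xi>, Y x0) * (x - x0)" by blast
    have "\<exists>\<eta>. \<bar>\<eta> - Y x0\<bar> \<le> \<bar>Y x - Y x0\<bar> \<and> min (Y x0) (Y x) \<le> \<eta> \<and> \<eta> \<le> max (Y x0) (Y x) \<and>
        F (x, Y x) - F (x, Y x0) = ?b (x, \<eta>) * (Y x - Y x0)"
      using x(1,2) by (intro mvt_between[where f="\<lambda>y. F (x, y)"] deriv_y box) auto
    then obtain \<eta> where \<eta>: "\<bar>\<eta> - Y x0\<bar> \<le> \<bar>Y x - Y x0\<bar>" "F (x, Y x) - F (x, Y x0) = ?b (x, \<eta>) * (Y x - Y x0)" by blast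
    have "(x, \<eta>) \<in> D" using x \<eta>(1) by (intro box) auto
    then have "?b (x, \<eta>) > 0" by (rule increase)
    then show ?thesis using \<xi> \<eta> assms(3)[OF assms(2)] assms(3)[OF x(3)] unfolding good_def
      by (intro exI[of _ \<xi>] exI[of _ \<eta>]) auto
  qed
  define \<xi> where "\<xi> x = (SOME u. \<exists>\<eta>. good x u \<eta>)" for x
  define \<eta> where "\<eta> x = (SOME w. good x (\<xi> x) w)" for x
  have ev: "\<forall>\<^sub>F x in at x0. good x (\<xi> x) (\<eta> x)"
    using evx evY evI
  proof eventually_elim
    case (elim x)
    then have "\<exists>w. good x (\<xi> x) w" using ex[of x] unfolding \<xi>_def by (rule_tac someI_ex) blast
    then show ?case unfolding \<eta>_def by (rule someI_ex)
  qed
  have "((\<lambda>x. \<xi> x - x0) \<longlongrightarrow> 0) (at x0)"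
  proof (rule Lim_null_comparison)
    show "\<forall>\<^sub>F x in at x0. norm (\<xi> x - x0) \<le> \<bar>x - x0\<bar>" using ev by eventually_elim (simp add: good_def)
    show "((\<lambda>x. \<bar>x - x0\<bar>) \<longlongrightarrow> 0) (at x0)" by (intro tendsto_eq_intros | simp)+
  qed
  then have "((\<lambda>x. \<xi> x) \<longlongrightarrow> x0) (at x0)" by (simp add: LIM_zero_iff)
  then have t1: "((\<lambda>x. (\<xi> x, Y x0)) \<longlongrightarrow> (x0, Y x0)) (at x0)" by (intro tendsto_Pair tendsto_const)
  have "((\<lambda>x. \<eta> x - Y x0) \<longlongrightarrow> 0) (at x0)"
  proof (rule Lim_null_comparison)
    show "\<forall>\<^sub>F x in at x0. norm (\<eta> x - Y x0) \<le> \<bar>Y x - Y x0\<bar>" using ev by eventually_elim (simp add: good_def)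
    show "((\<lambda>x. \<bar>Y x - Y x0\<bar>) \<longlongrightarrow> 0) (at x0)" using Yt by (intro tendsto_rabs_zero) (simp add: LIM_zero_iff)
  qed
  then have "((\<lambda>x. \<eta> x) \<longlongrightarrow> Y x0) (at x0)" by (simp add: LIM_zero_iff)
  then have t2: "((\<lambda>x. (x, \<eta> x)) \<longlongrightarrow> (x0, Y x0)) (at x0)" by (intro tendsto_Pair tendsto_ident_at)
  have cont: "isCont ?a (x0, Y x0)" "isCont ?b (x0, Y x0)"
    using p0 smooth_on_continuous[OF smooth_on_frechet[OF smooth_F]]
    by (simp_all add: continuous_on_eq_continuous_at[OF open_D])
  have "((\<lambda>x. - ?a (\<xi> x, Y x0) / ?b (x, \<eta> x)) \<longlongrightarrow> - ?a (x0, Y x0) / ?b (x0, Y x0)) (at x0)"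
    using increase[OF p0]
    by (intro tendsto_divide tendsto_minus isCont_tendsto_compose[OF cont(1) t1] isCont_tendsto_compose[OF cont(2) t2]) auto
  moreover have "\<forall>\<^sub>F x in at x0. - ?a (\<xi> x, Y x0) / ?b (x, \<eta> x) = (Y x - Y x0) / (x - x0)"
  proof -
    have "\<forall>\<^sub>F x in at x0. x \<noteq> x0" by (simp add: eventually_at_filter)
    with ev show ?thesis
    proof eventually_elim
      case (elim x)
      have "- ?a (\<xi> x, Y x0) * (x - x0) = (Y x - Y x0) * ?b (x, \<eta> x)" "?b (x, \<eta> x) > 0"
        using elim(1) by (auto simp: good_def algebra_simps)
      then show ?case using elim(2) by (subst frac_eq_eq) auto
    qed
  qed
  ultimately show ?thesis
    unfolding has_field_derivative_iff by (rule Lim_transform_eventually)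
qed

text \<open>The root satisfies \<open>Y' = - F\<^sub>x / F\<^sub>y\<close> along its graph, so each order of differentiability of \<open>Y\<close> yields the
  next one.\<close>

lemma root_smooth:
  assumes "open I" "\<And>x. x \<in> I \<Longrightarrow> (x, Y x) \<in> D \<and> F (x, Y x) = 0"
  shows "smooth_on I Y"
proof -
  let ?G = "\<lambda>p. - dd (1, 0) F p / dd (0, 1) F p"
  have G: "smooth_on D ?G"
    by (intro smooth_intros open_D smooth_on_frechet smooth_F) (use increase in force)
  have "Ck_on k I Y" for k
  proof (induction k)
    case 0
    then show ?case using root_isCont[OF assms(1) _ assms(2)]
      by (simp add: continuous_on_eq_continuous_at[OF assms(1)])
  next
    case (Suc k)
    have "Ck_on k I (\<lambda>x. ?G (x, Y x))"
    proof (rule Ck_on_compose[OF assms(1) open_D])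
      show "Ck_on k I (\<lambda>x. (x, Y x))"
        using Suc Ck_on_bounded_linear[OF bounded_linear_ident assms(1)] by (rule_tac Ck_on_Pair[OF assms(1)])
      show "Ck_on k D ?G" using G by (simp add: smooth_on_def)
    qed (use assms(2) in blast)
    then show ?case
      by (rule Ck_on_real_SucI[OF assms(1), rotated]) (rule root_deriv[OF assms(1) _ assms(2)])
  qed
  then show ?thesis by (simp add: smooth_on_def)
qed

lemma smooth_root_ex:
  assumes "open I" "\<And>x. x \<in> I \<Longrightarrow> \<exists>y. (x, y) \<in> D \<and> F (x, y) = 0"
  shows "\<exists>Y. smooth_on I Y \<and> (\<forall>x\<in>I. (x, Y x) \<in> D \<and> F (x, Y x) = 0 \<and> (\<forall>y. (x, y) \<in> D \<longrightarrow> F (x, y) = 0 \<longrightarrow> y = Y x))"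
proof -
  obtain Y where Y: "\<And>x. x \<in> I \<Longrightarrow> (x, Y x) \<in> D \<and> F (x, Y x) = 0" using assms(2) by metis
  have "smooth_on I Y" by (rule root_smooth[OF assms(1) Y])
  moreover have "y = Y x" if "x \<in> I" "(x, y) \<in> D" "F (x, y) = 0" for x y
    using root_unique[of x y "Y x"] Y[OF that(1)] that by blast
  ultimately show ?thesis using Y by blast
qed

end

text \<open>A small rectangle around the zero whose lower and upper sides carry opposite signs of \<open>F\<close> is a domain
  on which \<open>F\<close> increases vertically and has a root above each point of the base.\<close>

lemma implicit_function_local:
  fixes F :: "real \<times> real \<Rightarrow> real"
  assumes "open S" "smooth_on S F" "(x0, y0) \<in> S" "F (x0, y0) = 0" "dd (0, 1) F (x0, y0) > 0"
  shows "\<exists>e Y. e > 0 \<and> smooth_on {x0 - e<..<x0 + e} Y \<and> Y x0 = y0 \<and>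
    (\<forall>x\<in>{x0 - e<..<x0 + e}. (x, Y x) \<in> S \<and> F (x, Y x) = 0)"
proof -
  have c: "continuous_on S (dd (0, 1) F)" by (intro smooth_on_continuous smooth_on_frechet assms)
  define T where "T = {p \<in> S. dd (0, 1) F p > 0}"
  have "open T" unfolding T_def
    using continuous_open_preimage[OF c assms(1), of "{0<..}"] by (simp add: Int_def vimage_def)
  moreover have "(x0, y0) \<in> T" using assms by (simp add: T_def)
  ultimately obtain A B where AB: "open A" "open B" "(x0, y0) \<in> A \<times> B" "A \<times> B \<subseteq> T"
    by (rule open_prod_elim)
  obtain \<delta> where \<delta>: "\<delta> > 0" "ball y0 \<delta> \<subseteq> B" using openE[of B y0] AB by auto
  define D where "D = A \<times> {y0 - \<delta><..<y0 + \<delta>}"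
  have DT: "D \<subseteq> T"
    using AB(4) \<delta>(2) by (auto simp: D_def ball_eq_greaterThanLessThan subset_iff)
  interpret vertical_increase D F
  proof
    show "open D" using AB(1) by (simp add: D_def open_Times)
    show "smooth_on D F" using smooth_on_subset[OF assms(2)] DT T_def by blast
    show "dd (0, 1) F p > 0" if "p \<in> D" for p using that DT by (auto simp: T_def)
  qed (auto simp: D_def)
  have x0A: "x0 \<in> A" using AB(3) by simp
  have D0: "(x0, y0) \<in> D" "(x0, y0 - \<delta>/2) \<in> D" "(x0, y0 + \<delta>/2) \<in> D" using x0A \<delta>(1) by (auto simp: D_def)
  have "F (x0, y0 - \<delta>/2) < 0" "F (x0, y0 + \<delta>/2) > 0"
    using strict[OF D0(2,1)] strict[OF D0(1,3)] \<delta>(1) assms(4) by auto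
  moreover have "((\<lambda>x. F (x, y0 - \<delta>/2)) \<longlongrightarrow> F (x0, y0 - \<delta>/2)) (at x0)"
    "((\<lambda>x. F (x, y0 + \<delta>/2)) \<longlongrightarrow> F (x0, y0 + \<delta>/2)) (at x0)"
    using DERIV_isCont[OF deriv_x[OF D0(2)]] DERIV_isCont[OF deriv_x[OF D0(3)]] by (simp_all add: isCont_def)
  ultimately have "\<forall>\<^sub>F x in at x0. F (x, y0 - \<delta>/2) < 0" "\<forall>\<^sub>F x in at x0. F (x, y0 + \<delta>/2) > 0"
    using order_tendstoD by blast+
  moreover have "\<forall>\<^sub>F x in at x0. x \<in> A" using AB(1) x0A by (auto intro: eventually_at_in_open')
  ultimately have "\<forall>\<^sub>F x in at x0. F (x, y0 - \<delta>/2) < 0 \<and> F (x, y0 + \<delta>/2) > 0 \<and> x \<in> A"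
    by eventually_elim simp
  then obtain e where e: "e > 0" "\<And>x. x \<noteq> x0 \<Longrightarrow> dist x x0 < e \<Longrightarrow>
      F (x, y0 - \<delta>/2) < 0 \<and> F (x, y0 + \<delta>/2) > 0 \<and> x \<in> A"
    unfolding eventually_at by auto
  let ?I = "{x0 - e<..<x0 + e}"
  have "\<exists>y. (x, y) \<in> D \<and> F (x, y) = 0" if "x \<in> ?I" for x
  proof (cases "x = x0")
    case True
    then show ?thesis using D0(1) assms(4) by blast
  next
    case False
    then have x: "F (x, y0 - \<delta>/2) < 0" "F (x, y0 + \<delta>/2) > 0" "x \<in> A"
      using e(2)[of x] that by (auto simp: dist_real_def)
    have in_D: "(x, y) \<in> D" if "y0 - \<delta>/2 \<le> y" "y \<le> y0 + \<delta>/2" for y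
      using x(3) that \<delta>(1) by (auto simp: D_def)
    have "\<exists>y\<ge>y0 - \<delta>/2. y \<le> y0 + \<delta>/2 \<and> F (x, y) = 0"
      using x \<delta>(1) by (intro IVT) (auto intro!: DERIV_isCont[OF deriv_y[OF in_D]])
    then show ?thesis using in_D by blast
  qed
  then obtain Y where Y: "smooth_on ?I Y" "\<forall>x\<in>?I. (x, Y x) \<in> D \<and> F (x, Y x) = 0 \<and>
      (\<forall>y. (x, y) \<in> D \<longrightarrow> F (x, y) = 0 \<longrightarrow> y = Y x)"
    using smooth_root_ex[of ?I] by auto
  have "x0 \<in> ?I" using e(1) by simp
  then have "Y x0 = y0" using Y(2) D0(1) assms(4) by metis
  then show ?thesis using e(1) Y DT T_def by (intro exI[of _ e] exI[of _ Y]) blast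
qed

section \<open>Vertices of level curves\<close>

text \<open>For a gradient \<open>(a1, a2)\<close> let \<open>(- a2, a1)\<close> be the tangent vector of the level curve. The next three
  definitions evaluate the second derivative on two tangent vectors, the second derivative on a tangent and a
  normal vector, and the third derivative on three tangent vectors.\<close>

definition hess_tt :: "real \<Rightarrow> real \<Rightarrow> real \<Rightarrow> real \<Rightarrow> real \<Rightarrow> real" where
  "hess_tt a1 a2 h11 h12 h22 = h11 * a2\<^sup>2 - 2 * h12 * a1 * a2 + h22 * a1\<^sup>2"

definition hess_tn :: "real \<Rightarrow> real \<Rightarrow> real \<Rightarrow> real \<Rightarrow> real \<Rightarrow> real" where
  "hess_tn a1 a2 h11 h12 h22 = a1 * a2 * (h22 - h11) + h12 * (a1\<^sup>2 - a2\<^sup>2)"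

definition third_ttt :: "real \<Rightarrow> real \<Rightarrow> real \<Rightarrow> real \<Rightarrow> real \<Rightarrow> real \<Rightarrow> real" where
  "third_ttt a1 a2 k0 k1 k2 k3 = - k0 * a2 ^ 3 + 3 * k1 * a2\<^sup>2 * a1 - 3 * k2 * a2 * a1\<^sup>2 + k3 * a1 ^ 3"

text \<open>With \<open>r = 1\<close> this is a positive multiple of the derivative of the curvature along the level curve. The
  factor \<open>r\<close> makes the expression homogeneous when the gradient is \<open>r\<close> times \<open>(a1, a2)\<close>.\<close>

definition vertex_poly ::
  "real \<Rightarrow> real \<Rightarrow> real \<Rightarrow> real \<Rightarrow> real \<Rightarrow> real \<Rightarrow> real \<Rightarrow> real \<Rightarrow> real \<Rightarrow> real \<Rightarrow> real" where
  "vertex_poly r a1 a2 h11 h12 h22 k0 k1 k2 k3 =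
     r * (a1\<^sup>2 + a2\<^sup>2) * third_ttt a1 a2 k0 k1 k2 k3 - 3 * hess_tt a1 a2 h11 h12 h22 * hess_tn a1 a2 h11 h12 h22"

lemmas vertex_poly_defs = vertex_poly_def hess_tt_def hess_tn_def third_ttt_def

lemma vertex_poly_scale:
  "vertex_poly 1 (r * a1) (r * a2) h11 h12 h22 k0 k1 k2 k3 = r ^ 4 * vertex_poly r a1 a2 h11 h12 h22 k0 k1 k2 k3"
  by (simp add: vertex_poly_defs power2_eq_square power3_eq_cube power4_eq_xxxx algebra_simps)

abbreviation px :: "(real \<times> real \<Rightarrow> real) \<Rightarrow> real \<times> real \<Rightarrow> real" where "px \<equiv> dd (1, 0)"
abbreviation py :: "(real \<times> real \<Rightarrow> real) \<Rightarrow> real \<times> real \<Rightarrow> real" where "py \<equiv> dd (0, 1)"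

definition vertex_fun :: "(real \<times> real \<Rightarrow> real) \<Rightarrow> real \<times> real \<Rightarrow> real" where
  "vertex_fun g p = vertex_poly 1 (px g p) (py g p) (px (px g) p) (px (py g) p) (py (py g) p)
     (px (px (px g)) p) (px (px (py g)) p) (px (py (py g)) p) (py (py (py g)) p)"

lemma dd_plane:
  fixes g :: "real \<times> real \<Rightarrow> real"
  assumes "smooth_on U g" "p \<in> U"
  shows "dd v g p = fst v * px g p + snd v * py g p"
proof -
  have "v = fst v *\<^sub>R (1, 0) + snd v *\<^sub>R (0, 1)" by (cases v) simp
  then have "dd v g p = dd (fst v *\<^sub>R (1, 0) + snd v *\<^sub>R (0, 1)) g p" by simp
  also have "\<dots> = dd (fst v *\<^sub>R (1, 0)) g p + dd (snd v *\<^sub>R (0, 1)) g p" by (rule dd_add[OF assms])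
  also have "\<dots> = fst v * px g p + snd v * py g p" by (simp only: dd_scaleR[OF assms] real_scaleR_def)
  finally show ?thesis .
qed

lemma smooth_curve_velocity:
  fixes \<gamma> :: "real \<Rightarrow> 'a::real_normed_vector"
  assumes "open S" "smooth_on S \<gamma>"
  shows "s \<in> S \<Longrightarrow> (\<gamma> has_vector_derivative vector_derivative \<gamma> (at s)) (at s)"
    and "smooth_on S (\<lambda>s. vector_derivative \<gamma> (at s))"
proof -
  show d: "(\<gamma> has_vector_derivative vector_derivative \<gamma> (at s)) (at s)" if "s \<in> S" for s
    using smooth_on_differentiable[OF assms(2) that] by (simp add: vector_derivative_works)
  have "frechet_derivative \<gamma> (at s) 1 = vector_derivative \<gamma> (at s)" if "s \<in> S" for s
  proof -
    have "(\<gamma> has_derivative (\<lambda>h. h *\<^sub>R vector_derivative \<gamma> (at s))) (at s)"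
      using d[OF that] by (simp add: has_vector_derivative_def)
    from frechet_derivative_at[OF this, symmetric] show ?thesis by simp
  qed
  then show "smooth_on S (\<lambda>s. vector_derivative \<gamma> (at s))"
    by (rule smooth_on_cong[OF assms(1) _ smooth_on_frechet[OF assms(2)]])
qed

lemma has_real_derivative_fst_snd:
  fixes v :: "real \<Rightarrow> real \<times> real"
  assumes "(v has_vector_derivative w) (at s)"
  shows "((\<lambda>s. fst (v s)) has_real_derivative fst w) (at s)" "((\<lambda>s. snd (v s)) has_real_derivative snd w) (at s)"
  using bounded_linear.has_vector_derivative[OF bounded_linear_fst assms]
    bounded_linear.has_vector_derivative[OF bounded_linear_snd assms]
  by (simp_all add: has_real_derivative_iff_has_vector_derivative)

text \<open>A curve in the level set has velocity \<open>h\<close> times the rotated gradient, and differentiating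
  \<open>g \<circ> \<gamma> = const\<close> twice expresses its curvature as a function of the point alone, up to the sign of
  \<open>h\<close>. The derivative of that function along the curve is the claim.\<close>

text \<open>A curve in the level set has velocity \<open>h\<close> times the rotated gradient, and differentiating
  \<open>g \<circ> \<gamma> = const\<close> twice expresses its curvature as a function of the point alone, up to the sign of
  \<open>h\<close>.\<close>

lemma curvature_algebra:
  fixes p1 p2 v1 v2 w1 w2 h11 h12 h22 :: real
  assumes "p1 * v1 + p2 * v2 = 0" "p1\<^sup>2 + p2\<^sup>2 > 0" "(v1, v2) \<noteq> (0, 0)"
    and "h11 * v1 * v1 + 2 * h12 * v1 * v2 + h22 * v2 * v2 + p1 * w1 + p2 * w2 = 0"
  defines "D \<equiv> p1\<^sup>2 + p2\<^sup>2" and "h \<equiv> (p1 * v2 - p2 * v1) / (p1\<^sup>2 + p2\<^sup>2)"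
  shows "v1 = - h * p2" "v2 = h * p1" "h \<noteq> 0"
    "(v1 * w2 - v2 * w1) / norm (v1, v2) ^ 3 = sgn h * (hess_tt p1 p2 h11 h12 h22 / (D * sqrt D))"
proof -
  have D: "D > 0" using assms(2) by (simp add: D_def)
  have hD: "h * D = p1 * v2 - p2 * v1" using D by (simp add: h_def D_def)
  have "D * v1 = D * (- h * p2)"
  proof -
    have "D * v1 = p1 * (p1 * v1 + p2 * v2) - p2 * (p1 * v2 - p2 * v1)"
      by (simp add: D_def power2_eq_square algebra_simps)
    then show ?thesis by (simp add: assms(1) hD[symmetric])
  qed
  then show v1: "v1 = - h * p2" using D by (metis less_irrefl mult_left_cancel)
  have "D * v2 = D * (h * p1)"
  proof -
    have "D * v2 = p2 * (p1 * v1 + p2 * v2) + p1 * (p1 * v2 - p2 * v1)"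
      by (simp add: D_def power2_eq_square algebra_simps)
    then show ?thesis by (simp add: assms(1) hD[symmetric] mult_ac)
  qed
  then show v2: "v2 = h * p1" using D by (metis less_irrefl mult_left_cancel)
  show h: "h \<noteq> 0" using assms(3) v1 v2 by auto
  have "norm (v1, v2) = sqrt (h\<^sup>2 * D)"
    by (simp add: norm_Pair v1 v2 D_def power2_eq_square algebra_simps)
  then have n: "norm (v1, v2) = \<bar>h\<bar> * sqrt D" by (simp add: real_sqrt_mult)
  have "sqrt D ^ 3 = D * sqrt D" using D by (simp add: power3_eq_cube)
  then have n3: "norm (v1, v2) ^ 3 = \<bar>h\<bar> ^ 3 * (D * sqrt D)" by (simp add: n power_mult_distrib)
  have "v1 * w2 - v2 * w1 = - h * (p1 * w1 + p2 * w2)" by (simp add: v1 v2 algebra_simps)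
  also have "p1 * w1 + p2 * w2 = - (h11 * v1 * v1 + 2 * h12 * v1 * v2 + h22 * v2 * v2)" using assms(4) by linarith
  also have "\<dots> = - h\<^sup>2 * hess_tt p1 p2 h11 h12 h22"
    by (simp add: v1 v2 hess_tt_def power2_eq_square algebra_simps)
  finally have "v1 * w2 - v2 * w1 = h ^ 3 * hess_tt p1 p2 h11 h12 h22"
    by (simp add: power2_eq_square power3_eq_cube)
  moreover have "h ^ 3 = sgn h * \<bar>h\<bar> ^ 3" using h by (cases "h > 0") (auto simp: power3_eq_cube)
  ultimately show "(v1 * w2 - v2 * w1) / norm (v1, v2) ^ 3 = sgn h * (hess_tt p1 p2 h11 h12 h22 / (D * sqrt D))"
    using h by (simp add: n3)
qed

text \<open>By continuity the sign of \<open>h\<close> is constant near the point, so differentiating the expression for the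
  curvature along the curve multiplies by \<open>h\<close> once more, and \<open>h sgn h\<close> is positive.\<close>

lemma curvature_deriv_level:
  fixes g :: "real \<times> real \<Rightarrow> real" and \<gamma> :: "real \<Rightarrow> real \<times> real"
  assumes U: "open U" "smooth_on U g" and e: "e > 0" "smooth_on {-e<..<e} \<gamma>"
    and reg: "\<And>s. s \<in> {-e<..<e} \<Longrightarrow> vector_derivative \<gamma> (at s) \<noteq> 0"
    and lev: "\<And>s. s \<in> {-e<..<e} \<Longrightarrow> g (\<gamma> s) = g (\<gamma> 0)"
    and p: "\<gamma> 0 \<in> U" "(px g (\<gamma> 0))\<^sup>2 + (py g (\<gamma> 0))\<^sup>2 > 0"
  shows "\<exists>c>0. (curvature \<gamma> has_real_derivative c * vertex_fun g (\<gamma> 0)) (at 0)"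
proof -
  let ?I = "{-e<..<e}"
  define v where "v = (\<lambda>s. vector_derivative \<gamma> (at s))"
  define w where "w = (\<lambda>s. vector_derivative v (at s))"
  have I: "open ?I" by simp
  have dg: "(\<gamma> has_vector_derivative v s) (at s)" if "s \<in> ?I" for s
    unfolding v_def by (rule smooth_curve_velocity(1)[OF I e(2) that])
  have sv: "smooth_on ?I v" unfolding v_def by (rule smooth_curve_velocity(2)[OF I e(2)])
  have dv: "(v has_vector_derivative w s) (at s)" if "s \<in> ?I" for s
    unfolding w_def by (rule smooth_curve_velocity(1)[OF I sv that])
  have sx: "smooth_on U (px g)" and sy: "smooth_on U (py g)"
    by (intro smooth_on_frechet U)+
  define P1 where "P1 s = px g (\<gamma> s)" for s
  define P2 where "P2 s = py g (\<gamma> s)" for s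
  define H11 where "H11 s = px (px g) (\<gamma> s)" for s
  define H12 where "H12 s = px (py g) (\<gamma> s)" for s
  define H22 where "H22 s = py (py g) (\<gamma> s)" for s
  define DD where "DD s = (P1 s)\<^sup>2 + (P2 s)\<^sup>2" for s
  have sub: "smooth_on U k \<Longrightarrow> s \<in> ?I \<Longrightarrow> \<gamma> s \<in> U \<Longrightarrow>
      ((\<lambda>s. k (\<gamma> s)) has_real_derivative fst (v s) * px k (\<gamma> s) + snd (v s) * py k (\<gamma> s)) (at s)"
    for k :: "real \<times> real \<Rightarrow> real" and s
    using smooth_on_chain_real[OF _ dg, of U k s] dd_plane[of U k "\<gamma> s" "v s"] by simp
  define J where "J = {s \<in> ?I. \<gamma> s \<in> U \<and> DD s > 0}"
  have contg: "continuous_on ?I \<gamma>" by (rule smooth_on_continuous[OF e(2)])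
  have oJ0: "open (?I \<inter> \<gamma> -` U)" by (rule continuous_open_preimage[OF contg I U(1)])
  have cP: "continuous_on (?I \<inter> \<gamma> -` U) P1" "continuous_on (?I \<inter> \<gamma> -` U) P2"
    unfolding P1_def P2_def
    by (rule continuous_on_compose2[OF smooth_on_continuous[OF sx] continuous_on_subset[OF contg]]
             continuous_on_compose2[OF smooth_on_continuous[OF sy] continuous_on_subset[OF contg]]; auto)+
  have "continuous_on (?I \<inter> \<gamma> -` U) DD" unfolding DD_def by (intro continuous_intros cP)
  from continuous_open_preimage[OF this oJ0, of "{0<..}"]
  have "open (?I \<inter> \<gamma> -` U \<inter> DD -` {0<..})" by simp
  also have "?I \<inter> \<gamma> -` U \<inter> DD -` {0<..} = J" by (auto simp: J_def)
  finally have oJ: "open J" .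
  have J0: "0 \<in> J" using e(1) p by (simp add: J_def DD_def P1_def P2_def)
  have JI: "s \<in> ?I" and JU: "\<gamma> s \<in> U" and JD: "DD s > 0" if "s \<in> J" for s using that by (auto simp: J_def)
  have dP1: "(P1 has_real_derivative fst (v s) * H11 s + snd (v s) * H12 s) (at s)" if "s \<in> J" for s
    using sub[OF sx JI[OF that] JU[OF that]] dd_commute[OF U JU[OF that], of "(0,1)" "(1,0)"]
    by (simp add: P1_def[abs_def] H11_def H12_def)
  have dP2: "(P2 has_real_derivative fst (v s) * H12 s + snd (v s) * H22 s) (at s)" if "s \<in> J" for s
    using sub[OF sy JI[OF that] JU[OF that]]
    by (simp add: P2_def[abs_def] H12_def H22_def)
  have eq1: "P1 s * fst (v s) + P2 s * snd (v s) = 0" if "s \<in> J" for s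
  proof -
    have "((\<lambda>s. g (\<gamma> s)) has_real_derivative 0) (at s)"
      by (rule has_field_derivative_transform_within_open[OF DERIV_const[of "g (\<gamma> 0)"] I JI[OF that]])
        (rule lev[symmetric])
    then have "0 = fst (v s) * P1 s + snd (v s) * P2 s"
      using sub[OF U(2) JI[OF that] JU[OF that]] unfolding P1_def P2_def by (rule DERIV_unique)
    then show ?thesis by (simp add: mult.commute)
  qed
  have eq2: "H11 s * fst (v s) * fst (v s) + 2 * H12 s * fst (v s) * snd (v s) + H22 s * snd (v s) * snd (v s)
      + P1 s * fst (w s) + P2 s * snd (w s) = 0" if "s \<in> J" for s
  proof -
    have "((\<lambda>s. P1 s * fst (v s) + P2 s * snd (v s)) has_real_derivative 0) (at s)"
      by (rule has_field_derivative_transform_within_open[OF DERIV_const[of 0] oJ that])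
        (use eq1 in simp)
    moreover have "((\<lambda>s. P1 s * fst (v s) + P2 s * snd (v s)) has_real_derivative
        ((fst (v s) * H11 s + snd (v s) * H12 s) * fst (v s) + fst (w s) * P1 s)
        + ((fst (v s) * H12 s + snd (v s) * H22 s) * snd (v s) + snd (w s) * P2 s)) (at s)"
      by (intro DERIV_add DERIV_mult dP1 dP2 that has_real_derivative_fst_snd dv JI)
    ultimately have "0 = ((fst (v s) * H11 s + snd (v s) * H12 s) * fst (v s) + fst (w s) * P1 s)
        + ((fst (v s) * H12 s + snd (v s) * H22 s) * snd (v s) + snd (w s) * P2 s)"
      by (rule DERIV_unique)
    then show ?thesis by (simp add: algebra_simps)
  qed
  define h where "h s = (P1 s * snd (v s) - P2 s * fst (v s)) / ((P1 s)\<^sup>2 + (P2 s)\<^sup>2)" for s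
  define N where "N s = hess_tt (P1 s) (P2 s) (H11 s) (H12 s) (H22 s)" for s
  have vne: "(fst (v s), snd (v s)) \<noteq> (0, 0)" if "s \<in> J" for s
    using reg[OF JI[OF that]] by (simp add: v_def zero_prod_def[symmetric])
  note alg = curvature_algebra[OF eq1 _ vne eq2, folded h_def N_def DD_def]
  have curv: "curvature \<gamma> s = sgn (h s) * (N s / (DD s * sqrt (DD s)))" if "s \<in> J" for s
    using alg(4)[OF that JD[OF that] that that]
    by (simp add: curvature_def v_def w_def Let_def)
  have hne: "h s \<noteq> 0" if "s \<in> J" for s using alg(3)[OF that JD[OF that] that that] .
  have v0: "fst (v 0) = - h 0 * P2 0" "snd (v 0) = h 0 * P1 0"
    using alg(1,2)[OF J0 JD[OF J0] J0 J0] by simp_all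
  have "isCont P1 0" "isCont P2 0" "isCont v 0"
    using dP1[OF J0] dP2[OF J0] has_vector_derivative_continuous[OF dv[OF JI[OF J0]]] by (auto intro: DERIV_isCont)
  then have "isCont h 0"
    unfolding h_def using JD[OF J0] by (intro continuous_intros) (auto simp: DD_def)
  then have "((\<lambda>s. h s * h 0) \<longlongrightarrow> h 0 * h 0) (nhds 0)"
    by (intro tendsto_intros) (simp add: isCont_def tendsto_at_iff_tendsto_nhds)
  moreover have "h 0 * h 0 > 0" using hne[OF J0] not_real_square_gt_zero by blast
  ultimately have "\<forall>\<^sub>F s in nhds 0. h s * h 0 > 0" by (rule order_tendstoD)
  moreover have "\<forall>\<^sub>F s in nhds 0. s \<in> J" using oJ J0 by (rule eventually_nhds_in_open)
  ultimately have ev: "\<forall>\<^sub>F s in nhds 0. curvature \<gamma> s = sgn (h 0) * (N s / (DD s * sqrt (DD s)))"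
  proof eventually_elim
    case (elim s)
    then have "sgn (h s) = sgn (h 0)" by (auto simp: zero_less_mult_iff)
    then show ?case using curv[OF elim(2)] by simp
  qed
  define K0 where "K0 = px (px (px g)) (\<gamma> 0)"
  define K1 where "K1 = px (px (py g)) (\<gamma> 0)"
  define K2 where "K2 = px (py (py g)) (\<gamma> 0)"
  define K3 where "K3 = py (py (py g)) (\<gamma> 0)"
  note J0' = JI[OF J0] JU[OF J0]
  have dH11: "(H11 has_real_derivative h 0 * (- P2 0 * K0 + P1 0 * K1)) (at 0)"
  proof -
    have "py (px (px g)) (\<gamma> 0) = px (py (px g)) (\<gamma> 0)" by (rule dd_commute[OF U(1) sx J0'(2)])
    also have "\<dots> = K1"
      unfolding K1_def
      by (rule arg_cong[where f="\<lambda>D. D (1,0)"], rule frechet_derivative_cong_open[OF U(1) J0'(2)])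
        (rule dd_commute[OF U])
    finally show ?thesis
      using sub[OF smooth_on_frechet[OF sx] J0', of "(1,0)"] v0
      by (simp add: H11_def[abs_def] K0_def algebra_simps)
  qed
  have dH12: "(H12 has_real_derivative h 0 * (- P2 0 * K1 + P1 0 * K2)) (at 0)"
  proof -
    have "py (px (py g)) (\<gamma> 0) = K2" unfolding K2_def by (rule dd_commute[OF U(1) sy J0'(2)])
    then show ?thesis
      using sub[OF smooth_on_frechet[OF sy] J0', of "(1,0)"] v0
      by (simp add: H12_def[abs_def] K1_def algebra_simps)
  qed
  have dH22: "(H22 has_real_derivative h 0 * (- P2 0 * K2 + P1 0 * K3)) (at 0)"
    using sub[OF smooth_on_frechet[OF sy] J0', of "(0,1)"] v0
    by (simp add: H22_def[abs_def] K2_def K3_def algebra_simps)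
  have d1: "(P1 has_real_derivative h 0 * (- P2 0 * H11 0 + P1 0 * H12 0)) (at 0)"
    using dP1[OF J0] v0 by (simp add: algebra_simps)
  have d2: "(P2 has_real_derivative h 0 * (- P2 0 * H12 0 + P1 0 * H22 0)) (at 0)"
    using dP2[OF J0] v0 by (simp add: algebra_simps)
  define N' where "N' = h 0 * ((- P2 0 * K0 + P1 0 * K1) * (P2 0)\<^sup>2 + H11 0 * (2 * P2 0 * (- P2 0 * H12 0 + P1 0 * H22 0))
     - 2 * ((- P2 0 * K1 + P1 0 * K2) * P1 0 * P2 0 + H12 0 * (- P2 0 * H11 0 + P1 0 * H12 0) * P2 0
        + H12 0 * P1 0 * (- P2 0 * H12 0 + P1 0 * H22 0))
     + ((- P2 0 * K2 + P1 0 * K3) * (P1 0)\<^sup>2 + H22 0 * (2 * P1 0 * (- P2 0 * H11 0 + P1 0 * H12 0))))"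
  have dN: "(N has_real_derivative N') (at 0)"
    unfolding N_def hess_tt_def N'_def
    by (rule derivative_eq_intros dH11 dH12 dH22 d1 d2 refl)+ (simp add: power2_eq_square algebra_simps)
  define D' where "D' = h 0 * (2 * P1 0 * (- P2 0 * H11 0 + P1 0 * H12 0) + 2 * P2 0 * (- P2 0 * H12 0 + P1 0 * H22 0))"
  have dD: "(DD has_real_derivative D') (at 0)"
    unfolding DD_def D'_def
    by (rule derivative_eq_intros d1 d2 refl)+ (simp add: power2_eq_square algebra_simps)
  have D0: "DD 0 > 0" by (rule JD[OF J0])
  have "((\<lambda>s. N s / (DD s * sqrt (DD s))) has_real_derivative
     (N' * (DD 0 * sqrt (DD 0)) - N 0 * (D' * sqrt (DD 0) + (D' * (inverse (sqrt (DD 0)) / 2)) * DD 0)) /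
       ((DD 0 * sqrt (DD 0)) * (DD 0 * sqrt (DD 0)))) (at 0)"
    by (rule DERIV_divide DERIV_mult dN dD DERIV_chain2[OF DERIV_real_sqrt[OF D0] dD, THEN DERIV_cong] | simp add: D0 less_imp_neq[OF D0, symmetric])+
  also have "(N' * (DD 0 * sqrt (DD 0)) - N 0 * (D' * sqrt (DD 0) + (D' * (inverse (sqrt (DD 0)) / 2)) * DD 0)) /
       ((DD 0 * sqrt (DD 0)) * (DD 0 * sqrt (DD 0))) = (N' * DD 0 - 3 / 2 * N 0 * D') / (DD 0 ^ 2 * sqrt (DD 0))"
  proof -
    define q where "q = sqrt (DD 0)"
    have q: "q > 0" "DD 0 = q * q" using D0 by (simp_all add: q_def)
    show ?thesis unfolding q_def[symmetric] unfolding q(2)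
      using q(1) by (simp add: field_simps power2_eq_square)
  qed
  also have "N' * DD 0 - 3 / 2 * N 0 * D' = h 0 * vertex_fun g (\<gamma> 0)"
  proof -
    have "vertex_fun g (\<gamma> 0) = vertex_poly 1 (P1 0) (P2 0) (H11 0) (H12 0) (H22 0) K0 K1 K2 K3"
      by (simp add: vertex_fun_def P1_def P2_def H11_def H12_def H22_def K0_def K1_def K2_def K3_def)
    then show ?thesis
      unfolding N'_def D'_def N_def DD_def vertex_poly_defs by algebra
  qed
  finally have "((\<lambda>s. sgn (h 0) * (N s / (DD s * sqrt (DD s)))) has_real_derivative
      sgn (h 0) * (h 0 * vertex_fun g (\<gamma> 0) / (DD 0 ^ 2 * sqrt (DD 0)))) (at 0)"
    by (rule DERIV_cmult)
  then have "(curvature \<gamma> has_real_derivative sgn (h 0) * (h 0 * vertex_fun g (\<gamma> 0) / (DD 0 ^ 2 * sqrt (DD 0)))) (at 0)"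
    using DERIV_cong_ev[OF refl ev refl] by blast
  moreover have "sgn (h 0) * (h 0 * vertex_fun g (\<gamma> 0) / (DD 0 ^ 2 * sqrt (DD 0))) =
      \<bar>h 0\<bar> / (DD 0 ^ 2 * sqrt (DD 0)) * vertex_fun g (\<gamma> 0)"
    by (simp add: abs_sgn)
  moreover have "\<bar>h 0\<bar> / (DD 0 ^ 2 * sqrt (DD 0)) > 0" using hne[OF J0] D0 by simp
  ultimately show ?thesis by metis
qed

text \<open>Whether a point is a vertex is independent of the parametrization, because every regular
  parametrization gives the same condition; it remains to produce one.\<close>

theorem level_curve_vertex_iff:
  fixes g :: "real \<times> real \<Rightarrow> real"
  assumes "open U" "smooth_on U g" "p \<in> U" "px g p \<noteq> 0 \<or> py g p \<noteq> 0"
  shows "level_curve_vertex g p \<longleftrightarrow> vertex_fun g p = 0"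
proof -
  define p1 where "p1 = px g p"
  define p2 where "p2 = py g p"
  have D: "p1\<^sup>2 + p2\<^sup>2 > 0" using assms(4) by (auto simp: p1_def p2_def sum_power2_gt_zero_iff)
  show ?thesis
  proof
    assume "level_curve_vertex g p"
    then obtain \<gamma> e where e: "e > 0" "smooth_on {-e<..<e} \<gamma>" "\<gamma> 0 = p"
        "\<forall>s\<in>{-e<..<e}. vector_derivative \<gamma> (at s) \<noteq> 0 \<and> g (\<gamma> s) = g p"
        "(curvature \<gamma> has_real_derivative 0) (at 0)"
      unfolding level_curve_vertex_def by blast
    obtain c where "c > 0" "(curvature \<gamma> has_real_derivative c * vertex_fun g (\<gamma> 0)) (at 0)"
      using curvature_deriv_level[OF assms(1,2) e(1,2)] e(3,4) assms(3) D unfolding p1_def p2_def by auto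
    then have "c * vertex_fun g p = 0" using e(3,5) DERIV_unique by metis
    then show "vertex_fun g p = 0" using \<open>c > 0\<close> by simp
  next
    assume z: "vertex_fun g p = 0"
    \<comment> \<open>coordinates along the tangent and the normal of the level curve, in which it is a graph\<close>
    define L where "L x = p + fst x *\<^sub>R (- p2, p1) + snd x *\<^sub>R (p1, p2)" for x :: "real \<times> real"
    define S where "S = L -` U"
    have S: "open S" unfolding S_def L_def by (intro open_vimage assms(1) continuous_intros)
    have sL: "smooth_on S L" unfolding L_def by (intro smooth_intros S)
    define F where "F x = g (L x) - g p" for x
    have sF: "smooth_on S F" unfolding F_def
      by (intro smooth_on_diff S smooth_on_const smooth_on_compose[OF assms(2) S assms(1) sL]) (simp add: S_def)
    have S0: "(0, 0) \<in> S" using assms(3) by (simp add: S_def L_def zero_prod_def[symmetric])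
    have "dd (0, 1) F (0, 0) = p1\<^sup>2 + p2\<^sup>2"
    proof -
      have "((\<lambda>s. F ((0, 0) + s *\<^sub>R (0, 1))) has_real_derivative dd (0, 1) F ((0, 0) + 0 *\<^sub>R (0, 1))) (at 0)"
        by (rule smooth_on_line_deriv[OF sF]) (use S0 in simp)
      moreover have "((\<lambda>s. g (p + s *\<^sub>R (p1, p2)) - g p) has_real_derivative dd (p1, p2) g (p + 0 *\<^sub>R (p1, p2)) - 0) (at 0)"
        by (intro DERIV_diff DERIV_const smooth_on_line_deriv[OF assms(2)]) (use assms(3) in \<open>simp add: zero_prod_def[symmetric]\<close>)
      ultimately have "dd (0, 1) F (0, 0) = dd (p1, p2) g p"
        by (simp add: F_def L_def zero_prod_def[symmetric] DERIV_unique)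
      then show ?thesis using dd_plane[OF assms(2,3), of "(p1, p2)"] by (simp add: p1_def p2_def power2_eq_square)
    qed
    with D have pos: "dd (0, 1) F (0, 0) > 0" by simp
    have F0: "F (0, 0) = 0" by (simp add: F_def L_def zero_prod_def[symmetric])
    obtain e Y where Y: "e > 0" "smooth_on {0 - e<..<0 + e} Y" "Y 0 = 0"
        "\<forall>x\<in>{0 - e<..<0 + e}. (x, Y x) \<in> S \<and> F (x, Y x) = 0"
      using implicit_function_local[OF S sF S0 F0 pos] by blast
    define \<gamma> where "\<gamma> s = L (s, Y s)" for s
    let ?I = "{-e<..<e}"
    have Y2: "smooth_on ?I Y" using Y(2) by simp
    have sg: "smooth_on ?I \<gamma>"
      unfolding \<gamma>_def by (rule smooth_on_compose[OF sL _ S]) (use Y(4) in \<open>auto intro!: smooth_intros Y2\<close>)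
    have g0: "\<gamma> 0 = p" by (simp add: \<gamma>_def L_def Y(3) zero_prod_def[symmetric])
    have lev: "g (\<gamma> s) = g p" if "s \<in> ?I" for s using Y(4) that by (simp add: F_def \<gamma>_def)
    have reg: "vector_derivative \<gamma> (at s) \<noteq> 0" if "s \<in> ?I" for s
    proof
      assume "vector_derivative \<gamma> (at s) = 0"
      then have "(\<gamma> has_vector_derivative 0) (at s)"
        using smooth_curve_velocity(1)[OF _ sg that] by simp
      then have d: "((\<lambda>s. - p2 * fst (\<gamma> s) + p1 * snd (\<gamma> s)) has_real_derivative - p2 * fst (0::real\<times>real) + p1 * snd (0::real\<times>real)) (at s)"
        by (intro DERIV_add DERIV_cmult has_real_derivative_fst_snd)
      have "(\<lambda>s. - p2 * fst (\<gamma> s) + p1 * snd (\<gamma> s)) = (\<lambda>s. (- p2 * fst p + p1 * snd p) + s * (p1\<^sup>2 + p2\<^sup>2))"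
        by (rule ext) (simp add: \<gamma>_def L_def power2_eq_square algebra_simps)
      moreover have "((\<lambda>s. (- p2 * fst p + p1 * snd p) + s * (p1\<^sup>2 + p2\<^sup>2)) has_real_derivative p1\<^sup>2 + p2\<^sup>2) (at s)"
        by (auto intro!: derivative_eq_intros)
      ultimately have "p1\<^sup>2 + p2\<^sup>2 = 0" using d by (auto dest: DERIV_unique)
      then show False using D by simp
    qed
    obtain c where "(curvature \<gamma> has_real_derivative c * vertex_fun g (\<gamma> 0)) (at 0)"
      using curvature_deriv_level[OF assms(1,2) Y(1) sg reg] lev g0 assms(3) D unfolding p1_def p2_def by auto
    then have "(curvature \<gamma> has_real_derivative 0) (at 0)" using z g0 by simp
    moreover have "g differentiable (at p)" by (rule smooth_on_differentiable[OF assms(2,3)])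
    moreover have "\<exists>v. frechet_derivative g (at p) v \<noteq> 0" using assms(4) by blast
    moreover have "\<forall>s\<in>?I. vector_derivative \<gamma> (at s) \<noteq> 0 \<and> g (\<gamma> s) = g p" using reg lev by blast
    ultimately show "level_curve_vertex g p"
      unfolding level_curve_vertex_def using Y(1) sg g0 by (intro conjI exI[of _ \<gamma>] exI[of _ e])
  qed
qed

section \<open>Trigonometric inequalities\<close>

lemma abs_sin_mult_le: "\<bar>sin (real n * x)\<bar> \<le> real n * \<bar>sin x\<bar>"
proof (induction n)
  case (Suc n)
  have "\<bar>sin (real (Suc n) * x)\<bar> = \<bar>sin (real n * x) * cos x + cos (real n * x) * sin x\<bar>"
    using sin_add[of "real n * x" x] by (simp add: distrib_right add.commute)
  also have "\<dots> \<le> \<bar>sin (real n * x)\<bar> * \<bar>cos x\<bar> + \<bar>cos (real n * x)\<bar> * \<bar>sin x\<bar>"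
    by (metis abs_mult abs_triangle_ineq)
  also have "\<dots> \<le> \<bar>sin (real n * x)\<bar> * 1 + 1 * \<bar>sin x\<bar>"
    by (intro add_mono mult_left_mono mult_right_mono) auto
  finally show ?case using Suc by (simp add: algebra_simps)
qed simp

text \<open>The cones \<open>\<bar>b\<bar> \<le> \<surd>3 a\<close> and \<open>\<surd>3 \<bar>Q\<bar> \<le> P\<close> are dual to each other. The following inequalities for trigonometric
  forms that are linear in \<open>(P, Q)\<close> are thereby reduced to inequalities without parameters.\<close>

lemma linear_form_pos:
  fixes P Q a b :: real
  assumes "P > sqrt 3 * \<bar>Q\<bar>" "\<bar>b\<bar> \<le> sqrt 3 * a" "(a, b) \<noteq> (0, 0)"
  shows "P * a + Q * b > 0"
proof -
  have "0 \<le> sqrt 3 * a" using assms(2) abs_ge_zero order_trans by blast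
  then have "a \<ge> 0" by (simp add: zero_le_mult_iff)
  moreover have "a \<noteq> 0" using assms(2,3) by auto
  ultimately have a: "a > 0" by simp
  have "- (Q * b) \<le> \<bar>Q\<bar> * \<bar>b\<bar>" by (metis abs_ge_minus_self abs_mult)
  also have "\<dots> \<le> \<bar>Q\<bar> * (sqrt 3 * a)" by (intro mult_left_mono assms) simp
  also have "\<dots> < P * a" using mult_strict_right_mono[OF assms(1) a] by (simp add: mult_ac)
  finally show ?thesis by linarith
qed

lemma sqrt3_sq: "sqrt 3 * sqrt 3 = 3" "sqrt 3 * (sqrt 3 * x) = 3 * x"
  by (simp_all add: mult.assoc[symmetric])

lemma sin_cos_5pi6: "sin (5 * pi / 6) = 1 / 2" "cos (5 * pi / 6) = - sqrt 3 / 2"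
proof -
  have "5 * pi / 6 = pi - pi / 6" by simp
  then show "sin (5 * pi / 6) = 1 / 2" "cos (5 * pi / 6) = - sqrt 3 / 2"
    by (simp_all only: sin_pi_minus cos_pi_minus sin_30 cos_30 minus_divide_left)
qed

lemma trig_wronskian_bound:
  assumes "pi / 6 \<le> \<phi>" "\<phi> \<le> 5 * pi / 6"
  shows "\<bar>5 * cos \<phi> - cos (5 * \<phi>)\<bar> \<le> sqrt 3 * (5 * sin \<phi> + sin (5 * \<phi>))"
proof -
  have five: "10 * sin x - 2 * sin (5 * x) \<ge> 0" if "0 \<le> x" "x \<le> pi" for x :: real
    using abs_sin_mult_le[of 5 x] sin_ge_zero[OF that] by simp
  have 1: "sqrt 3 * (5 * sin \<phi> + sin (5 * \<phi>)) - (5 * cos \<phi> - cos (5 * \<phi>)) \<ge> 0"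
  proof -
    define x where "x = \<phi> - pi / 6"
    have \<phi>: "\<phi> = x + pi / 6" "5 * \<phi> = 5 * x + 5 * pi / 6" by (simp_all add: x_def field_simps)
    have "sqrt 3 * (5 * sin \<phi> + sin (5 * \<phi>)) - (5 * cos \<phi> - cos (5 * \<phi>)) = 10 * sin x - 2 * sin (5 * x)"
      unfolding \<phi>(2) unfolding \<phi>(1)
      by (simp only: sin_add cos_add sin_30 cos_30 sin_cos_5pi6) (simp add: algebra_simps sqrt3_sq)
    then show ?thesis using five[of x] assms pi_gt_zero by (simp add: x_def)
  qed
  have 2: "sqrt 3 * (5 * sin \<phi> + sin (5 * \<phi>)) + (5 * cos \<phi> - cos (5 * \<phi>)) \<ge> 0"
  proof -
    define x where "x = 5 * pi / 6 - \<phi>"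
    have \<phi>: "\<phi> = 5 * pi / 6 - x" "5 * \<phi> = (pi / 6 - 5 * x) + 2 * pi + 2 * pi" by (simp_all add: x_def field_simps)
    have "sin (5 * \<phi>) = sin (pi / 6 - 5 * x)" "cos (5 * \<phi>) = cos (pi / 6 - 5 * x)"
      unfolding \<phi>(2) by (simp_all only: sin_periodic cos_periodic)
    then have "sqrt 3 * (5 * sin \<phi> + sin (5 * \<phi>)) + (5 * cos \<phi> - cos (5 * \<phi>)) = 10 * sin x - 2 * sin (5 * x)"
      unfolding \<phi>(1)
      by (simp only: sin_diff cos_diff sin_30 cos_30 sin_cos_5pi6) (simp add: algebra_simps sqrt3_sq)
    then show ?thesis using five[of x] assms pi_gt_zero by (simp add: x_def)
  qed
  show ?thesis using 1 2 by (simp add: abs_le_iff)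
qed

text \<open>This is the Wronskian \<open>B A' - A B'\<close> on the exceptional fibre \<open>r = t = 0\<close>, over the range of angles of the second and
  third sector; its sign makes \<open>B / A\<close> increase.\<close>

lemma trig_wronskian_neg:
  assumes "pi / 6 \<le> \<phi>" "\<phi> \<le> 5 * pi / 6" "P > sqrt 3 * \<bar>Q\<bar>"
  shows "(P * cos (2 * \<phi>) + Q * sin (2 * \<phi>)) * (- 3 * sin (3 * \<phi>))
    - cos (3 * \<phi>) * (- 2 * P * sin (2 * \<phi>) + 2 * Q * cos (2 * \<phi>)) < 0"
proof -
  let ?a = "5 * sin \<phi> + sin (5 * \<phi>)" and ?b = "5 * cos \<phi> - cos (5 * \<phi>)"
  have "(?a, ?b) \<noteq> (0, 0)"
  proof
    assume "(?a, ?b) = (0, 0)"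
    then have e: "sin (5 * \<phi>) = - 5 * sin \<phi>" "cos (5 * \<phi>) = 5 * cos \<phi>" by simp_all
    have "(sin (5 * \<phi>))\<^sup>2 + (cos (5 * \<phi>))\<^sup>2 = 25 * ((sin \<phi>)\<^sup>2 + (cos \<phi>)\<^sup>2)"
      unfolding e by (simp only: power_mult_distrib distrib_left) simp
    then show False by (simp only: sin_cos_squared_add)
  qed
  then have pos: "P * ?a + Q * ?b > 0"
    by (rule linear_form_pos[OF assms(3) trig_wronskian_bound[OF assms(1,2)]])
  have s: "sin (5 * \<phi>) = sin (3 * \<phi> + 2 * \<phi>)" "cos (5 * \<phi>) = cos (3 * \<phi> + 2 * \<phi>)"
    "sin \<phi> = sin (3 * \<phi> - 2 * \<phi>)" "cos \<phi> = cos (3 * \<phi> - 2 * \<phi>)" by simp_all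
  have "P * ?a + Q * ?b = - 2 * ((P * cos (2 * \<phi>) + Q * sin (2 * \<phi>)) * (- 3 * sin (3 * \<phi>))
    - cos (3 * \<phi>) * (- 2 * P * sin (2 * \<phi>) + 2 * Q * cos (2 * \<phi>)))"
    unfolding s sin_add sin_diff cos_add cos_diff by (simp add: algebra_simps)
  moreover have "X < 0" if "0 < - 2 * X" for X :: real using that by simp
  ultimately show ?thesis using pos by metis
qed

lemma trig_sector_bound:
  assumes "\<bar>z\<bar> \<le> pi / 3"
  shows "\<bar>6 * sin z + 2 * sin (3 * z) * cos z\<bar> \<le> sqrt 3 * (6 * cos z - 2 * sin (3 * z) * sin z)"
    and "\<bar>sin z\<bar> \<le> sqrt 3 * cos z"
proof -
  have main: "sqrt 3 * (6 * cos z - 2 * sin (3 * z) * sin z) - (6 * sin z + 2 * sin (3 * z) * cos z) \<ge> 0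
      \<and> sqrt 3 * cos z - sin z \<ge> 0"
    if z: "\<bar>z\<bar> \<le> pi / 3" for z :: real
  proof -
    define x where "x = pi / 3 - z"
    have x: "0 \<le> x" "x \<le> pi" using z pi_gt_zero by (auto simp: x_def abs_le_iff)
    have zx: "z = pi / 3 - x" "3 * z = pi - 3 * x" by (simp_all add: x_def field_simps)
    have e1: "sqrt 3 * cos z - sin z = 2 * sin x" "sqrt 3 * sin z + cos z = 2 * cos x"
      unfolding zx(1) by (simp_all only: sin_diff cos_diff sin_60 cos_60) (simp_all add: algebra_simps sqrt3_sq)
    have e2: "sin (3 * z) = sin (3 * x)" unfolding zx(2) by (rule sin_pi_minus)
    have "sqrt 3 * (6 * cos z - 2 * sin (3 * z) * sin z) - (6 * sin z + 2 * sin (3 * z) * cos z)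
        = 6 * (sqrt 3 * cos z - sin z) - 2 * sin (3 * z) * (sqrt 3 * sin z + cos z)"
      by (simp add: algebra_simps)
    also have "\<dots> = 12 * sin x - 4 * (sin (3 * x) * cos x)" unfolding e1 e2 by simp
    also have "\<dots> \<ge> 0"
    proof -
      have "sin (3 * x) * cos x \<le> \<bar>sin (3 * x)\<bar> * \<bar>cos x\<bar>" by (metis abs_ge_self abs_mult)
      also have "\<dots> \<le> (3 * \<bar>sin x\<bar>) * 1" using abs_sin_mult_le[of 3 x] by (intro mult_mono) auto
      finally show ?thesis using sin_ge_zero[OF x] by linarith
    qed
    finally show ?thesis using e1(1) sin_ge_zero[OF x] by linarith
  qed
  have z': "\<bar>- z\<bar> \<le> pi / 3" using assms by simp
  show "\<bar>6 * sin z + 2 * sin (3 * z) * cos z\<bar> \<le> sqrt 3 * (6 * cos z - 2 * sin (3 * z) * sin z)"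
    "\<bar>sin z\<bar> \<le> sqrt 3 * cos z"
    using main[OF assms] main[OF z'] unfolding abs_le_iff by (simp_all add: algebra_simps)
qed

text \<open>With \<open>z = 2 \<phi>\<close> and \<open>\<bar>\<phi>\<bar> \<le> \<pi> / 6\<close> the first inequality is the positivity of \<open>B\<close> on the first sector, and the
  second one expresses that \<open>r A / B\<close> increases across it in the coordinate \<open>v\<close> of the half-plane.\<close>

lemma trig_sector_pos:
  assumes "\<bar>z\<bar> \<le> pi / 3" "P > sqrt 3 * \<bar>Q\<bar>"
  shows "P * cos z + Q * sin z > 0"
    and "3 * (P * cos z + Q * sin z) + sin (3 * z) * (- P * sin z + Q * cos z) > 0"
proof -
  show "P * cos z + Q * sin z > 0"
    by (rule linear_form_pos[OF assms(2) trig_sector_bound(2)[OF assms(1)]])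
      (metis Pair_inject sin_zero_abs_cos_one abs_zero zero_neq_one)
  let ?a = "6 * cos z - 2 * sin (3 * z) * sin z" and ?b = "6 * sin z + 2 * sin (3 * z) * cos z"
  have "?a * cos z + ?b * sin z = 6 * ((cos z)\<^sup>2 + (sin z)\<^sup>2)" by algebra
  then have "?a * cos z + ?b * sin z = 6" by (simp only: sin_cos_squared_add2)
  moreover have "?a * cos z + ?b * sin z = 0" if "?a = 0" "?b = 0"
    unfolding that by simp
  ultimately have "(?a, ?b) \<noteq> (0, 0)" by force
  then have "P * ?a + Q * ?b > 0" by (rule linear_form_pos[OF assms(2) trig_sector_bound(1)[OF assms(1)]])
  then show "3 * (P * cos z + Q * sin z) + sin (3 * z) * (- P * sin z + Q * cos z) > 0"
    by (simp add: algebra_simps)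
qed

section \<open>Asymptotic directions and sectors\<close>

text \<open>The zeros of \<open>cos (3 \<phi>)\<close>, which are the tangent directions of the unperturbed branches; the first
  sector lies between number \<open>0\<close> and number \<open>1\<close> and is bisected by the angle \<open>0\<close>.\<close>

definition asym_angle :: "nat \<Rightarrow> real" where
  "asym_angle k = - pi / 6 + real k * pi / 3"

lemma three_asym_angle: "3 * (asym_angle k + x) = real k * pi + 3 * x - pi / 2"
  by (simp add: asym_angle_def field_simps)

lemma cos_three_asym: "cos (3 * (asym_angle k + x)) = (- 1) ^ k * sin (3 * x)"
proof -
  have "cos (3 * (asym_angle k + x)) = cos (real k * pi + 3 * x - pi / 2)" by (simp only: three_asym_angle)
  also have "\<dots> = sin (real k * pi + 3 * x)" by (simp add: cos_diff)
  also have "\<dots> = (- 1) ^ k * sin (3 * x)" by (simp add: sin_add cos_npi sin_npi)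
  finally show ?thesis .
qed

lemma sin_three_asym: "sin (3 * (asym_angle k + x)) = - ((- 1) ^ k * cos (3 * x))"
proof -
  have "sin (3 * (asym_angle k + x)) = sin (real k * pi + 3 * x - pi / 2)" by (simp only: three_asym_angle)
  also have "\<dots> = - cos (real k * pi + 3 * x)" by (simp add: sin_diff)
  also have "\<dots> = - ((- 1) ^ k * cos (3 * x))" by (simp add: cos_add cos_npi sin_npi)
  finally show ?thesis .
qed

text \<open>A continuous function that is positive on a compact segment of the fibre over \<open>(0, 0)\<close> is bounded
  below on a neighbourhood of the segment.\<close>

text \<open>All inequalities needed near the origin are checked on the exceptional fibre \<open>r = t = 0\<close>, where the
  functions are explicit, and extended to small \<open>r\<close> and \<open>t\<close> by compactness of a range of angles.\<close>

lemma segment_tube: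
  fixes h :: "real \<Rightarrow> real \<Rightarrow> real \<Rightarrow> real"
  assumes "open W" "continuous_on W (\<lambda>x. h (fst x) (fst (snd x)) (snd (snd x)))" "a \<le> b"
    and "\<And>\<phi>. a \<le> \<phi> \<Longrightarrow> \<phi> \<le> b \<Longrightarrow> (0, \<phi>, 0) \<in> W"
    and pos: "\<And>\<phi>. a \<le> \<phi> \<Longrightarrow> \<phi> \<le> b \<Longrightarrow> h 0 \<phi> 0 > 0"
  obtains c d where "c > 0" "d > 0"
    "\<And>r \<phi> t. \<bar>r\<bar> < d \<Longrightarrow> a - d < \<phi> \<Longrightarrow> \<phi> < b + d \<Longrightarrow> \<bar>t\<bar> < d \<Longrightarrow> (r, \<phi>, t) \<in> W \<and> h r \<phi> t > c"
proof -
  define H where "H x = h (fst x) (fst (snd x)) (snd (snd x))" for x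
  have cH: "continuous_on W H" using assms(2) by (simp add: H_def[abs_def])
  define K where "K = (\<lambda>\<phi>. (0::real, \<phi>, 0::real)) ` {a..b}"
  have K: "compact K" unfolding K_def
    by (intro compact_continuous_image continuous_intros) auto
  have KW: "K \<subseteq> W" using assms(4) by (auto simp: K_def)
  have "K \<noteq> {}" using assms(3) by (auto simp: K_def)
  then obtain x where x: "x \<in> K" "\<And>y. y \<in> K \<Longrightarrow> H x \<le> H y"
    using continuous_attains_inf[OF K _ continuous_on_subset[OF cH KW]] by blast
  define c where "c = H x / 2"
  have c: "c > 0" using x(1) pos by (auto simp: K_def c_def H_def)
  have op: "open (W \<inter> H -` {c<..})" by (rule continuous_open_preimage[OF cH assms(1)]) simp
  have "K \<subseteq> W \<inter> H -` {c<..}" using KW x(2) c by (fastforce simp: c_def)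
  then obtain e where e: "e > 0" "(\<Union>y\<in>K. ball y e) \<subseteq> W \<inter> H -` {c<..}"
    using compact_subset_open_imp_ball_epsilon_subset[OF K op] by blast
  define d where "d = e / 3"
  have "(r, \<phi>, t) \<in> W \<and> h r \<phi> t > c"
    if "\<bar>r\<bar> < d" "a - d < \<phi>" "\<phi> < b + d" "\<bar>t\<bar> < d" for r \<phi> t
  proof -
    define \<psi> where "\<psi> = max a (min b \<phi>)"
    have inK: "(0, \<psi>, 0) \<in> K" using assms(3) by (auto simp: K_def \<psi>_def)
    have "\<bar>\<psi> - \<phi>\<bar> < e / 3" using that assms(3) e(1) by (auto simp: \<psi>_def d_def max_def min_def)
    have "dist (0, \<psi>, 0) (r, \<phi>, t) \<le> dist 0 r + dist (\<psi>, 0) (\<phi>, t)"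
      using norm_Pair_le[of "0 - r" "(\<psi>, 0) - (\<phi>, t)"] by (simp add: dist_norm)
    also have "dist (\<psi>, 0) (\<phi>, t) \<le> dist \<psi> \<phi> + dist 0 t"
      using norm_Pair_le[of "\<psi> - \<phi>" "0 - t"] by (simp add: dist_norm)
    finally have "dist (0, \<psi>, 0) (r, \<phi>, t) < e"
      using that \<open>\<bar>\<psi> - \<phi>\<bar> < e / 3\<close> by (simp add: dist_real_def d_def)
    then have "(r, \<phi>, t) \<in> (\<Union>y\<in>K. ball y e)" by (intro UN_I[OF inK]) (simp add: mem_ball)
    then have "(r, \<phi>, t) \<in> W \<inter> H -` {c<..}" by (rule subsetD[OF e(2)])
    then show ?thesis by (simp add: H_def)
  qed
  moreover have "d > 0" using e(1) by (simp add: d_def)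
  ultimately show ?thesis using c that by blast
qed

lemma segment_bound:
  fixes h :: "real \<Rightarrow> real \<Rightarrow> real \<Rightarrow> real"
  assumes "open W" "continuous_on W (\<lambda>x. h (fst x) (fst (snd x)) (snd (snd x)))" "a \<le> b"
    and "\<And>\<phi>. a \<le> \<phi> \<Longrightarrow> \<phi> \<le> b \<Longrightarrow> (0, \<phi>, 0) \<in> W"
  obtains C d where "C > 0" "d > 0"
    "\<And>r \<phi> t. \<bar>r\<bar> < d \<Longrightarrow> a - d < \<phi> \<Longrightarrow> \<phi> < b + d \<Longrightarrow> \<bar>t\<bar> < d \<Longrightarrow> \<bar>h r \<phi> t\<bar> < C"
proof -
  have "continuous_on {a..b} (\<lambda>\<phi>. h 0 \<phi> 0)"
    using continuous_on_compose2[OF assms(2), of "{a..b}" "\<lambda>\<phi>. (0, \<phi>, 0)"] assms(4)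
    by (auto simp: continuous_on_Pair continuous_on_const continuous_on_id image_subset_iff)
  then have "compact ((\<lambda>\<phi>. h 0 \<phi> 0) ` {a..b})" by (rule compact_continuous_image) simp
  then obtain M where M: "M > 0" "\<And>y. y \<in> (\<lambda>\<phi>. h 0 \<phi> 0) ` {a..b} \<Longrightarrow> norm y \<le> M"
    using compact_imp_bounded bounded_pos by metis
  have pos: "M + 1 - \<bar>h 0 \<phi> 0\<bar> > 0" if "a \<le> \<phi>" "\<phi> \<le> b" for \<phi>
  proof -
    have "norm (h 0 \<phi> 0) \<le> M" by (rule M(2)) (use that in auto)
    then show ?thesis by simp
  qed
  have cont: "continuous_on W (\<lambda>x. M + 1 - \<bar>h (fst x) (fst (snd x)) (snd (snd x))\<bar>)"
    by (intro continuous_on_diff continuous_on_const continuous_on_rabs assms)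
  obtain c d where cd: "c > 0" "d > 0" "\<And>r \<phi> t. \<bar>r\<bar> < d \<Longrightarrow> a - d < \<phi> \<Longrightarrow> \<phi> < b + d \<Longrightarrow> \<bar>t\<bar> < d \<Longrightarrow>
      (r, \<phi>, t) \<in> W \<and> M + 1 - \<bar>h r \<phi> t\<bar> > c"
    by (rule segment_tube[where h="\<lambda>r \<phi> t. M + 1 - \<bar>h r \<phi> t\<bar>", OF assms(1) cont assms(3,4) pos]) blast+
  have "\<bar>h r \<phi> t\<bar> < M + 1" if "\<bar>r\<bar> < d" "a - d < \<phi>" "\<phi> < b + d" "\<bar>t\<bar> < d" for r \<phi> t
    using cd(3)[OF that] cd(1) by linarith
  moreover have "M + 1 > 0" using M(1) by simp
  ultimately show ?thesis using cd(2) that by blast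
qed

text \<open>The blown-up vertex set is \<open>r A (r, \<phi>) + t B (r, \<phi>, t) = 0\<close>, normalized on the exceptional fibre.
  The condition on \<open>P\<close> and \<open>Q\<close> says that \<open>B\<close> is positive on the closed first sector of the fibre. The antisymmetry of \<open>A\<close>
  expresses that \<open>(r, \<phi>)\<close> and \<open>(- r, \<phi> + \<pi>)\<close> are polar coordinates of the same point.\<close>

locale umbilic_polar =
  fixes A :: "real \<times> real \<Rightarrow> real" and B :: "real \<times> real \<times> real \<Rightarrow> real" and R0 \<tau>0 P Q :: real
  assumes R0: "R0 > 0" and tau0: "\<tau>0 > 0"
    and smooth_A: "smooth_on ({-R0<..<R0} \<times> UNIV) A"
    and smooth_B: "smooth_on ({-R0<..<R0} \<times> UNIV \<times> {-\<tau>0<..<\<tau>0}) B"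
    and A0: "A (0, \<phi>) = cos (3 * \<phi>)"
    and B0: "B (0, \<phi>, 0) = P * cos (2 * \<phi>) + Q * sin (2 * \<phi>)"
    and PQ: "P > sqrt 3 * \<bar>Q\<bar>"
    and A_sym: "\<bar>r\<bar> < R0 \<Longrightarrow> A (- r, \<phi> + pi) = - A (r, \<phi>)"
begin

definition dom :: "(real \<times> real \<times> real) set" where
  "dom = {-R0<..<R0} \<times> UNIV \<times> {-\<tau>0<..<\<tau>0}"

definition A' :: "real \<Rightarrow> real \<Rightarrow> real" where "A' r \<phi> = dd (0, 1) A (r, \<phi>)"
definition B' :: "real \<Rightarrow> real \<Rightarrow> real \<Rightarrow> real" where "B' r \<phi> t = dd (0, 1, 0) B (r, \<phi>, t)"

lemma open_dom: "open dom" by (simp add: dom_def open_Times)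

lemma mem_dom: "(r, \<phi>, t) \<in> dom \<longleftrightarrow> \<bar>r\<bar> < R0 \<and> \<bar>t\<bar> < \<tau>0"
  by (auto simp: dom_def abs_less_iff)

lemma fibre_dom: "(0, \<phi>, 0) \<in> dom" using R0 tau0 by (simp add: mem_dom)

lemma deriv_A: "\<bar>r\<bar> < R0 \<Longrightarrow> ((\<lambda>\<phi>. A (r, \<phi>)) has_real_derivative A' r \<phi>) (at \<phi>)"
  unfolding A'_def
  by (rule smooth_on_chain_real[OF smooth_A])
    (auto intro!: has_vector_derivative_Pair has_vector_derivative_const has_vector_derivative_id simp: abs_less_iff)

lemma deriv_B: "\<bar>r\<bar> < R0 \<Longrightarrow> \<bar>t\<bar> < \<tau>0 \<Longrightarrow> ((\<lambda>\<phi>. B (r, \<phi>, t)) has_real_derivative B' r \<phi> t) (at \<phi>)"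
  unfolding B'_def
  by (rule smooth_on_chain_real[OF smooth_B])
    (auto intro!: has_vector_derivative_Pair has_vector_derivative_const has_vector_derivative_id simp: abs_less_iff)

lemma A'0: "A' 0 \<phi> = - 3 * sin (3 * \<phi>)"
proof -
  have "((\<lambda>\<phi>. cos (3 * \<phi>)) has_real_derivative A' 0 \<phi>) (at \<phi>)"
    using deriv_A[of 0 \<phi>] R0 by (simp add: A0)
  moreover have "((\<lambda>\<phi>. cos (3 * \<phi>)) has_real_derivative - 3 * sin (3 * \<phi>)) (at \<phi>)"
    by (auto intro!: derivative_eq_intros)
  ultimately show ?thesis by (rule DERIV_unique)
qed

lemma B'0: "B' 0 \<phi> 0 = - 2 * P * sin (2 * \<phi>) + 2 * Q * cos (2 * \<phi>)"
proof -
  have "((\<lambda>\<phi>. P * cos (2 * \<phi>) + Q * sin (2 * \<phi>)) has_real_derivative B' 0 \<phi> 0) (at \<phi>)"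
    using deriv_B[of 0 0 \<phi>] R0 tau0 by (simp add: B0)
  moreover have "((\<lambda>\<phi>. P * cos (2 * \<phi>) + Q * sin (2 * \<phi>)) has_real_derivative
      - 2 * P * sin (2 * \<phi>) + 2 * Q * cos (2 * \<phi>)) (at \<phi>)"
    by (auto intro!: derivative_eq_intros)
  ultimately show ?thesis by (rule DERIV_unique)
qed

lemma cont_dom:
  "continuous_on dom (\<lambda>x. A (fst x, fst (snd x)))"
  "continuous_on dom (\<lambda>x. A' (fst x) (fst (snd x)))"
  "continuous_on dom (\<lambda>x. B (fst x, fst (snd x), snd (snd x)))"
  "continuous_on dom (\<lambda>x. B' (fst x) (fst (snd x)) (snd (snd x)))"
proof -
  show "continuous_on dom (\<lambda>x. A (fst x, fst (snd x)))"
    by (rule continuous_on_compose2[OF smooth_on_continuous[OF smooth_A]]) (auto simp: dom_def intro!: continuous_intros)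
  show "continuous_on dom (\<lambda>x. A' (fst x) (fst (snd x)))"
    unfolding A'_def
    by (rule continuous_on_compose2[OF smooth_on_continuous[OF smooth_on_frechet[OF smooth_A]]])
      (auto simp: dom_def intro!: continuous_intros)
  show "continuous_on dom (\<lambda>x. B (fst x, fst (snd x), snd (snd x)))"
    using smooth_on_continuous[OF smooth_B] by (simp add: dom_def)
  show "continuous_on dom (\<lambda>x. B' (fst x) (fst (snd x)) (snd (snd x)))"
    using smooth_on_continuous[OF smooth_on_frechet[OF smooth_B]] by (simp add: B'_def dom_def)
qed

text \<open>The zeros of \<open>cos (3 \<phi>)\<close> are simple, so they continue to zeros of \<open>A (r, \<cdot>)\<close> for small \<open>r\<close>. The bound
  \<open>\<pi> / 12\<close> is a quarter of the distance of two neighbouring zeros.\<close>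

lemma root_ex:
  "\<exists>d \<theta>. 0 < d \<and> d \<le> R0 \<and> smooth_on {-d<..<d} \<theta> \<and> \<theta> 0 = asym_angle k \<and>
    (\<forall>r. \<bar>r\<bar> < d \<longrightarrow> \<bar>\<theta> r - asym_angle k\<bar> < pi / 12 \<and> A (r, \<theta> r) = 0 \<and>
      (\<forall>\<phi>. \<bar>\<phi> - asym_angle k\<bar> \<le> pi / 12 \<longrightarrow>
        (\<theta> r < \<phi> \<longrightarrow> (- 1) ^ k * A (r, \<phi>) > 0) \<and> (\<phi> < \<theta> r \<longrightarrow> (- 1) ^ k * A (r, \<phi>) < 0)))"
proof -
  let ?\<alpha> = "asym_angle k" and ?\<sigma> = "(- 1) ^ k :: real"
  have sq: "?\<sigma> * (?\<sigma> * x) = x" for x by (simp add: mult.assoc[symmetric] power_mult_distrib[symmetric])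
  have A_at: "A (0, ?\<alpha> + x) = ?\<sigma> * sin (3 * x)" for x by (simp only: A0 cos_three_asym)
  have A'_at: "A' 0 (?\<alpha> + x) = 3 * (?\<sigma> * cos (3 * x))" for x unfolding A'0 sin_three_asym by (simp only: mult_minus_left mult_minus_right minus_minus)
  have sq': "?\<sigma> * (c * (?\<sigma> * x)) = c * x" for c x by (simp only: mult.left_commute[of c] sq)
  have 1: "?\<sigma> * A' 0 \<phi> > 0" if "?\<alpha> - pi / 12 \<le> \<phi>" "\<phi> \<le> ?\<alpha> + pi / 12" for \<phi>
  proof -
    define x where "x = \<phi> - ?\<alpha>"
    have \<phi>: "\<phi> = ?\<alpha> + x" by (simp add: x_def)
    have "- (pi / 2) < 3 * x" "3 * x < pi / 2" using that pi_gt_zero unfolding x_def by argo+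
    then have "cos (3 * x) > 0" by (rule cos_gt_zero_pi)
    then show ?thesis unfolding \<phi> A'_at sq' by simp
  qed
  obtain c1 d1 where d1: "c1 > 0" "d1 > 0" "\<And>r \<phi> t. \<bar>r\<bar> < d1 \<Longrightarrow> ?\<alpha> - pi / 12 - d1 < \<phi> \<Longrightarrow>
      \<phi> < ?\<alpha> + pi / 12 + d1 \<Longrightarrow> \<bar>t\<bar> < d1 \<Longrightarrow> (r, \<phi>, t) \<in> dom \<and> ?\<sigma> * A' r \<phi> > c1"
    by (rule segment_tube[where h="\<lambda>r \<phi> t. ?\<sigma> * A' r \<phi>", OF open_dom _ _ fibre_dom 1])
      (use cont_dom(2) pi_gt_zero in \<open>auto intro: continuous_on_mult_left\<close>)
  have s45: "sin (pi / 4) > 0" by (rule sin_gt_zero) auto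
  have 2: "?\<sigma> * A (0, \<phi>) > 0" if "?\<alpha> + pi / 12 \<le> \<phi>" "\<phi> \<le> ?\<alpha> + pi / 12" for \<phi>
  proof -
    have \<phi>: "\<phi> = ?\<alpha> + pi / 12" using that by simp
    show ?thesis unfolding \<phi> A_at sq using s45 by simp
  qed
  obtain c2 d2 where d2: "c2 > 0" "d2 > 0" "\<And>r \<phi> t. \<bar>r\<bar> < d2 \<Longrightarrow> ?\<alpha> + pi / 12 - d2 < \<phi> \<Longrightarrow>
      \<phi> < ?\<alpha> + pi / 12 + d2 \<Longrightarrow> \<bar>t\<bar> < d2 \<Longrightarrow> (r, \<phi>, t) \<in> dom \<and> ?\<sigma> * A (r, \<phi>) > c2"
    by (rule segment_tube[where h="\<lambda>r \<phi> t. ?\<sigma> * A (r, \<phi>)", OF open_dom _ _ fibre_dom 2])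
      (use cont_dom(1) in \<open>auto intro: continuous_on_mult_left\<close>)
  have 3: "- (?\<sigma> * A (0, \<phi>)) > 0" if "?\<alpha> - pi / 12 \<le> \<phi>" "\<phi> \<le> ?\<alpha> - pi / 12" for \<phi>
  proof -
    have \<phi>: "\<phi> = ?\<alpha> + - (pi / 12)" using that by simp
    show ?thesis unfolding \<phi> A_at sq using s45 by simp
  qed
  obtain c3 d3 where d3: "c3 > 0" "d3 > 0" "\<And>r \<phi> t. \<bar>r\<bar> < d3 \<Longrightarrow> ?\<alpha> - pi / 12 - d3 < \<phi> \<Longrightarrow>
      \<phi> < ?\<alpha> - pi / 12 + d3 \<Longrightarrow> \<bar>t\<bar> < d3 \<Longrightarrow> (r, \<phi>, t) \<in> dom \<and> - (?\<sigma> * A (r, \<phi>)) > c3"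
    by (rule segment_tube[where h="\<lambda>r \<phi> t. - (?\<sigma> * A (r, \<phi>))", OF open_dom _ _ fibre_dom 3])
      (use cont_dom(1) in \<open>auto intro: continuous_on_mult_left continuous_on_minus\<close>)
  define d where "d = min R0 (min d1 (min d2 d3))"
  have d: "d > 0" "d \<le> R0" "d \<le> d1" "d \<le> d2" "d \<le> d3" using d1 d2 d3 R0 by (auto simp: d_def)
  define D where "D = {-d<..<d} \<times> {?\<alpha> - pi / 12 - d<..<?\<alpha> + pi / 12 + d}"
  define F where "F p = ?\<sigma> * A p" for p
  have op: "open D" by (simp add: D_def open_Times)
  have DA: "smooth_on D A" by (rule smooth_on_subset[OF smooth_A]) (use d in \<open>auto simp: D_def\<close>)
  have sF: "smooth_on D F" unfolding F_def by (intro smooth_intros op DA)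
  have inc: "dd (0, 1) F p > 0" if "p \<in> D" for p
  proof -
    obtain r \<phi> where p: "p = (r, \<phi>)" by (cases p)
    have r: "\<bar>r\<bar> < R0" using that d by (auto simp: p D_def abs_less_iff)
    have "((\<lambda>\<phi>. F (r, \<phi>)) has_real_derivative dd (0, 1) F (r, \<phi>)) (at \<phi>)"
      by (rule smooth_on_chain_real[OF sF])
        (use that p in \<open>auto intro!: has_vector_derivative_Pair has_vector_derivative_const has_vector_derivative_id\<close>)
    moreover have "((\<lambda>\<phi>. F (r, \<phi>)) has_real_derivative ?\<sigma> * A' r \<phi>) (at \<phi>)"
      unfolding F_def by (rule DERIV_cmult[OF deriv_A[OF r]])
    ultimately have "dd (0, 1) F p = ?\<sigma> * A' r \<phi>" unfolding p by (rule DERIV_unique)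
    moreover have "?\<sigma> * A' r \<phi> > c1" using d1(3)[of r \<phi> 0] that d d1(2) by (auto simp: p D_def abs_less_iff)
    ultimately show ?thesis using d1(1) by simp
  qed
  interpret vertical_increase D F
    by unfold_locales (use op sF inc in \<open>auto simp: D_def\<close>)
  have in_D: "(r, \<phi>) \<in> D" if "\<bar>r\<bar> < d" "\<bar>\<phi> - ?\<alpha>\<bar> \<le> pi / 12" for r \<phi>
  proof -
    have "?\<alpha> - pi / 12 - d < \<phi>" "\<phi> < ?\<alpha> + pi / 12 + d" using that(2) d(1) by linarith+
    then show ?thesis using that(1) by (auto simp: D_def)
  qed
  have ends: "F (r, ?\<alpha> - pi / 12) < 0" "F (r, ?\<alpha> + pi / 12) > 0" if "\<bar>r\<bar> < d" for r
    using d2(3)[of r "?\<alpha> + pi / 12" 0] d3(3)[of r "?\<alpha> - pi / 12" 0] that d d2(1,2) d3(1,2) by (auto simp: F_def)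
  have ex: "\<exists>\<phi>. (r, \<phi>) \<in> D \<and> F (r, \<phi>) = 0" if "r \<in> {-d<..<d}" for r
  proof -
    have r: "\<bar>r\<bar> < d" using that by auto
    have "\<exists>\<phi>\<ge>?\<alpha> - pi / 12. \<phi> \<le> ?\<alpha> + pi / 12 \<and> F (r, \<phi>) = 0"
    proof (rule IVT)
      show "\<forall>x. ?\<alpha> - pi / 12 \<le> x \<and> x \<le> ?\<alpha> + pi / 12 \<longrightarrow> isCont (\<lambda>\<phi>. F (r, \<phi>)) x"
        by (intro allI impI DERIV_isCont[OF deriv_y] in_D[OF r]) linarith
    qed (use ends[OF r] in auto)
    then obtain \<phi> where "?\<alpha> - pi / 12 \<le> \<phi>" "\<phi> \<le> ?\<alpha> + pi / 12" "F (r, \<phi>) = 0" by blast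
    moreover from this have "\<bar>\<phi> - ?\<alpha>\<bar> \<le> pi / 12" by linarith
    ultimately show ?thesis using in_D[OF r, of \<phi>] by blast
  qed
  obtain \<theta> where \<theta>: "smooth_on {-d<..<d} \<theta>" "\<And>r. r \<in> {-d<..<d} \<Longrightarrow> (r, \<theta> r) \<in> D \<and> F (r, \<theta> r) = 0 \<and>
      (\<forall>\<phi>. (r, \<phi>) \<in> D \<longrightarrow> F (r, \<phi>) = 0 \<longrightarrow> \<phi> = \<theta> r)"
    using smooth_root_ex[OF open_real_greaterThanLessThan ex] by blast
  have F0: "F (0, ?\<alpha>) = 0" using A_at[of 0] by (simp add: F_def)
  have D0: "(0, ?\<alpha>) \<in> D" by (rule in_D) (use d(1) in simp_all)
  have "0 \<in> {-d<..<d}" using d(1) by simp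
  from \<theta>(2)[OF this, THEN conjunct2, THEN conjunct2, rule_format, OF D0 F0] have "\<theta> 0 = ?\<alpha>" by simp
  moreover have "\<bar>\<theta> r - ?\<alpha>\<bar> < pi / 12 \<and> A (r, \<theta> r) = 0 \<and> (\<forall>\<phi>. \<bar>\<phi> - ?\<alpha>\<bar> \<le> pi / 12 \<longrightarrow>
        (\<theta> r < \<phi> \<longrightarrow> ?\<sigma> * A (r, \<phi>) > 0) \<and> (\<phi> < \<theta> r \<longrightarrow> ?\<sigma> * A (r, \<phi>) < 0))"
    if r: "\<bar>r\<bar> < d" for r
  proof -
    have \<theta>r: "(r, \<theta> r) \<in> D" "F (r, \<theta> r) = 0" using \<theta>(2)[of r] r by (auto simp: abs_less_iff)
    have sgn: "(\<theta> r < \<phi> \<longrightarrow> F (r, \<phi>) > 0) \<and> (\<phi> < \<theta> r \<longrightarrow> F (r, \<phi>) < 0)"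
      if "\<bar>\<phi> - ?\<alpha>\<bar> \<le> pi / 12" for \<phi>
      using strict[OF \<theta>r(1) in_D[OF r that]] strict[OF in_D[OF r that] \<theta>r(1)] \<theta>r(2) by auto
    have "\<theta> r < ?\<alpha> + pi / 12"
      using sgn[of "?\<alpha> + pi / 12"] ends[OF r] \<theta>r(2) pi_gt_zero by (cases "\<theta> r" "?\<alpha> + pi / 12" rule: linorder_cases) auto
    moreover have "\<theta> r > ?\<alpha> - pi / 12"
      using sgn[of "?\<alpha> - pi / 12"] ends[OF r] \<theta>r(2) pi_gt_zero by (cases "\<theta> r" "?\<alpha> - pi / 12" rule: linorder_cases) auto
    ultimately have "\<bar>\<theta> r - ?\<alpha>\<bar> < pi / 12" by linarith
    then show ?thesis using sgn \<theta>r(2) by (simp add: F_def)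
  qed
  ultimately show ?thesis using d \<theta>(1) by (intro exI[of _ d] exI[of _ \<theta>]) auto
qed

end

text \<open>Six arcs of roots bound sectors; in the one around angle \<open>0\<close> the sum \<open>r A + t B\<close> has
  definite summands, in the two others it vanishes once for each \<open>r\<close>.\<close>

text \<open>The roots \<open>th 0, \<dots>, th 3\<close> of \<open>A (r, \<cdot>)\<close> bound three sectors; together with their antipodes they fill the
  disc, since \<open>th 3\<close> is \<open>th 0\<close> on the opposite side. The signs of \<open>B\<close> at the edges and the Wronskian decide how
  often \<open>r A + t B\<close> vanishes in a sector.\<close>

locale umbilic_sectors = umbilic_polar +
  fixes R \<tau> :: real and th :: "nat \<Rightarrow> real \<Rightarrow> real"
  assumes R: "R > 0" "R \<le> R0" and tau: "\<tau> > 0" "\<tau> \<le> \<tau>0"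
    and th_smooth: "k \<le> 3 \<Longrightarrow> smooth_on {-R<..<R} (th k)"
    and th_0: "k \<le> 3 \<Longrightarrow> th k 0 = asym_angle k"
    and th_near: "k \<le> 3 \<Longrightarrow> \<bar>r\<bar> < R \<Longrightarrow> \<bar>th k r - asym_angle k\<bar> < pi / 12"
    and th_root: "k \<le> 3 \<Longrightarrow> \<bar>r\<bar> < R \<Longrightarrow> A (r, th k r) = 0"
    and th_3: "\<bar>r\<bar> < R \<Longrightarrow> th 3 r = th 0 (- r) + pi"
    and A_sign: "k < 3 \<Longrightarrow> \<bar>r\<bar> < R \<Longrightarrow> th k r < \<phi> \<Longrightarrow> \<phi> < th (Suc k) r \<Longrightarrow> (- 1) ^ k * A (r, \<phi>) > 0"
    and B_0: "\<bar>r\<bar> < R \<Longrightarrow> \<bar>t\<bar> < \<tau> \<Longrightarrow> th 0 r \<le> \<phi> \<Longrightarrow> \<phi> \<le> th 1 r \<Longrightarrow> B (r, \<phi>, t) > 0"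
    and B_2: "\<bar>r\<bar> < R \<Longrightarrow> \<bar>t\<bar> < \<tau> \<Longrightarrow> B (r, th 2 r, t) < 0"
    and B_3: "\<bar>r\<bar> < R \<Longrightarrow> \<bar>t\<bar> < \<tau> \<Longrightarrow> B (r, th 3 r, t) > 0"
    and wronskian: "\<bar>r\<bar> < R \<Longrightarrow> \<bar>t\<bar> < \<tau> \<Longrightarrow> th 1 r \<le> \<phi> \<Longrightarrow> \<phi> \<le> th 3 r \<Longrightarrow>
      B (r, \<phi>, t) * A' r \<phi> - A (r, \<phi>) * B' r \<phi> t < 0"

lemma (in umbilic_polar) sectors_ex: "\<exists>R \<tau> th. umbilic_sectors A B R0 \<tau>0 P Q R \<tau> th"
proof -
  obtain d \<theta> where "\<And>k. 0 < d k \<and> d k \<le> R0 \<and> smooth_on {-d k<..<d k} (\<theta> k) \<and> \<theta> k 0 = asym_angle k \<and>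
    (\<forall>r. \<bar>r\<bar> < d k \<longrightarrow> \<bar>\<theta> k r - asym_angle k\<bar> < pi / 12 \<and> A (r, \<theta> k r) = 0 \<and>
      (\<forall>\<phi>. \<bar>\<phi> - asym_angle k\<bar> \<le> pi / 12 \<longrightarrow>
        (\<theta> k r < \<phi> \<longrightarrow> (- 1) ^ k * A (r, \<phi>) > 0) \<and> (\<phi> < \<theta> k r \<longrightarrow> (- 1) ^ k * A (r, \<phi>) < 0)))"
    using root_ex by metis
  then have d: "0 < d k" "d k \<le> R0" "smooth_on {-d k<..<d k} (\<theta> k)" "\<theta> k 0 = asym_angle k"
    and near: "\<bar>r\<bar> < d k \<Longrightarrow> \<bar>\<theta> k r - asym_angle k\<bar> < pi / 12"
    and root: "\<bar>r\<bar> < d k \<Longrightarrow> A (r, \<theta> k r) = 0"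
    and sgp: "\<bar>r\<bar> < d k \<Longrightarrow> \<bar>\<phi> - asym_angle k\<bar> \<le> pi / 12 \<Longrightarrow> \<theta> k r < \<phi> \<Longrightarrow> (- 1) ^ k * A (r, \<phi>) > 0"
    and sgn: "\<bar>r\<bar> < d k \<Longrightarrow> \<bar>\<phi> - asym_angle k\<bar> \<le> pi / 12 \<Longrightarrow> \<phi> < \<theta> k r \<Longrightarrow> (- 1) ^ k * A (r, \<phi>) < 0"
    for k r \<phi> by blast+
  have asym: "asym_angle 0 = - pi / 6" "asym_angle 1 = pi / 6" "asym_angle 2 = pi / 2" "asym_angle 3 = 5 * pi / 6"
    "asym_angle (Suc k) = asym_angle k + pi / 3" for k
    by (simp_all add: asym_angle_def field_simps)
  note [simp del] = One_nat_def
  \<comment> \<open>Near the edges of a sector \<open>root_ex\<close> gives the sign of \<open>A\<close>; in the middle it is the one for \<open>r = 0\<close>.\<close>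
  have "\<exists>e>0. \<forall>r \<phi>. \<bar>r\<bar> < e \<longrightarrow> asym_angle k + pi / 12 \<le> \<phi> \<longrightarrow> \<phi> \<le> asym_angle k + pi / 4 \<longrightarrow>
      (- 1) ^ k * A (r, \<phi>) > 0" for k
  proof -
    let ?\<sigma> = "(- 1) ^ k :: real"
    have pos: "?\<sigma> * A (0, \<phi>) > 0" if "asym_angle k + pi / 12 \<le> \<phi>" "\<phi> \<le> asym_angle k + pi / 4" for \<phi>
    proof -
      define x where "x = \<phi> - asym_angle k"
      have \<phi>: "\<phi> = asym_angle k + x" by (simp add: x_def)
      have "0 < 3 * x" "3 * x < pi" using that pi_gt_zero unfolding x_def by argo+
      then have "sin (3 * x) > 0" by (rule sin_gt_zero)
      then show ?thesis
        unfolding \<phi> A0 cos_three_asym by (simp add: mult.assoc[symmetric] power_mult_distrib[symmetric])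
    qed
    obtain c e where "c > 0" "e > 0" "\<And>r \<phi> t. \<bar>r\<bar> < e \<Longrightarrow> asym_angle k + pi / 12 - e < \<phi> \<Longrightarrow>
        \<phi> < asym_angle k + pi / 4 + e \<Longrightarrow> \<bar>t\<bar> < e \<Longrightarrow> (r, \<phi>, t) \<in> dom \<and> ?\<sigma> * A (r, \<phi>) > c"
      by (rule segment_tube[where h="\<lambda>r \<phi> t. ?\<sigma> * A (r, \<phi>)", OF open_dom _ _ fibre_dom pos])
        (use cont_dom(1) pi_gt_zero in \<open>auto intro: continuous_on_mult_left\<close>)
    then show ?thesis by (intro exI[of _ e]) (smt (verit, best))
  qed
  then obtain e where e: "\<And>k. e k > 0" and mid: "\<And>k r \<phi>. \<bar>r\<bar> < e k \<Longrightarrow> asym_angle k + pi / 12 \<le> \<phi> \<Longrightarrow>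
      \<phi> \<le> asym_angle k + pi / 4 \<Longrightarrow> (- 1) ^ k * A (r, \<phi>) > 0" by metis
  have sect: "(- 1) ^ k * A (r, \<phi>) > 0"
    if "\<bar>r\<bar> < d k" "\<bar>r\<bar> < d (Suc k)" "\<bar>r\<bar> < e k" "\<theta> k r < \<phi>" "\<phi> < \<theta> (Suc k) r" for k r \<phi>
  proof -
    consider "\<phi> \<le> asym_angle k + pi / 12" | "asym_angle k + pi / 12 \<le> \<phi>" "\<phi> \<le> asym_angle k + pi / 4"
      | "asym_angle k + pi / 4 \<le> \<phi>" by linarith
    then show ?thesis
    proof cases
      case 1
      then have "\<bar>\<phi> - asym_angle k\<bar> \<le> pi / 12" using near[OF that(1)] that(4) by linarith
      then show ?thesis by (rule sgp[OF that(1) _ that(4)])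
    next
      case 2
      then show ?thesis using mid[OF that(3)] by blast
    next
      case 3
      then have "\<bar>\<phi> - asym_angle (Suc k)\<bar> \<le> pi / 12" using near[OF that(2)] that(5) asym(5)[of k] by linarith
      then have "(- 1) ^ Suc k * A (r, \<phi>) < 0" by (rule sgn[OF that(2) _ that(5)])
      then show ?thesis by simp
    qed
  qed
  \<comment> \<open>Each of the four conditions on \<open>B\<close> is extended from its own range of angles on the exceptional fibre.\<close>
  have L: "P * cos z + Q * sin z > 0" if "\<bar>z\<bar> \<le> pi / 3" for z by (rule trig_sector_pos(1)[OF that PQ])
  have B0': "B (0, \<phi>, 0) > 0" if "- pi / 6 \<le> \<phi>" "\<phi> \<le> pi / 6" for \<phi>
    unfolding B0 by (rule L) (use that in \<open>auto simp: abs_le_iff\<close>)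
  obtain c1 e1 where e1: "c1 > 0" "e1 > 0" "\<And>r \<phi> t. \<bar>r\<bar> < e1 \<Longrightarrow> - pi / 6 - e1 < \<phi> \<Longrightarrow>
        \<phi> < pi / 6 + e1 \<Longrightarrow> \<bar>t\<bar> < e1 \<Longrightarrow> (r, \<phi>, t) \<in> dom \<and> B (r, \<phi>, t) > c1"
    by (rule segment_tube[where h="\<lambda>r \<phi> t. B (r, \<phi>, t)" and a="- pi / 6" and b="pi / 6", OF open_dom cont_dom(3) _ fibre_dom B0'])
      (use pi_gt_zero in auto)
  have Pp: "P > 0" using PQ by (smt (verit) abs_ge_zero mult_nonneg_nonneg real_sqrt_ge_zero)
  have B2': "- B (0, \<phi>, 0) > 0" if "pi / 2 \<le> \<phi>" "\<phi> \<le> pi / 2" for \<phi>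
  proof -
    have \<phi>: "2 * \<phi> = pi" using that by simp
    show ?thesis unfolding B0 \<phi> using Pp by simp
  qed
  obtain c2 e2 where e2: "c2 > 0" "e2 > 0" "\<And>r \<phi> t. \<bar>r\<bar> < e2 \<Longrightarrow> pi / 2 - e2 < \<phi> \<Longrightarrow>
        \<phi> < pi / 2 + e2 \<Longrightarrow> \<bar>t\<bar> < e2 \<Longrightarrow> (r, \<phi>, t) \<in> dom \<and> - B (r, \<phi>, t) > c2"
    by (rule segment_tube[where h="\<lambda>r \<phi> t. - B (r, \<phi>, t)" and a="pi / 2" and b="pi / 2", OF open_dom continuous_on_minus[OF cont_dom(3)] _ fibre_dom B2'])
      auto
  have B3': "B (0, \<phi>, 0) > 0" if "5 * pi / 6 \<le> \<phi>" "\<phi> \<le> 5 * pi / 6" for \<phi>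
  proof -
    have \<phi>: "2 * \<phi> = - pi / 3 + 2 * pi" using that by simp
    have "cos (2 * \<phi>) = cos (- pi / 3)" "sin (2 * \<phi>) = sin (- pi / 3)" unfolding \<phi> by (simp_all only: cos_periodic sin_periodic)
    then show ?thesis unfolding B0 using L[of "- pi / 3"] by simp
  qed
  obtain c3 e3 where e3: "c3 > 0" "e3 > 0" "\<And>r \<phi> t. \<bar>r\<bar> < e3 \<Longrightarrow> 5 * pi / 6 - e3 < \<phi> \<Longrightarrow>
        \<phi> < 5 * pi / 6 + e3 \<Longrightarrow> \<bar>t\<bar> < e3 \<Longrightarrow> (r, \<phi>, t) \<in> dom \<and> B (r, \<phi>, t) > c3"
    by (rule segment_tube[where h="\<lambda>r \<phi> t. B (r, \<phi>, t)" and a="5 * pi / 6" and b="5 * pi / 6", OF open_dom cont_dom(3) _ fibre_dom B3']) auto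
  have W': "- (B (0, \<phi>, 0) * A' 0 \<phi> - A (0, \<phi>) * B' 0 \<phi> 0) > 0" if "pi / 6 \<le> \<phi>" "\<phi> \<le> 5 * pi / 6" for \<phi>
    using trig_wronskian_neg[OF that PQ] unfolding A0 B0 A'0 B'0 by linarith
  have cW: "continuous_on dom (\<lambda>x. - (B (fst x, fst (snd x), snd (snd x)) * A' (fst x) (fst (snd x))
      - A (fst x, fst (snd x)) * B' (fst x) (fst (snd x)) (snd (snd x))))"
    by (intro continuous_on_minus continuous_on_diff continuous_on_mult cont_dom)
  obtain c4 e4 where e4: "c4 > 0" "e4 > 0" "\<And>r \<phi> t. \<bar>r\<bar> < e4 \<Longrightarrow> pi / 6 - e4 < \<phi> \<Longrightarrow>
        \<phi> < 5 * pi / 6 + e4 \<Longrightarrow> \<bar>t\<bar> < e4 \<Longrightarrow> (r, \<phi>, t) \<in> dom \<and>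
        - (B (r, \<phi>, t) * A' r \<phi> - A (r, \<phi>) * B' r \<phi> t) > c4"
    by (rule segment_tube[where h="\<lambda>r \<phi> t. - (B (r, \<phi>, t) * A' r \<phi> - A (r, \<phi>) * B' r \<phi> t)"
          and a="pi / 6" and b="5 * pi / 6", OF open_dom cW _ fibre_dom W'])
      (use pi_gt_zero in auto)
  define \<epsilon> where "\<epsilon> = min e1 (min e2 (min e3 e4))"
  have \<epsilon>: "\<epsilon> > 0" "\<epsilon> \<le> e1" "\<epsilon> \<le> e2" "\<epsilon> \<le> e3" "\<epsilon> \<le> e4" using e1 e2 e3 e4 by (auto simp: \<epsilon>_def)
  have "\<exists>g>0. \<forall>r. \<bar>r\<bar> < g \<longrightarrow> \<bar>\<theta> k r - asym_angle k\<bar> < \<epsilon>" for k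
  proof -
    have "isCont (\<theta> k) 0"
      using smooth_on_continuous[OF d(3)[of k]] d(1)[of k] by (simp add: continuous_on_eq_continuous_at)
    then have "\<forall>\<^sub>F r in at 0. dist (\<theta> k r) (\<theta> k 0) < \<epsilon>" using \<epsilon>(1) by (simp add: isCont_def tendsto_iff)
    then obtain g where g: "g > 0" "\<And>r. r \<noteq> 0 \<Longrightarrow> dist r 0 < g \<Longrightarrow> dist (\<theta> k r) (\<theta> k 0) < \<epsilon>"
      unfolding eventually_at by auto
    have "\<bar>\<theta> k r - asym_angle k\<bar> < \<epsilon>" if "\<bar>r\<bar> < g" for r
      using g(2)[of r] that \<epsilon>(1) d(4)[of k] by (cases "r = 0") (auto simp: dist_real_def)
    then show ?thesis using g(1) by blast
  qed
  then obtain g where g: "\<And>k. g k > 0" and close: "\<And>k r. \<bar>r\<bar> < g k \<Longrightarrow> \<bar>\<theta> k r - asym_angle k\<bar> < \<epsilon>" by metis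
  define R where "R = Min ({R0, \<epsilon>} \<union> d ` {..4} \<union> e ` {..4} \<union> g ` {..4})"
  have Rle: "R \<le> x" if "x \<in> {R0, \<epsilon>} \<union> d ` {..4} \<union> e ` {..4} \<union> g ` {..4}" for x
    unfolding R_def by (rule Min_le) (use that in auto)
  have Rpos: "R > 0" unfolding R_def using R0 \<epsilon>(1) d(1) e g by (subst Min_gr_iff) auto
  have RR: "R \<le> R0" "R \<le> \<epsilon>" "k \<le> 4 \<Longrightarrow> R \<le> d k" "k \<le> 4 \<Longrightarrow> R \<le> e k" "k \<le> 4 \<Longrightarrow> R \<le> g k" for k
    by (rule Rle; simp)+
  define \<tau> where "\<tau> = min \<tau>0 \<epsilon>"
  have cl: "\<bar>\<theta> k r - asym_angle k\<bar> < \<epsilon>" if "k \<le> 3" "\<bar>r\<bar> < R" for k r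
    using close[of r k] RR(5)[of k] that by simp
  have "umbilic_sectors A B R0 \<tau>0 P Q R \<tau> \<theta>"
  proof unfold_locales
    show "R > 0" "R \<le> R0" "\<tau> > 0" "\<tau> \<le> \<tau>0" using Rpos RR(1) tau0 \<epsilon>(1) by (auto simp: \<tau>_def)
    show "smooth_on {-R<..<R} (\<theta> k)" if "k \<le> 3" for k
      by (rule smooth_on_subset[OF d(3)[of k]]) (use RR(3)[of k] that in auto)
    show "\<theta> k 0 = asym_angle k" for k by (rule d(4))
    show "\<bar>\<theta> k r - asym_angle k\<bar> < pi / 12" "A (r, \<theta> k r) = 0" if "k \<le> 3" "\<bar>r\<bar> < R" for k r
      using near[of r k] root[of r k] RR(3)[of k] that by simp_all
    show "(- 1) ^ k * A (r, \<phi>) > 0" if "k < 3" "\<bar>r\<bar> < R" "\<theta> k r < \<phi>" "\<phi> < \<theta> (Suc k) r" for k r \<phi>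
      using sect[of r k \<phi>] RR(3)[of k] RR(3)[of "Suc k"] RR(4)[of k] that by simp
    show "\<theta> 3 r = \<theta> 0 (- r) + pi" if "\<bar>r\<bar> < R" for r
    proof -
      have r: "\<bar>- r\<bar> < R" using that by simp
      have "A (r, \<theta> 0 (- r) + pi) = 0"
        using A_sym[of "- r" "\<theta> 0 (- r)"] root[of "- r" 0] RR(3)[of 0] RR(1) that by simp
      moreover have "\<bar>\<theta> 0 (- r) + pi - asym_angle 3\<bar> \<le> pi / 12"
      proof -
        have "\<bar>\<theta> 0 (- r) - asym_angle 0\<bar> < pi / 12" using near[of "- r" 0] RR(3)[of 0] that by simp
        then show ?thesis unfolding asym by linarith
      qed
      ultimately show ?thesis
        using sgp[of r 3 "\<theta> 0 (- r) + pi"] sgn[of r 3 "\<theta> 0 (- r) + pi"] RR(3)[of 3] that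
        by (cases "\<theta> 3 r" "\<theta> 0 (- r) + pi" rule: linorder_cases) auto
    qed
    fix r t assume rt: "\<bar>r\<bar> < R" "\<bar>t\<bar> < \<tau>"
    then have rt': "\<bar>r\<bar> < \<epsilon>" "\<bar>t\<bar> < \<epsilon>" using RR(2) by (auto simp: \<tau>_def)
    show "B (r, \<phi>, t) > 0" if "\<theta> 0 r \<le> \<phi>" "\<phi> \<le> \<theta> 1 r" for \<phi>
    proof -
      have "- pi / 6 - e1 < \<phi>" "\<phi> < pi / 6 + e1"
        using cl[OF _ rt(1), of 0] cl[OF _ rt(1), of 1] that \<epsilon> unfolding asym by linarith+
      then show ?thesis using e1(3)[of r \<phi> t] e1(1) rt' \<epsilon> by simp
    qed
    show "B (r, \<theta> 2 r, t) < 0"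
    proof -
      have "pi / 2 - e2 < \<theta> 2 r" "\<theta> 2 r < pi / 2 + e2"
        using cl[OF _ rt(1), of 2] \<epsilon> unfolding asym by linarith+
      then show ?thesis using e2(3)[of r "\<theta> 2 r" t] e2(1) rt' \<epsilon> by simp
    qed
    show "B (r, \<theta> 3 r, t) > 0"
    proof -
      have "5 * pi / 6 - e3 < \<theta> 3 r" "\<theta> 3 r < 5 * pi / 6 + e3"
        using cl[OF _ rt(1), of 3] \<epsilon> unfolding asym by linarith+
      then show ?thesis using e3(3)[of r "\<theta> 3 r" t] e3(1) rt' \<epsilon> by simp
    qed
    show "B (r, \<phi>, t) * A' r \<phi> - A (r, \<phi>) * B' r \<phi> t < 0" if "\<theta> 1 r \<le> \<phi>" "\<phi> \<le> \<theta> 3 r" for \<phi>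
    proof -
      have "pi / 6 - e4 < \<phi>" "\<phi> < 5 * pi / 6 + e4"
        using cl[OF _ rt(1), of 1] cl[OF _ rt(1), of 3] that \<epsilon> unfolding asym by linarith+
      then show ?thesis using e4(3)[of r \<phi> t] e4(1) rt' \<epsilon> by simp
    qed
  qed
  then show ?thesis by blast
qed

section \<open>Curves in the sectors\<close>

text \<open>To be applied to the squared norm along a graph over the line, where it cuts out the part of the
  graph in a disc.\<close>

lemma sublevel_half:
  fixes g g' :: "real \<Rightarrow> real"
  assumes "0 \<le> M" "M < \<omega>" "\<rho> < \<omega>" "0 < \<rho>"
    and d: "\<And>u. \<bar>u\<bar> < \<omega> \<Longrightarrow> (g has_real_derivative g' u) (at u)"
    and inc: "\<And>u. M < u \<Longrightarrow> u < \<omega> \<Longrightarrow> g' u > 0"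
    and low: "g M < K"
    and high: "\<And>u. \<rho> < u \<Longrightarrow> u < \<omega> \<Longrightarrow> g u > K"
  shows "\<exists>b. M < b \<and> b \<le> \<rho> \<and> g b = K \<and> (\<forall>u. M < u \<longrightarrow> u < \<omega> \<longrightarrow> (g u \<le> K \<longleftrightarrow> u \<le> b) \<and> (g u < K \<longleftrightarrow> u < b))"
proof -
  have mono: "g x < g y" if "M < x" "x < y" "y < \<omega>" for x y
  proof (rule DERIV_pos_imp_increasing[OF that(2)])
    fix u assume "x \<le> u" "u \<le> y"
    then have "\<bar>u\<bar> < \<omega>" "M < u" "u < \<omega>" using that assms(1) by auto
    then show "\<exists>y. (g has_real_derivative y) (at u) \<and> y > 0" using d inc by blast
  qed
  define w where "w = (max M \<rho> + \<omega>) / 2"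
  have w: "M < w" "\<rho> < w" "w < \<omega>" using assms(2,3) by (auto simp: w_def max_def)
  have "\<exists>b\<ge>M. b \<le> w \<and> g b = K"
  proof (rule IVT)
    show "g M \<le> K" "K \<le> g w" "M \<le> w" using low high[OF w(2,3)] w(1) by auto
    show "\<forall>x. M \<le> x \<and> x \<le> w \<longrightarrow> isCont g x"
      using w assms(1) by (intro allI impI DERIV_isCont[OF d]) auto
  qed
  then obtain b where b: "M \<le> b" "b \<le> w" "g b = K" by blast
  have b': "M < b" "b < \<omega>" using b low w(3) by (auto simp: order_le_less)
  moreover have "b \<le> \<rho>" using high[of b] b'(2) b(3) by (cases "\<rho> < b") auto
  moreover have "(g u \<le> K \<longleftrightarrow> u \<le> b) \<and> (g u < K \<longleftrightarrow> u < b)" if "M < u" "u < \<omega>" for u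
    using mono[OF that(1), of b] mono[OF b'(1), of u] that(2) b'(2) b(3)
    by (cases u b rule: linorder_cases) auto
  ultimately show ?thesis using b(3) by blast
qed

text \<open>The two halves of the line are treated separately, after reflecting one of them.\<close>

lemma sublevel_interval:
  fixes g g' :: "real \<Rightarrow> real"
  assumes "0 \<le> M" "M < \<omega>" "\<rho> < \<omega>" "0 < \<rho>"
    and d: "\<And>u. \<bar>u\<bar> < \<omega> \<Longrightarrow> (g has_real_derivative g' u) (at u)"
    and inc: "\<And>u. M < u \<Longrightarrow> u < \<omega> \<Longrightarrow> g' u > 0"
    and dec: "\<And>u. M < u \<Longrightarrow> u < \<omega> \<Longrightarrow> g' (- u) < 0"
    and low: "\<And>u. \<bar>u\<bar> \<le> M \<Longrightarrow> g u < K"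
    and high: "\<And>u. \<rho> < \<bar>u\<bar> \<Longrightarrow> \<bar>u\<bar> < \<omega> \<Longrightarrow> g u > K"
  shows "\<exists>a b. - \<rho> \<le> a \<and> a < 0 \<and> 0 < b \<and> b \<le> \<rho> \<and> g a = K \<and> g b = K \<and>
    (\<forall>u. \<bar>u\<bar> < \<omega> \<longrightarrow> (g u \<le> K \<longleftrightarrow> a \<le> u \<and> u \<le> b) \<and> (g u < K \<longleftrightarrow> a < u \<and> u < b))"
proof -
  obtain b where b: "M < b" "b \<le> \<rho>" "g b = K"
    "\<And>u. M < u \<Longrightarrow> u < \<omega> \<Longrightarrow> (g u \<le> K \<longleftrightarrow> u \<le> b) \<and> (g u < K \<longleftrightarrow> u < b)"
    using sublevel_half[OF assms(1-4) d inc low[of M]] high assms(1,4) by auto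
  have d2: "((\<lambda>u. g (- u)) has_real_derivative - g' (- u)) (at u)" if "\<bar>u\<bar> < \<omega>" for u
    using DERIV_mirror[of g "g' (- u)" u] d[of "- u"] that by (simp add: DERIV_mirror)
  obtain a where a: "M < a" "a \<le> \<rho>" "g (- a) = K"
    "\<And>u. M < u \<Longrightarrow> u < \<omega> \<Longrightarrow> (g (- u) \<le> K \<longleftrightarrow> u \<le> a) \<and> (g (- u) < K \<longleftrightarrow> u < a)"
    using sublevel_half[OF assms(1-4) d2, where K=K] dec low[of "- M"] high[of "- u" for u] assms(1,4)
    by auto
  have "(g u \<le> K \<longleftrightarrow> - a \<le> u \<and> u \<le> b) \<and> (g u < K \<longleftrightarrow> - a < u \<and> u < b)" if "\<bar>u\<bar> < \<omega>" for u
  proof -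
    consider "u > M" | "\<bar>u\<bar> \<le> M" | "- u > M" by linarith
    then show ?thesis
    proof cases
      case 1
      then show ?thesis using b(4)[of u] that a(1) assms(1) by auto
    next
      case 2
      then have "g u < K" "- a < u" "u < b" using low[OF 2] a(1) b(1) by auto
      then show ?thesis by simp
    next
      case 3
      then show ?thesis using a(4)[of "- u"] that b(1) assms(1) by auto
    qed
  qed
  then show ?thesis using a b assms(1) by (intro exI[of _ "- a"] exI[of _ b]) auto
qed

context umbilic_sectors
begin

lemma asym_angle_Suc: "asym_angle (Suc k) = asym_angle k + pi / 3"
  by (simp add: asym_angle_def field_simps)

lemma th_order:
  assumes "\<bar>r\<bar> < R" "k < 3"
  shows "th k r < th (Suc k) r"
proof -
  have "\<bar>th k r - asym_angle k\<bar> < pi / 12" "\<bar>th (Suc k) r - asym_angle (Suc k)\<bar> < pi / 12"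
    using th_near[OF _ assms(1)] assms(2) by simp_all
  then show ?thesis using pi_gt_zero asym_angle_Suc[of k] by linarith
qed

lemma B_1: "\<bar>r\<bar> < R \<Longrightarrow> \<bar>t\<bar> < \<tau> \<Longrightarrow> B (r, th 1 r, t) > 0"
  using B_0[of r t "th 1 r"] th_order[of r 0] by simp

lemma open_sector:
  assumes "k < 3"
  shows "open {(r, \<phi>). \<bar>r\<bar> < R \<and> th k r < \<phi> \<and> \<phi> < th (Suc k) r}"
proof -
  let ?S = "{-R<..<R} \<times> (UNIV :: real set)"
  have c: "continuous_on ?S (\<lambda>p. th k (fst p))" if "k \<le> 3" for k
    by (rule continuous_on_compose2[OF smooth_on_continuous[OF th_smooth[OF that]]]) (auto intro!: continuous_intros)
  have S: "open ?S" by (simp add: open_Times)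
  have c1: "continuous_on ?S (\<lambda>p. snd p - th k (fst p))" "continuous_on ?S (\<lambda>p. th (Suc k) (fst p) - snd p)"
    using assms by (auto intro!: continuous_intros c)
  have "open ((?S \<inter> (\<lambda>p. snd p - th k (fst p)) -` {0<..}) \<inter> (?S \<inter> (\<lambda>p. th (Suc k) (fst p) - snd p) -` {0<..}))"
    by (intro open_Int continuous_open_preimage[OF _ S] c1) auto
  also have "(?S \<inter> (\<lambda>p. snd p - th k (fst p)) -` {0<..}) \<inter> (?S \<inter> (\<lambda>p. th (Suc k) (fst p) - snd p) -` {0<..})
      = {(r, \<phi>). \<bar>r\<bar> < R \<and> th k r < \<phi> \<and> \<phi> < th (Suc k) r}"
    by (auto simp: abs_less_iff)
  finally show ?thesis .
qed

text \<open>In the second and third sector the quotient \<open>B / A\<close> increases with the angle from \<open>-\<infinity>\<close> to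
  \<open>\<infinity>\<close>, so that it takes the value \<open>- r / t\<close> once.\<close>

text \<open>In the second and third sector the quotient \<open>B / A\<close> increases with the angle from \<open>-\<infinity>\<close> to \<open>\<infinity>\<close>, because \<open>A\<close>
  vanishes at both edges and \<open>B\<close> changes its sign, so that it takes the value \<open>- r / t\<close> once. This includes
  \<open>r = 0\<close>, where the curve passes through the origin.\<close>

lemma through_branch:
  assumes k: "k = 1 \<or> k = 2" and t: "\<bar>t\<bar> < \<tau>" "t \<noteq> 0"
  obtains \<Theta> where "smooth_on {-R<..<R} \<Theta>"
    "\<And>r. \<bar>r\<bar> < R \<Longrightarrow> th k r < \<Theta> r \<and> \<Theta> r < th (Suc k) r"
    "\<And>r \<phi>. \<bar>r\<bar> < R \<Longrightarrow> th k r < \<phi> \<Longrightarrow> \<phi> < th (Suc k) r \<Longrightarrow> r * A (r, \<phi>) + t * B (r, \<phi>, t) = 0 \<longleftrightarrow> \<phi> = \<Theta> r"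
proof -
  define D where "D = {(r, \<phi>). \<bar>r\<bar> < R \<and> th k r < \<phi> \<and> \<phi> < th (Suc k) r}"
  define F where "F p = fst p / t + B (fst p, snd p, t) / A p" for p
  have k3: "k < 3" using k by auto
  have op: "open D" unfolding D_def by (rule open_sector[OF k3])
  have Ane: "A p \<noteq> 0" if "p \<in> D" for p
    using that A_sign[OF k3] by (force simp: D_def)
  have tt: "\<bar>t\<bar> < \<tau>0" using t tau by simp
  have RR0: "\<bar>r\<bar> < R0" if "\<bar>r\<bar> < R" for r using that R by simp
  have sA: "smooth_on D A" by (rule smooth_on_subset[OF smooth_A]) (use R in \<open>auto simp: D_def abs_less_iff\<close>)
  have sB: "smooth_on D (\<lambda>p. B (fst p, snd p, t))"
  proof (rule smooth_on_compose[OF smooth_B op])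
    show "open ({-R0<..<R0} \<times> (UNIV::real set) \<times> {-\<tau>0<..<\<tau>0})" by (simp add: open_Times)
    show "smooth_on D (\<lambda>p. (fst p, snd p, t))" by (intro smooth_intros op)
  qed (use R tt in \<open>auto simp: D_def abs_less_iff\<close>)
  have sF: "smooth_on D F"
    unfolding F_def by (intro smooth_intros op sA sB) (use Ane t in auto)
  have inc: "dd (0, 1) F p > 0" if p: "p \<in> D" for p
  proof -
    obtain r \<phi> where p': "p = (r, \<phi>)" by (cases p)
    have r: "\<bar>r\<bar> < R" "th k r < \<phi>" "\<phi> < th (Suc k) r" using p by (auto simp: p' D_def)
    have "((\<lambda>\<phi>. F (r, \<phi>)) has_real_derivative dd (0, 1) F (r, \<phi>)) (at \<phi>)"
      by (rule smooth_on_chain_real[OF sF])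
        (use p p' in \<open>auto intro!: has_vector_derivative_Pair has_vector_derivative_const has_vector_derivative_id\<close>)
    moreover have "((\<lambda>\<phi>. F (r, \<phi>)) has_real_derivative 0 + (B' r \<phi> t * A (r, \<phi>) - B (r, \<phi>, t) * A' r \<phi>) / (A (r, \<phi>) * A (r, \<phi>))) (at \<phi>)"
      unfolding F_def fst_conv snd_conv
      by (intro DERIV_add DERIV_const DERIV_divide deriv_A deriv_B RR0 r tt) (use Ane[OF p] p' in auto)
    ultimately have eq: "dd (0, 1) F p = 0 + (B' r \<phi> t * A (r, \<phi>) - B (r, \<phi>, t) * A' r \<phi>) / (A (r, \<phi>) * A (r, \<phi>))"
      unfolding p' by (rule DERIV_unique)
    have "th 1 r \<le> \<phi>" "\<phi> \<le> th 3 r"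
      using k r th_order[OF r(1), of 1] th_order[OF r(1), of 2] by (auto simp: numeral_2_eq_2 numeral_3_eq_3)
    from wronskian[OF r(1) t(1) this]
    have "B' r \<phi> t * A (r, \<phi>) - B (r, \<phi>, t) * A' r \<phi> > 0" by (simp add: mult.commute)
    moreover have "A (r, \<phi>) * A (r, \<phi>) > 0" using Ane[OF p] p' not_real_square_gt_zero by blast
    ultimately show ?thesis unfolding eq by simp
  qed
  interpret vertical_increase D F
    by unfold_locales (use op sF inc in \<open>auto simp: D_def\<close>)
  have zero: "F (r, \<phi>) = 0 \<longleftrightarrow> r * A (r, \<phi>) + t * B (r, \<phi>, t) = 0" if "(r, \<phi>) \<in> D" for r \<phi>
    using Ane[OF that] t(2) by (simp add: F_def field_simps)
  have Bsgn: "B (r, th k r, t) * B (r, th (Suc k) r, t) < 0" if "\<bar>r\<bar> < R" for r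
    using k B_1[OF that t(1)] B_2[OF that t(1)] B_3[OF that t(1)]
    by (auto simp: numeral_2_eq_2[symmetric] numeral_3_eq_3[symmetric] mult_pos_neg mult_neg_pos)
  have ex: "\<exists>\<phi>. (r, \<phi>) \<in> D \<and> F (r, \<phi>) = 0" if "r \<in> {-R<..<R}" for r
  proof -
    have r: "\<bar>r\<bar> < R" using that by auto
    define G where "G \<phi> = r * A (r, \<phi>) + t * B (r, \<phi>, t)" for \<phi>
    have cont: "isCont G x" for x
      unfolding G_def using DERIV_isCont[OF deriv_A[OF RR0[OF r], of x]] DERIV_isCont[OF deriv_B[OF RR0[OF r] tt, of x]]
      by (intro continuous_intros)
    have ends: "G (th k r) = t * B (r, th k r, t)" "G (th (Suc k) r) = t * B (r, th (Suc k) r, t)"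
      using th_root[OF _ r, of k] th_root[OF _ r, of "Suc k"] k3 by (simp_all add: G_def)
    have prod: "G (th k r) * G (th (Suc k) r) < 0"
    proof -
      have "G (th k r) * G (th (Suc k) r) = (t * t) * (B (r, th k r, t) * B (r, th (Suc k) r, t))"
        unfolding ends by (simp only: mult_ac)
      moreover have "t * t > 0" using t(2) not_real_square_gt_zero by blast
      ultimately show ?thesis using Bsgn[OF r] by (simp only: mult_pos_neg)
    qed
    have le: "th k r \<le> th (Suc k) r" using th_order[OF r k3] by simp
    have "\<exists>\<phi>\<ge>th k r. \<phi> \<le> th (Suc k) r \<and> G \<phi> = 0"
    proof (cases "G (th k r) < 0")
      case True
      then have "G (th (Suc k) r) > 0" using prod by (simp add: mult_less_0_iff)
      then show ?thesis using True le cont by (intro IVT) auto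
    next
      case False
      then have "G (th k r) > 0" "G (th (Suc k) r) < 0" using prod by (auto simp: mult_less_0_iff)
      then show ?thesis using le cont by (intro IVT2) auto
    qed
    then obtain \<phi> where \<phi>: "th k r \<le> \<phi>" "\<phi> \<le> th (Suc k) r" "G \<phi> = 0" by blast
    then have "th k r < \<phi>" "\<phi> < th (Suc k) r" using prod by (auto simp: order_le_less)
    then have "(r, \<phi>) \<in> D" using r by (simp add: D_def)
    then show ?thesis using zero \<phi>(3) by (auto simp: G_def)
  qed
  obtain \<Theta> where \<Theta>: "smooth_on {-R<..<R} \<Theta>" "\<And>r. r \<in> {-R<..<R} \<Longrightarrow> (r, \<Theta> r) \<in> D \<and> F (r, \<Theta> r) = 0 \<and>
      (\<forall>\<phi>. (r, \<phi>) \<in> D \<longrightarrow> F (r, \<phi>) = 0 \<longrightarrow> \<phi> = \<Theta> r)"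
    using smooth_root_ex[OF open_real_greaterThanLessThan ex] by blast
  show ?thesis
  proof (rule that[OF \<Theta>(1)])
    fix r assume "\<bar>r\<bar> < R"
    then have r: "r \<in> {-R<..<R}" by (auto simp: abs_less_iff)
    show "th k r < \<Theta> r \<and> \<Theta> r < th (Suc k) r" using \<Theta>(2)[OF r] by (auto simp: D_def)
    fix \<phi> assume "th k r < \<phi>" "\<phi> < th (Suc k) r"
    then have "(r, \<phi>) \<in> D" using \<open>\<bar>r\<bar> < R\<close> by (simp add: D_def)
    then show "r * A (r, \<phi>) + t * B (r, \<phi>, t) = 0 \<longleftrightarrow> \<phi> = \<Theta> r"
      using \<Theta>(2)[OF r] zero by blast
  qed
qed

subsection \<open>Half-plane coordinates on the first sector\<close>

text \<open>The angle \<open>\<psi>\<close> with \<open>\<phi> = ang r \<psi>\<close> rescales the first sector to \<open>[- \<pi> / 2, \<pi> / 2]\<close>. With \<open>(u, v) = r (sin \<psi>, cos \<psi>)\<close> the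
  sector becomes the half-plane \<open>v \<ge> 0\<close>, with the two edges forming the line \<open>v = 0\<close>.\<close>

definition mid :: "real \<Rightarrow> real" where "mid r = (th 0 r + th 1 r) / 2"
definition wid :: "real \<Rightarrow> real" where "wid r = (th 1 r - th 0 r) / pi"
definition ang :: "real \<Rightarrow> real \<Rightarrow> real" where "ang r \<psi> = mid r + \<psi> * wid r"

lemma wid_pos: "\<bar>r\<bar> < R \<Longrightarrow> wid r > 0"
  using th_order[of r 0] by (simp add: wid_def)

lemma ang_diff: "ang r \<psi> - th 0 r = (\<psi> + pi / 2) * wid r" "th 1 r - ang r \<psi> = (pi / 2 - \<psi>) * wid r"
  by (simp_all add: ang_def mid_def wid_def field_simps)

lemma ang_ends: "ang r (- (pi / 2)) = th 0 r" "ang r (pi / 2) = th 1 r"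
  using ang_diff(1)[of r "- (pi / 2)"] ang_diff(2)[of r "pi / 2"] by simp_all

lemma ang_le: "\<bar>r\<bar> < R \<Longrightarrow> \<bar>\<psi>\<bar> \<le> pi / 2 \<Longrightarrow> th 0 r \<le> ang r \<psi> \<and> ang r \<psi> \<le> th 1 r"
proof -
  assume r: "\<bar>r\<bar> < R" and c: "\<bar>\<psi>\<bar> \<le> pi / 2"
  have "(\<psi> + pi / 2) * wid r \<ge> 0" "(pi / 2 - \<psi>) * wid r \<ge> 0"
    using wid_pos[OF r] c by (auto intro!: mult_nonneg_nonneg simp: abs_le_iff)
  then show ?thesis using ang_diff[of r \<psi>] by linarith
qed

lemma ang_less: "\<bar>r\<bar> < R \<Longrightarrow> \<bar>\<psi>\<bar> < pi / 2 \<Longrightarrow> th 0 r < ang r \<psi> \<and> ang r \<psi> < th 1 r"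
proof -
  assume r: "\<bar>r\<bar> < R" and c: "\<bar>\<psi>\<bar> < pi / 2"
  have "(\<psi> + pi / 2) * wid r > 0" "(pi / 2 - \<psi>) * wid r > 0"
    using wid_pos[OF r] c by (auto intro!: mult_pos_pos simp: abs_less_iff)
  then show ?thesis using ang_diff[of r \<psi>] by linarith
qed

lemma ang_0: "ang 0 \<psi> = \<psi> / 3"
  by (simp add: ang_def mid_def wid_def th_0 asym_angle_def field_simps)

text \<open>The quotient \<open>A / B\<close> in the rescaled angle. In the first sector \<open>B\<close> is positive, so this is smooth up to
  and beyond the edges, on which it vanishes.\<close>

definition quo :: "real \<times> real \<times> real \<Rightarrow> real" where
  "quo x = A (fst x, ang (fst x) (fst (snd x))) / B (fst x, ang (fst x) (fst (snd x)), snd (snd x))"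

definition slab :: "(real \<times> real \<times> real) set" where "slab = {-R<..<R} \<times> UNIV \<times> {-\<tau><..<\<tau>}"

definition Om :: "(real \<times> real \<times> real) set" where
  "Om = slab \<inter> (\<lambda>x. B (fst x, ang (fst x) (fst (snd x)), snd (snd x))) -` (- {0})"

lemma open_slab: "open slab" by (simp add: slab_def open_Times)

lemma smooth_th:
  assumes "k \<le> 3"
  shows "smooth_on slab (\<lambda>x. th k (fst x))"
proof (rule smooth_on_compose[OF th_smooth[OF assms] open_slab])
  show "smooth_on slab fst" by (rule smooth_on_bounded_linear[OF bounded_linear_fst open_slab])
qed (auto simp: slab_def)

lemma smooth_ang: "smooth_on slab (\<lambda>x. ang (fst x) (fst (snd x)))"
  unfolding ang_def mid_def wid_def by (intro smooth_intros open_slab smooth_th) auto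

lemma smooth_A_ang: "smooth_on slab (\<lambda>x. A (fst x, ang (fst x) (fst (snd x))))"
proof (rule smooth_on_compose[OF smooth_A open_slab])
  show "open ({-R0<..<R0} \<times> (UNIV::real set))" by (simp add: open_Times)
  show "smooth_on slab (\<lambda>x. (fst x, ang (fst x) (fst (snd x))))" by (intro smooth_intros open_slab smooth_ang)
qed (use R in \<open>auto simp: slab_def\<close>)

lemma smooth_B_ang: "smooth_on slab (\<lambda>x. B (fst x, ang (fst x) (fst (snd x)), snd (snd x)))"
proof (rule smooth_on_compose[OF smooth_B open_slab])
  show "open ({-R0<..<R0} \<times> (UNIV::real set) \<times> {-\<tau>0<..<\<tau>0})" by (simp add: open_Times)
  show "smooth_on slab (\<lambda>x. (fst x, ang (fst x) (fst (snd x)), snd (snd x)))"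
    by (intro smooth_intros open_slab smooth_ang)
qed (use R tau in \<open>auto simp: slab_def\<close>)

lemma open_Om: "open Om"
  unfolding Om_def
  by (intro continuous_open_preimage[OF smooth_on_continuous[OF smooth_B_ang] open_slab] open_Compl) simp

lemma smooth_quo: "smooth_on Om quo"
proof -
  have sub: "Om \<subseteq> slab" by (auto simp: Om_def)
  show ?thesis
    unfolding quo_def
    by (intro smooth_on_divide open_Om smooth_on_subset[OF smooth_A_ang sub] smooth_on_subset[OF smooth_B_ang sub])
      (auto simp: Om_def)
qed

lemma sector_Om: "\<bar>r\<bar> < R \<Longrightarrow> \<bar>\<psi>\<bar> \<le> pi / 2 \<Longrightarrow> \<bar>t\<bar> < \<tau> \<Longrightarrow> (r, \<psi>, t) \<in> Om"
  using B_0[of r t "ang r \<psi>"] ang_le[of r \<psi>] by (auto simp: Om_def slab_def abs_less_iff)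

definition quo_r :: "real \<Rightarrow> real \<Rightarrow> real \<Rightarrow> real" where "quo_r r \<psi> t = dd (1, 0, 0) quo (r, \<psi>, t)"
definition quo_c :: "real \<Rightarrow> real \<Rightarrow> real \<Rightarrow> real" where "quo_c r \<psi> t = dd (0, 1, 0) quo (r, \<psi>, t)"

text \<open>The derivatives of \<open>r quo (r, \<psi>, t)\<close> with respect to the coordinates \<open>v\<close> and \<open>u\<close> of the half-plane, in polar
  coordinates. They extend continuously to \<open>r = 0\<close>, although \<open>(u, v)\<close> are singular there.\<close>

definition Ev :: "real \<Rightarrow> real \<Rightarrow> real \<Rightarrow> real" where
  "Ev r \<psi> t = cos \<psi> * (quo (r, \<psi>, t) + r * quo_r r \<psi> t) - sin \<psi> * quo_c r \<psi> t"
definition Eu :: "real \<Rightarrow> real \<Rightarrow> real \<Rightarrow> real" where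
  "Eu r \<psi> t = sin \<psi> * (quo (r, \<psi>, t) + r * quo_r r \<psi> t) + cos \<psi> * quo_c r \<psi> t"

lemma quo_chain:
  assumes "(X has_real_derivative X') (at s)" "(\<psi> has_real_derivative \<psi>') (at s)" "(X s, \<psi> s, t) \<in> Om"
  shows "((\<lambda>s. quo (X s, \<psi> s, t)) has_real_derivative X' * quo_r (X s) (\<psi> s) t + \<psi>' * quo_c (X s) (\<psi> s) t) (at s)"
proof -
  have "((\<lambda>s. (X s, \<psi> s, t)) has_vector_derivative (X', \<psi>', 0)) (at s)"
    using assms(1,2)
    by (intro has_vector_derivative_Pair has_vector_derivative_const)
      (simp_all add: has_real_derivative_iff_has_vector_derivative)
  from smooth_on_chain_real[OF smooth_quo this assms(3)]
  have "((\<lambda>s. quo (X s, \<psi> s, t)) has_real_derivative dd (X', \<psi>', 0) quo (X s, \<psi> s, t)) (at s)" .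
  moreover have "dd (X', \<psi>', 0) quo (X s, \<psi> s, t) = X' * quo_r (X s) (\<psi> s) t + \<psi>' * quo_c (X s) (\<psi> s) t"
    using dd_add[OF smooth_quo assms(3), of "X' *\<^sub>R (1, 0, 0)" "\<psi>' *\<^sub>R (0, 1, 0)"]
      dd_scaleR[OF smooth_quo assms(3), of X' "(1, 0, 0)"] dd_scaleR[OF smooth_quo assms(3), of \<psi>' "(0, 1, 0)"]
    by (simp add: quo_r_def quo_c_def)
  ultimately show ?thesis by simp
qed

text \<open>On the exceptional fibre \<open>quo\<close> is \<open>cos \<psi>\<close> divided by the trigonometric form \<open>l\<close>, and the claim becomes
  \<open>3 l + sin (2 \<psi>) l' > 0\<close>.\<close>

lemma Ev_0:
  assumes "\<bar>\<psi>\<bar> \<le> pi / 2"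
  shows "Ev 0 \<psi> 0 > 0"
proof -
  define l where "l \<psi> = P * cos (2 * \<psi> / 3) + Q * sin (2 * \<psi> / 3)" for \<psi>
  define l' where "l' = - P * sin (2 * \<psi> / 3) + Q * cos (2 * \<psi> / 3)"
  have q: "quo (0, \<psi>, 0) = cos \<psi> / l \<psi>" for \<psi> by (simp add: quo_def ang_0 A0 B0 l_def)
  have z: "\<bar>2 * \<psi> / 3\<bar> \<le> pi / 3" using assms by simp
  note tp = trig_sector_pos[OF z PQ]
  have l: "l \<psi> > 0" unfolding l_def by (rule tp(1))
  have "((\<lambda>s. quo (0, s, 0)) has_real_derivative 0 * quo_r 0 \<psi> 0 + 1 * quo_c 0 \<psi> 0) (at \<psi>)"
    by (rule quo_chain) (use assms R tau in \<open>auto intro!: sector_Om\<close>)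
  then have "((\<lambda>s. cos s / l s) has_real_derivative quo_c 0 \<psi> 0) (at \<psi>)" by (simp add: q)
  moreover have "(l has_real_derivative 2 / 3 * l') (at \<psi>)"
    unfolding l_def[abs_def] l'_def by (auto intro!: derivative_eq_intros simp: algebra_simps)
  then have "((\<lambda>s. cos s / l s) has_real_derivative (- sin \<psi> * l \<psi> - cos \<psi> * (2 / 3 * l')) / (l \<psi> * l \<psi>)) (at \<psi>)"
    using l by (intro DERIV_divide DERIV_cos) auto
  ultimately have qc: "quo_c 0 \<psi> 0 = (- sin \<psi> * l \<psi> - cos \<psi> * (2 / 3 * l')) / (l \<psi> * l \<psi>)" by (rule DERIV_unique)
  have s3: "sin (3 * (2 * \<psi> / 3)) = 2 * sin \<psi> * cos \<psi>" using sin_double[of \<psi>] by simp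
  have "3 * (l \<psi> * l \<psi>) * Ev 0 \<psi> 0 = 3 * (cos \<psi> * cos \<psi> + sin \<psi> * sin \<psi>) * l \<psi> + 2 * sin \<psi> * cos \<psi> * l'"
  proof -
    have "3 * (L * L) * (c * (c / L + 0 * d) - s * ((- s * L - c * (2 / 3 * k)) / (L * L))) = 3 * (c * c + s * s) * L + 2 * s * c * k"
      if "L > 0" for L c s k d :: real
      using that by (simp add: field_simps)
    then show ?thesis unfolding Ev_def q qc using l by blast
  qed
  also have "\<dots> = 3 * l \<psi> + 2 * sin \<psi> * cos \<psi> * l'" by (simp add: power2_eq_square[symmetric])
  also have "\<dots> > 0" using tp(2) unfolding s3 l_def l'_def .
  finally show ?thesis using l by (simp add: zero_less_mult_iff)
qed

lemma cont_quo: "continuous_on Om quo"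
  "continuous_on Om (\<lambda>x. quo_r (fst x) (fst (snd x)) (snd (snd x)))"
  "continuous_on Om (\<lambda>x. quo_c (fst x) (fst (snd x)) (snd (snd x)))"
  using smooth_on_continuous[OF smooth_quo] smooth_on_continuous[OF smooth_on_frechet[OF smooth_quo]]
  by (simp_all add: quo_r_def quo_c_def)

lemma cont_E: "continuous_on Om (\<lambda>x. Ev (fst x) (fst (snd x)) (snd (snd x)))"
  "continuous_on Om (\<lambda>x. Eu (fst x) (fst (snd x)) (snd (snd x)))"
  unfolding Ev_def Eu_def prod.collapse by (intro continuous_intros cont_quo)+

end

text \<open>Over the compact interval \<open>[- \<pi> / 2, \<pi> / 2]\<close> the positivity of \<open>Ev\<close> and the boundedness of \<open>Eu\<close> are uniform.\<close>

locale umbilic_chart = umbilic_sectors +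
  fixes \<rho> \<tau>1 c1 C1 :: real
  assumes rho: "\<rho> > 0" "\<rho> \<le> R" and tau1: "\<tau>1 > 0" "\<tau>1 \<le> \<tau>" and c1: "c1 > 0" and C1: "C1 > 0"
    and Ev_gt: "\<bar>r\<bar> < \<rho> \<Longrightarrow> \<bar>\<psi>\<bar> \<le> pi / 2 \<Longrightarrow> \<bar>t\<bar> < \<tau>1 \<Longrightarrow> Ev r \<psi> t > c1"
    and Eu_less: "\<bar>r\<bar> < \<rho> \<Longrightarrow> \<bar>\<psi>\<bar> \<le> pi / 2 \<Longrightarrow> \<bar>t\<bar> < \<tau>1 \<Longrightarrow> \<bar>Eu r \<psi> t\<bar> < C1"

lemma (in umbilic_sectors) chart_ex: "\<exists>\<rho> \<tau>1 c1 C1. umbilic_chart A B R0 \<tau>0 P Q R \<tau> th \<rho> \<tau>1 c1 C1"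
proof -
  have inOm: "(0, \<psi>, 0) \<in> Om" if "- pi / 2 \<le> \<psi>" "\<psi> \<le> pi / 2" for \<psi>
    by (rule sector_Om) (use that R tau in \<open>auto simp: abs_le_iff\<close>)
  have pos: "Ev 0 \<psi> 0 > 0" if "- pi / 2 \<le> \<psi>" "\<psi> \<le> pi / 2" for \<psi>
    by (rule Ev_0) (use that in \<open>auto simp: abs_le_iff\<close>)
  have le: "- pi / 2 \<le> pi / 2" by simp
  obtain c1 d1 where d1: "c1 > 0" "d1 > 0" "\<And>r \<phi> t. \<bar>r\<bar> < d1 \<Longrightarrow> - pi / 2 - d1 < \<phi> \<Longrightarrow> \<phi> < pi / 2 + d1 \<Longrightarrow>
      \<bar>t\<bar> < d1 \<Longrightarrow> (r, \<phi>, t) \<in> Om \<and> Ev r \<phi> t > c1"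
    by (rule segment_tube[where h=Ev and a="- pi / 2" and b="pi / 2", OF open_Om cont_E(1) le inOm pos]) blast+
  obtain C1 d2 where d2: "C1 > 0" "d2 > 0" "\<And>r \<phi> t. \<bar>r\<bar> < d2 \<Longrightarrow> - pi / 2 - d2 < \<phi> \<Longrightarrow> \<phi> < pi / 2 + d2 \<Longrightarrow>
      \<bar>t\<bar> < d2 \<Longrightarrow> \<bar>Eu r \<phi> t\<bar> < C1"
    by (rule segment_bound[where h=Eu and a="- pi / 2" and b="pi / 2", OF open_Om cont_E(2) le inOm]) blast+
  define \<rho> where "\<rho> = min R (min d1 d2)"
  define \<tau>1 where "\<tau>1 = min \<tau> (min d1 d2)"
  have "umbilic_chart A B R0 \<tau>0 P Q R \<tau> th \<rho> \<tau>1 c1 C1"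
  proof unfold_locales
    show "\<rho> > 0" "\<rho> \<le> R" "\<tau>1 > 0" "\<tau>1 \<le> \<tau>" "c1 > 0" "C1 > 0"
      using R tau d1 d2 by (auto simp: \<rho>_def \<tau>1_def)
    fix r \<psi> t :: real assume a: "\<bar>r\<bar> < \<rho>" "\<bar>\<psi>\<bar> \<le> pi / 2" "\<bar>t\<bar> < \<tau>1"
    have b: "- pi / 2 - d1 < \<psi>" "\<psi> < pi / 2 + d1" "- pi / 2 - d2 < \<psi>" "\<psi> < pi / 2 + d2"
      using a(2) d1(2) d2(2) by linarith+
    show "Ev r \<psi> t > c1" using d1(3)[OF _ b(1,2), of r t] a by (auto simp: \<rho>_def \<tau>1_def)
    show "\<bar>Eu r \<psi> t\<bar> < C1" using d2(3)[OF _ b(3,4), of r t] a by (auto simp: \<rho>_def \<tau>1_def)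
  qed
  then show ?thesis by blast
qed

lemma dd_01_eq:
  fixes F :: "real \<times> real \<Rightarrow> real"
  assumes "smooth_on D F" "(x, y) \<in> D" "((\<lambda>y. F (x, y)) has_real_derivative d) (at y)"
  shows "dd (0, 1) F (x, y) = d"
proof -
  have "((\<lambda>y. (x, y)) has_vector_derivative (0, 1)) (at y)"
    by (intro has_vector_derivative_Pair has_vector_derivative_const has_vector_derivative_id)
  from smooth_on_chain_real[OF assms(1) this assms(2)] show ?thesis using assms(3) by (rule DERIV_unique)
qed

lemma dd_10_eq:
  fixes F :: "real \<times> real \<Rightarrow> real"
  assumes "smooth_on D F" "(x, y) \<in> D" "((\<lambda>x. F (x, y)) has_real_derivative d) (at x)"
  shows "dd (1, 0) F (x, y) = d"
proof -
  have "((\<lambda>x. (x, y)) has_vector_derivative (1, 0)) (at x)"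
    by (intro has_vector_derivative_Pair has_vector_derivative_const has_vector_derivative_id)
  from smooth_on_chain_real[OF assms(1) this assms(2)] show ?thesis using assms(3) by (rule DERIV_unique)
qed

text \<open>Inverse of \<open>(r, \<psi>) \<mapsto> (r sin \<psi>, r cos \<psi>)\<close> on the half-plane \<open>v \<ge> 0\<close>, continuous up to the edge \<open>v = 0\<close>
  apart from the origin, where the angle is \<open>0\<close> since a quotient by \<open>0\<close> is \<open>0\<close>.\<close>

definition rad :: "real \<Rightarrow> real \<Rightarrow> real" where "rad u v = sqrt (u\<^sup>2 + v\<^sup>2)"
definition chi :: "real \<Rightarrow> real \<Rightarrow> real" where "chi u v = arcsin (u / rad u v)"

lemma rad_nonneg: "rad u v \<ge> 0" by (simp add: rad_def)
lemma rad_sq: "(rad u v)\<^sup>2 = u\<^sup>2 + v\<^sup>2" by (simp add: rad_def)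
lemma rad_sq': "rad u v * rad u v = u\<^sup>2 + v\<^sup>2" using rad_sq[of u v] by (simp add: power2_eq_square)
lemma rad_pos: "v \<noteq> 0 \<or> u \<noteq> 0 \<Longrightarrow> rad u v > 0"
  by (auto simp: rad_def sum_power2_gt_zero_iff)
lemma rad_pos_v: "v > 0 \<Longrightarrow> rad u v > 0"
  by (rule rad_pos) simp
lemma rad_less_iff: "b \<ge> 0 \<Longrightarrow> rad u v < b \<longleftrightarrow> u\<^sup>2 + v\<^sup>2 < b\<^sup>2"
  by (metis rad_def real_sqrt_abs abs_of_nonneg real_sqrt_less_iff)
lemma rad_le_iff: "b \<ge> 0 \<Longrightarrow> rad u v \<le> b \<longleftrightarrow> u\<^sup>2 + v\<^sup>2 \<le> b\<^sup>2"
  by (metis rad_def real_sqrt_abs abs_of_nonneg real_sqrt_le_iff)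
lemma abs_le_rad: "\<bar>u\<bar> \<le> rad u v" "\<bar>v\<bar> \<le> rad u v"
  unfolding rad_def by (simp_all add: real_le_rsqrt)
lemma rad_u0: "rad u 0 = \<bar>u\<bar>" by (simp add: rad_def)

lemma ratio_le: "\<bar>u / rad u v\<bar> \<le> 1"
  using abs_le_rad(1)[of u v] rad_nonneg[of u v] by (cases "rad u v = 0") (simp_all add: abs_divide)

lemma ratio_less: "v > 0 \<Longrightarrow> \<bar>u / rad u v\<bar> < 1"
proof -
  assume "v > 0"
  then have "\<bar>u\<bar>\<^sup>2 < (rad u v)\<^sup>2" by (simp add: rad_sq)
  then have "\<bar>u\<bar> < rad u v" using rad_nonneg power2_less_imp_less by blast
  then show ?thesis using rad_pos[of v u] \<open>v > 0\<close> by (simp add: abs_divide)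
qed

lemma ratio_bounds: "- 1 \<le> u / rad u v" "u / rad u v \<le> 1"
  using ratio_le[of u v] by linarith+

lemma ratio_strict: "v > 0 \<Longrightarrow> - 1 < u / rad u v" "v > 0 \<Longrightarrow> u / rad u v < 1"
  using ratio_less[of v u] by linarith+

lemma chi_le: "\<bar>chi u v\<bar> \<le> pi / 2"
  using arcsin_bounded[OF ratio_bounds, of u v] unfolding chi_def by linarith

lemma chi_less: "v > 0 \<Longrightarrow> \<bar>chi u v\<bar> < pi / 2"
  using arcsin_lt_bounded[OF ratio_strict, of v u] unfolding chi_def by linarith

lemma sin_chi: "sin (chi u v) = u / rad u v"
  unfolding chi_def by (rule sin_arcsin[OF ratio_bounds])

lemma cos_chi: "v > 0 \<Longrightarrow> cos (chi u v) = v / rad u v"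
proof -
  assume v: "v > 0"
  have r: "rad u v > 0" by (rule rad_pos_v[OF v])
  have "cos (chi u v) = sqrt (1 - (u / rad u v)\<^sup>2)"
    unfolding chi_def by (rule cos_arcsin[OF ratio_bounds])
  also have "1 - (u / rad u v)\<^sup>2 = (v / rad u v)\<^sup>2"
  proof -
    have "1 - (u / rad u v)\<^sup>2 = ((rad u v)\<^sup>2 - u\<^sup>2) / (rad u v)\<^sup>2"
      using r by (simp add: power_divide diff_divide_distrib)
    also have "(rad u v)\<^sup>2 - u\<^sup>2 = v\<^sup>2" by (simp add: rad_sq)
    finally show ?thesis by (simp add: power_divide)
  qed
  finally show ?thesis using v r by simp
qed

lemma rad_sin_chi: "rad u v * sin (chi u v) = u"
proof (cases "u = 0")
  case False
  then have "rad u v > 0" by (intro rad_pos) simp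
  then show ?thesis by (simp add: sin_chi)
qed (simp add: sin_chi)

lemma chi_polar:
  assumes "x > 0" "\<bar>\<psi>\<bar> < pi / 2"
  shows "rad (x * sin \<psi>) (x * cos \<psi>) = x" "chi (x * sin \<psi>) (x * cos \<psi>) = \<psi>"
proof -
  have "(x * sin \<psi>)\<^sup>2 + (x * cos \<psi>)\<^sup>2 = x\<^sup>2 * ((sin \<psi>)\<^sup>2 + (cos \<psi>)\<^sup>2)"
    by (simp only: power_mult_distrib distrib_left)
  then show r: "rad (x * sin \<psi>) (x * cos \<psi>) = x"
    using assms(1) by (simp add: rad_def)
  show "chi (x * sin \<psi>) (x * cos \<psi>) = \<psi>"
  proof -
    have "x * sin \<psi> / x = sin \<psi>" using assms(1) by simp
    moreover have "arcsin (sin \<psi>) = \<psi>" using assms(2) by (intro arcsin_sin) linarith+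
    ultimately show ?thesis unfolding chi_def r by simp
  qed
qed

lemma rad_deriv_v:
  assumes "v > 0"
  shows "((\<lambda>v. rad u v) has_real_derivative v / rad u v) (at v)"
proof -
  have pos: "u\<^sup>2 + v\<^sup>2 > 0" using assms by (simp add: sum_power2_gt_zero_iff)
  have "((\<lambda>v. u\<^sup>2 + v\<^sup>2) has_real_derivative 2 * v) (at v)" by (auto intro!: derivative_eq_intros)
  from DERIV_chain2[where f=sqrt and g="\<lambda>v. u\<^sup>2 + v\<^sup>2" and x=v, OF DERIV_real_sqrt[OF pos] this] show ?thesis
    unfolding rad_def by (rule DERIV_cong) (simp add: inverse_eq_divide)
qed

lemma rad_deriv_u:
  assumes "v > 0"
  shows "((\<lambda>u. rad u v) has_real_derivative u / rad u v) (at u)"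
proof -
  have pos: "u\<^sup>2 + v\<^sup>2 > 0" using assms by (simp add: sum_power2_gt_zero_iff)
  have "((\<lambda>u. u\<^sup>2 + v\<^sup>2) has_real_derivative 2 * u) (at u)" by (auto intro!: derivative_eq_intros)
  from DERIV_chain2[where f=sqrt and g="\<lambda>u. u\<^sup>2 + v\<^sup>2" and x=u, OF DERIV_real_sqrt[OF pos] this] show ?thesis
    unfolding rad_def by (rule DERIV_cong) (simp add: inverse_eq_divide)
qed

lemma sqrt_ratio:
  assumes "v > 0"
  shows "sqrt (1 - (u / rad u v)\<^sup>2) = v / rad u v"
proof -
  have "cos (chi u v) = sqrt (1 - (u / rad u v)\<^sup>2)"
    unfolding chi_def by (rule cos_arcsin[OF ratio_bounds])
  from this[symmetric] cos_chi[OF assms] show ?thesis by (rule trans)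
qed

lemma chi_deriv_v:
  assumes "v > 0"
  shows "((\<lambda>v. chi u v) has_real_derivative - u / (rad u v)\<^sup>2) (at v)"
proof -
  have r: "rad u v > 0" by (rule rad_pos_v[OF assms])
  have 1: "((\<lambda>v. u / rad u v) has_real_derivative (0 * rad u v - u * (v / rad u v)) / (rad u v * rad u v)) (at v)"
    using r by (intro DERIV_divide DERIV_const rad_deriv_v[OF assms]) auto
  have 2: "(arcsin has_real_derivative inverse (sqrt (1 - (u / rad u v)\<^sup>2))) (at (u / rad u v))"
    by (rule DERIV_arcsin[OF ratio_strict[OF assms]])
  have "((\<lambda>v. chi u v) has_real_derivative inverse (sqrt (1 - (u / rad u v)\<^sup>2)) *
      ((0 * rad u v - u * (v / rad u v)) / (rad u v * rad u v))) (at v)"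
    unfolding chi_def by (rule DERIV_chain2[where f=arcsin and g="\<lambda>v. u / rad u v" and x=v, OF 2 1])
  then show ?thesis
    unfolding sqrt_ratio[OF assms] by (rule DERIV_cong) (use r assms in \<open>simp add: field_simps power2_eq_square\<close>)
qed

lemma chi_deriv_u:
  assumes "v > 0"
  shows "((\<lambda>u. chi u v) has_real_derivative v / (rad u v)\<^sup>2) (at u)"
proof -
  have r: "rad u v > 0" by (rule rad_pos_v[OF assms])
  have 1: "((\<lambda>u. u / rad u v) has_real_derivative (1 * rad u v - u * (u / rad u v)) / (rad u v * rad u v)) (at u)"
    using r by (intro DERIV_divide DERIV_ident rad_deriv_u[OF assms]) auto
  have 2: "(arcsin has_real_derivative inverse (sqrt (1 - (u / rad u v)\<^sup>2))) (at (u / rad u v))"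
    by (rule DERIV_arcsin[OF ratio_strict[OF assms]])
  have d: "((\<lambda>u. chi u v) has_real_derivative inverse (sqrt (1 - (u / rad u v)\<^sup>2)) *
      ((1 * rad u v - u * (u / rad u v)) / (rad u v * rad u v))) (at u)"
    unfolding chi_def by (rule DERIV_chain2[where f=arcsin and g="\<lambda>u. u / rad u v" and x=u, OF 2 1])
  have e: "1 * rad u v - u * (u / rad u v) = v * v / rad u v"
    using r rad_sq'[of u v] by (simp add: field_simps power2_eq_square)
  from d[unfolded sqrt_ratio[OF assms] e] show ?thesis
    by (rule DERIV_cong) (use r assms in \<open>simp add: field_simps power2_eq_square\<close>)
qed

context umbilic_chart
begin

text \<open>The function \<open>\<bar>r\<bar> A / B\<close> in half-plane coordinates. The sign \<open>\<sigma>\<close> of \<open>r\<close> selects the sector or its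
  antipode.\<close>

definition q :: "real \<Rightarrow> real \<Rightarrow> real \<Rightarrow> real \<Rightarrow> real" where
  "q \<sigma> t u v = rad u v * quo (\<sigma> * rad u v, chi u v, t)"

lemma q_Om:
  assumes "\<bar>\<sigma>\<bar> = 1" "rad u v < \<rho>" "\<bar>t\<bar> < \<tau>1"
  shows "(\<sigma> * rad u v, chi u v, t) \<in> Om"
proof (rule sector_Om)
  show "\<bar>\<sigma> * rad u v\<bar> < R" using assms rho rad_nonneg[of u v] by (simp add: abs_mult)
  show "\<bar>t\<bar> < \<tau>" using assms(3) tau1 by simp
qed (rule chi_le)

lemma q_deriv_v:
  assumes "\<bar>\<sigma>\<bar> = 1" "rad u v < \<rho>" "\<bar>t\<bar> < \<tau>1" "v > 0"
  shows "((\<lambda>v. q \<sigma> t u v) has_real_derivative Ev (\<sigma> * rad u v) (chi u v) t) (at v)"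
proof -
  have r: "rad u v > 0" by (rule rad_pos_v[OF assms(4)])
  have ss: "\<sigma> * \<sigma> = 1" using assms(1) by (metis abs_mult_self_eq mult_1)
  show ?thesis
    unfolding q_def
    by (rule DERIV_cong[OF DERIV_mult[OF rad_deriv_v[OF assms(4)]
            quo_chain[OF DERIV_cmult[OF rad_deriv_v[OF assms(4)]] chi_deriv_v[OF assms(4)] q_Om[OF assms(1-3)]]]])
      (use r ss in \<open>simp add: Ev_def sin_chi cos_chi[OF assms(4)] field_simps power2_eq_square\<close>)
qed

lemma q_deriv_u:
  assumes "\<bar>\<sigma>\<bar> = 1" "rad u v < \<rho>" "\<bar>t\<bar> < \<tau>1" "v > 0"
  shows "((\<lambda>u. q \<sigma> t u v) has_real_derivative Eu (\<sigma> * rad u v) (chi u v) t) (at u)"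
proof -
  have r: "rad u v > 0" by (rule rad_pos_v[OF assms(4)])
  show ?thesis
    unfolding q_def
    by (rule DERIV_cong[OF DERIV_mult[OF rad_deriv_u[OF assms(4)]
            quo_chain[OF DERIV_cmult[OF rad_deriv_u[OF assms(4)]] chi_deriv_u[OF assms(4)] q_Om[OF assms(1-3)]]]])
      (use r in \<open>simp add: Eu_def sin_chi cos_chi[OF assms(4)] field_simps power2_eq_square\<close>)
qed

lemma q_edge:
  assumes "\<bar>\<sigma>\<bar> = 1" "\<bar>u\<bar> < \<rho>"
  shows "q \<sigma> t u 0 = 0"
proof (cases "u = 0")
  case False
  have r: "\<bar>\<sigma> * \<bar>u\<bar>\<bar> < R" using assms rho by (simp add: abs_mult)
  have "chi u 0 = pi / 2 \<or> chi u 0 = - (pi / 2)"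
    using False by (auto simp: chi_def rad_u0 abs_if)
  then have "ang (\<sigma> * \<bar>u\<bar>) (chi u 0) = th 1 (\<sigma> * \<bar>u\<bar>) \<or> ang (\<sigma> * \<bar>u\<bar>) (chi u 0) = th 0 (\<sigma> * \<bar>u\<bar>)"
    using ang_ends[of "\<sigma> * \<bar>u\<bar>"] by metis
  then have "A (\<sigma> * \<bar>u\<bar>, ang (\<sigma> * \<bar>u\<bar>) (chi u 0)) = 0"
    using th_root[of 0, OF _ r] th_root[of 1, OF _ r] by auto
  then show ?thesis by (simp add: q_def quo_def rad_u0)
qed (simp add: q_def rad_u0)

lemma chi_cont: "continuous_on ({p. snd p \<ge> 0} - {(0, 0)}) (\<lambda>p. chi (fst p) (snd p))"
proof -
  have "continuous_on ({p. snd p \<ge> 0} - {(0, 0)}) (\<lambda>p. fst p / rad (fst p) (snd p))"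
    unfolding rad_def
    by (intro continuous_intros) (auto simp: sum_power2_eq_zero_iff)
  then show ?thesis
    unfolding chi_def using ratio_bounds by (intro continuous_on_arcsin) auto
qed

lemma rad_cont: "continuous_on S (\<lambda>p. rad (fst p) (snd p))"
  unfolding rad_def by (intro continuous_intros)

lemma q_cont:
  assumes "\<bar>\<sigma>\<bar> = 1" "u\<^sup>2 + w\<^sup>2 < \<rho>\<^sup>2" "\<bar>t\<bar> < \<tau>1" "w > 0"
  shows "continuous_on {0..w} (\<lambda>v. q \<sigma> t u v)"
proof -
  have rw: "rad u v < \<rho>" if "v \<in> {0..w}" for v
  proof -
    have "v\<^sup>2 \<le> w\<^sup>2" using that by (intro power_mono) auto
    then show ?thesis using assms(2) rho by (simp add: rad_less_iff)
  qed
  have cr: "continuous_on {0..w} (\<lambda>v. rad u v)" unfolding rad_def by (intro continuous_intros)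
  have cc: "continuous_on {0..w} (\<lambda>v. chi u v)"
  proof (cases "u = 0")
    case True
    then show ?thesis by (simp add: chi_def)
  next
    case False
    then show ?thesis
      using continuous_on_compose2[OF chi_cont, of "{0..w}" "\<lambda>v. (u, v)"]
      by (auto simp: continuous_on_Pair continuous_on_const continuous_on_id image_subset_iff)
  qed
  show ?thesis
    unfolding q_def
    by (intro continuous_on_mult cr continuous_on_compose2[OF cont_quo(1)] continuous_intros cc)
      (use q_Om[OF assms(1) rw assms(3)] in auto)
qed

text \<open>Along each vertical line the function \<open>q\<close> rises from \<open>0\<close> at a speed of at least \<open>c1\<close>.\<close>

text \<open>Along each vertical line the function \<open>q\<close> rises from \<open>0\<close> at a speed of at least \<open>c1\<close>, so it reaches \<open>\<bar>t\<bar>\<close>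
  before height \<open>\<bar>t\<bar> / c1\<close>. The slope of the level curve is the quotient of the two partial derivatives.\<close>

lemma wedge_root:
  assumes \<sigma>: "\<bar>\<sigma>\<bar> = 1" and t: "\<bar>t\<bar> < \<tau>1" "t \<noteq> 0" and \<omega>: "\<omega>\<^sup>2 + (\<bar>t\<bar> / c1)\<^sup>2 < \<rho>\<^sup>2"
  obtains Y where "smooth_on {-\<omega><..<\<omega>} Y"
    "\<And>u. \<bar>u\<bar> < \<omega> \<Longrightarrow> 0 < Y u \<and> Y u \<le> \<bar>t\<bar> / c1 \<and> q \<sigma> t u (Y u) = \<bar>t\<bar>"
    "\<And>u v. \<bar>u\<bar> < \<omega> \<Longrightarrow> v > 0 \<Longrightarrow> u\<^sup>2 + v\<^sup>2 < \<rho>\<^sup>2 \<Longrightarrow> q \<sigma> t u v = \<bar>t\<bar> \<Longrightarrow> v = Y u"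
    "\<And>u. \<bar>u\<bar> < \<omega> \<Longrightarrow> \<exists>d. (Y has_real_derivative d) (at u) \<and> \<bar>d\<bar> \<le> C1 / c1"
proof -
  define D where "D = {p::real \<times> real. snd p > 0 \<and> (fst p)\<^sup>2 + (snd p)\<^sup>2 < \<rho>\<^sup>2}"
  define F where "F p = q \<sigma> t (fst p) (snd p) - \<bar>t\<bar>" for p
  have "open ({p::real \<times> real. snd p > 0} \<inter> {p. (fst p)\<^sup>2 + (snd p)\<^sup>2 < \<rho>\<^sup>2})"
    by (intro open_Int open_Collect_less continuous_intros)
  also have "{p::real \<times> real. snd p > 0} \<inter> {p. (fst p)\<^sup>2 + (snd p)\<^sup>2 < \<rho>\<^sup>2} = D" by (auto simp: D_def)
  finally have op: "open D" .
  have radD: "rad (fst p) (snd p) < \<rho>" "snd p > 0" if "p \<in> D" for p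
    using that rho by (simp_all add: D_def rad_less_iff)
  have srad: "smooth_on D (\<lambda>p. rad (fst p) (snd p))"
    unfolding rad_def by (intro smooth_intros op smooth_on_bounded_linear[OF bounded_linear_fst] smooth_on_bounded_linear[OF bounded_linear_snd])
      (auto simp: D_def sum_power2_gt_zero_iff)
  have schi: "smooth_on D (\<lambda>p. chi (fst p) (snd p))"
    unfolding chi_def
    by (intro smooth_on_arcsin smooth_on_divide srad op smooth_on_bounded_linear[OF bounded_linear_fst])
      (use ratio_less[OF radD(2)] rad_pos_v[OF radD(2)] in \<open>simp_all add: less_imp_neq[symmetric]\<close>)
  have sF: "smooth_on D F"
    unfolding F_def q_def
  proof (intro smooth_on_diff smooth_on_mult srad op smooth_on_const)
    show "smooth_on D (\<lambda>p. quo (\<sigma> * rad (fst p) (snd p), chi (fst p) (snd p), t))"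
    proof (rule smooth_on_compose[OF smooth_quo op open_Om])
      show "smooth_on D (\<lambda>p. (\<sigma> * rad (fst p) (snd p), chi (fst p) (snd p), t))"
        by (intro smooth_intros op srad schi)
    qed (rule q_Om[OF \<sigma> radD(1) t(1)])
  qed
  have Esmall: "\<bar>\<sigma> * rad u v\<bar> < \<rho>" if "rad u v < \<rho>" for u v
    using that \<sigma> rad_nonneg[of u v] by (simp add: abs_mult)
  have dy: "dd (0, 1) F (u, v) = Ev (\<sigma> * rad u v) (chi u v) t" if "(u, v) \<in> D" for u v
    using q_deriv_v[OF \<sigma> _ t(1)] radD[OF that]
    by (intro dd_01_eq[OF sF that]) (auto simp: F_def intro!: derivative_eq_intros)
  have dx: "dd (1, 0) F (u, v) = Eu (\<sigma> * rad u v) (chi u v) t" if "(u, v) \<in> D" for u v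
    using q_deriv_u[OF \<sigma> _ t(1)] radD[OF that]
    by (intro dd_10_eq[OF sF that]) (auto simp: F_def intro!: derivative_eq_intros)
  have Evc: "Ev (\<sigma> * rad u v) (chi u v) t > c1" if "rad u v < \<rho>" for u v
    by (rule Ev_gt[OF Esmall[OF that] chi_le t(1)])
  have Euc: "\<bar>Eu (\<sigma> * rad u v) (chi u v) t\<bar> < C1" if "rad u v < \<rho>" for u v
    by (rule Eu_less[OF Esmall[OF that] chi_le t(1)])
  have sec: "(u, v) \<in> D" if "(u, y1) \<in> D" "(u, y2) \<in> D" "y1 \<le> v" "v \<le> y2" for u v y1 y2
  proof -
    have "v\<^sup>2 \<le> y2\<^sup>2" using that by (intro power_mono) (auto simp: D_def)
    moreover have "u\<^sup>2 + y2\<^sup>2 < \<rho>\<^sup>2" using that(2) by (simp add: D_def)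
    ultimately have "u\<^sup>2 + v\<^sup>2 < \<rho>\<^sup>2" by linarith
    then show ?thesis using that(1,3) by (simp add: D_def)
  qed
  interpret vertical_increase D F
  proof unfold_locales
    show "dd (0, 1) F p > 0" if "p \<in> D" for p
    proof -
      have "dd (0, 1) F p = Ev (\<sigma> * rad (fst p) (snd p)) (chi (fst p) (snd p)) t"
        using dy[of "fst p" "snd p"] that by simp
      then show ?thesis using Evc[OF radD(1)[OF that]] c1 by linarith
    qed
    show "open D" "smooth_on D F" by (rule op, rule sF)
    show "(x, y) \<in> D" if "(x, y1) \<in> D" "(x, y2) \<in> D" "y1 \<le> y" "y \<le> y2" for x y1 y2 y
      by (rule sec[OF that])
  qed
  define w where "w = \<bar>t\<bar> / c1"
  have w: "w > 0" "c1 * w = \<bar>t\<bar>" using t(2) c1 by (simp_all add: w_def)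
  have ex: "\<exists>v. (u, v) \<in> D \<and> F (u, v) = 0 \<and> v \<le> w" if "u \<in> {-\<omega><..<\<omega>}" for u
  proof -
    have "\<bar>u\<bar> < \<omega>" using that by auto
    then have "u\<^sup>2 < \<omega>\<^sup>2" by (metis abs_ge_zero power2_abs power_strict_mono zero_less_numeral)
    then have uw: "u\<^sup>2 + w\<^sup>2 < \<rho>\<^sup>2" using \<omega> by (simp add: w_def)
    have rv: "rad u v < \<rho>" if "0 \<le> v" "v \<le> w" for v
    proof -
      have "v\<^sup>2 \<le> w\<^sup>2" using that by (intro power_mono) auto
      then show ?thesis using uw rho by (simp add: rad_less_iff)
    qed
    have cont: "continuous_on {0..w} (\<lambda>v. q \<sigma> t u v)" by (rule q_cont[OF \<sigma> uw t(1) w(1)])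
    have "\<bar>u\<bar> < \<rho>" using rv[of 0] w(1) by (simp add: rad_u0)
    then have q0: "q \<sigma> t u 0 = 0" by (rule q_edge[OF \<sigma>])
    have der: "((\<lambda>v. q \<sigma> t u v) has_real_derivative Ev (\<sigma> * rad u v) (chi u v) t) (at v)" if "0 < v" "v \<le> w" for v
      using that rv by (intro q_deriv_v[OF \<sigma> _ t(1)]) auto
    obtain l z where z: "0 < z" "z < w" "((\<lambda>v. q \<sigma> t u v) has_real_derivative l) (at z)"
        "q \<sigma> t u w - q \<sigma> t u 0 = (w - 0) * l"
      using MVT[OF w(1) cont] der by (force simp: real_differentiable_def)
    have "l = Ev (\<sigma> * rad u z) (chi u z) t" using DERIV_unique[OF z(3) der] z by simp
    then have "l > c1" using Evc[OF rv[of z]] z by simp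
    then have "q \<sigma> t u w > \<bar>t\<bar>"
      using z(4) w mult_strict_right_mono[of c1 l w] by (simp add: q0 mult.commute)
    then have "\<exists>v\<ge>0. v \<le> w \<and> q \<sigma> t u v = \<bar>t\<bar>"
      using q0 w(1) cont by (intro IVT') auto
    then obtain v where v: "0 \<le> v" "v \<le> w" "q \<sigma> t u v = \<bar>t\<bar>" by blast
    have "v \<noteq> 0" using v(3) q0 t(2) by auto
    then have "(u, v) \<in> D" using v rv[of v] rho by (simp add: D_def rad_less_iff)
    then show ?thesis using v by (auto simp: F_def)
  qed
  obtain Y where Y: "smooth_on {-\<omega><..<\<omega>} Y" "\<And>u. u \<in> {-\<omega><..<\<omega>} \<Longrightarrow> (u, Y u) \<in> D \<and> F (u, Y u) = 0 \<and>
      (\<forall>v. (u, v) \<in> D \<longrightarrow> F (u, v) = 0 \<longrightarrow> v = Y u)"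
  proof -
    have "\<exists>v. (u, v) \<in> D \<and> F (u, v) = 0" if "u \<in> {-\<omega><..<\<omega>}" for u using ex[OF that] by blast
    from smooth_root_ex[OF open_real_greaterThanLessThan this] show ?thesis using that by blast
  qed
  show ?thesis
  proof (rule that[OF Y(1)])
    fix u assume "\<bar>u\<bar> < \<omega>"
    then have u: "u \<in> {-\<omega><..<\<omega>}" by (auto simp: abs_less_iff)
    note Yu = Y(2)[OF u]
    obtain v where "(u, v) \<in> D" "F (u, v) = 0" "v \<le> w" using ex[OF u] by blast
    then have "Y u \<le> w" using Yu by blast
    then show "0 < Y u \<and> Y u \<le> \<bar>t\<bar> / c1 \<and> q \<sigma> t u (Y u) = \<bar>t\<bar>"
      using Yu by (auto simp: D_def F_def w_def)
    show "v = Y u" if "v > 0" "u\<^sup>2 + v\<^sup>2 < \<rho>\<^sup>2" "q \<sigma> t u v = \<bar>t\<bar>" for v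
      using Yu that by (auto simp: D_def F_def)
    have uD: "(u, Y u) \<in> D" using Yu by blast
    have r: "rad u (Y u) < \<rho>" using radD(1)[OF uD] by simp
    have "(Y has_real_derivative - dd (1, 0) F (u, Y u) / dd (0, 1) F (u, Y u)) (at u)"
      by (rule root_deriv[OF open_real_greaterThanLessThan u]) (use Y(2) in blast)
    moreover have "\<bar>- dd (1, 0) F (u, Y u) / dd (0, 1) F (u, Y u)\<bar> \<le> C1 / c1"
      unfolding dx[OF uD] dy[OF uD] abs_divide abs_minus
      using Euc[OF r] Evc[OF r] c1 C1 by (intro frac_le) auto
    ultimately show "\<exists>d. (Y has_real_derivative d) (at u) \<and> \<bar>d\<bar> \<le> C1 / c1" by blast
  qed
qed

end

section \<open>Polar coordinates in the plane\<close>

definition pol :: "real \<Rightarrow> real \<Rightarrow> real \<Rightarrow> real \<times> real" where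
  "pol \<beta> r \<phi> = (r * cos (\<beta> + \<phi>), r * sin (\<beta> + \<phi>))"

lemma norm_pol: "norm (pol \<beta> r \<phi>) = \<bar>r\<bar>"
proof -
  have "(r * cos (\<beta> + \<phi>))\<^sup>2 + (r * sin (\<beta> + \<phi>))\<^sup>2 = r\<^sup>2 * ((sin (\<beta> + \<phi>))\<^sup>2 + (cos (\<beta> + \<phi>))\<^sup>2)"
    by (simp only: power_mult_distrib distrib_left add.commute)
  then show ?thesis by (simp add: pol_def norm_Pair)
qed

lemma pol_0: "pol \<beta> 0 \<phi> = 0"
  by (simp add: pol_def zero_prod_def)

lemma pol_eq_0_iff: "pol \<beta> r \<phi> = 0 \<longleftrightarrow> r = 0"
  by (metis abs_eq_0_iff norm_eq_zero norm_pol)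

lemma pol_neg: "pol \<beta> (- r) (\<phi> + pi) = pol \<beta> r \<phi>"
  by (simp add: pol_def add.assoc[symmetric])

lemma pol_inj:
  assumes "pol \<beta> r \<phi> = pol \<beta> r \<phi>'" "r \<noteq> 0" "\<bar>\<phi> - \<phi>'\<bar> < 2 * pi"
  shows "\<phi> = \<phi>'"
proof -
  have e: "cos (\<beta> + \<phi>) = cos (\<beta> + \<phi>')" "sin (\<beta> + \<phi>) = sin (\<beta> + \<phi>')"
    using assms(1,2) by (simp_all add: pol_def)
  have "cos (\<phi> - \<phi>') = cos ((\<beta> + \<phi>) - (\<beta> + \<phi>'))" by simp
  also have "\<dots> = (cos (\<beta> + \<phi>'))\<^sup>2 + (sin (\<beta> + \<phi>'))\<^sup>2" by (simp only: cos_diff e power2_eq_square)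
  finally have "cos (\<phi> - \<phi>') = 1" by simp
  then obtain n :: int where n: "\<phi> - \<phi>' = real_of_int n * 2 * pi" unfolding cos_one_2pi_int by blast
  then have "\<bar>real_of_int n\<bar> * (2 * pi) < 1 * (2 * pi)" using assms(3) by (simp add: abs_mult)
  then have "\<bar>real_of_int n\<bar> < 1" using pi_gt_zero by (simp add: mult_less_cancel_right)
  then have "n = 0" by linarith
  then show ?thesis using n by simp
qed

lemma pol_opposite:
  assumes "pol \<beta> r \<phi> = pol \<beta> (- r) \<phi>'" "r \<noteq> 0"
  shows "\<bar>\<phi> - \<phi>'\<bar> \<ge> pi"
proof (rule ccontr)
  assume "\<not> \<bar>\<phi> - \<phi>'\<bar> \<ge> pi"
  then have small: "\<bar>\<phi> - \<phi>'\<bar> < pi" by simp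
  have e: "cos (\<beta> + \<phi>) = - cos (\<beta> + \<phi>')" "sin (\<beta> + \<phi>) = - sin (\<beta> + \<phi>')"
  proof -
    have "r * cos (\<beta> + \<phi>) = r * (- cos (\<beta> + \<phi>'))" "r * sin (\<beta> + \<phi>) = r * (- sin (\<beta> + \<phi>'))"
      using assms(1) by (simp_all add: pol_def)
    then show "cos (\<beta> + \<phi>) = - cos (\<beta> + \<phi>')" "sin (\<beta> + \<phi>) = - sin (\<beta> + \<phi>')"
      using assms(2) mult_left_cancel by blast+
  qed
  have "cos (\<phi> - \<phi>') = cos ((\<beta> + \<phi>) - (\<beta> + \<phi>'))" by simp
  also have "\<dots> = - ((cos (\<beta> + \<phi>'))\<^sup>2 + (sin (\<beta> + \<phi>'))\<^sup>2)" 
    unfolding cos_diff e power2_eq_square by (simp only: mult_minus_left minus_add_distrib)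
  finally have "cos \<bar>\<phi> - \<phi>'\<bar> = - 1" by simp
  moreover have "cos pi < cos \<bar>\<phi> - \<phi>'\<bar>" using small by (intro cos_monotone_0_pi) auto
  ultimately show False by simp
qed

lemma pol_surj:
  assumes "p \<noteq> 0"
  shows "\<exists>\<phi>. a \<le> \<phi> \<and> \<phi> < a + 2 * pi \<and> p = pol \<beta> (norm p) \<phi>"
proof -
  define n where "n = norm p"
  have n: "n > 0" using assms by (simp add: n_def)
  have "n\<^sup>2 = (fst p)\<^sup>2 + (snd p)\<^sup>2" by (cases p) (simp add: n_def norm_Pair)
  moreover have "(fst p / n)\<^sup>2 + (snd p / n)\<^sup>2 = ((fst p)\<^sup>2 + (snd p)\<^sup>2) / n\<^sup>2"
    by (simp add: power_divide add_divide_distrib)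
  ultimately have "(fst p / n)\<^sup>2 + (snd p / n)\<^sup>2 = n\<^sup>2 / n\<^sup>2" by simp
  then have "(fst p / n)\<^sup>2 + (snd p / n)\<^sup>2 = 1" using n by simp
  then obtain u where u: "fst p / n = cos u" "snd p / n = sin u" using sincos_total_2pi by metis
  define k where "k = \<lfloor>(u - \<beta> - a) / (2 * pi)\<rfloor>"
  define \<phi> where "\<phi> = u - \<beta> - 2 * pi * of_int k"
  have k: "of_int k \<le> (u - \<beta> - a) / (2 * pi)" "(u - \<beta> - a) / (2 * pi) < of_int k + 1"
    unfolding k_def by linarith+
  have "of_int k * (2 * pi) \<le> u - \<beta> - a" "u - \<beta> - a < (of_int k + 1) * (2 * pi)"
    using k pi_gt_zero by (simp_all only: pos_le_divide_eq pos_divide_less_eq mult_pos_pos zero_less_numeral)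
  then have "a \<le> \<phi>" "\<phi> < a + 2 * pi" by (simp_all add: \<phi>_def algebra_simps)
  moreover have "cos (\<beta> + \<phi>) = cos u" "sin (\<beta> + \<phi>) = sin u"
  proof -
    have e: "\<beta> + \<phi> = u - 2 * pi * of_int k" by (simp add: \<phi>_def)
    have "cos (2 * pi * of_int k) = 1" "sin (2 * pi * of_int k) = (0::real)"
      by (auto intro: cos_integer_2pi sin_integer_2pi)
    then show "cos (\<beta> + \<phi>) = cos u" "sin (\<beta> + \<phi>) = sin u" unfolding e cos_diff sin_diff by simp_all
  qed
  moreover have "p = (n * cos u, n * sin u)" using u n by (cases p) (auto simp: field_simps)
  ultimately show ?thesis unfolding pol_def n_def[symmetric] by metis
qed

lemma pol_velocity:
  assumes "(X has_real_derivative X') (at s)" "(\<psi> has_real_derivative \<psi>') (at s)"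
  shows "((\<lambda>s. pol \<beta> (X s) (\<psi> s)) has_vector_derivative
    (X' * cos (\<beta> + \<psi> s) - X s * \<psi>' * sin (\<beta> + \<psi> s), X' * sin (\<beta> + \<psi> s) + X s * \<psi>' * cos (\<beta> + \<psi> s))) (at s)"
proof -
  have d: "((\<lambda>s. \<beta> + \<psi> s) has_real_derivative \<psi>') (at s)"
    using DERIV_add[OF DERIV_const[of \<beta>] assms(2)] by simp
  have c: "((\<lambda>s. cos (\<beta> + \<psi> s)) has_real_derivative - sin (\<beta> + \<psi> s) * \<psi>') (at s)"
    by (rule DERIV_chain2[where f=cos and g="\<lambda>s. \<beta> + \<psi> s", OF DERIV_cos d])
  have s: "((\<lambda>s. sin (\<beta> + \<psi> s)) has_real_derivative cos (\<beta> + \<psi> s) * \<psi>') (at s)"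
    by (rule DERIV_chain2[where f=sin and g="\<lambda>s. \<beta> + \<psi> s", OF DERIV_sin d])
  have "((\<lambda>s. X s * cos (\<beta> + \<psi> s)) has_real_derivative X' * cos (\<beta> + \<psi> s) - X s * \<psi>' * sin (\<beta> + \<psi> s)) (at s)"
    by (rule DERIV_cong[OF DERIV_mult[OF assms(1) c]]) (simp add: algebra_simps)
  moreover have "((\<lambda>s. X s * sin (\<beta> + \<psi> s)) has_real_derivative X' * sin (\<beta> + \<psi> s) + X s * \<psi>' * cos (\<beta> + \<psi> s)) (at s)"
    by (rule DERIV_cong[OF DERIV_mult[OF assms(1) s]]) (simp add: algebra_simps)
  ultimately show ?thesis
    unfolding pol_def by (intro has_vector_derivative_Pair) (simp_all only: has_real_derivative_iff_has_vector_derivative)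
qed

lemma pol_velocity_zero:
  assumes "(X has_real_derivative X') (at s)" "(\<psi> has_real_derivative \<psi>') (at s)"
    and "vector_derivative (\<lambda>s. pol \<beta> (X s) (\<psi> s)) (at s) = 0"
  shows "X' = 0" "X s * \<psi>' = 0"
proof -
  define c where "c = cos (\<beta> + \<psi> s)"
  define d where "d = sin (\<beta> + \<psi> s)"
  define y where "y = X s * \<psi>'"
  have 1: "c * c + d * d = 1" by (simp add: c_def d_def power2_eq_square[symmetric])
  have "(X' * c - y * d, X' * d + y * c) = 0"
    using assms(3) vector_derivative_at[OF pol_velocity[OF assms(1,2), of \<beta>]] by (simp add: c_def d_def y_def)
  then have 2: "X' * c - y * d = 0" "X' * d + y * c = 0" by (simp_all add: zero_prod_def)
  have "X' * (c * c + d * d) = (X' * c - y * d) * c + (X' * d + y * c) * d" by (simp add: algebra_simps)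
  then show "X' = 0" unfolding 1 2 by simp
  have "y * (c * c + d * d) = (X' * d + y * c) * c - (X' * c - y * d) * d" by (simp add: algebra_simps)
  then show "X s * \<psi>' = 0" unfolding 1 2 y_def[symmetric] by simp
qed

lemma smooth_on_pol:
  assumes "open S" "smooth_on S X" "smooth_on S \<psi>"
  shows "smooth_on S (\<lambda>s. pol \<beta> (X s) (\<psi> s))"
  unfolding pol_def by (intro smooth_intros assms)

lemma smooth_on_real_deriv_ex:
  fixes f :: "real \<Rightarrow> real"
  assumes "smooth_on S f" "x \<in> S"
  shows "\<exists>d. (f has_real_derivative d) (at x)"
  using smooth_on_differentiable[OF assms] by (simp add: real_differentiable_def)

lemma abs_less_mem: "\<bar>y\<bar> < R \<Longrightarrow> y \<in> {-R<..<R}" for y :: real by auto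
lemma abs_le_mem: "\<bar>y\<bar> \<le> R \<Longrightarrow> y \<in> {-R..R}" for y :: real by auto

text \<open>A graph of the angle over the signed radius is a branch: the norm \<open>\<bar>r s\<bar>\<close> shows the conditions on the
  end points, and the bound on the angle excludes that opposite radii give the same point.\<close>

lemma branch_param_graph:
  assumes "smooth_on {-R<..<R} \<Theta>" "0 < r" "r < R" "\<And>x. \<bar>x\<bar> < R \<Longrightarrow> \<bar>\<Theta> x - c\<bar> < pi / 2"
  shows "branch_param r (\<lambda>s. pol \<beta> (r * s) (\<Theta> (r * s)))"
proof -
  define S where "S = {- (R / r)<..<R / r}"
  have S: "open S" by (simp add: S_def)
  have inS: "\<bar>r * s\<bar> < R" if "s \<in> S" for s
  proof -
    have "\<bar>s\<bar> < R / r" using that by (auto simp: S_def)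
    then show ?thesis using assms(2) by (simp add: abs_mult field_simps)
  qed
  have "1 < R / r" using assms(2,3) by simp
  then have sub: "{-1..1} \<subseteq> S" by (auto simp: S_def)
  have sX: "smooth_on S (\<lambda>s. r * s)" by (intro smooth_intros S)
  have sT: "smooth_on S (\<lambda>s. \<Theta> (r * s))"
  proof (rule smooth_on_compose[OF assms(1) S _ sX])
    show "r * s \<in> {-R<..<R}" if "s \<in> S" for s by (rule abs_less_mem[OF inS[OF that]])
  qed simp
  have nrm: "norm (pol \<beta> (r * s) (\<Theta> (r * s))) = r * \<bar>s\<bar>" for s
    using assms(2) by (simp add: norm_pol abs_mult)
  show ?thesis
    unfolding branch_param_def
  proof (intro conjI exI[of _ S] ballI)
    show "smooth_on S (\<lambda>s. pol \<beta> (r * s) (\<Theta> (r * s)))" by (rule smooth_on_pol[OF S sX sT])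
    show "vector_derivative (\<lambda>s. pol \<beta> (r * s) (\<Theta> (r * s))) (at s) \<noteq> 0" if s: "s \<in> {-1..1}" for s
    proof
      assume z: "vector_derivative (\<lambda>s. pol \<beta> (r * s) (\<Theta> (r * s))) (at s) = 0"
      obtain d where d: "((\<lambda>s. \<Theta> (r * s)) has_real_derivative d) (at s)"
        using smooth_on_real_deriv_ex[OF sT subsetD[OF sub s]] by blast
      have "((\<lambda>s. r * s) has_real_derivative r) (at s)" using DERIV_cmult[OF DERIV_ident, of r s] by simp
      from pol_velocity_zero(1)[OF this d z] show False using assms(2) by simp
    qed
    show "inj_on (\<lambda>s. pol \<beta> (r * s) (\<Theta> (r * s))) {-1..1}"
    proof (rule inj_onI)
      fix s s' assume s: "s \<in> {-1..1}" "s' \<in> {-1..1}" and eq: "pol \<beta> (r * s) (\<Theta> (r * s)) = pol \<beta> (r * s') (\<Theta> (r * s'))"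
      have "r * \<bar>s\<bar> = r * \<bar>s'\<bar>" using arg_cong[OF eq, of norm] by (simp only: nrm)
      then have "s' = s \<or> s' = - s" using assms(2) by (auto simp: abs_eq_iff)
      moreover have False if o: "s' = - s" "s \<noteq> 0"
      proof -
        have "pi \<le> \<bar>\<Theta> (r * s) - \<Theta> (- (r * s))\<bar>"
          by (rule pol_opposite[of \<beta> "r * s"]) (use eq o assms(2) in auto)
        moreover have "\<bar>\<Theta> (r * s) - c\<bar> < pi / 2" "\<bar>\<Theta> (- (r * s)) - c\<bar> < pi / 2"
          using inS[of s] s(1) sub by (intro assms(4); auto)+
        ultimately show False by linarith
      qed
      ultimately show "s = s'" by fastforce
    qed
    show "norm (pol \<beta> (r * - 1) (\<Theta> (r * - 1))) = r" "norm (pol \<beta> (r * 1) (\<Theta> (r * 1))) = r" by (simp_all only: nrm)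
    show "norm (pol \<beta> (r * s) (\<Theta> (r * s))) < r" if "s \<in> {-1<..<1}" for s
      using that assms(2) unfolding nrm by (simp add: abs_less_iff mult_less_cancel_left_pos[of r _ 1, simplified])
  qed (use sub S in auto)
qed

text \<open>The vertex sets are described in blown-up coordinates; \<open>\<beta>\<close> is the direction of the bisector of
  the first sector.\<close>

text \<open>The link between the plane and the blown-up coordinates; \<open>\<beta>\<close> is the direction of the bisector of the
  first sector.\<close>

locale umbilic_family = umbilic_polar +
  fixes \<beta> :: real and V0 :: "(real \<times> real) set" and V :: "real \<Rightarrow> (real \<times> real) set"
  assumes V0_0: "0 \<in> V0" and V_0: "0 \<in> V t"
    and V0_iff: "r \<noteq> 0 \<Longrightarrow> \<bar>r\<bar> < R0 \<Longrightarrow> pol \<beta> r \<phi> \<in> V0 \<longleftrightarrow> A (r, \<phi>) = 0"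
    and V_iff: "r \<noteq> 0 \<Longrightarrow> \<bar>r\<bar> < R0 \<Longrightarrow> t \<noteq> 0 \<Longrightarrow> \<bar>t\<bar> < \<tau>0 \<Longrightarrow>
      pol \<beta> r \<phi> \<in> V t \<longleftrightarrow> r * A (r, \<phi>) + t * B (r, \<phi>, t) = 0"

locale umbilic_all = umbilic_chart A B R0 \<tau>0 P Q R \<tau> th \<rho> \<tau>1 c1 C1 + umbilic_family A B R0 \<tau>0 P Q \<beta> V0 V
  for A B R0 \<tau>0 P Q R \<tau> th \<rho> \<tau>1 c1 C1 \<beta> V0 V
begin

abbreviation pt :: "real \<Rightarrow> real \<Rightarrow> real \<times> real" where "pt \<equiv> pol \<beta>"

lemma th_width: "\<bar>x\<bar> < R \<Longrightarrow> th 3 x < th 0 x + 2 * pi"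
proof -
  assume x: "\<bar>x\<bar> < R"
  have "\<bar>th 3 x - asym_angle 3\<bar> < pi / 12" "\<bar>th 0 x - asym_angle 0\<bar> < pi / 12"
    by (rule th_near[OF _ x]; simp)+
  moreover have "asym_angle 3 = asym_angle 0 + pi" by (simp add: asym_angle_def)
  ultimately show ?thesis using pi_gt_zero by linarith
qed

text \<open>The three sectors and their antipodes cover the punctured disc, each point once: a point beyond
  \<open>th 3\<close> is described by the opposite radius.\<close>

lemma coord_ex:
  assumes "p \<noteq> 0" "norm p < R"
  shows "\<exists>x \<phi>. \<bar>x\<bar> = norm p \<and> th 0 x \<le> \<phi> \<and> \<phi> < th 3 x \<and> p = pt x \<phi>"
proof -
  define n where "n = norm p"
  have n: "n > 0" "\<bar>n\<bar> < R" "\<bar>- n\<bar> < R" using assms by (auto simp: n_def)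
  obtain \<phi> where \<phi>: "th 0 n \<le> \<phi>" "\<phi> < th 0 n + 2 * pi" "p = pt n \<phi>"
    using pol_surj[OF assms(1), of "th 0 n" \<beta>] unfolding n_def by blast
  show ?thesis
  proof (cases "\<phi> < th 3 n")
    case True
    moreover have "\<bar>n\<bar> = norm p" by (simp add: n_def)
    ultimately show ?thesis using \<phi>(1,3) by blast
  next
    case False
    have "th 3 n = th 0 (- n) + pi" "th 3 (- n) = th 0 n + pi" using th_3[OF n(2)] th_3[OF n(3)] by simp_all
    then have "th 0 (- n) \<le> \<phi> - pi" "\<phi> - pi < th 3 (- n)" using False \<phi>(2) by linarith+
    moreover have "p = pt (- n) (\<phi> - pi)" using pol_neg[of \<beta> "- n" "\<phi> - pi"] \<phi>(3) by simp
    moreover have "\<bar>- n\<bar> = norm p" by (simp add: n_def)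
    ultimately show ?thesis by blast
  qed
qed

lemma coord_unique:
  assumes "pt x \<phi> = pt y \<psi>" "x \<noteq> 0" "\<bar>x\<bar> < R"
    "th 0 x \<le> \<phi>" "\<phi> < th 3 x" "th 0 y \<le> \<psi>" "\<psi> < th 3 y"
  shows "x = y \<and> \<phi> = \<psi>"
proof -
  have "\<bar>x\<bar> = \<bar>y\<bar>" using arg_cong[OF assms(1), of norm] by (simp add: norm_pol)
  then consider "y = x" | "y = - x" by (auto simp: abs_eq_iff)
  then show ?thesis
  proof cases
    case 1
    have "\<bar>\<phi> - \<psi>\<bar> < 2 * pi" using assms(4-7) th_width[OF assms(3)] unfolding 1 by linarith
    then show ?thesis using pol_inj[of \<beta> x \<phi> \<psi>] assms(1,2) 1 by simp
  next
    case 2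
    have "\<bar>- x\<bar> < R" using assms(3) by simp
    then have "th 3 x = th 0 (- x) + pi" "th 3 (- x) = th 0 x + pi"
      using th_3[OF assms(3)] th_3[of "- x"] by simp_all
    then have "\<bar>\<phi> - \<psi>\<bar> < pi" using assms(4-7) unfolding 2 by linarith
    moreover have "\<bar>\<phi> - \<psi>\<bar> \<ge> pi" by (rule pol_opposite[of \<beta> x]) (use assms(1,2) 2 in auto)
    ultimately show ?thesis by simp
  qed
qed

lemma th_le:
  assumes "\<bar>x\<bar> < R"
  shows "th 0 x < th 1 x" "th 1 x < th 2 x" "th 2 x < th 3 x"
  using th_order[OF assms, of 0] th_order[OF assms, of 1] th_order[OF assms, of 2]
  by (simp_all add: numeral_2_eq_2 numeral_3_eq_3)

lemma sector_cases:
  assumes "\<bar>x\<bar> < R" "th 0 x \<le> \<phi>" "\<phi> < th 3 x"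
  obtains j where "j < 3" "\<phi> = th j x" | "th 0 x < \<phi>" "\<phi> < th 1 x" | "th 1 x < \<phi>" "\<phi> < th 2 x"
    | "th 2 x < \<phi>" "\<phi> < th 3 x"
proof -
  consider "\<phi> = th 0 x" | "\<phi> = th 1 x" | "\<phi> = th 2 x" | "th 0 x < \<phi>" "\<phi> < th 1 x"
    | "th 1 x < \<phi>" "\<phi> < th 2 x" | "th 2 x < \<phi>"
    using assms(2) by linarith
  then show ?thesis by cases (use that(1)[of 0] that(1)[of 1] that(1)[of 2] that(2-4) assms(3) in auto)
qed

lemma A_signs:
  assumes "\<bar>x\<bar> < R"
  shows "th 0 x < \<phi> \<Longrightarrow> \<phi> < th 1 x \<Longrightarrow> A (x, \<phi>) > 0" "th 1 x < \<phi> \<Longrightarrow> \<phi> < th 2 x \<Longrightarrow> A (x, \<phi>) < 0"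
    "th 2 x < \<phi> \<Longrightarrow> \<phi> < th 3 x \<Longrightarrow> A (x, \<phi>) > 0"
  using A_sign[OF _ assms, of 0 \<phi>] A_sign[OF _ assms, of 1 \<phi>] A_sign[OF _ assms, of 2 \<phi>]
  by (simp_all add: numeral_2_eq_2 numeral_3_eq_3)

lemma th_range:
  assumes "\<bar>x\<bar> < R" "j < 3"
  shows "th 0 x \<le> th j x" "th j x < th 3 x"
proof -
  have "j = 0 \<or> j = 1 \<or> j = 2" using assms(2) by auto
  then show "th 0 x \<le> th j x" "th j x < th 3 x" using th_le[OF assms(1)] by auto
qed

definition gam :: "real \<Rightarrow> nat \<Rightarrow> real \<Rightarrow> real \<times> real" where
  "gam r j s = pt (r * s) (th j (r * s))"

lemma near_center:
  assumes "k \<le> 3" "\<bar>x\<bar> < R"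
  shows "\<bar>th k x - asym_angle k\<bar> < pi / 2"
  using th_near[OF assms] pi_gt_zero by linarith

lemma gam_branch:
  assumes "0 < r" "r < R" "j < 3"
  shows "branch_param r (gam r j)"
proof -
  have j: "j \<le> 3" using assms(3) by simp
  show ?thesis
    unfolding gam_def[abs_def] by (rule branch_param_graph[OF th_smooth[OF j] assms(1,2) near_center[OF j]])
qed

lemma V0_disc:
  assumes "0 < r" "r < R"
  shows "V0 \<inter> cball 0 r = (\<Union>j<3. gam r j ` {-1..1})"
proof
  show "(\<Union>j<3. gam r j ` {-1..1}) \<subseteq> V0 \<inter> cball 0 r"
  proof
    fix p assume "p \<in> (\<Union>j<3. gam r j ` {-1..1})"
    then obtain j s where js: "j < 3" "s \<in> {-1..1}" "p = gam r j s" by blast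
    have "\<bar>r * s\<bar> \<le> r" using js(2) assms(1) by (simp add: abs_mult mult_left_le abs_le_iff)
    then have x: "\<bar>r * s\<bar> < R" "norm p \<le> r" using assms(2) by (simp_all add: js(3) gam_def norm_pol)
    have "p \<in> V0"
    proof (cases "r * s = 0")
      case True
      then show ?thesis unfolding js(3) gam_def by (simp only: True pol_0 V0_0)
    next
      case False
      then show ?thesis
        unfolding js(3) gam_def using V0_iff[OF False] x(1) R th_root[of j, OF _ x(1)] js(1) by simp
    qed
    then show "p \<in> V0 \<inter> cball 0 r" using x(2) by simp
  qed
  show "V0 \<inter> cball 0 r \<subseteq> (\<Union>j<3. gam r j ` {-1..1})"
  proof
    fix p assume p: "p \<in> V0 \<inter> cball 0 r"
    show "p \<in> (\<Union>j<3. gam r j ` {-1..1})"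
    proof (cases "p = 0")
      case True
      have "gam r 0 0 = p" using True by (simp add: gam_def pol_0)
      then show ?thesis by (intro UN_I[of 0] image_eqI[of _ _ 0]) auto
    next
      case False
      have n: "norm p < R" "norm p \<le> r" using p assms by auto
      obtain x \<phi> where x: "\<bar>x\<bar> = norm p" "th 0 x \<le> \<phi>" "\<phi> < th 3 x" "p = pt x \<phi>" using coord_ex[OF False n(1)] by blast
      have x0: "x \<noteq> 0" "\<bar>x\<bar> < R" using x(1) False n by auto
      then have "A (x, \<phi>) = 0" using V0_iff[OF x0(1)] x(4) p R by auto
      moreover note A_signs[OF x0(2), of \<phi>]
      ultimately have "\<exists>j<3. \<phi> = th j x"
        by (cases rule: sector_cases[OF x0(2) x(2,3)]) (blast, simp_all)
      then obtain j where j: "j < 3" "\<phi> = th j x" by blast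
      have "r * (x / r) = x" using assms(1) by simp
      then have "p = gam r j (x / r)" by (simp only: gam_def x(4) j(2))
      moreover have "\<bar>x / r\<bar> \<le> 1" using x(1) n(2) assms(1) by (simp add: abs_divide)
      then have "x / r \<in> {-1..1}" by (rule abs_le_mem)
      ultimately have "p = gam r j (x / r)" "x / r \<in> {-1..1}" by blast+
      then show ?thesis using j(1) by blast
    qed
  qed
qed

text \<open>Since the radius may be negative, this also contains points of the antipode of the first sector; as \<open>A\<close> and
  \<open>B\<close> are positive in that sector, only the radii of the sign opposite to \<open>t\<close> occur.\<close>

definition Barc :: "real \<Rightarrow> real \<Rightarrow> (real \<times> real) set" where
  "Barc r t = {pt x \<phi> | x \<phi>. x \<noteq> 0 \<and> \<bar>x\<bar> \<le> r \<and> th 0 x < \<phi> \<and> \<phi> < th 1 x \<and> x * A (x, \<phi>) + t * B (x, \<phi>, t) = 0}"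

text \<open>By the sign conditions no point of the perturbed vertex set other than the origin lies on an edge
  of a sector, so the set is the disjoint union of its parts in the three open double sectors.\<close>

lemma Barc_nonorigin:
  assumes r: "0 < r" "r < R" and t: "\<bar>t\<bar> < \<tau>" "t \<noteq> 0" and sm: "smooth_branch r (Barc r t)"
  shows "nonorigin_branch r (V t) (Barc r t)"
proof -
  have tt: "\<bar>t\<bar> < \<tau>0" using t(1) tau by simp
  obtain T1 where T1: "smooth_on {-R<..<R} T1" "\<And>x. \<bar>x\<bar> < R \<Longrightarrow> th 1 x < T1 x \<and> T1 x < th 2 x"
    "\<And>x \<phi>. \<bar>x\<bar> < R \<Longrightarrow> th 1 x < \<phi> \<Longrightarrow> \<phi> < th 2 x \<Longrightarrow> x * A (x, \<phi>) + t * B (x, \<phi>, t) = 0 \<longleftrightarrow> \<phi> = T1 x"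
    using through_branch[of 1, OF _ t] by (auto simp: numeral_2_eq_2)
  obtain T2 where T2: "smooth_on {-R<..<R} T2" "\<And>x. \<bar>x\<bar> < R \<Longrightarrow> th 2 x < T2 x \<and> T2 x < th 3 x"
    "\<And>x \<phi>. \<bar>x\<bar> < R \<Longrightarrow> th 2 x < \<phi> \<Longrightarrow> \<phi> < th 3 x \<Longrightarrow> x * A (x, \<phi>) + t * B (x, \<phi>, t) = 0 \<longleftrightarrow> \<phi> = T2 x"
    using through_branch[of 2, OF _ t] by (auto simp: numeral_2_eq_2 numeral_3_eq_3)
  define A1 where "A1 = (\<lambda>s. pt (r * s) (T1 (r * s))) ` {-1..1}"
  define A2 where "A2 = (\<lambda>s. pt (r * s) (T2 (r * s))) ` {-1..1}"
  have asym: "asym_angle 1 = pi / 6" "asym_angle 2 = pi / 2" "asym_angle 3 = 5 * pi / 6"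
    by (simp_all add: asym_angle_def field_simps)
  have b1: "smooth_branch r A1"
  proof -
    have "\<bar>T1 x - pi / 3\<bar> < pi / 2" if "\<bar>x\<bar> < R" for x
    proof -
      have "\<bar>th 1 x - pi / 6\<bar> < pi / 12" "\<bar>th 2 x - pi / 2\<bar> < pi / 12"
        using th_near[of 1, OF _ that] th_near[of 2, OF _ that] unfolding asym by simp_all
      then show ?thesis using T1(2)[OF that] pi_gt_zero by linarith
    qed
    from branch_param_graph[OF T1(1) r this] show ?thesis unfolding smooth_branch_def A1_def by blast
  qed
  have b2: "smooth_branch r A2"
  proof -
    have "\<bar>T2 x - 2 * pi / 3\<bar> < pi / 2" if "\<bar>x\<bar> < R" for x
    proof -
      have "\<bar>th 2 x - pi / 2\<bar> < pi / 12" "\<bar>th 3 x - 5 * pi / 6\<bar> < pi / 12"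
        using th_near[of 2, OF _ that] th_near[of 3, OF _ that] unfolding asym by simp_all
      then show ?thesis using T2(2)[OF that] pi_gt_zero by linarith
    qed
    from branch_param_graph[OF T2(1) r this] show ?thesis unfolding smooth_branch_def A2_def by blast
  qed
  have mem: "\<exists>x. \<bar>x\<bar> \<le> r \<and> p = pt x (T x)" if p: "p \<in> (\<lambda>s. pt (r * s) (T (r * s))) ` {-1..1}" for p T
  proof -
    obtain s where "s \<in> {-1..1}" "p = pt (r * s) (T (r * s))" using p by blast
    moreover from this have "\<bar>r * s\<bar> \<le> r" using r(1) by (simp add: abs_mult mult_left_le abs_le_iff)
    ultimately show ?thesis by blast
  qed
  have mem': "pt x (T x) \<in> (\<lambda>s. pt (r * s) (T (r * s))) ` {-1..1}" if "\<bar>x\<bar> \<le> r" for x T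
  proof (rule image_eqI[of _ _ "x / r"])
    have "r * (x / r) = x" using r(1) by simp
    then show "pt x (T x) = pt (r * (x / r)) (T (r * (x / r)))" by (simp only:)
    have "\<bar>x / r\<bar> \<le> 1" using that r(1) by (simp add: abs_divide)
    then show "x / r \<in> {-1..1}" by (rule abs_le_mem)
  qed
  have rg: "th 0 x \<le> T1 x" "T1 x < th 3 x" "th 0 x \<le> T2 x" "T2 x < th 3 x" if "\<bar>x\<bar> < R" for x
    using T1(2)[OF that] T2(2)[OF that] th_le[OF that] by linarith+
  have z12: "0 \<in> A1" "0 \<in> A2"
    using mem'[of 0 T1] mem'[of 0 T2] r(1) by (simp_all add: A1_def A2_def pol_0)
  have z0: "0 \<notin> Barc r t" by (auto simp: Barc_def pol_eq_0_iff)
  have ne: "A1 \<noteq> A2"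
  proof
    assume "A1 = A2"
    then have "pt r (T1 r) \<in> A2" using mem'[of r T1] r(1) by (simp add: A1_def)
    then obtain x where x: "\<bar>x\<bar> \<le> r" "pt r (T1 r) = pt x (T2 x)" using mem[of "pt r (T1 r)" T2] unfolding A2_def by blast
    have rr: "\<bar>r\<bar> < R" "\<bar>x\<bar> < R" using r x(1) by auto
    have "r = x \<and> T1 r = T2 x" by (rule coord_unique[OF x(2) _ rr(1) rg(1,2)[OF rr(1)] rg(3,4)[OF rr(2)]]) (use r in simp)
    then show False using T1(2)[OF rr(1)] T2(2)[OF rr(1)] by auto
  qed
  have dj: "Barc r t \<inter> (A1 \<union> A2) = {}"
  proof (rule ccontr)
    assume "Barc r t \<inter> (A1 \<union> A2) \<noteq> {}"
    then obtain p where p: "p \<in> Barc r t" "p \<in> A1 \<or> p \<in> A2" by blast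
    obtain x \<phi> where x: "p = pt x \<phi>" "x \<noteq> 0" "\<bar>x\<bar> \<le> r" "th 0 x < \<phi>" "\<phi> < th 1 x" using p(1) by (auto simp: Barc_def)
    have xR: "\<bar>x\<bar> < R" using x(3) r by simp
    have \<phi>3: "\<phi> < th 3 x" using x(5) th_le[OF xR] by linarith
    obtain y T where y: "\<bar>y\<bar> \<le> r" "p = pt y (T y)" "T = T1 \<or> T = T2"
      using p(2) mem[of p T1] mem[of p T2] unfolding A1_def A2_def by blast
    have yR: "\<bar>y\<bar> < R" using y(1) r by simp
    have "x = y \<and> \<phi> = T y"
    proof (rule coord_unique)
      show "pt x \<phi> = pt y (T y)" using x(1) y(2) by (rule trans[OF sym])
      show "th 0 y \<le> T y" "T y < th 3 y" using y(3) rg[OF yR] by blast+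
    qed (use x(2,4) xR \<phi>3 in simp_all)
    then have "\<phi> = T1 x \<or> \<phi> = T2 x" using y(3) by blast
    then show False using x(5) T1(2)[OF xR] T2(2)[OF xR] th_le[OF xR] by linarith
  qed
  have un: "V t \<inter> cball 0 r = A1 \<union> A2 \<union> Barc r t"
  proof
    show "A1 \<union> A2 \<union> Barc r t \<subseteq> V t \<inter> cball 0 r"
    proof
      fix p assume p: "p \<in> A1 \<union> A2 \<union> Barc r t"
      have "p = 0 \<or> (\<exists>x \<phi>. x \<noteq> 0 \<and> \<bar>x\<bar> \<le> r \<and> p = pt x \<phi> \<and> x * A (x, \<phi>) + t * B (x, \<phi>, t) = 0)"
      proof (cases "p \<in> Barc r t")
        case True
        then show ?thesis unfolding Barc_def by blast
      next
        case False
        then obtain y T where y: "\<bar>y\<bar> \<le> r" "p = pt y (T y)" "T = T1 \<or> T = T2"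
          using p mem[of p T1] mem[of p T2] unfolding A1_def A2_def by blast
        have yR: "\<bar>y\<bar> < R" using y(1) r by simp
        have "y * A (y, T y) + t * B (y, T y, t) = 0"
          using y(3) T1(3)[OF yR, of "T1 y"] T2(3)[OF yR, of "T2 y"] T1(2)[OF yR] T2(2)[OF yR] by blast
        then show ?thesis using y(1,2) by (cases "y = 0") (simp add: pol_0, blast)
      qed
      then show "p \<in> V t \<inter> cball 0 r"
      proof
        assume "p = 0"
        then show ?thesis using V_0 r by simp
      next
        assume "\<exists>x \<phi>. x \<noteq> 0 \<and> \<bar>x\<bar> \<le> r \<and> p = pt x \<phi> \<and> x * A (x, \<phi>) + t * B (x, \<phi>, t) = 0"
        then obtain x \<phi> where x: "x \<noteq> 0" "\<bar>x\<bar> \<le> r" "p = pt x \<phi>" "x * A (x, \<phi>) + t * B (x, \<phi>, t) = 0" by blast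
        have "\<bar>x\<bar> < R0" using x(2) r R by simp
        then show ?thesis using V_iff[OF x(1) _ t(2) tt] x by (simp add: norm_pol)
      qed
    qed
    show "V t \<inter> cball 0 r \<subseteq> A1 \<union> A2 \<union> Barc r t"
    proof
      fix p assume p: "p \<in> V t \<inter> cball 0 r"
      show "p \<in> A1 \<union> A2 \<union> Barc r t"
      proof (cases "p = 0")
        case True
        then show ?thesis using \<open>0 \<in> A1\<close> by simp
      next
        case False
        have n: "norm p < R" "norm p \<le> r" using p r by auto
        obtain x \<phi> where x: "\<bar>x\<bar> = norm p" "th 0 x \<le> \<phi>" "\<phi> < th 3 x" "p = pt x \<phi>" using coord_ex[OF False n(1)] by blast
        have x0: "x \<noteq> 0" "\<bar>x\<bar> < R" "\<bar>x\<bar> \<le> r" using x(1) False n by auto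
        then have "\<bar>x\<bar> < R0" using R by simp
        from V_iff[OF x0(1) this t(2) tt, of \<phi>] have eq: "x * A (x, \<phi>) + t * B (x, \<phi>, t) = 0"
          using x(4) p by blast
        show ?thesis
        proof (rule sector_cases[OF x0(2) x(2,3)])
          fix j :: nat assume j: "j < 3" "\<phi> = th j x"
          have "j = 0 \<or> j = 1 \<or> j = 2" using j(1) by linarith
          moreover have "B (x, th 0 x, t) > 0" by (rule B_0[OF x0(2) t(1)]) (use th_le[OF x0(2)] in simp_all)
          ultimately have "B (x, th j x, t) \<noteq> 0"
            using B_1[OF x0(2) t(1)] B_2[OF x0(2) t(1)] by (metis less_irrefl)
          moreover have "A (x, th j x) = 0" using th_root[of j, OF _ x0(2)] j(1) by simp
          ultimately show ?thesis using eq t(2) j(2) by simp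
        next
          assume "th 0 x < \<phi>" "\<phi> < th 1 x"
          then have "p \<in> Barc r t" unfolding Barc_def using x(4) x0 eq by blast
          then show ?thesis by blast
        next
          assume "th 1 x < \<phi>" "\<phi> < th 2 x"
          then have "\<phi> = T1 x" using T1(3)[OF x0(2)] eq by blast
          then show ?thesis using mem'[OF x0(3), of T1] x(4) by (simp add: A1_def)
        next
          assume "th 2 x < \<phi>" "\<phi> < th 3 x"
          then have "\<phi> = T2 x" using T2(3)[OF x0(2)] eq by blast
          then show ?thesis using mem'[OF x0(3), of T2] x(4) by (simp add: A2_def)
        qed
      qed
    qed
  qed
  show ?thesis
    unfolding nonorigin_branch_def
    by (rule exI[of _ A1], rule exI[of _ A2], intro conjI) (rule un ne b1 b2 sm z12 z0 dj)+
qed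

end

section \<open>The branch off the origin\<close>

context umbilic_all
begin

text \<open>The half-plane chart of the first sector for \<open>\<sigma> = 1\<close> and of its antipode for \<open>\<sigma> = - 1\<close>.\<close>

definition ch :: "real \<Rightarrow> real \<Rightarrow> real \<Rightarrow> real \<times> real" where
  "ch \<sigma> u v = pt (\<sigma> * rad u v) (ang (\<sigma> * rad u v) (chi u v))"

lemma norm_ch: "\<bar>\<sigma>\<bar> = 1 \<Longrightarrow> norm (ch \<sigma> u v) = rad u v"
  using rad_nonneg[of u v] by (simp add: ch_def norm_pol abs_mult)

lemma abs_sig: "\<bar>\<sigma>\<bar> = 1 \<Longrightarrow> \<bar>\<sigma> * rad u v\<bar> = rad u v"
  using rad_nonneg[of u v] by (simp add: abs_mult)

lemma cont_th: "k \<le> 3 \<Longrightarrow> continuous_on {-R<..<R} (th k)"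
  by (rule smooth_on_continuous[OF th_smooth])

lemma smooth_mid: "smooth_on {-R<..<R} mid" and smooth_wid: "smooth_on {-R<..<R} wid"
  unfolding mid_def[abs_def] wid_def[abs_def] by (intro smooth_intros th_smooth; simp)+

text \<open>Continuity at the origin, where the angle jumps, holds because the norm tends to \<open>0\<close>.\<close>

lemma ch_cont:
  assumes "\<bar>\<sigma>\<bar> = 1"
  shows "continuous_on {p. snd p \<ge> 0 \<and> (fst p)\<^sup>2 + (snd p)\<^sup>2 < R\<^sup>2} (\<lambda>p. ch \<sigma> (fst p) (snd p))"
    (is "continuous_on ?S ?f")
proof -
  have radS: "\<sigma> * rad (fst p) (snd p) \<in> {-R<..<R}" if "p \<in> ?S" for p
  proof -
    have "rad (fst p) (snd p) < R" using that R(1) by (simp add: rad_less_iff)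
    then show ?thesis using abs_sig[OF assms, of "fst p" "snd p"] by (intro abs_less_mem) simp
  qed
  have cX: "continuous_on T (\<lambda>p. \<sigma> * rad (fst p) (snd p))" for T by (intro continuous_intros rad_cont)
  have c0: "continuous_on (?S - {(0, 0)}) ?f"
  proof -
    have cm: "continuous_on (?S - {(0, 0)}) (\<lambda>p. h (\<sigma> * rad (fst p) (snd p)))"
      if "smooth_on {-R<..<R} h" for h :: "real \<Rightarrow> real"
      by (rule continuous_on_compose2[OF smooth_on_continuous[OF that] cX]) (use radS in blast)
    have cc: "continuous_on (?S - {(0, 0)}) (\<lambda>p. chi (fst p) (snd p))"
      by (rule continuous_on_subset[OF chi_cont]) auto
    show ?thesis
      unfolding ch_def pol_def ang_def by (intro continuous_intros cX cm smooth_mid smooth_wid cc)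
  qed
  have "continuous (at x within ?S) ?f" if x: "x \<in> ?S" for x
  proof (cases "x = (0, 0)")
    case False
    have "continuous (at x within ?S - {(0, 0)}) ?f"
      using c0 x False by (simp add: continuous_on_eq_continuous_within)
    moreover have "at x within ?S - {(0, 0)} = at x within ?S"
      by (rule at_within_nhd[of x "- {(0, 0)}"]) (use False in \<open>auto intro: open_Compl\<close>)
    ultimately show ?thesis by simp
  next
    case True
    have "((\<lambda>p. rad (fst p) (snd p)) \<longlongrightarrow> rad (fst x) (snd x)) (at x within ?S)"
      using rad_cont[of ?S, unfolded continuous_on_def] x by blast
    then have "((\<lambda>p. norm (?f p)) \<longlongrightarrow> 0) (at x within ?S)"
      unfolding norm_ch[OF assms] True by (simp add: rad_def)
    then have "(?f \<longlongrightarrow> 0) (at x within ?S)" by (rule tendsto_norm_zero_cancel)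
    moreover have "?f x = 0" by (simp add: True ch_def rad_def pol_0)
    ultimately show ?thesis by (simp add: continuous_within)
  qed
  then show ?thesis by (simp add: continuous_on_eq_continuous_within)
qed

lemma ch_inj:
  assumes \<sigma>: "\<bar>\<sigma>\<bar> = 1" and eq: "ch \<sigma> u v = ch \<sigma> u' v'" and r: "rad u v < R"
  shows "u = u'"
proof -
  have re: "rad u v = rad u' v'" using arg_cong[OF eq, of norm] by (simp only: norm_ch[OF \<sigma>])
  define x where "x = \<sigma> * rad u v"
  have xR: "\<bar>x\<bar> < R" using r abs_sig[OF \<sigma>, of u v] by (simp add: x_def)
  have pe: "pt x (ang x (chi u v)) = pt x (ang x (chi u' v'))" using eq by (simp add: ch_def x_def re)
  show ?thesis
  proof (cases "rad u v = 0")
    case True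
    then show ?thesis using rad_sin_chi[of u v] rad_sin_chi[of u' v'] re by simp
  next
    case False
    then have x0: "x \<noteq> 0" using \<sigma> by (auto simp: x_def)
    have "\<bar>ang x (chi u v) - ang x (chi u' v')\<bar> < 2 * pi"
      using ang_le[OF xR chi_le[of u v]] ang_le[OF xR chi_le[of u' v']] th_width[OF xR] th_le[OF xR] by linarith
    then have "ang x (chi u v) = ang x (chi u' v')" by (rule pol_inj[OF pe x0])
    then have "chi u v * wid x = chi u' v' * wid x" by (simp add: ang_def)
    then have "chi u v = chi u' v'" using wid_pos[OF xR] by simp
    then show ?thesis using rad_sin_chi[of u v] rad_sin_chi[of u' v'] re by metis
  qed
qed

lemma ch_edge:
  assumes "u \<ge> 0"
  shows "ch \<sigma> u 0 = pt (\<sigma> * u) (th 1 (\<sigma> * u))" "ch \<sigma> (- u) 0 = pt (\<sigma> * u) (th 0 (\<sigma> * u))"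
proof -
  show "ch \<sigma> u 0 = pt (\<sigma> * u) (th 1 (\<sigma> * u))"
  proof (cases "u = 0")
    case False
    then have "chi u 0 = pi / 2" "rad u 0 = u" using assms by (simp_all add: chi_def rad_u0)
    then show ?thesis by (simp only: ch_def ang_ends)
  qed (simp add: ch_def rad_u0 pol_0)
  show "ch \<sigma> (- u) 0 = pt (\<sigma> * u) (th 0 (\<sigma> * u))"
  proof (cases "u = 0")
    case False
    then have "chi (- u) 0 = - (pi / 2)" "rad (- u) 0 = u" using assms by (simp_all add: chi_def rad_u0)
    then show ?thesis by (simp only: ch_def ang_ends)
  qed (simp add: ch_def rad_u0 pol_0)
qed

text \<open>For small \<open>t\<close> the part of the vertex set in the first sector is, in half-plane coordinates,
  the graph of a function over an interval.\<close>

text \<open>In half-plane coordinates the set is the graph of a function \<open>Y\<close> with values in \<open>(0, w]\<close> and slope at most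
  \<open>C1 / c1\<close>. Hence \<open>u\<^sup>2 + Y\<^sup>2\<close> is monotone in \<open>\<bar>u\<bar>\<close> outside \<open>\<bar>u\<bar> \<le> (C1 / c1) w\<close>, so that the disc cuts out an interval,
  whose end points are within \<open>w\<close> of \<open>\<plusminus> r\<close>.\<close>

lemma arc_ex:
  assumes \<sigma>: "\<bar>\<sigma>\<bar> = 1" "\<sigma> * t = - \<bar>t\<bar>" and t: "\<bar>t\<bar> < \<tau>1" "t \<noteq> 0"
    and w: "w = \<bar>t\<bar> / c1" and r: "0 < r" "r < \<omega>"
    and small: "\<omega>\<^sup>2 + w\<^sup>2 < \<rho>\<^sup>2" "C1 / c1 * w < \<omega>" "(C1 / c1 * w)\<^sup>2 + w\<^sup>2 < r\<^sup>2"
  obtains a b Y where "- r \<le> a" "a < 0" "0 < b" "b \<le> r" "a + r \<le> w" "r - b \<le> w"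
    "continuous_on {a..b} Y" "\<And>u. u \<in> {a..b} \<Longrightarrow> 0 < Y u \<and> Y u \<le> w \<and> rad u (Y u) < R"
    "smooth_branch r (Barc r t)" "(\<lambda>u. ch \<sigma> u (Y u)) ` {a..b} = Barc r t"
proof -
  have w0: "w > 0" using t(2) c1 by (simp add: w)
  obtain Y where Y: "smooth_on {-\<omega><..<\<omega>} Y"
    "\<And>u. \<bar>u\<bar> < \<omega> \<Longrightarrow> 0 < Y u \<and> Y u \<le> w \<and> q \<sigma> t u (Y u) = \<bar>t\<bar>"
    "\<And>u v. \<bar>u\<bar> < \<omega> \<Longrightarrow> v > 0 \<Longrightarrow> u\<^sup>2 + v\<^sup>2 < \<rho>\<^sup>2 \<Longrightarrow> q \<sigma> t u v = \<bar>t\<bar> \<Longrightarrow> v = Y u"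
    "\<And>u. \<bar>u\<bar> < \<omega> \<Longrightarrow> \<exists>d. (Y has_real_derivative d) (at u) \<and> \<bar>d\<bar> \<le> C1 / c1"
    using wedge_root[OF \<sigma>(1) t small(1)[unfolded w]] unfolding w by blast
  obtain d where d: "\<And>u. \<bar>u\<bar> < \<omega> \<Longrightarrow> (Y has_real_derivative d u) (at u)" "\<And>u. \<bar>u\<bar> < \<omega> \<Longrightarrow> \<bar>d u\<bar> \<le> C1 / c1"
    using Y(4) by metis
  define M where "M = C1 / c1 * w"
  have M0: "0 \<le> M" using C1 c1 w0 by (simp add: M_def)
  define g where "g u = u\<^sup>2 + (Y u)\<^sup>2" for u
  have Yd: "\<bar>Y u * d u\<bar> \<le> M" if "\<bar>u\<bar> < \<omega>" for u
  proof -
    have "\<bar>Y u * d u\<bar> = \<bar>d u\<bar> * \<bar>Y u\<bar>" by (simp only: abs_mult mult.commute)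
    also have "\<dots> \<le> C1 / c1 * w"
      by (rule mult_mono) (use d(2)[OF that] Y(2)[OF that] C1 c1 in simp_all)
    finally show ?thesis by (simp add: M_def)
  qed
  have \<omega>0: "\<omega> > 0" using r by simp
  have "\<exists>a b. - r \<le> a \<and> a < 0 \<and> 0 < b \<and> b \<le> r \<and> g a = r\<^sup>2 \<and> g b = r\<^sup>2 \<and>
    (\<forall>u. \<bar>u\<bar> < \<omega> \<longrightarrow> (g u \<le> r\<^sup>2 \<longleftrightarrow> a \<le> u \<and> u \<le> b) \<and> (g u < r\<^sup>2 \<longleftrightarrow> a < u \<and> u < b))"
  proof (rule sublevel_interval[where g'="\<lambda>u. 2 * u + 2 * (Y u * d u)", OF M0 small(2)[folded M_def] r(2,1)])
    show "(g has_real_derivative 2 * u + 2 * (Y u * d u)) (at u)" if "\<bar>u\<bar> < \<omega>" for u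
      unfolding g_def by (rule derivative_eq_intros d(1)[OF that] refl)+ simp
    show "0 < 2 * u + 2 * (Y u * d u)" if "M < u" "u < \<omega>" for u
    proof -
      have "\<bar>u\<bar> < \<omega>" using that M0 by simp
      then show ?thesis using Yd[of u] that(1) by linarith
    qed
    show "2 * - u + 2 * (Y (- u) * d (- u)) < 0" if "M < u" "u < \<omega>" for u
    proof -
      have "\<bar>- u\<bar> < \<omega>" using that M0 by simp
      then show ?thesis using Yd[of "- u"] that(1) by linarith
    qed
    show "g u < r\<^sup>2" if "\<bar>u\<bar> \<le> M" for u
    proof -
      have u: "\<bar>u\<bar> < \<omega>" using that small(2) by (simp add: M_def)
      have "u\<^sup>2 \<le> M\<^sup>2" using that M0 by (simp add: abs_le_square_iff[symmetric])
      moreover have "(Y u)\<^sup>2 \<le> w\<^sup>2" using Y(2)[OF u] by (intro power_mono) auto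
      ultimately show ?thesis using small(3) unfolding g_def M_def by linarith
    qed
    show "r\<^sup>2 < g u" if "r < \<bar>u\<bar>" "\<bar>u\<bar> < \<omega>" for u
    proof -
      have "r\<^sup>2 < \<bar>u\<bar>\<^sup>2" using that(1) r(1) by (intro power_strict_mono) auto
      then show ?thesis unfolding g_def power2_abs by (smt (verit) zero_le_power2)
    qed
  qed
  then obtain a b where ab: "- r \<le> a" "a < 0" "0 < b" "b \<le> r" "g a = r\<^sup>2" "g b = r\<^sup>2"
    and g_le: "\<And>u. \<bar>u\<bar> < \<omega> \<Longrightarrow> g u \<le> r\<^sup>2 \<longleftrightarrow> a \<le> u \<and> u \<le> b"
    and g_less: "\<And>u. \<bar>u\<bar> < \<omega> \<Longrightarrow> g u < r\<^sup>2 \<longleftrightarrow> a < u \<and> u < b"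
    by blast
  have in\<omega>: "\<bar>u\<bar> < \<omega>" if "u \<in> {a..b}" for u using that ab r by (auto simp: abs_less_iff)
  have end_close: "r - \<bar>u\<bar> \<le> w" if "\<bar>u\<bar> < \<omega>" "\<bar>u\<bar> \<le> r" "g u = r\<^sup>2" for u
  proof -
    have "(r - \<bar>u\<bar>)\<^sup>2 = (r - \<bar>u\<bar>) * (r - \<bar>u\<bar>)" by (simp add: power2_eq_square)
    also have "\<dots> \<le> (r - \<bar>u\<bar>) * (r + \<bar>u\<bar>)" using that(2) by (intro mult_left_mono) auto
    also have "\<dots> = r\<^sup>2 - \<bar>u\<bar>\<^sup>2" by (simp add: power2_eq_square algebra_simps)
    also have "\<dots> = (Y u)\<^sup>2" using that(3) by (simp add: g_def)
    finally have "r - \<bar>u\<bar> \<le> Y u" by (rule power2_le_imp_le) (use Y(2)[OF that(1)] in simp)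
    then show ?thesis using Y(2)[OF that(1)] by linarith
  qed
  have ea: "a + r \<le> w" using end_close[of a] in\<omega>[of a] ab by simp
  have eb: "r - b \<le> w" using end_close[of b] in\<omega>[of b] ab by simp
  have gR: "rad u (Y u) < \<rho>" if "\<bar>u\<bar> < \<omega>" for u
  proof -
    have "u\<^sup>2 \<le> \<omega>\<^sup>2" using that \<omega>0 by (simp add: abs_le_square_iff[symmetric])
    moreover have "(Y u)\<^sup>2 \<le> w\<^sup>2" using Y(2)[OF that] by (intro power_mono) auto
    ultimately have "u\<^sup>2 + (Y u)\<^sup>2 < \<rho>\<^sup>2" using small(1) by linarith
    then show ?thesis using rho(1) by (simp add: rad_less_iff)
  qed
  have radg: "(rad u (Y u))\<^sup>2 = g u" for u by (simp add: rad_sq g_def)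
  define X where "X u = \<sigma> * rad u (Y u)" for u
  define Z where "Z u = chi u (Y u)" for u
  define I where "I = {-\<omega><..<\<omega>}"
  have I: "open I" by (simp add: I_def)
  have I_iff: "u \<in> I \<longleftrightarrow> \<bar>u\<bar> < \<omega>" for u by (auto simp: I_def)
  have XR: "\<bar>X u\<bar> < R" if "u \<in> I" for u
    using gR[of u] that abs_sig[OF \<sigma>(1), of u "Y u"] rho(2) by (simp add: X_def I_iff)
  have sY: "smooth_on I Y" using Y(1) by (simp add: I_def)
  have Ypos: "Y u > 0" if "u \<in> I" for u using Y(2)[of u] that by (simp add: I_iff)
  have srad: "smooth_on I (\<lambda>u. rad u (Y u))"
    unfolding rad_def by (intro smooth_intros I sY) (use Ypos in \<open>simp add: sum_power2_gt_zero_iff less_imp_neq[symmetric]\<close>)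
  have sX: "smooth_on I X" unfolding X_def[abs_def] by (intro smooth_intros I srad)
  have sZ: "smooth_on I Z"
    unfolding Z_def[abs_def] chi_def
  proof (intro smooth_on_arcsin smooth_on_divide I srad smooth_on_ident)
    show "rad u (Y u) \<noteq> 0" if "u \<in> I" for u using rad_pos_v[OF Ypos[OF that], of u] by simp
    show "\<bar>u / rad u (Y u)\<bar> < 1" if "u \<in> I" for u by (rule ratio_less[OF Ypos[OF that]])
  qed
  have comp: "smooth_on I (\<lambda>u. h (X u))" if "smooth_on {-R<..<R} h" for h :: "real \<Rightarrow> real"
    by (rule smooth_on_compose[OF that I _ sX]) (simp, rule abs_less_mem[OF XR])
  have sang: "smooth_on I (\<lambda>u. ang (X u) (Z u))"
    unfolding ang_def by (intro smooth_intros I comp smooth_mid smooth_wid sZ)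
  define U where "U s = (a + b) / 2 + (b - a) / 2 * s" for s
  have Uab: "U s \<in> {a..b}" if "s \<in> {-1..1}" for s
  proof -
    have "(b - a) / 2 * s \<le> (b - a) / 2 * 1" "(b - a) / 2 * (- 1) \<le> (b - a) / 2 * s"
      using that ab by (intro mult_left_mono; simp)+
    then show ?thesis by (simp add: U_def field_simps)
  qed
  have Uab': "a < U s \<and> U s < b" if "s \<in> {-1<..<1}" for s
  proof -
    have "(b - a) / 2 * s < (b - a) / 2 * 1" "(b - a) / 2 * (- 1) < (b - a) / 2 * s"
      using that ab by (intro mult_strict_left_mono; simp)+
    then show ?thesis by (simp add: U_def field_simps)
  qed
  have Uends: "U (- 1) = a" "U 1 = b" by (simp_all add: U_def field_simps)
  have Uinj: "inj U" using ab by (intro injI) (simp add: U_def)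
  have Uimg: "U ` {-1..1} = {a..b}"
  proof
    show "{a..b} \<subseteq> U ` {-1..1}"
    proof
      fix u assume u: "u \<in> {a..b}"
      define s where "s = (u - (a + b) / 2) / ((b - a) / 2)"
      have ne: "(b - a) / 2 \<noteq> 0" using ab by simp
      have "x * (y / x) = y" if "x \<noteq> 0" for x y :: real using that by simp
      from this[OF ne] have "(b - a) / 2 * s = u - (a + b) / 2" unfolding s_def .
      then have "U s = u" unfolding U_def by linarith
      moreover have "s \<in> {-1..1}" using u ab by (auto simp: s_def field_simps)
      ultimately show "u \<in> U ` {-1..1}" by blast
    qed
  qed (use Uab in blast)
  define S where "S = U -` I"
  have S: "open S" unfolding S_def U_def[abs_def] by (intro open_vimage I continuous_intros)
  have sub: "{-1..1} \<subseteq> S" using Uab in\<omega> by (auto simp: S_def I_iff)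
  have sU: "smooth_on S U" unfolding U_def[abs_def] by (intro smooth_intros S)
  have compU: "smooth_on S (\<lambda>s. h (U s))" if "smooth_on I h" for h :: "real \<Rightarrow> real"
    by (rule smooth_on_compose[OF that S I sU]) (simp add: S_def)
  define \<gamma> where "\<gamma> s = ch \<sigma> (U s) (Y (U s))" for s
  have \<gamma>_eq: "\<gamma> = (\<lambda>s. pt (X (U s)) (ang (X (U s)) (Z (U s))))"
    by (rule ext) (simp add: \<gamma>_def ch_def X_def Z_def)
  have n\<gamma>: "norm (\<gamma> s) = rad (U s) (Y (U s))" for s unfolding \<gamma>_def by (rule norm_ch[OF \<sigma>(1)])
  have n_eq: "rad u (Y u) = r" if "g u = r\<^sup>2" for u
    using radg[of u] that r(1) rad_nonneg[of u "Y u"] by (metis less_imp_le power2_eq_imp_eq)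
  have bp: "branch_param r \<gamma>"
    unfolding branch_param_def
  proof (intro conjI exI[of _ S] ballI)
    show "smooth_on S \<gamma>" unfolding \<gamma>_eq by (intro smooth_on_pol S compU sX sang)
    show "vector_derivative \<gamma> (at s) \<noteq> 0" if s: "s \<in> {-1..1}" for s
    proof
      assume z: "vector_derivative \<gamma> (at s) = 0"
      have sS: "s \<in> S" and UI: "U s \<in> I" using sub s by (auto simp: S_def)
      obtain X' where X': "((\<lambda>s. X (U s)) has_real_derivative X') (at s)"
        using smooth_on_real_deriv_ex[OF compU[OF sX] sS] by blast
      obtain Z' where Z': "((\<lambda>s. Z (U s)) has_real_derivative Z') (at s)"
        using smooth_on_real_deriv_ex[OF compU[OF sZ] sS] by blast
      have XU: "X (U s) \<in> {-R<..<R}" by (rule abs_less_mem[OF XR[OF UI]])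
      obtain m' where m': "(mid has_real_derivative m') (at (X (U s)))"
        using smooth_on_real_deriv_ex[OF smooth_mid XU] by blast
      obtain w' where w': "(wid has_real_derivative w') (at (X (U s)))"
        using smooth_on_real_deriv_ex[OF smooth_wid XU] by blast
      have dm: "((\<lambda>s. mid (X (U s))) has_real_derivative m' * X') (at s)"
        by (rule DERIV_chain2[where f=mid and g="\<lambda>s. X (U s)", OF m' X'])
      have dw: "((\<lambda>s. wid (X (U s))) has_real_derivative w' * X') (at s)"
        by (rule DERIV_chain2[where f=wid and g="\<lambda>s. X (U s)", OF w' X'])
      have da: "((\<lambda>s. ang (X (U s)) (Z (U s))) has_real_derivative
          m' * X' + (Z' * wid (X (U s)) + w' * X' * Z (U s))) (at s)"
        unfolding ang_def by (intro DERIV_add DERIV_mult dm dw Z')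
      note pz = pol_velocity_zero[OF X' da z[unfolded \<gamma>_eq]]
      have "X (U s) \<noteq> 0" using \<sigma>(1) rad_pos_v[OF Ypos[OF UI], of "U s"] by (auto simp: X_def)
      then have "Z' * wid (X (U s)) = 0" using pz by simp
      then have Z0: "Z' = 0" using wid_pos[OF XR[OF UI]] by simp
      have ss: "\<sigma> * \<sigma> = 1" using \<sigma>(1) by (metis abs_mult_self_eq mult_1)
      have "U = (\<lambda>s. \<sigma> * (X (U s) * sin (Z (U s))))"
      proof
        fix s
        have "\<sigma> * (X (U s) * sin (Z (U s))) = (\<sigma> * \<sigma>) * (rad (U s) (Y (U s)) * sin (chi (U s) (Y (U s))))"
          by (simp only: X_def Z_def mult_ac)
        then show "U s = \<sigma> * (X (U s) * sin (Z (U s)))" unfolding ss rad_sin_chi by simp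
      qed
      moreover have "((\<lambda>s. \<sigma> * (X (U s) * sin (Z (U s)))) has_real_derivative
          \<sigma> * (X' * sin (Z (U s)) + (cos (Z (U s)) * Z') * X (U s))) (at s)"
        by (intro DERIV_cmult DERIV_mult X' DERIV_chain2[where f=sin and g="\<lambda>s. Z (U s)", OF DERIV_sin Z'])
      ultimately have "(U has_real_derivative \<sigma> * (X' * sin (Z (U s)) + (cos (Z (U s)) * Z') * X (U s))) (at s)" by simp
      moreover have "(U has_real_derivative (b - a) / 2) (at s)"
        unfolding U_def[abs_def] by (auto intro!: derivative_eq_intros)
      ultimately have "\<sigma> * (X' * sin (Z (U s)) + (cos (Z (U s)) * Z') * X (U s)) = (b - a) / 2" by (rule DERIV_unique)
      then show False using pz(1) Z0 ab by simp
    qed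
    show "inj_on \<gamma> {-1..1}"
    proof (rule inj_onI)
      fix s s' assume s: "s \<in> {-1..1}" "s' \<in> {-1..1}" and "\<gamma> s = \<gamma> s'"
      then have "ch \<sigma> (U s) (Y (U s)) = ch \<sigma> (U s') (Y (U s'))" by (simp add: \<gamma>_def)
      moreover have "rad (U s) (Y (U s)) < R" using gR[OF in\<omega>[OF Uab[OF s(1)]]] rho(2) by simp
      ultimately have "U s = U s'" by (rule ch_inj[OF \<sigma>(1)])
      then show "s = s'" using Uinj by (simp add: inj_eq)
    qed
    show "norm (\<gamma> (- 1)) = r" "norm (\<gamma> 1) = r" unfolding n\<gamma> Uends by (rule n_eq[OF ab(5)], rule n_eq[OF ab(6)])
    show "norm (\<gamma> s) < r" if "s \<in> {-1<..<1}" for s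
    proof -
      have "\<bar>U s\<bar> < \<omega>" using Uab[of s] that by (intro in\<omega>) auto
      then have "g (U s) < r\<^sup>2" using g_less Uab'[OF that] by blast
      then have "(rad (U s) (Y (U s)))\<^sup>2 < r\<^sup>2" by (simp only: radg)
      then show ?thesis unfolding n\<gamma> by (rule power_less_imp_less_base) (use r in simp)
    qed
  qed (use sub S in simp_all)
  have img: "\<gamma> ` {-1..1} = (\<lambda>u. ch \<sigma> u (Y u)) ` {a..b}"
    unfolding Uimg[symmetric] image_image \<gamma>_def ..
  have root_iff: "x * A (x, \<phi>) + t * B (x, \<phi>, t) = 0 \<longleftrightarrow> \<bar>x\<bar> * (A (x, \<phi>) / B (x, \<phi>, t)) = \<bar>t\<bar>"
    if "x = \<sigma> * \<bar>x\<bar>" "B (x, \<phi>, t) > 0" for x \<phi>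
  proof -
    have tt: "t = - \<sigma> * \<bar>t\<bar>"
    proof -
      have "\<sigma> * \<sigma> = 1" using \<sigma>(1) by (metis abs_mult_self_eq mult_1)
      then have "t = \<sigma> * (\<sigma> * t)" by (simp add: mult.assoc[symmetric])
      then show ?thesis unfolding \<sigma>(2) by simp
    qed
    have "x * A (x, \<phi>) + t * B (x, \<phi>, t) = \<sigma> * \<bar>x\<bar> * A (x, \<phi>) + (- \<sigma> * \<bar>t\<bar>) * B (x, \<phi>, t)"
      using that(1) tt by metis
    also have "\<dots> = \<sigma> * (\<bar>x\<bar> * A (x, \<phi>) - \<bar>t\<bar> * B (x, \<phi>, t))" by (simp add: algebra_simps)
    finally have "x * A (x, \<phi>) + t * B (x, \<phi>, t) = 0 \<longleftrightarrow> \<bar>x\<bar> * A (x, \<phi>) = \<bar>t\<bar> * B (x, \<phi>, t)"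
      using \<sigma>(1) by auto
    also have "\<dots> \<longleftrightarrow> \<bar>x\<bar> * A (x, \<phi>) / B (x, \<phi>, t) = \<bar>t\<bar>" using that(2) by (simp add: divide_eq_eq)
    finally show ?thesis by simp
  qed
  have tau': "\<bar>t\<bar> < \<tau>" using t(1) tau1 by simp
  have Barc_img: "(\<lambda>u. ch \<sigma> u (Y u)) ` {a..b} = Barc r t"
  proof
    show "(\<lambda>u. ch \<sigma> u (Y u)) ` {a..b} \<subseteq> Barc r t"
    proof
      fix p assume "p \<in> (\<lambda>u. ch \<sigma> u (Y u)) ` {a..b}"
      then obtain u where u: "u \<in> {a..b}" "p = ch \<sigma> u (Y u)" by blast
      have u\<omega>: "\<bar>u\<bar> < \<omega>" by (rule in\<omega>[OF u(1)])
      have uI: "u \<in> I" using u\<omega> by (simp add: I_iff)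
      have rp: "rad u (Y u) > 0" by (rule rad_pos_v[OF Ypos[OF uI]])
      have ax: "\<bar>X u\<bar> = rad u (Y u)" unfolding X_def by (rule abs_sig[OF \<sigma>(1)])
      have an: "th 0 (X u) < ang (X u) (Z u)" "ang (X u) (Z u) < th 1 (X u)"
        using ang_less[OF XR[OF uI] chi_less[OF Ypos[OF uI], of u]] by (simp_all add: Z_def)
      have Bp: "B (X u, ang (X u) (Z u), t) > 0" by (rule B_0[OF XR[OF uI] tau']) (use an in simp_all)
      have xs: "X u = \<sigma> * \<bar>X u\<bar>" unfolding ax by (rule X_def)
      have "q \<sigma> t u (Y u) = \<bar>t\<bar>" using Y(2)[OF u\<omega>] by blast
      then have "\<bar>X u\<bar> * (A (X u, ang (X u) (Z u)) / B (X u, ang (X u) (Z u), t)) = \<bar>t\<bar>"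
        unfolding ax by (simp add: q_def quo_def X_def Z_def)
      then have eq: "X u * A (X u, ang (X u) (Z u)) + t * B (X u, ang (X u) (Z u), t) = 0"
        using root_iff[OF xs Bp] by blast
      have "g u \<le> r\<^sup>2" using g_le[OF u\<omega>] u(1) by simp
      then have "\<bar>X u\<bar> \<le> r" unfolding ax using r(1) by (simp add: rad_le_iff g_def)
      moreover have "p = pt (X u) (ang (X u) (Z u))" by (simp add: u(2) ch_def X_def Z_def)
      moreover have "X u \<noteq> 0" using rp ax by auto
      ultimately show "p \<in> Barc r t" unfolding Barc_def using an eq by blast
    qed
    show "Barc r t \<subseteq> (\<lambda>u. ch \<sigma> u (Y u)) ` {a..b}"
    proof
      fix p assume "p \<in> Barc r t"
      then obtain x \<phi> where x: "p = pt x \<phi>" "x \<noteq> 0" "\<bar>x\<bar> \<le> r" "th 0 x < \<phi>" "\<phi> < th 1 x"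
        "x * A (x, \<phi>) + t * B (x, \<phi>, t) = 0" unfolding Barc_def by blast
      have r\<rho>: "r < \<rho>"
      proof -
        have "r\<^sup>2 \<le> \<omega>\<^sup>2" using r by (intro power_mono) auto
        then have "r\<^sup>2 < \<rho>\<^sup>2" using small(1) zero_le_power2[of w] by linarith
        then show ?thesis by (rule power_less_imp_less_base) (use rho in simp)
      qed
      have xR: "\<bar>x\<bar> < R" using x(3) r\<rho> rho(2) by linarith
      have Bp: "B (x, \<phi>, t) > 0" by (rule B_0[OF xR tau']) (use x in simp_all)
      have Ap: "A (x, \<phi>) > 0" by (rule A_signs(1)[OF xR x(4,5)])
      have xs: "x = \<sigma> * \<bar>x\<bar>"
      proof -
        have "x * A (x, \<phi>) * \<sigma> = (- (\<sigma> * t)) * B (x, \<phi>, t)" using x(6) by (simp add: add_eq_0_iff algebra_simps)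
        also have "\<dots> > 0" using \<sigma>(2) Bp t(2) by simp
        finally have "A (x, \<phi>) * (x * \<sigma>) > 0" by (simp only: mult_ac)
        then have "x * \<sigma> > 0" using Ap by (rule zero_less_mult_pos)
        moreover have "\<sigma> = 1 \<or> \<sigma> = - 1" using \<sigma>(1) by (auto simp: abs_eq_iff)
        ultimately show ?thesis by auto
      qed
      define \<psi> where "\<psi> = (\<phi> - mid x) / wid x"
      have wp: "wid x > 0" by (rule wid_pos[OF xR])
      have ang\<psi>: "ang x \<psi> = \<phi>" using wp by (simp add: ang_def \<psi>_def)
      have \<psi>: "\<bar>\<psi>\<bar> < pi / 2"
      proof -
        have "(\<psi> + pi / 2) * wid x > 0" "(pi / 2 - \<psi>) * wid x > 0"
          using ang_diff[of x \<psi>] x(4,5) unfolding ang\<psi> by linarith+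
        then have "\<psi> + pi / 2 > 0" "pi / 2 - \<psi> > 0" using wp by (simp_all add: zero_less_mult_iff)
        then show ?thesis by linarith
      qed
      define u where "u = \<bar>x\<bar> * sin \<psi>"
      define v where "v = \<bar>x\<bar> * cos \<psi>"
      have ax: "\<bar>x\<bar> > 0" using x(2) by simp
      have rc: "rad u v = \<bar>x\<bar>" "chi u v = \<psi>" unfolding u_def v_def by (rule chi_polar[OF ax \<psi>])+
      have cp: "cos \<psi> > 0" using \<psi> by (intro cos_gt_zero_pi) linarith+
      have v0: "v > 0" unfolding v_def by (rule mult_pos_pos[OF ax cp])
      have u\<omega>: "\<bar>u\<bar> < \<omega>" using abs_le_rad(1)[of u v] rc(1) x(3) r(2) by linarith
      have uv: "u\<^sup>2 + v\<^sup>2 = \<bar>x\<bar>\<^sup>2" using rad_sq[of u v] unfolding rc by simp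
      have "\<bar>x\<bar>\<^sup>2 \<le> r\<^sup>2" using x(3) by (intro power_mono) auto
      moreover have "r\<^sup>2 < \<rho>\<^sup>2" using r\<rho> r(1) by (intro power_strict_mono) auto
      ultimately have lt: "u\<^sup>2 + v\<^sup>2 < \<rho>\<^sup>2" unfolding uv by linarith
      have "q \<sigma> t u v = \<bar>x\<bar> * (A (x, \<phi>) / B (x, \<phi>, t))"
        using xs[symmetric] by (simp add: q_def quo_def rc ang\<psi>)
      also have "\<dots> = \<bar>t\<bar>" using root_iff[OF xs Bp] x(6) by blast
      finally have vY: "v = Y u" by (rule Y(3)[OF u\<omega> v0 lt])
      have "g u \<le> r\<^sup>2" using \<open>\<bar>x\<bar>\<^sup>2 \<le> r\<^sup>2\<close> uv vY by (simp add: g_def)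
      then have "u \<in> {a..b}" using g_le[OF u\<omega>] by simp
      moreover have "p = ch \<sigma> u (Y u)" unfolding vY[symmetric] ch_def rc xs[symmetric] ang\<psi> by (rule x(1))
      ultimately show "p \<in> (\<lambda>u. ch \<sigma> u (Y u)) ` {a..b}" by blast
    qed
  qed
  have sb: "smooth_branch r (Barc r t)"
    unfolding smooth_branch_def by (rule exI[of _ \<gamma>], rule conjI[OF bp]) (simp only: img Barc_img)
  have cY: "continuous_on {a..b} Y"
    by (rule continuous_on_subset[OF smooth_on_continuous[OF sY]], rule subsetI, simp only: I_iff in\<omega>)
  have pY: "0 < Y u \<and> Y u \<le> w \<and> rad u (Y u) < R" if "u \<in> {a..b}" for u
    using Y(2)[OF in\<omega>[OF that]] gR[OF in\<omega>[OF that]] rho(2) by simp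
  show ?thesis by (rule that[OF ab(1-4) ea eb cY pY sb Barc_img])
qed

end

context umbilic_all
begin

text \<open>The boundary line of the half-plane, that is, the two half-branches which bound the sector.\<close>

definition edges :: "real \<Rightarrow> real \<Rightarrow> (real \<times> real) set" where
  "edges \<sigma> r = (\<lambda>u. ch \<sigma> u 0) ` {-r..r}"

text \<open>The homeomorphism moves points along the curve by at most \<open>w\<close> in the coordinate \<open>u\<close> and across
  it by at most \<open>w\<close> in the coordinate \<open>v\<close>; the chart is uniformly continuous.\<close>

lemma arc_C0_close:
  assumes \<sigma>: "\<bar>\<sigma>\<bar> = 1" and r: "0 < r"
    and ab: "- r \<le> a" "a < 0" "0 < b" "b \<le> r" "a + r \<le> w" "r - b \<le> w"
    and Y: "continuous_on {a..b} Y" "\<And>u. u \<in> {a..b} \<Longrightarrow> 0 < Y u \<and> Y u \<le> w \<and> rad u (Y u) < R"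
    and rR: "r < R"
    and uc: "\<And>u v u'. u' \<in> {-r..r} \<Longrightarrow> u \<in> {-r..r} \<Longrightarrow> 0 \<le> v \<Longrightarrow> v \<le> w \<Longrightarrow> \<bar>u - u'\<bar> \<le> w \<Longrightarrow>
      dist (ch \<sigma> u v) (ch \<sigma> u' 0) < e"
  shows "C0_close e (edges \<sigma> r) ((\<lambda>u. ch \<sigma> u (Y u)) ` {a..b})"
proof -
  \<comment> \<open>the affine map of \<open>{- r..r}\<close> onto \<open>{a..b}\<close>, which matches the end points of the two curves\<close>
  define U where "U u = (a + b) / 2 + (b - a) / (2 * r) * u" for u
  have U_alt: "U u - u = (a + b) / 2 - (2 * r - (b - a)) / (2 * r) * u" for u
    using r by (simp add: U_def field_simps)
  have Uends: "U (- r) = a" "U r = b" using r by (simp_all add: U_def field_simps)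
  have slope: "(b - a) / (2 * r) > 0" using ab r by simp
  have Umono: "U u \<le> U u'" if "u \<le> u'" for u u'
    using mult_left_mono[OF that less_imp_le[OF slope]] by (simp add: U_def)
  have Uab: "U u \<in> {a..b}" if "u \<in> {-r..r}" for u
    using Umono[of "- r" u] Umono[of u r] that unfolding Uends by simp
  have Uinj: "inj U" using slope ab by (intro injI) (simp add: U_def)
  have Uimg: "U ` {-r..r} = {a..b}"
  proof
    show "{a..b} \<subseteq> U ` {-r..r}"
    proof
      fix y assume y: "y \<in> {a..b}"
      have "continuous_on {-r..r} U" unfolding U_def[abs_def] by (intro continuous_intros)
      then have "\<exists>u\<ge>- r. u \<le> r \<and> U u = y" using y r by (intro IVT') (simp_all add: Uends)
      then show "y \<in> U ` {-r..r}" by auto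
    qed
  qed (use Uab in blast)
  have Uclose: "\<bar>U u - u\<bar> \<le> w" if "u \<in> {-r..r}" for u
  proof -
    define k where "k = (2 * r - (b - a)) / (2 * r)"
    have k0: "k \<ge> 0" using ab r by (simp add: k_def)
    have kr: "k * r = (2 * r - (b - a)) / 2" using r by (simp add: k_def)
    have "k * u \<le> k * r" "k * (- r) \<le> k * u" using that k0 by (intro mult_left_mono; simp)+
    then have "k * u \<le> (2 * r - (b - a)) / 2" "- ((2 * r - (b - a)) / 2) \<le> k * u" using kr by simp_all
    then show ?thesis using ab(5,6) unfolding U_alt k_def[symmetric] by argo
  qed
  define p0 where "p0 u = ch \<sigma> u 0" for u
  define p1 where "p1 u = ch \<sigma> (U u) (Y (U u))" for u
  have radr: "rad u 0 < R" if "u \<in> {-r..r}" for u using that rR by (auto simp: rad_u0 abs_less_iff)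
  have in_S: "0 \<le> v \<and> u\<^sup>2 + v\<^sup>2 < R\<^sup>2" if "0 \<le> v" "rad u v < R" for u v
    using that R(1) by (simp add: rad_less_iff)
  have c0: "continuous_on {-r..r} p0"
    unfolding p0_def
    using continuous_on_compose2[OF ch_cont[OF \<sigma>], of "{-r..r}" "\<lambda>u. (u, 0)"] in_S[OF order_refl radr]
    by (auto simp: continuous_on_Pair continuous_on_const continuous_on_id image_subset_iff)
  have cU: "continuous_on {-r..r} U" unfolding U_def[abs_def] by (intro continuous_intros)
  have cYU: "continuous_on {-r..r} (\<lambda>u. Y (U u))"
    by (rule continuous_on_compose2[OF Y(1) cU]) (use Uab in blast)
  have c1: "continuous_on {-r..r} p1"
    unfolding p1_def
  proof -
    have sub: "(\<lambda>u. (U u, Y (U u))) ` {-r..r} \<subseteq> {p. 0 \<le> snd p \<and> (fst p)\<^sup>2 + (snd p)\<^sup>2 < R\<^sup>2}"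
    proof (rule image_subsetI)
      fix u assume u: "u \<in> {-r..r}"
      have "0 < Y (U u)" "rad (U u) (Y (U u)) < R" using Y(2)[OF Uab[OF u]] by simp_all
      from in_S[OF less_imp_le[OF this(1)] this(2)]
      show "(U u, Y (U u)) \<in> {p. 0 \<le> snd p \<and> (fst p)\<^sup>2 + (snd p)\<^sup>2 < R\<^sup>2}" by simp
    qed
    show "continuous_on {-r..r} (\<lambda>u. ch \<sigma> (U u) (Y (U u)))"
      using continuous_on_compose2[OF ch_cont[OF \<sigma>] continuous_on_Pair[OF cU cYU] sub] by simp
  qed
  have i0: "inj_on p0 {-r..r}"
    by (rule inj_onI) (use ch_inj[OF \<sigma> _ radr] in \<open>auto simp: p0_def\<close>)
  have i1: "inj_on p1 {-r..r}"
  proof (rule inj_onI)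
    fix u u' assume u: "u \<in> {-r..r}" "u' \<in> {-r..r}" "p1 u = p1 u'"
    have "U u = U u'" by (rule ch_inj[OF \<sigma> u(3)[unfolded p1_def]]) (use Y(2)[OF Uab[OF u(1)]] in blast)
    then show "u = u'" using Uinj by (simp add: inj_eq)
  qed
  have im0: "p0 ` {-r..r} = edges \<sigma> r" unfolding edges_def p0_def ..
  have im1: "p1 ` {-r..r} = (\<lambda>u. ch \<sigma> u (Y u)) ` {a..b}" unfolding Uimg[symmetric] image_image p1_def ..
  obtain g0 where g0: "homeomorphism {-r..r} (edges \<sigma> r) p0 g0"
    using homeomorphism_compact[OF compact_Icc c0 im0 i0] by blast
  obtain g1 where g1: "homeomorphism {-r..r} ((\<lambda>u. ch \<sigma> u (Y u)) ` {a..b}) p1 g1"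
    using homeomorphism_compact[OF compact_Icc c1 im1 i1] by blast
  have "homeomorphism (edges \<sigma> r) ((\<lambda>u. ch \<sigma> u (Y u)) ` {a..b}) (p1 \<circ> g0) (p0 \<circ> g1)"
    by (rule homeomorphism_compose[OF homeomorphism_symD[OF g0] g1])
  moreover have "dist ((p1 \<circ> g0) p) p < e" if "p \<in> edges \<sigma> r" for p
  proof -
    define u where "u = g0 p"
    have "g0 ` edges \<sigma> r = {-r..r}" "\<forall>y\<in>edges \<sigma> r. p0 (g0 y) = y" using g0 by (auto simp: homeomorphism_def)
    then have u: "u \<in> {-r..r}" "p0 u = p" using that unfolding u_def by blast+
    have "U u \<in> {-r..r}" using Uab[OF u(1)] ab by auto
    moreover have "0 \<le> Y (U u)" "Y (U u) \<le> w" using Y(2)[OF Uab[OF u(1)]] by simp_all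
    ultimately have "dist (ch \<sigma> (U u) (Y (U u))) (ch \<sigma> u 0) < e" by (rule uc[OF u(1) _ _ _ Uclose[OF u(1)]])
    then show ?thesis using u(2) by (simp add: u_def[symmetric] p1_def p0_def)
  qed
  ultimately show ?thesis unfolding C0_close_def by blast
qed

lemma eventually_small:
  fixes f :: "real \<Rightarrow> real"
  assumes "isCont f 0" "f 0 < c"
  shows "\<exists>d>0. \<forall>w. 0 < w \<longrightarrow> w < d \<longrightarrow> f w < c"
proof -
  have "(f \<longlongrightarrow> f 0) (at 0)" using assms(1) by (simp add: isCont_def)
  then have "\<forall>\<^sub>F w in at 0. f w < c" using assms(2) by (rule order_tendstoD)
  then obtain d where d: "d > 0" "\<And>w. w \<noteq> 0 \<Longrightarrow> dist w 0 < d \<Longrightarrow> f w < c" unfolding eventually_at by blast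
  have "f w < c" if "0 < w" "w < d" for w
  proof (rule d(2))
    show "w \<noteq> 0" "dist w 0 < d" using that by (simp_all add: dist_real_def)
  qed
  then show ?thesis using d(1) by blast
qed

text \<open>The branch lies in the sector with sign \<open>\<sigma>\<close> opposite to that of \<open>t\<close>, at height at most \<open>\<bar>t\<bar> / c1\<close> above the
  edges. All smallness conditions on \<open>t\<close> are conditions on this height.\<close>

lemma nonorigin_deform:
  assumes \<sigma>: "\<bar>\<sigma>\<bar> = 1" and r: "0 < r" "r < \<rho>" and e: "e > 0"
  shows "\<exists>\<delta>>0. \<forall>t. t \<noteq> 0 \<longrightarrow> \<bar>t\<bar> < \<delta> \<longrightarrow> \<sigma> * t = - \<bar>t\<bar> \<longrightarrow>
    nonorigin_branch r (V t) (Barc r t) \<and> C0_close e (edges \<sigma> r) (Barc r t)"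
proof -
  define \<omega> where "\<omega> = (r + \<rho>) / 2"
  have \<omega>: "r < \<omega>" "\<omega> < \<rho>" "0 < \<omega>" using r by (auto simp: \<omega>_def)
  have \<omega>2: "\<omega>\<^sup>2 < \<rho>\<^sup>2" using \<omega> by (intro power_strict_mono) auto
  have rR: "r < R" using r rho by simp
  obtain d1 where d1: "d1 > 0" "\<And>w. 0 < w \<Longrightarrow> w < d1 \<Longrightarrow> \<omega>\<^sup>2 + w\<^sup>2 < \<rho>\<^sup>2"
    using eventually_small[of "\<lambda>w. \<omega>\<^sup>2 + w\<^sup>2" "\<rho>\<^sup>2"] \<omega>2 by auto
  have cc: "isCont (\<lambda>w. C1 / c1 * w) 0" by (intro continuous_intros)
  have cc3: "isCont (\<lambda>w. (C1 / c1 * w)\<^sup>2 + w\<^sup>2) 0" by (intro continuous_intros)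
  have z2: "C1 / c1 * 0 < \<omega>" and z3: "(C1 / c1 * 0)\<^sup>2 + 0\<^sup>2 < r\<^sup>2" using \<omega>(3) r(1) by simp_all
  obtain d2 where d2: "d2 > 0" "\<And>w. 0 < w \<Longrightarrow> w < d2 \<Longrightarrow> C1 / c1 * w < \<omega>"
    using eventually_small[OF cc z2] by meson
  obtain d3 where d3: "d3 > 0" "\<And>w. 0 < w \<Longrightarrow> w < d3 \<Longrightarrow> (C1 / c1 * w)\<^sup>2 + w\<^sup>2 < r\<^sup>2"
    using eventually_small[OF cc3 z3] by meson
  define K where "K = {-r..r} \<times> {0..d1 / 2}"
  have "compact K" unfolding K_def by (intro compact_Times compact_Icc)
  moreover have "continuous_on K (\<lambda>p. ch \<sigma> (fst p) (snd p))"
  proof (rule continuous_on_subset[OF ch_cont[OF \<sigma>]], rule subsetI)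
    fix p assume p: "p \<in> K"
    have "\<bar>fst p\<bar> \<le> \<omega>" using p \<omega> by (auto simp: K_def)
    then have "(fst p)\<^sup>2 \<le> \<omega>\<^sup>2" using \<omega>(3) by (simp add: abs_le_square_iff[symmetric])
    moreover have "(snd p)\<^sup>2 \<le> (d1 / 2)\<^sup>2" using p by (intro power_mono) (auto simp: K_def)
    moreover have "\<omega>\<^sup>2 + (d1 / 2)\<^sup>2 < \<rho>\<^sup>2" using d1(1) by (intro d1(2)) auto
    moreover have "\<rho>\<^sup>2 \<le> R\<^sup>2" using rho by (intro power_mono) auto
    ultimately have "(fst p)\<^sup>2 + (snd p)\<^sup>2 < R\<^sup>2" by linarith
    then show "p \<in> {p. 0 \<le> snd p \<and> (fst p)\<^sup>2 + (snd p)\<^sup>2 < R\<^sup>2}" using p by (auto simp: K_def)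
  qed
  ultimately have "uniformly_continuous_on K (\<lambda>p. ch \<sigma> (fst p) (snd p))"
    by (intro compact_uniformly_continuous)
  then obtain d4 where d4: "d4 > 0" "\<And>p p'. p \<in> K \<Longrightarrow> p' \<in> K \<Longrightarrow> dist p' p < d4 \<Longrightarrow>
      dist (ch \<sigma> (fst p') (snd p')) (ch \<sigma> (fst p) (snd p)) < e"
    using e unfolding uniformly_continuous_on_def by metis
  define \<eta> where "\<eta> = min (d1 / 2) (min d2 (min d3 (d4 / 2)))"
  define \<delta> where "\<delta> = min \<tau>1 (c1 * \<eta>)"
  have \<eta>: "\<eta> > 0" using d1 d2 d3 d4 by (simp add: \<eta>_def)
  have \<delta>0: "\<delta> > 0" using tau1 c1 \<eta> by (simp add: \<delta>_def)
  have "nonorigin_branch r (V t) (Barc r t) \<and> C0_close e (edges \<sigma> r) (Barc r t)"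
    if t: "t \<noteq> 0" "\<bar>t\<bar> < \<delta>" "\<sigma> * t = - \<bar>t\<bar>" for t
  proof -
    define w where "w = \<bar>t\<bar> / c1"
    have w0: "w > 0" using t(1) c1 by (simp add: w_def)
    have "\<bar>t\<bar> < c1 * \<eta>" using t(2) by (simp add: \<delta>_def)
    then have w\<eta>: "w < \<eta>" using c1 by (simp add: w_def pos_divide_less_eq mult.commute)
    have wd: "w < d1 / 2" "w < d1" "w < d2" "w < d3" "w < d4 / 2" using w\<eta> d1(1) by (auto simp: \<eta>_def)
    have t1: "\<bar>t\<bar> < \<tau>1" using t(2) by (simp add: \<delta>_def)
    have tt: "\<bar>t\<bar> < \<tau>" using t1 tau1 by simp
    obtain a b Y where ab: "- r \<le> a" "a < 0" "0 < b" "b \<le> r" "a + r \<le> w" "r - b \<le> w"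
      and Y: "continuous_on {a..b} Y" "\<And>u. u \<in> {a..b} \<Longrightarrow> 0 < Y u \<and> Y u \<le> w \<and> rad u (Y u) < R"
      and sb: "smooth_branch r (Barc r t)" and im: "(\<lambda>u. ch \<sigma> u (Y u)) ` {a..b} = Barc r t"
      by (rule arc_ex[OF \<sigma> t(3) t1 t(1) w_def r(1) \<omega>(1) d1(2)[OF w0 wd(2)] d2(2)[OF w0 wd(3)] d3(2)[OF w0 wd(4)]]) blast
    have uc: "dist (ch \<sigma> u v) (ch \<sigma> u' 0) < e"
      if "u' \<in> {-r..r}" "u \<in> {-r..r}" "0 \<le> v" "v \<le> w" "\<bar>u - u'\<bar> \<le> w" for u v u'
    proof -
      have "dist (u, v) (u', 0) \<le> \<bar>u - u'\<bar> + \<bar>v\<bar>"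
        using norm_Pair_le[of "u - u'" "v - 0"] by (simp add: dist_norm)
      also have "\<dots> < d4" using that wd(5) by linarith
      finally have "dist (u, v) (u', 0) < d4" .
      moreover have "(u, v) \<in> K" "(u', 0) \<in> K" using that wd(1) d1(1) by (auto simp: K_def)
      ultimately show ?thesis using d4(2)[of "(u', 0)" "(u, v)"] by simp
    qed
    have "C0_close e (edges \<sigma> r) ((\<lambda>u. ch \<sigma> u (Y u)) ` {a..b})"
      by (rule arc_C0_close[OF \<sigma> r(1) ab Y rR uc])
    then show ?thesis using Barc_nonorigin[OF r(1) rR tt t(1) sb] im by simp
  qed
  then show ?thesis using \<delta>0 by blast
qed

lemma edges_half:
  assumes "r > 0"
  shows "edges 1 r = half_pos (gam r 0) \<union> half_pos (gam r 1)" "edges (- 1) r = half_neg (gam r 0) \<union> half_neg (gam r 1)"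
proof -
  have split: "{-r..r} = (\<lambda>s. - (r * s)) ` {0..1} \<union> (\<lambda>s. r * s) ` {0..1}"
  proof -
    have 1: "(\<lambda>s. r * s) ` {0..1} = {0..r}" using assms image_mult_atLeastAtMost[of r 0 1] by simp
    have "(\<lambda>s. - (r * s)) ` {0..1} = uminus ` ((\<lambda>s. r * s) ` {0..1})" by (simp add: image_image)
    also have "\<dots> = {-r..0}" unfolding 1 by simp
    finally show ?thesis unfolding 1 using assms by auto
  qed
  have im: "edges \<sigma> r = (\<lambda>s. pt (\<sigma> * (r * s)) (th 0 (\<sigma> * (r * s)))) ` {0..1} \<union> (\<lambda>s. pt (\<sigma> * (r * s)) (th 1 (\<sigma> * (r * s)))) ` {0..1}" for \<sigma>
    unfolding edges_def split image_Un image_image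
    using assms by (intro arg_cong2[where f="(\<union>)"] image_cong refl) (simp_all add: ch_edge)
  have hn: "half_neg (gam r j) = (\<lambda>s. pt (- 1 * (r * s)) (th j (- 1 * (r * s)))) ` {0..1}" for j
  proof -
    have eq: "{-1..0::real} = uminus ` {0..1}" by simp
    show ?thesis unfolding half_neg_def gam_def[abs_def] eq image_image by simp
  qed
  show "edges 1 r = half_pos (gam r 0) \<union> half_pos (gam r 1)"
    unfolding im half_pos_def gam_def[abs_def] by simp
  show "edges (- 1) r = half_neg (gam r 0) \<union> half_neg (gam r 1)"
    unfolding im hn ..
qed

lemma deforms_canonical:
  assumes r: "0 < r" "r < \<rho>"
  shows "\<forall>e>0. \<forall>\<^sub>F t in at_left 0. nonorigin_branch r (V t) (Barc r t) \<and> C0_close e (edges 1 r) (Barc r t)"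
    "\<forall>e>0. \<forall>\<^sub>F t in at_right 0. nonorigin_branch r (V t) (Barc r t) \<and> C0_close e (edges (- 1) r) (Barc r t)"
proof -
  show "\<forall>e>0. \<forall>\<^sub>F t in at_left 0. nonorigin_branch r (V t) (Barc r t) \<and> C0_close e (edges 1 r) (Barc r t)"
  proof (intro allI impI)
    fix e :: real assume "e > 0"
    then obtain \<delta> where \<delta>: "\<delta> > 0" "\<forall>t. t \<noteq> 0 \<longrightarrow> \<bar>t\<bar> < \<delta> \<longrightarrow> 1 * t = - \<bar>t\<bar> \<longrightarrow>
      nonorigin_branch r (V t) (Barc r t) \<and> C0_close e (edges 1 r) (Barc r t)"
      using nonorigin_deform[of 1, OF _ r] by auto
    show "\<forall>\<^sub>F t in at_left 0. nonorigin_branch r (V t) (Barc r t) \<and> C0_close e (edges 1 r) (Barc r t)"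
      unfolding eventually_at by (rule exI[of _ \<delta>]) (use \<delta> in \<open>auto simp: dist_real_def\<close>)
  qed
  show "\<forall>e>0. \<forall>\<^sub>F t in at_right 0. nonorigin_branch r (V t) (Barc r t) \<and> C0_close e (edges (- 1) r) (Barc r t)"
  proof (intro allI impI)
    fix e :: real assume "e > 0"
    then obtain \<delta> where \<delta>: "\<delta> > 0" "\<forall>t. t \<noteq> 0 \<longrightarrow> \<bar>t\<bar> < \<delta> \<longrightarrow> - 1 * t = - \<bar>t\<bar> \<longrightarrow>
      nonorigin_branch r (V t) (Barc r t) \<and> C0_close e (edges (- 1) r) (Barc r t)"
      using nonorigin_deform[of "- 1", OF _ r] by auto
    show "\<forall>\<^sub>F t in at_right 0. nonorigin_branch r (V t) (Barc r t) \<and> C0_close e (edges (- 1) r) (Barc r t)"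
      unfolding eventually_at by (rule exI[of _ \<delta>]) (use \<delta> in \<open>auto simp: dist_real_def\<close>)
  qed
qed

end

section \<open>Identifying the branches\<close>

lemma branch_compact_connected:
  assumes "smooth_branch r B"
  shows "compact B" "connected B" "B \<noteq> {}"
proof -
  obtain \<gamma> where \<gamma>: "branch_param r \<gamma>" "B = \<gamma> ` {-1..1}" using assms by (auto simp: smooth_branch_def)
  obtain S where "{-1..1} \<subseteq> S" "smooth_on S \<gamma>" using \<gamma>(1) unfolding branch_param_def by blast
  then have c: "continuous_on {-1..1} \<gamma>" using smooth_on_continuous continuous_on_subset by blast
  show "compact B" unfolding \<gamma>(2) by (rule compact_continuous_image[OF c compact_Icc])
  show "connected B" unfolding \<gamma>(2) by (rule connected_continuous_image[OF c connected_Icc])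
  show "B \<noteq> {}" unfolding \<gamma>(2) by simp
qed

text \<open>In a decomposition of the set the two branches through the origin form a connected closed set
  disjoint from the third branch. The branches of another decomposition are connected, so those through the
  origin stay on one side and the remaining one on the other.\<close>

lemma nonorigin_branch_subset:
  assumes "nonorigin_branch r V B" "nonorigin_branch r V B'"
  shows "B' \<subseteq> B"
proof -
  obtain A1 A2 where A: "V \<inter> cball 0 r = A1 \<union> A2 \<union> B" "smooth_branch r A1" "smooth_branch r A2" "smooth_branch r B"
    "0 \<in> A1" "0 \<in> A2" "B \<inter> (A1 \<union> A2) = {}"
    using assms(1) unfolding nonorigin_branch_def by blast
  obtain A1' A2' where A': "V \<inter> cball 0 r = A1' \<union> A2' \<union> B'" "smooth_branch r A1'" "smooth_branch r A2'" "smooth_branch r B'"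
    "0 \<in> A1'" "0 \<in> A2'" "0 \<notin> B'"
    using assms(2) unfolding nonorigin_branch_def by blast
  note b = branch_compact_connected
  have cl: "closed (A1 \<union> A2)" "closed B"
    by (intro closed_Un compact_imp_closed b(1)[OF A(2)] b(1)[OF A(3)])
      (rule compact_imp_closed[OF b(1)[OF A(4)]])
  have split: "(A1 \<union> A2) \<inter> C = {} \<or> B \<inter> C = {}" if "connected C" "C \<subseteq> V \<inter> cball 0 r" for C
  proof (rule connected_closedD[OF that(1) _ _ cl])
    show "(A1 \<union> A2) \<inter> B \<inter> C = {}" using A(7) by blast
    show "C \<subseteq> (A1 \<union> A2) \<union> B" using that(2) A(1) by blast
  qed
  have "connected (A1' \<union> A2')"
    by (rule connected_Un[OF b(2)[OF A'(2)] b(2)[OF A'(3)]]) (use A'(5,6) in blast)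
  then have "B \<inter> (A1' \<union> A2') = {}" using split[of "A1' \<union> A2'"] A'(1,5) A(5) by blast
  moreover have "B \<noteq> {}" by (rule b(3)[OF A(4)])
  ultimately have "B \<inter> B' \<noteq> {}" using A(1) A'(1) by blast
  then have "(A1 \<union> A2) \<inter> B' = {}" using split[of B'] b(2)[OF A'(4)] A'(1) by blast
  then show ?thesis using A(1) A'(1) by blast
qed

lemma nonorigin_branch_unique: "nonorigin_branch r V B \<Longrightarrow> nonorigin_branch r V B' \<Longrightarrow> B = B'"
  by (intro equalityI nonorigin_branch_subset)

text \<open>Each point of \<open>\<Gamma>\<close> is close to a point of the approximating set, which is close to a point of \<open>\<Gamma>'\<close>.\<close>

lemma C0_close_limit:
  assumes "\<And>e. e > 0 \<Longrightarrow> \<exists>B. C0_close e \<Gamma> B \<and> C0_close e \<Gamma>' B" "closed \<Gamma>'"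
  shows "\<Gamma> \<subseteq> \<Gamma>'"
proof
  fix p assume p: "p \<in> \<Gamma>"
  have "\<exists>y\<in>\<Gamma>'. dist y p < e" if e: "e > 0" for e
  proof -
    obtain B where B: "C0_close (e / 2) \<Gamma> B" "C0_close (e / 2) \<Gamma>' B" using assms(1)[OF half_gt_zero[OF e]] by blast
    obtain h k where h: "homeomorphism \<Gamma> B h k" "\<forall>p\<in>\<Gamma>. dist (h p) p < e / 2" using B(1) unfolding C0_close_def by blast
    obtain h' k' where h': "homeomorphism \<Gamma>' B h' k'" "\<forall>p\<in>\<Gamma>'. dist (h' p) p < e / 2" using B(2) unfolding C0_close_def by blast
    have "h p \<in> B" using h(1) p unfolding homeomorphism_def by blast
    then obtain y where y: "y \<in> \<Gamma>'" "h' y = h p" using h'(1) unfolding homeomorphism_def by (metis imageE)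
    have "dist y p \<le> dist (h' y) y + dist (h p) p" unfolding y(2) by (rule dist_triangle3)
    also have "\<dots> < e / 2 + e / 2" using h(2) h'(2) y(1) p by (intro add_strict_mono) auto
    finally show ?thesis using y(1) by auto
  qed
  then have "p \<in> closure \<Gamma>'" unfolding closure_approachable by blast
  then show "p \<in> \<Gamma>'" using assms(2) by (simp add: closure_closed)
qed

context umbilic_all
begin

text \<open>The six half-branches of the unperturbed vertex set, numbered by the root \<open>j\<close> and the sign \<open>\<sigma>\<close> of the
  radius.\<close>

definition H :: "real \<Rightarrow> nat \<Rightarrow> real \<Rightarrow> (real \<times> real) set" where
  "H r j \<sigma> = (\<lambda>x. pt (\<sigma> * x) (th j (\<sigma> * x))) ` {0..r}"

lemma H_half: "r > 0 \<Longrightarrow> half_pos (gam r j) = H r j 1" "r > 0 \<Longrightarrow> half_neg (gam r j) = H r j (- 1)"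
proof -
  assume r: "r > 0"
  have 1: "{0..r} = (\<lambda>s. r * s) ` {0..1}" using r image_mult_atLeastAtMost[of r 0 1] by simp
  have 2: "{-1..0::real} = uminus ` {0..1}" by simp
  show "half_pos (gam r j) = H r j 1" unfolding half_pos_def H_def gam_def[abs_def] 1 by (simp add: image_image)
  show "half_neg (gam r j) = H r j (- 1)" unfolding half_neg_def H_def gam_def[abs_def] 1 2 image_image by simp
qed

lemma H_closed:
  assumes "0 < r" "r < R" "j < 3" "\<bar>\<sigma>\<bar> = 1"
  shows "closed (H r j \<sigma>)"
proof -
  have j: "j \<le> 3" using assms(3) by simp
  have "continuous_on {0..r} (\<lambda>x. th j (\<sigma> * x))"
  proof (rule continuous_on_compose2[OF cont_th[OF j]])
    show "(\<lambda>x. \<sigma> * x) ` {0..r} \<subseteq> {-R<..<R}"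
    proof (rule image_subsetI, rule abs_less_mem)
      show "\<bar>\<sigma> * x\<bar> < R" if "x \<in> {0..r}" for x using that assms(2,4) by (simp add: abs_mult)
    qed
  qed (intro continuous_intros)
  then have "continuous_on {0..r} (\<lambda>x. pt (\<sigma> * x) (th j (\<sigma> * x)))"
    unfolding pol_def by (intro continuous_intros)
  then have "compact (H r j \<sigma>)" unfolding H_def by (rule compact_continuous_image) (rule compact_Icc)
  then show ?thesis by (rule compact_imp_closed)
qed

lemma H_norm:
  assumes "p \<in> H r j \<sigma>" "\<bar>\<sigma>\<bar> = 1"
  shows "p = pt (\<sigma> * norm p) (th j (\<sigma> * norm p))" "norm p \<le> r"
proof -
  obtain x where x: "x \<in> {0..r}" "p = pt (\<sigma> * x) (th j (\<sigma> * x))" using assms(1) by (auto simp: H_def)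
  have "norm p = x" using x assms(2) by (simp add: norm_pol abs_mult)
  then show "p = pt (\<sigma> * norm p) (th j (\<sigma> * norm p))" "norm p \<le> r" using x by simp_all
qed

lemma H_unique:
  assumes p: "p \<in> H r j \<sigma>" "p \<in> H r j' \<sigma>'" "p \<noteq> 0" and r: "r < R"
    and j: "j < 3" "j' < 3" and \<sigma>: "\<bar>\<sigma>\<bar> = 1" "\<bar>\<sigma>'\<bar> = 1"
  shows "j = j' \<and> \<sigma> = \<sigma>'"
proof -
  define n where "n = norm p"
  have n: "n > 0" "n \<le> r" using p(3) H_norm(2)[OF p(1) \<sigma>(1)] by (simp_all add: n_def)
  have x: "\<bar>\<sigma> * n\<bar> < R" "\<bar>\<sigma>' * n\<bar> < R" using n r \<sigma> by (simp_all add: abs_mult)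
  have "\<sigma> * n \<noteq> 0" using n(1) \<sigma>(1) by auto
  moreover have "pt (\<sigma> * n) (th j (\<sigma> * n)) = pt (\<sigma>' * n) (th j' (\<sigma>' * n))"
    using H_norm(1)[OF p(1) \<sigma>(1)] H_norm(1)[OF p(2) \<sigma>(2)] unfolding n_def by (rule trans[OF sym])
  ultimately have eq: "\<sigma> * n = \<sigma>' * n \<and> th j (\<sigma> * n) = th j' (\<sigma>' * n)"
    by (intro coord_unique[OF _ _ x(1)] th_range[OF x(1) j(1)] th_range[OF x(2) j(2)])
  then have s: "\<sigma> = \<sigma>'" using n(1) by simp
  have "j = 0 \<or> j = 1 \<or> j = 2" "j' = 0 \<or> j' = 1 \<or> j' = 2" using j by linarith+
  then have "j = j'" using eq th_le[OF x(1)] unfolding s by fastforce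
  then show ?thesis using s by simp
qed

lemma V0_H:
  assumes "0 < r" "r < R"
  shows "V0 \<inter> cball 0 r = (\<Union>x\<in>{..<3} \<times> {1, - 1}. H r (fst x) (snd x))"
proof -
  have "gam r j ` {-1..1} = H r j 1 \<union> H r j (- 1)" for j
  proof -
    have "{-1..1::real} = {0..1} \<union> {-1..0}" by auto
    then show ?thesis unfolding H_half[OF assms(1), symmetric] half_pos_def half_neg_def by (simp only: image_Un)
  qed
  then have "V0 \<inter> cball 0 r = (\<Union>j<3. H r j 1 \<union> H r j (- 1))" using V0_disc[OF assms] by simp
  also have "\<dots> = (\<Union>x\<in>{..<3} \<times> {1, - 1}. H r (fst x) (snd x))" by auto
  finally show ?thesis .
qed

text \<open>A simple path from the origin to the boundary circle in the unperturbed vertex set stays in one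
  half-branch by connectedness, and covers it since the norm is a coordinate on it.\<close>

lemma path_is_H:
  fixes \<delta> :: "real \<Rightarrow> real \<times> real"
  assumes r: "0 < r" "r < R" and c: "continuous_on {0..1} \<delta>" and inj: "inj_on \<delta> {0..1}"
    and e: "\<delta> 0 = 0" "norm (\<delta> 1) = r" and V: "\<delta> ` {0..1} \<subseteq> V0 \<inter> cball 0 r"
  shows "\<exists>j \<sigma>. j < 3 \<and> \<bar>\<sigma>\<bar> = 1 \<and> \<delta> ` {0..1} = H r j \<sigma>"
proof -
  have "\<delta> 1 \<in> V0 \<inter> cball 0 r" by (rule subsetD[OF V imageI]) simp
  then obtain j \<sigma> where j: "(j, \<sigma>) \<in> {..<3} \<times> {1, - 1}" "\<delta> 1 \<in> H r j \<sigma>" unfolding V0_H[OF r] by auto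
  have js: "j < 3" "\<bar>\<sigma>\<bar> = 1" using j(1) by auto
  define I where "I = {..<3::nat} \<times> {1, - 1 :: real} - {(j, \<sigma>)}"
  define C where "C = (\<Union>x\<in>I. H r (fst x) (snd x))"
  have clC: "closed C" unfolding C_def by (intro closed_UN) (auto simp: I_def intro!: H_closed r)
  have ne: "\<delta> s \<noteq> 0" if "s \<in> {0<..1}" for s
    using inj_onD[OF inj, of s 0] that e(1) by auto
  have conn: "connected (\<delta> ` {0<..1})"
    by (intro connected_continuous_image continuous_on_subset[OF c] connected_Ioc) auto
  have "H r j \<sigma> \<inter> \<delta> ` {0<..1} = {} \<or> C \<inter> \<delta> ` {0<..1} = {}"
  proof (rule connected_closedD[OF conn _ _ H_closed[OF r js] clC])
    show "\<delta> ` {0<..1} \<subseteq> H r j \<sigma> \<union> C"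
    proof
      fix p assume "p \<in> \<delta> ` {0<..1}"
      then have "p \<in> \<delta> ` {0..1}" by force
      then have "p \<in> V0 \<inter> cball 0 r" using V by blast
      then obtain x where x: "x \<in> {..<3} \<times> {1, - 1}" "p \<in> H r (fst x) (snd x)" unfolding V0_H[OF r] by blast
      show "p \<in> H r j \<sigma> \<union> C"
      proof (cases "x = (j, \<sigma>)")
        case False
        then have "x \<in> I" using x(1) by (simp add: I_def)
        then show ?thesis using x(2) unfolding C_def by blast
      qed (use x(2) in simp)
    qed
    show "H r j \<sigma> \<inter> C \<inter> \<delta> ` {0<..1} = {}"
    proof (rule ccontr)
      assume "H r j \<sigma> \<inter> C \<inter> \<delta> ` {0<..1} \<noteq> {}"
      then obtain p where p: "p \<in> H r j \<sigma>" "p \<in> C" "p \<in> \<delta> ` {0<..1}" by blast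
      obtain x where x: "x \<in> I" "p \<in> H r (fst x) (snd x)" using p(2) unfolding C_def by blast
      have "p \<noteq> 0" using p(3) ne by (metis imageE)
      moreover have "fst x < 3" "\<bar>snd x\<bar> = 1" "x \<noteq> (j, \<sigma>)" using x(1) unfolding I_def by auto
      ultimately have "j = fst x \<and> \<sigma> = snd x" by (intro H_unique[OF p(1) x(2) _ r(2) js(1) _ js(2)])
      then show False using \<open>x \<noteq> (j, \<sigma>)\<close> by (simp add: prod_eq_iff)
    qed
  qed
  moreover have "\<delta> 1 \<in> H r j \<sigma> \<inter> \<delta> ` {0<..1}" using j(2) by auto
  ultimately have "C \<inter> \<delta> ` {0<..1} = {}" by blast
  have z: "0 \<in> H r j \<sigma>" unfolding H_def by (rule image_eqI[of _ _ 0]) (use r in \<open>simp_all add: pol_0\<close>)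
  have sub: "\<delta> s \<in> H r j \<sigma>" if s: "s \<in> {0..1}" for s
  proof (cases "s = 0")
    case False
    then have sI: "\<delta> s \<in> \<delta> ` {0<..1}" using s by auto
    have "\<delta> s \<in> V0 \<inter> cball 0 r" by (rule subsetD[OF V imageI[OF s]])
    then obtain x where x: "x \<in> {..<3} \<times> {1, - 1}" "\<delta> s \<in> H r (fst x) (snd x)" unfolding V0_H[OF r] by blast
    have "x \<notin> I" using x(2) sI \<open>C \<inter> \<delta> ` {0<..1} = {}\<close> unfolding C_def by blast
    then have "x = (j, \<sigma>)" using x(1) by (simp add: I_def)
    then show ?thesis using x(2) by simp
  qed (use z e(1) in simp)
  have "H r j \<sigma> \<subseteq> \<delta> ` {0..1}"
  proof
    fix p assume p: "p \<in> H r j \<sigma>"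
    have "continuous_on {0..1} (\<lambda>s. norm (\<delta> s))" by (intro continuous_intros c)
    then have "\<exists>s\<ge>0. s \<le> 1 \<and> norm (\<delta> s) = norm p"
      using H_norm(2)[OF p js(2)] e by (intro IVT') auto
    then obtain s where s: "s \<in> {0..1}" "norm (\<delta> s) = norm p" by auto
    have "\<delta> s = p" using H_norm(1)[OF sub[OF s(1)] js(2)] H_norm(1)[OF p js(2)] s(2) by metis
    then show "p \<in> \<delta> ` {0..1}" using s(1) by blast
  qed
  then show ?thesis using sub js by (intro exI[of _ j] exI[of _ \<sigma>]) blast
qed

text \<open>On a half-branch the direction of a point is determined by its norm, and tends to the asymptotic
  direction; the direction of \<open>\<delta> s\<close> tends to that of the velocity.\<close>

lemma H_tangent:
  assumes r: "0 < r" "r < R" and j: "j < 3" "\<bar>\<sigma>\<bar> = 1"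
    and \<delta>: "(\<delta> has_vector_derivative v) (at 0)" "\<delta> 0 = 0" "v \<noteq> 0" and sub: "\<delta> ` {0..1} \<subseteq> H r j \<sigma>"
  shows "v = norm v *\<^sub>R pt \<sigma> (asym_angle j)"
proof -
  define F where "F = at_right (0::real)"
  have F0: "F \<noteq> bot" by (simp add: F_def trivial_limit_at_right_real)
  have le: "F \<le> at 0" unfolding F_def by (rule at_le) simp
  note d = has_real_derivative_fst_snd[OF \<delta>(1)]
  have l1: "((\<lambda>s. fst (\<delta> s) / s) \<longlongrightarrow> fst v) F" "((\<lambda>s. snd (\<delta> s) / s) \<longlongrightarrow> snd v) F"
    using d[unfolded has_field_derivative_iff] \<delta>(2) by (auto intro: tendsto_mono[OF le])
  have ev: "\<forall>\<^sub>F s in F. s \<in> {0<..<1}"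
    unfolding F_def using eventually_at_right_real[of 0 1] by simp
  have ln: "((\<lambda>s. norm (\<delta> s) / s) \<longlongrightarrow> norm v) F"
  proof (rule Lim_transform_eventually)
    show "((\<lambda>s. norm (fst (\<delta> s) / s, snd (\<delta> s) / s)) \<longlongrightarrow> norm v) F"
      using tendsto_norm[OF tendsto_Pair[OF l1]] by simp
    show "\<forall>\<^sub>F s in F. norm (fst (\<delta> s) / s, snd (\<delta> s) / s) = norm (\<delta> s) / s"
      using ev
    proof eventually_elim
      case (elim s)
      have "(fst (\<delta> s) / s, snd (\<delta> s) / s) = (1 / s) *\<^sub>R \<delta> s" by (cases "\<delta> s") simp
      then show ?case using elim by simp
    qed
  qed
  have "isCont \<delta> 0" by (rule has_vector_derivative_continuous[OF \<delta>(1)])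
  then have "(\<delta> \<longlongrightarrow> 0) F" using \<delta>(2) tendsto_mono[OF le] by (simp add: isCont_def)
  then have "((\<lambda>s. \<sigma> * norm (\<delta> s)) \<longlongrightarrow> \<sigma> * 0) F"
    using tendsto_norm_zero by (intro tendsto_mult tendsto_const) blast
  then have ln0: "((\<lambda>s. \<sigma> * norm (\<delta> s)) \<longlongrightarrow> 0) F" by simp
  have j3: "j \<le> 3" using j(1) by simp
  have "isCont (th j) 0"
    using cont_th[OF j3] R(1) by (simp add: continuous_on_eq_continuous_at)
  from isCont_tendsto_compose[OF this ln0] have lt: "((\<lambda>s. th j (\<sigma> * norm (\<delta> s))) \<longlongrightarrow> asym_angle j) F"
    by (simp add: th_0[OF j3])
  have eq: "\<forall>\<^sub>F s in F. \<delta> s = pt (\<sigma> * norm (\<delta> s)) (th j (\<sigma> * norm (\<delta> s)))"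
    using ev
  proof eventually_elim
    case (elim s)
    then have "\<delta> s \<in> H r j \<sigma>" using sub by auto
    then show ?case by (rule H_norm(1)[OF _ j(2)])
  qed
  have c1: "((\<lambda>s. \<sigma> * (norm (\<delta> s) / s) * cos (\<beta> + th j (\<sigma> * norm (\<delta> s)))) \<longlongrightarrow> \<sigma> * norm v * cos (\<beta> + asym_angle j)) F"
    "((\<lambda>s. \<sigma> * (norm (\<delta> s) / s) * sin (\<beta> + th j (\<sigma> * norm (\<delta> s)))) \<longlongrightarrow> \<sigma> * norm v * sin (\<beta> + asym_angle j)) F"
    by (intro tendsto_intros ln lt)+
  have c2: "((\<lambda>s. fst (\<delta> s) / s) \<longlongrightarrow> \<sigma> * norm v * cos (\<beta> + asym_angle j)) F"
  proof (rule Lim_transform_eventually[OF c1(1)])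
    show "\<forall>\<^sub>F s in F. \<sigma> * (norm (\<delta> s) / s) * cos (\<beta> + th j (\<sigma> * norm (\<delta> s))) = fst (\<delta> s) / s"
      using eq
    proof eventually_elim
      case (elim s)
      have "fst (\<delta> s) = \<sigma> * norm (\<delta> s) * cos (\<beta> + th j (\<sigma> * norm (\<delta> s)))"
        using arg_cong[OF elim, of fst] by (simp only: pol_def fst_conv)
      then show ?case by (metis times_divide_eq_left times_divide_eq_right)
    qed
  qed
  have c3: "((\<lambda>s. snd (\<delta> s) / s) \<longlongrightarrow> \<sigma> * norm v * sin (\<beta> + asym_angle j)) F"
  proof (rule Lim_transform_eventually[OF c1(2)])
    show "\<forall>\<^sub>F s in F. \<sigma> * (norm (\<delta> s) / s) * sin (\<beta> + th j (\<sigma> * norm (\<delta> s))) = snd (\<delta> s) / s"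
      using eq
    proof eventually_elim
      case (elim s)
      have "snd (\<delta> s) = \<sigma> * norm (\<delta> s) * sin (\<beta> + th j (\<sigma> * norm (\<delta> s)))"
        using arg_cong[OF elim, of snd] by (simp only: pol_def snd_conv)
      then show ?case by (metis times_divide_eq_left times_divide_eq_right)
    qed
  qed
  have "fst v = \<sigma> * norm v * cos (\<beta> + asym_angle j)" by (rule tendsto_unique[OF F0 l1(1) c2])
  moreover have "snd v = \<sigma> * norm v * sin (\<beta> + asym_angle j)" by (rule tendsto_unique[OF F0 l1(2) c3])
  ultimately show ?thesis by (intro prod_eqI) (simp_all add: pol_def)
qed

lemma asym_diff_lt: "j < 3 \<Longrightarrow> j' < 3 \<Longrightarrow> \<bar>asym_angle j - asym_angle j'\<bar> < pi"
proof -
  assume j: "j < 3" "j' < 3"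
  have eq: "asym_angle j - asym_angle j' = (real j - real j') * (pi / 3)" by (simp add: asym_angle_def field_simps)
  have "\<bar>real j - real j'\<bar> \<le> 2" using j by linarith
  then have "\<bar>real j - real j'\<bar> * (pi / 3) \<le> 2 * (pi / 3)" by (intro mult_right_mono) auto
  then have "\<bar>(real j - real j') * (pi / 3)\<bar> \<le> 2 * (pi / 3)" by (simp add: abs_mult)
  then show ?thesis unfolding eq using pi_gt_zero by linarith
qed

text \<open>A smooth branch has opposite outgoing tangents at the origin, so its halves are opposite.\<close>

lemma branch_is_H:
  assumes r: "0 < r" "r < R" and \<gamma>: "branch_param r \<gamma>" "\<gamma> 0 = 0" "\<gamma> ` {-1..1} \<subseteq> V0"
  obtains j \<sigma> where "j < 3" "\<bar>\<sigma>\<bar> = 1" "half_pos \<gamma> = H r j \<sigma>" "half_neg \<gamma> = H r j (- \<sigma>)"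
proof -
  obtain S where S: "open S" "{-1..1} \<subseteq> S" "smooth_on S \<gamma>" and v0: "vector_derivative \<gamma> (at 0) \<noteq> 0"
    and inj: "inj_on \<gamma> {-1..1}" and n: "norm (\<gamma> (- 1)) = r" "norm (\<gamma> 1) = r" "\<forall>s\<in>{-1<..<1}. norm (\<gamma> s) < r"
    using \<gamma>(1) unfolding branch_param_def by auto
  define v where "v = vector_derivative \<gamma> (at 0)"
  have "0 \<in> S" using S(2) by auto
  then have d: "(\<gamma> has_vector_derivative v) (at 0)" unfolding v_def by (rule smooth_curve_velocity(1)[OF S(1,3)])
  have c: "continuous_on {-1..1} \<gamma>" by (rule continuous_on_subset[OF smooth_on_continuous[OF S(3)] S(2)])
  have inV: "\<gamma> s \<in> V0 \<inter> cball 0 r" if s: "s \<in> {-1..1}" for s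
  proof -
    have "norm (\<gamma> s) \<le> r"
    proof (cases "s = 1 \<or> s = - 1")
      case False
      then have "s \<in> {-1<..<1}" using s by auto
      then show ?thesis using n(3) by fastforce
    qed (use n in auto)
    then show ?thesis using \<gamma>(3) s by auto
  qed
  have c1: "continuous_on {0..1} \<gamma>" by (rule continuous_on_subset[OF c]) auto
  have i1: "inj_on \<gamma> {0..1}" by (rule inj_on_subset[OF inj]) auto
  have V1: "\<gamma> ` {0..1} \<subseteq> V0 \<inter> cball 0 r" using inV by auto
  obtain j \<sigma> where j: "j < 3" "\<bar>\<sigma>\<bar> = 1" "\<gamma> ` {0..1} = H r j \<sigma>"
    using path_is_H[OF r c1 i1 \<gamma>(2) n(2) V1] by blast
  define \<delta> where "\<delta> s = \<gamma> (- s)" for s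
  have c2: "continuous_on {0..1} \<delta>" unfolding \<delta>_def
    by (rule continuous_on_compose2[OF c]) (auto intro!: continuous_intros)
  have i2: "inj_on \<delta> {0..1}" by (rule inj_onI) (use inj_onD[OF inj] in \<open>force simp: \<delta>_def\<close>)
  have V2: "\<delta> ` {0..1} \<subseteq> V0 \<inter> cball 0 r"
  proof (rule image_subsetI)
    show "\<delta> s \<in> V0 \<inter> cball 0 r" if "s \<in> {0..1}" for s unfolding \<delta>_def by (rule inV) (use that in auto)
  qed
  have e2: "\<delta> 0 = 0" "norm (\<delta> 1) = r" using \<gamma>(2) n(1) by (simp_all add: \<delta>_def)
  obtain j' \<sigma>' where j': "j' < 3" "\<bar>\<sigma>'\<bar> = 1" "\<delta> ` {0..1} = H r j' \<sigma>'"
    using path_is_H[OF r c2 i2 e2 V2] by blast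
  have "(uminus has_vector_derivative - 1) (at (0::real))" by (auto intro!: derivative_eq_intros)
  from vector_diff_chain_at[OF this, of \<gamma> v] d have "(\<gamma> \<circ> uminus has_vector_derivative - v) (at 0)" by simp
  then have d2: "(\<delta> has_vector_derivative - v) (at 0)" by (simp add: \<delta>_def[abs_def] o_def)
  have vne: "v \<noteq> 0" using v0 by (simp add: v_def)
  have t1: "v = norm v *\<^sub>R pt \<sigma> (asym_angle j)"
    by (rule H_tangent[OF r j(1,2) d \<gamma>(2) vne]) (simp add: j(3))
  have t2: "- v = norm (- v) *\<^sub>R pt \<sigma>' (asym_angle j')"
    by (rule H_tangent[OF r j'(1,2) d2 e2(1)]) (simp_all add: j'(3) vne)
  have "norm v *\<^sub>R pt \<sigma>' (asym_angle j') = - (norm v *\<^sub>R pt \<sigma> (asym_angle j))" using t1 t2 by simp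
  also have "\<dots> = norm v *\<^sub>R pt (- \<sigma>) (asym_angle j)" by (simp add: pol_def)
  finally have eq: "pt \<sigma>' (asym_angle j') = pt (- \<sigma>) (asym_angle j)" using vne by simp
  have lt: "\<bar>asym_angle j' - asym_angle j\<bar> < pi" by (rule asym_diff_lt[OF j'(1) j(1)])
  have "\<sigma>' \<noteq> \<sigma>"
  proof
    assume "\<sigma>' = \<sigma>"
    then have "pi \<le> \<bar>asym_angle j' - asym_angle j\<bar>" using eq j(2) by (intro pol_opposite[of \<beta> \<sigma>]) auto
    then show False using lt by simp
  qed
  then have s: "\<sigma>' = - \<sigma>" using j(2) j'(2) by (auto simp: abs_if split: if_splits)
  have "asym_angle j' = asym_angle j"
    by (rule pol_inj[OF eq[unfolded s]]) (use j(2) lt pi_gt_zero in auto)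
  then have jj: "j' = j" by (simp add: asym_angle_def)
  have hp: "half_pos \<gamma> = H r j \<sigma>" unfolding half_pos_def by (rule j(3))
  have eq: "{-1..0::real} = uminus ` {0..1}" by simp
  have "half_neg \<gamma> = \<delta> ` {0..1}" unfolding half_neg_def \<delta>_def[abs_def] eq image_image ..
  then have "half_neg \<gamma> = H r j (- \<sigma>)" using j'(3) s jj by simp
  then show ?thesis by (rule that[OF j(1,2) hp])
qed

lemma gam_velocity:
  assumes "0 < r" "j < 3"
  shows "vector_derivative (gam r j) (at 0) = pt r (asym_angle j)"
proof -
  have j: "j \<le> 3" using assms(2) by simp
  obtain d where d: "(th j has_real_derivative d) (at (r * 0))"
    using smooth_on_real_deriv_ex[OF th_smooth[OF j], of 0] R(1) by auto
  have X: "((\<lambda>s. r * s) has_real_derivative r) (at 0)" using DERIV_cmult[OF DERIV_ident, of r 0] by simp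
  have "((\<lambda>s. th j (r * s)) has_real_derivative d * r) (at 0)"
    by (rule DERIV_chain2[where f="th j" and g="\<lambda>s. r * s", OF d X])
  from vector_derivative_at[OF pol_velocity[OF X this, of \<beta>]] show ?thesis
    by (simp add: gam_def[abs_def] pol_def th_0[OF j])
qed

lemma gam_ccw:
  assumes "0 < r"
  shows "ccw_order [pt r (asym_angle 0), pt r (asym_angle 1), pt r (asym_angle 2),
    - pt r (asym_angle 0), - pt r (asym_angle 1), - pt r (asym_angle 2)]"
proof -
  have p: "pt r a = norm (pt r a) *\<^sub>R (cos (\<beta> + a), sin (\<beta> + a))" for a
    using assms by (simp add: norm_pol) (simp add: pol_def)
  have m: "- pt r a = norm (- pt r a) *\<^sub>R (cos (\<beta> + a + pi), sin (\<beta> + a + pi))" for a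
    using assms by (simp add: norm_pol) (simp add: pol_def)
  have nz: "pt r a \<noteq> 0" "- pt r a \<noteq> 0" for a using assms by (simp_all add: pol_eq_0_iff)
  have asym: "asym_angle 0 = - pi / 6" "asym_angle 1 = pi / 6" "asym_angle 2 = pi / 2"
    by (simp_all add: asym_angle_def field_simps)
  let ?\<theta> = "[\<beta> + asym_angle 0, \<beta> + asym_angle 1, \<beta> + asym_angle 2,
      \<beta> + asym_angle 0 + pi, \<beta> + asym_angle 1 + pi, \<beta> + asym_angle 2 + pi]"
  show ?thesis
    unfolding ccw_order_def
  proof (intro exI[of _ ?\<theta>] conjI)
    show "sorted_wrt (<) ?\<theta>" by (simp add: asym asym[unfolded One_nat_def]) (intro conjI; use pi_gt_zero in linarith)
    have lt: "\<beta> + asym_angle 0 < \<beta> + asym_angle 0 + 2 * pi" "\<beta> + asym_angle 1 < \<beta> + asym_angle 0 + 2 * pi"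
      "\<beta> + asym_angle 2 < \<beta> + asym_angle 0 + 2 * pi" "\<beta> + asym_angle 0 + pi < \<beta> + asym_angle 0 + 2 * pi"
      "\<beta> + asym_angle 1 + pi < \<beta> + asym_angle 0 + 2 * pi" "\<beta> + asym_angle 2 + pi < \<beta> + asym_angle 0 + 2 * pi"
      using pi_gt_zero unfolding asym by linarith+
    show "\<forall>i<length [pt r (asym_angle 0), pt r (asym_angle 1), pt r (asym_angle 2),
        - pt r (asym_angle 0), - pt r (asym_angle 1), - pt r (asym_angle 2)].
      ?\<theta> ! i < ?\<theta> ! 0 + 2 * pi \<and>
      [pt r (asym_angle 0), pt r (asym_angle 1), pt r (asym_angle 2),
        - pt r (asym_angle 0), - pt r (asym_angle 1), - pt r (asym_angle 2)] ! i \<noteq> 0 \<and>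
      [pt r (asym_angle 0), pt r (asym_angle 1), pt r (asym_angle 2),
        - pt r (asym_angle 0), - pt r (asym_angle 1), - pt r (asym_angle 2)] ! i =
      norm ([pt r (asym_angle 0), pt r (asym_angle 1), pt r (asym_angle 2),
        - pt r (asym_angle 0), - pt r (asym_angle 1), - pt r (asym_angle 2)] ! i) *\<^sub>R (cos (?\<theta> ! i), sin (?\<theta> ! i))"
      unfolding list.size add_0 add_Suc_right add_0_right One_nat_def All_less_Suc2 nth_Cons_0 nth_Cons_Suc
      by (intro conjI allI impI lt[unfolded One_nat_def] nz p m) simp_all
  qed simp
qed

text \<open>For the labelling \<open>gam r 0, gam r 1, gam r 2\<close> both deformations are \<open>deforms_canonical\<close>. For another
  labelling, the uniqueness of the limit makes the half-branches with the label \<open>+\<close> of the first two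
  branches the edges of the first sector, and those with the label \<open>-\<close> are opposite to them.\<close>

theorem branches_swap:
  assumes r: "0 < r" "r < \<rho>"
  shows "(\<exists>\<gamma>1 \<gamma>2 \<gamma>3. labelled_branches r V0 \<gamma>1 \<gamma>2 \<gamma>3 \<and>
       nonorigin_branch_deforms r V (at_left 0) (half_pos \<gamma>1 \<union> half_pos \<gamma>2)) \<and>
    (\<forall>\<gamma>1 \<gamma>2 \<gamma>3. labelled_branches r V0 \<gamma>1 \<gamma>2 \<gamma>3 \<and>
       nonorigin_branch_deforms r V (at_left 0) (half_pos \<gamma>1 \<union> half_pos \<gamma>2) \<longrightarrow>
       nonorigin_branch_deforms r V (at_right 0) (half_neg \<gamma>1 \<union> half_neg \<gamma>2))"
proof (intro conjI allI impI)
  have rR: "r < R" using r rho by simp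
  note can = deforms_canonical[OF r]
  have defl: "nonorigin_branch_deforms r V (at_left 0) (edges 1 r)"
    unfolding nonorigin_branch_deforms_def
  proof (intro allI impI)
    fix e :: real assume "e > 0"
    then have "\<forall>\<^sub>F t in at_left 0. nonorigin_branch r (V t) (Barc r t) \<and> C0_close e (edges 1 r) (Barc r t)" using can(1) by blast
    then show "\<forall>\<^sub>F t in at_left 0. \<exists>B. nonorigin_branch r (V t) B \<and> C0_close e (edges 1 r) B"
      by eventually_elim blast
  qed
  have defr: "nonorigin_branch_deforms r V (at_right 0) (edges (- 1) r)"
    unfolding nonorigin_branch_deforms_def
  proof (intro allI impI)
    fix e :: real assume "e > 0"
    then have "\<forall>\<^sub>F t in at_right 0. nonorigin_branch r (V t) (Barc r t) \<and> C0_close e (edges (- 1) r) (Barc r t)" using can(2) by blast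
    then show "\<forall>\<^sub>F t in at_right 0. \<exists>B. nonorigin_branch r (V t) B \<and> C0_close e (edges (- 1) r) B"
      by eventually_elim blast
  qed
  have "{..<3::nat} = {0, 1, 2}" by auto
  then have "V0 \<inter> cball 0 r = gam r 0 ` {-1..1} \<union> gam r 1 ` {-1..1} \<union> gam r 2 ` {-1..1}"
    unfolding V0_disc[OF r(1) rR] by (simp add: Un_assoc)
  moreover have "gam r j 0 = 0" for j by (simp add: gam_def pol_0)
  ultimately have "labelled_branches r V0 (gam r 0) (gam r 1) (gam r 2)"
    unfolding labelled_branches_def Let_def
    using gam_branch[OF r(1) rR] gam_velocity[OF r(1)] gam_ccw[OF r(1)] by simp
  then show "\<exists>\<gamma>1 \<gamma>2 \<gamma>3. labelled_branches r V0 \<gamma>1 \<gamma>2 \<gamma>3 \<and>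
       nonorigin_branch_deforms r V (at_left 0) (half_pos \<gamma>1 \<union> half_pos \<gamma>2)"
    using defl unfolding edges_half(1)[OF r(1)] by blast
  fix \<gamma>1 \<gamma>2 \<gamma>3 assume a: "labelled_branches r V0 \<gamma>1 \<gamma>2 \<gamma>3 \<and>
       nonorigin_branch_deforms r V (at_left 0) (half_pos \<gamma>1 \<union> half_pos \<gamma>2)"
  have b: "branch_param r \<gamma>1" "\<gamma>1 0 = 0" "branch_param r \<gamma>2" "\<gamma>2 0 = 0" and
    im: "V0 \<inter> cball 0 r = \<gamma>1 ` {-1..1} \<union> \<gamma>2 ` {-1..1} \<union> \<gamma>3 ` {-1..1}"
    using a unfolding labelled_branches_def by blast+
  have sub: "\<gamma>1 ` {-1..1} \<subseteq> V0" "\<gamma>2 ` {-1..1} \<subseteq> V0" using im by blast+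
  obtain j \<sigma> where j: "j < 3" "\<bar>\<sigma>\<bar> = 1" "half_pos \<gamma>1 = H r j \<sigma>" "half_neg \<gamma>1 = H r j (- \<sigma>)"
    by (rule branch_is_H[OF r(1) rR b(1,2) sub(1)])
  obtain k \<kappa> where k: "k < 3" "\<bar>\<kappa>\<bar> = 1" "half_pos \<gamma>2 = H r k \<kappa>" "half_neg \<gamma>2 = H r k (- \<kappa>)"
    by (rule branch_is_H[OF r(1) rR b(3,4) sub(2)])
  define \<Gamma> where "\<Gamma> = H r j \<sigma> \<union> H r k \<kappa>"
  have d\<Gamma>: "nonorigin_branch_deforms r V (at_left 0) \<Gamma>" using a j(3) k(3) by (simp add: \<Gamma>_def)
  have common: "\<exists>B. C0_close e (edges 1 r) B \<and> C0_close e \<Gamma> B" if e: "e > 0" for e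
  proof -
    have "\<forall>\<^sub>F t in at_left 0. \<exists>B. nonorigin_branch r (V t) B \<and> C0_close e (edges 1 r) B"
      using defl e unfolding nonorigin_branch_deforms_def by blast
    moreover have "\<forall>\<^sub>F t in at_left 0. \<exists>B. nonorigin_branch r (V t) B \<and> C0_close e \<Gamma> B"
      using d\<Gamma> e unfolding nonorigin_branch_deforms_def by blast
    ultimately have "\<forall>\<^sub>F t in at_left (0::real). \<exists>B. C0_close e (edges 1 r) B \<and> C0_close e \<Gamma> B"
    proof eventually_elim
      case (elim t)
      then show ?case using nonorigin_branch_unique by blast
    qed
    then show ?thesis using eventually_happens trivial_limit_at_left_real by blast
  qed
  have "closed \<Gamma>" unfolding \<Gamma>_def by (intro closed_Un H_closed r rR j k)
  then have "edges 1 r \<subseteq> \<Gamma>" using C0_close_limit common by blast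
  then have sub2: "H r 0 1 \<union> H r 1 1 \<subseteq> \<Gamma>" unfolding edges_half(1)[OF r(1)] H_half[OF r(1)] .
  have uniq: "i = j \<and> \<sigma> = 1 \<or> i = k \<and> \<kappa> = 1" if i: "i < 3" "H r i 1 \<subseteq> \<Gamma>" for i
  proof -
    define p where "p = pt r (th i r)"
    have p: "p \<in> H r i 1" unfolding H_def p_def by (rule image_eqI[of _ _ r]) (use r in simp_all)
    have p0: "p \<noteq> 0" using r(1) by (simp add: p_def pol_eq_0_iff)
    have "p \<in> H r j \<sigma> \<or> p \<in> H r k \<kappa>" using i(2) p unfolding \<Gamma>_def by blast
    then show ?thesis
    proof
      assume "p \<in> H r j \<sigma>"
      from H_unique[OF p this p0 rR i(1) j(1) _ j(2)] show ?thesis by simp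
    next
      assume "p \<in> H r k \<kappa>"
      from H_unique[OF p this p0 rR i(1) k(1) _ k(2)] show ?thesis by simp
    qed
  qed
  have u0: "0 = j \<and> \<sigma> = 1 \<or> 0 = k \<and> \<kappa> = 1" by (rule uniq) (use sub2 in auto)
  have u1: "1 = j \<and> \<sigma> = 1 \<or> 1 = k \<and> \<kappa> = 1" by (rule uniq) (use sub2 in auto)
  have "half_neg \<gamma>1 \<union> half_neg \<gamma>2 = H r 0 (- 1) \<union> H r 1 (- 1)"
    unfolding j(4) k(4) using u0 u1 by auto
  also have "\<dots> = edges (- 1) r" unfolding edges_half(2)[OF r(1)] H_half[OF r(1)] ..
  finally show "nonorigin_branch_deforms r V (at_right 0) (half_neg \<gamma>1 \<union> half_neg \<gamma>2)" using defr by simp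
qed

end

section \<open>Partial derivatives of families and Taylor coefficients\<close>

text \<open>The derivatives of the members of a family are partial derivatives of the family, which exhibits
  their smooth dependence on the parameter.\<close>

lemma dd_slice:
  fixes G :: "('a::euclidean_space) \<times> ('b::euclidean_space) \<Rightarrow> real"
  assumes "open U" "\<And>q. q \<in> U \<Longrightarrow> h q = G (q, t)" "smooth_on (U \<times> T) G" "p \<in> U" "t \<in> T"
  shows "dd v h p = dd (v, 0) G (p, t)"
proof -
  have 1: "(G has_derivative frechet_derivative G (at (p, t))) (at (p, t))"
    using smooth_on_has_derivative[OF assms(3)] assms(4,5) by simp
  have 2: "((\<lambda>p. (p, t)) has_derivative (\<lambda>v. (v, 0))) (at p)"
    by (intro has_derivative_Pair has_derivative_ident has_derivative_const)
  have "frechet_derivative h (at p) = frechet_derivative (\<lambda>p. G (p, t)) (at p)"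
    by (rule frechet_derivative_cong_open[OF assms(1,4,2)])
  also have "\<dots> = (\<lambda>v. frechet_derivative G (at (p, t)) (v, 0))"
    by (rule frechet_derivative_at[OF has_derivative_compose[OF 2 1], symmetric])
  finally show ?thesis by simp
qed

lemma dd_dd_plane:
  assumes "open U" "smooth_on U g" "p \<in> U"
  shows "dd v (dd v g) p = (fst v)\<^sup>2 * px (px g) p + 2 * fst v * snd v * px (py g) p + (snd v)\<^sup>2 * py (py g) p"
proof -
  note s = smooth_on_frechet[OF assms(2)]
  note c = dd_commute[OF assms]
  have "dd v (dd v g) p = fst v * px (dd v g) p + snd v * py (dd v g) p" by (rule dd_plane[OF s assms(3)])
  also have "px (dd v g) p = dd v (px g) p" by (rule c)
  also have "\<dots> = fst v * px (px g) p + snd v * py (px g) p" by (rule dd_plane[OF s assms(3)])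
  also have "py (px g) p = px (py g) p" by (rule c)
  also have "py (dd v g) p = dd v (py g) p" by (rule c)
  also have "\<dots> = fst v * px (py g) p + snd v * py (py g) p" by (rule dd_plane[OF s assms(3)])
  finally show ?thesis by (simp add: power2_eq_square algebra_simps)
qed

lemma dd_swap2:
  fixes g :: "'a::euclidean_space \<Rightarrow> real"
  assumes "open U" "smooth_on U g" "p \<in> U"
  shows "dd u (dd v (dd w g)) p = dd u (dd w (dd v g)) p" "dd u (dd v (dd w g)) p = dd v (dd u (dd w g)) p"
proof -
  have "frechet_derivative (dd v (dd w g)) (at p) = frechet_derivative (dd w (dd v g)) (at p)"
    by (rule frechet_derivative_cong_open[OF assms(1,3) dd_commute[OF assms(1,2)]])
  then show "dd u (dd v (dd w g)) p = dd u (dd w (dd v g)) p" by simp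
  show "dd u (dd v (dd w g)) p = dd v (dd u (dd w g)) p"
    by (rule dd_commute[OF assms(1) smooth_on_frechet[OF assms(2)] assms(3)])
qed

text \<open>By symmetry of the derivatives, \<open>dd v\<close> may be moved past the others, where it is a combination of the
  two coordinate derivatives.\<close>

lemma dd_dd_dd_plane:
  assumes "open U" "smooth_on U g" "p \<in> U"
  shows "dd v (dd v (dd v g)) p = fst v ^ 3 * px (px (px g)) p + 3 * (fst v)\<^sup>2 * snd v * px (px (py g)) p
    + 3 * fst v * (snd v)\<^sup>2 * px (py (py g)) p + snd v ^ 3 * py (py (py g)) p"
proof -
  note s = smooth_on_frechet[OF assms(2)]
  note s2 = smooth_on_frechet[OF s]
  note sw = dd_swap2[OF assms]
  have in3: "dd u (dd w (dd v g)) p = fst v * px (dd u (dd w g)) p + snd v * py (dd u (dd w g)) p" for u w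
  proof -
    have "dd u (dd w (dd v g)) p = dd u (dd v (dd w g)) p" by (rule sw(1))
    also have "\<dots> = dd v (dd u (dd w g)) p" by (rule sw(2))
    also have "\<dots> = fst v * px (dd u (dd w g)) p + snd v * py (dd u (dd w g)) p" by (rule dd_plane[OF s2 assms(3)])
    finally show ?thesis .
  qed
  have yxx: "py (px (px g)) p = px (px (py g)) p" by (rule trans[OF sw(2) sw(1)])
  have yxy: "py (px (py g)) p = px (py (py g)) p" by (rule sw(2))
  have "dd v (dd v (dd v g)) p = (fst v)\<^sup>2 * px (px (dd v g)) p + 2 * fst v * snd v * px (py (dd v g)) p
    + (snd v)\<^sup>2 * py (py (dd v g)) p"
    by (rule dd_dd_plane[OF assms(1) s assms(3)])
  also have "\<dots> = (fst v)\<^sup>2 * (fst v * px (px (px g)) p + snd v * px (px (py g)) p)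
    + 2 * fst v * snd v * (fst v * px (px (py g)) p + snd v * px (py (py g)) p)
    + (snd v)\<^sup>2 * (fst v * px (py (py g)) p + snd v * py (py (py g)) p)"
    by (simp only: in3[of "(1, 0)" "(1, 0)"] in3[of "(1, 0)" "(0, 1)"] in3[of "(0, 1)" "(0, 1)"] in3[of "(0, 1)" "(1, 0)"] yxx yxy
      sw(2)[where u="(0, 1)" and v="(1, 0)" and w="(0, 1)"])
  finally show ?thesis
    by (simp add: power2_eq_square power3_eq_cube algebra_simps)
qed

lemma hom_part_plane:
  assumes "open U" "smooth_on U g" "0 \<in> U"
  shows "hom_part 1 g v = fst v * px g 0 + snd v * py g 0"
    "hom_part 2 g v = ((fst v)\<^sup>2 * px (px g) 0 + 2 * fst v * snd v * px (py g) 0 + (snd v)\<^sup>2 * py (py g) 0) / 2"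
    "hom_part 3 g v = (fst v ^ 3 * px (px (px g)) 0 + 3 * (fst v)\<^sup>2 * snd v * px (px (py g)) 0
      + 3 * fst v * (snd v)\<^sup>2 * px (py (py g)) 0 + snd v ^ 3 * py (py (py g)) 0) / 6"
proof -
  have f: "fact 2 = (2::real)" "fact 3 = (6::real)" by (simp_all add: fact_numeral)
  show "hom_part 1 g v = fst v * px g 0 + snd v * py g 0"
    unfolding dd_plane[OF assms(2,3), symmetric] hom_part_def by simp
  show "hom_part 2 g v = ((fst v)\<^sup>2 * px (px g) 0 + 2 * fst v * snd v * px (py g) 0 + (snd v)\<^sup>2 * py (py g) 0) / 2"
    unfolding dd_dd_plane[OF assms, symmetric] hom_part_def f by (simp add: numeral_2_eq_2)
  show "hom_part 3 g v = (fst v ^ 3 * px (px (px g)) 0 + 3 * (fst v)\<^sup>2 * snd v * px (px (py g)) 0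
      + 3 * fst v * (snd v)\<^sup>2 * px (py (py g)) 0 + snd v ^ 3 * py (py (py g)) 0) / 6"
    unfolding dd_dd_dd_plane[OF assms, symmetric] hom_part_def f by (simp add: numeral_3_eq_3)
qed

lemma deriv_mult_zero:
  fixes u v :: "real \<Rightarrow> real"
  assumes "isCont u 0" "(v has_real_derivative D) (at 0)" "v 0 = 0"
  shows "((\<lambda>s. u s * v s) has_real_derivative u 0 * D) (at 0)"
proof -
  have "(\<lambda>s. u s * (v s / s)) \<midarrow>0\<rightarrow> u 0 * D"
    using assms by (intro tendsto_mult) (simp_all add: isCont_def has_field_derivative_iff)
  then show ?thesis using assms(3) by (simp add: has_field_derivative_iff)
qed

text \<open>The pairs \<open>(\<beta>, \<sigma>)\<close> with \<open>\<sigma> = \<plusminus> 1\<close> and \<open>cos (3 (\<beta> + \<phi>)) = \<sigma> cos (3 \<phi>)\<close> are the rotations by multiples of \<open>\<pi> / 3\<close>,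
  and \<open>m + i l\<close> is multiplied by the numbers \<open>\<sigma> exp (2 i \<beta>)\<close>, which are the six sixth roots of unity. The
  excluded lines bound six sectors of angle \<open>\<pi> / 3\<close>, which these permute, so one of them moves \<open>m + i l\<close> into
  the sector around the positive real axis.\<close>

lemma rotation_ex:
  fixes l m :: real
  assumes "m \<noteq> 0" "m \<noteq> sqrt 3 * l" "m \<noteq> - sqrt 3 * l"
  shows "\<exists>\<beta> \<sigma>. (\<sigma> = 1 \<or> \<sigma> = - 1) \<and> (\<forall>\<phi>. cos (3 * (\<beta> + \<phi>)) = \<sigma> * cos (3 * \<phi>)) \<and>
    \<sigma> * (m * cos (2 * \<beta>) - l * sin (2 * \<beta>)) > sqrt 3 * \<bar>\<sigma> * (m * sin (2 * \<beta>) + l * cos (2 * \<beta>))\<bar>"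
proof -
  define s where "s = sqrt 3"
  have s: "s > 0" "s * s = 3" "\<And>x. s * (s * x) = 3 * x" by (simp_all add: s_def sqrt3_sq)
  define good where "good C S \<sigma> \<longleftrightarrow> \<sigma> * (m * C - l * S) > s * \<bar>\<sigma> * (m * S + l * C)\<bar>" for C S \<sigma> :: real
  have sc: "sin (2 * (pi / 3)) = s / 2" "cos (2 * (pi / 3)) = - 1 / 2"
    unfolding sin_double cos_double by (simp_all add: s_def sin_60 cos_60 power2_eq_square)
  have c1: "cos (3 * (0 + \<phi>)) = 1 * cos (3 * \<phi>)" for \<phi> :: real by simp
  have c2: "cos (3 * (pi + \<phi>)) = - 1 * cos (3 * \<phi>)" for \<phi>
    using cos_periodic_pi[of "3 * \<phi>"] cos_periodic[of "3 * \<phi> + pi"] by (simp add: algebra_simps)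
  have c3: "cos (3 * (pi / 3 + \<phi>)) = - 1 * cos (3 * \<phi>)" for \<phi>
    using cos_periodic_pi[of "3 * \<phi>"] by (simp add: algebra_simps)
  have c4: "cos (3 * (- (2 * (pi / 3)) + \<phi>)) = 1 * cos (3 * \<phi>)" for \<phi>
    using cos_periodic[of "3 * \<phi> - 2 * pi"] by (simp add: algebra_simps)
  have c5: "cos (3 * (- (pi / 3) + \<phi>)) = - 1 * cos (3 * \<phi>)" for \<phi>
    using cos_periodic_pi[of "3 * \<phi> - pi"] by (simp add: algebra_simps)
  have c6: "cos (3 * (2 * (pi / 3) + \<phi>)) = 1 * cos (3 * \<phi>)" for \<phi>
    using cos_periodic[of "3 * \<phi>"] by (simp add: algebra_simps)
  have d4: "cos (2 * (- (2 * (pi / 3)))) = - 1 / 2" "sin (2 * (- (2 * (pi / 3)))) = s / 2"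
  proof -
    have e: "2 * (- (2 * (pi / 3))) = 2 * (pi / 3) - 2 * pi" by simp
    show "cos (2 * (- (2 * (pi / 3)))) = - 1 / 2" "sin (2 * (- (2 * (pi / 3)))) = s / 2"
      unfolding e cos_diff sin_diff by (simp_all only: sc cos_two_pi sin_two_pi)
  qed
  have d5: "cos (2 * (- (pi / 3))) = - 1 / 2" "sin (2 * (- (pi / 3))) = - s / 2"
    using sc by (simp_all only: mult_minus_right cos_minus sin_minus)
  have d6: "cos (2 * (2 * (pi / 3))) = - 1 / 2" "sin (2 * (2 * (pi / 3))) = - s / 2"
    using d4 by (simp_all only: mult_minus_right cos_minus sin_minus)
  have use: ?thesis if "\<sigma> = 1 \<or> \<sigma> = - 1" "\<And>\<phi>. cos (3 * (\<beta> + \<phi>)) = \<sigma> * cos (3 * \<phi>)" "cos (2 * \<beta>) = C" "sin (2 * \<beta>) = S" "good C S \<sigma>" for \<beta> \<sigma> C S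
    by (rule exI[of _ \<beta>], rule exI[of _ \<sigma>]) (use that in \<open>simp add: good_def s_def\<close>)
  define k where "k = s * l"
  have sabs: "s * \<bar>x\<bar> = \<bar>s * x\<bar>" for x using s(1) by (simp add: abs_mult)
  have gp: "good (- 1 / 2) (s / 2) \<sigma> \<longleftrightarrow> \<sigma> * (- m / 2 - k / 2) > \<bar>\<sigma> * (3 * m / 2 - k / 2)\<bar>" for \<sigma>
  proof -
    have "s * (\<sigma> * (m * (s / 2) + l * (- 1 / 2))) = \<sigma> * ((s * s) * m / 2 - k / 2)"
      by (simp add: k_def algebra_simps)
    moreover have "m * (- 1 / 2) - l * (s / 2) = - m / 2 - k / 2" by (simp add: k_def)
    ultimately show ?thesis unfolding good_def sabs s(2) by (simp only:)
  qed
  have gm: "good (- 1 / 2) (- s / 2) \<sigma> \<longleftrightarrow> \<sigma> * (- m / 2 + k / 2) > \<bar>\<sigma> * (3 * m / 2 + k / 2)\<bar>" for \<sigma>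
  proof -
    have "s * (\<sigma> * (m * (- s / 2) + l * (- 1 / 2))) = - (\<sigma> * ((s * s) * m / 2 + k / 2))"
      by (simp add: k_def algebra_simps)
    moreover have "m * (- 1 / 2) - l * (- s / 2) = - m / 2 + k / 2" by (simp add: k_def)
    ultimately show ?thesis unfolding good_def sabs s(2) by (simp only: abs_minus_cancel)
  qed
  have g0: "good 1 0 \<sigma> \<longleftrightarrow> \<sigma> * m > \<bar>\<sigma> * k\<bar>" for \<sigma>
    unfolding good_def sabs k_def by (simp add: mult.left_commute)
  have "m \<noteq> k" "m \<noteq> - k" using assms(2,3) by (simp_all add: k_def s_def)
  then consider "m > \<bar>k\<bar>" | "- m > \<bar>k\<bar>" | "m > 0" "m < k" | "m > 0" "m < - k"
    | "m < 0" "- m < k" | "m < 0" "- m < - k"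
    using assms(1) by argo
  then show ?thesis
  proof cases
    case 1
    then have "good 1 0 1" unfolding g0 by simp
    then show ?thesis by (intro use[OF _ c1]) simp_all
  next
    case 2
    then have "good 1 0 (- 1)" unfolding g0 by simp
    then show ?thesis by (intro use[OF _ c2]) simp_all
  next
    case 3
    then have "good (- 1 / 2) (s / 2) (- 1)" unfolding gp by argo
    then show ?thesis by (intro use[OF _ c3 sc(2,1)]) simp_all
  next
    case 6
    then have "good (- 1 / 2) (s / 2) 1" unfolding gp by argo
    then show ?thesis by (intro use[OF _ c4 d4]) simp_all
  next
    case 4
    then have "good (- 1 / 2) (- s / 2) (- 1)" unfolding gm by argo
    then show ?thesis by (intro use[OF _ c5 d5]) simp_all
  next
    case 5
    then have "good (- 1 / 2) (- s / 2) 1" unfolding gm by argo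
    then show ?thesis by (intro use[OF _ c6 d6]) simp_all
  qed
qed

section \<open>Blowing up the vertex set at the origin\<close>

abbreviation qx :: "((real \<times> real) \<times> real \<Rightarrow> real) \<Rightarrow> (real \<times> real) \<times> real \<Rightarrow> real" where "qx \<equiv> dd ((1, 0), 0)"
abbreviation qy :: "((real \<times> real) \<times> real \<Rightarrow> real) \<Rightarrow> (real \<times> real) \<times> real \<Rightarrow> real" where "qy \<equiv> dd ((0, 1), 0)"

definition pol_param :: "real \<times> real \<times> real \<Rightarrow> (real \<times> real) \<times> real" where
  "pol_param x = ((fst x * cos (fst (snd x)), fst x * sin (fst (snd x))), snd (snd x))"

lemma pol_param_simp: "pol_param (r, \<theta>, t) = (pol 0 r \<theta>, t)"
  by (simp add: pol_param_def pol_def)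

text \<open>The Taylor data of the deformation at the origin. The numbers \<open>l\<close> and \<open>m\<close> are the components of the velocity of
  its projection at \<open>t = 0\<close>.\<close>

locale umbilic_deformation =
  fixes F :: "(real \<times> real) \<times> real \<Rightarrow> real" and U :: "(real \<times> real) set" and \<tau> \<rho> a b c l m :: real
  assumes openU: "open U" and U0: "0 \<in> U" and tau: "\<tau> > 0"
    and smooth_F: "smooth_on (U \<times> {-\<tau><..<\<tau>}) F"
    and grad0: "\<bar>t\<bar> < \<tau> \<Longrightarrow> qx F (0, t) = 0" "\<bar>t\<bar> < \<tau> \<Longrightarrow> qy F (0, t) = 0"
    and hess0: "qx (qx F) (0, 0) = 2 * \<rho>" "qx (qy F) (0, 0) = 0" "qy (qy F) (0, 0) = 2 * \<rho>"
    and rho: "\<rho> \<noteq> 0"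
    and third0: "qx (qx (qx F)) (0, 0) = 6 * a" "qx (qx (qy F)) (0, 0) = 2 * b"
      "qx (qy (qy F)) (0, 0) = 2 * a" "qy (qy (qy F)) (0, 0) = 6 * c"
    and bc: "b \<noteq> c"
    and diag: "((\<lambda>t. qx (qx F) (0, t) - qy (qy F) (0, t)) has_real_derivative 4 * l) (at 0)"
    and mixed: "((\<lambda>t. qx (qy F) (0, t)) has_real_derivative 2 * m) (at 0)"
    and transverse: "m \<noteq> 0" "m \<noteq> sqrt 3 * l" "m \<noteq> - sqrt 3 * l"
begin

lemma open_dom: "open (U \<times> {-\<tau><..<\<tau>})" by (simp add: open_Times openU)

lemmas smooth_dd = smooth_on_frechet[where S="U \<times> {-\<tau><..<\<tau>}"]

lemma smooth_partials:
  "smooth_on (U \<times> {-\<tau><..<\<tau>}) (qx F)" "smooth_on (U \<times> {-\<tau><..<\<tau>}) (qy F)"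
  "smooth_on (U \<times> {-\<tau><..<\<tau>}) (qx (qx F))" "smooth_on (U \<times> {-\<tau><..<\<tau>}) (qx (qy F))"
  "smooth_on (U \<times> {-\<tau><..<\<tau>}) (qy (qy F))"
  "smooth_on (U \<times> {-\<tau><..<\<tau>}) (qx (qx (qx F)))" "smooth_on (U \<times> {-\<tau><..<\<tau>}) (qx (qx (qy F)))"
  "smooth_on (U \<times> {-\<tau><..<\<tau>}) (qx (qy (qy F)))" "smooth_on (U \<times> {-\<tau><..<\<tau>}) (qy (qy (qy F)))"
  by (intro smooth_dd smooth_F)+

lemma dom0: "\<bar>t\<bar> < \<tau> \<Longrightarrow> (0, t) \<in> U \<times> {-\<tau><..<\<tau>}" using U0 by (auto simp: abs_less_iff)

lemma partials_slice:
  assumes "\<forall>q\<in>U. h q = F (q, t)" "\<bar>t\<bar> < \<tau>" "p \<in> U"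
  shows "px h p = qx F (p, t)" "py h p = qy F (p, t)"
    "px (px h) p = qx (qx F) (p, t)" "px (py h) p = qx (qy F) (p, t)" "py (py h) p = qy (qy F) (p, t)"
    "px (px (px h)) p = qx (qx (qx F)) (p, t)" "px (px (py h)) p = qx (qx (qy F)) (p, t)"
    "px (py (py h)) p = qx (qy (qy F)) (p, t)" "py (py (py h)) p = qy (qy (qy F)) (p, t)"
proof -
  have t: "t \<in> {-\<tau><..<\<tau>}" using assms(2) by (simp add: abs_less_iff)
  have sl: "dd v k p = dd (v, 0) G (p, t)"
    if "\<And>q. q \<in> U \<Longrightarrow> k q = G (q, t)" "smooth_on (U \<times> {-\<tau><..<\<tau>}) G" "p \<in> U" for v and k :: "real \<times> real \<Rightarrow> real" and G p
    by (rule dd_slice[OF openU that(1,2,3) t])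
  have 1: "px h q = qx F (q, t)" "py h q = qy F (q, t)" if "q \<in> U" for q
    by (rule sl[OF bspec[OF assms(1)] smooth_F that]; assumption)+
  have 2: "px (px h) q = qx (qx F) (q, t)" "px (py h) q = qx (qy F) (q, t)" "py (py h) q = qy (qy F) (q, t)" if "q \<in> U" for q
    by (rule sl[OF 1(1) smooth_partials(1) that]; assumption) (rule sl[OF 1(2) smooth_partials(2) that]; assumption)+
  show "px h p = qx F (p, t)" "py h p = qy F (p, t)" by (rule 1[OF assms(3)])+
  show "px (px h) p = qx (qx F) (p, t)" "px (py h) p = qx (qy F) (p, t)" "py (py h) p = qy (qy F) (p, t)"
    by (rule 2[OF assms(3)])+
  show "px (px (px h)) p = qx (qx (qx F)) (p, t)" by (rule sl[OF 2(1) smooth_partials(3) assms(3)])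
  show "px (px (py h)) p = qx (qx (qy F)) (p, t)" by (rule sl[OF 2(2) smooth_partials(4) assms(3)])
  show "px (py (py h)) p = qx (qy (qy F)) (p, t)" by (rule sl[OF 2(3) smooth_partials(5) assms(3)])
  show "py (py (py h)) p = qy (qy (qy F)) (p, t)" by (rule sl[OF 2(3) smooth_partials(5) assms(3)])
qed

end

text \<open>The gradient in polar coordinates is \<open>r\<close> times the smooth field \<open>(a1, a2)\<close>.\<close>

locale umbilic_blowup = umbilic_deformation +
  fixes R1 :: real and a1 a2 :: "real \<times> real \<times> real \<Rightarrow> real"
  assumes R1: "R1 > 0" and ball: "ball 0 R1 \<subseteq> U"
    and smooth_a: "smooth_on ({-R1<..<R1} \<times> UNIV \<times> {-\<tau><..<\<tau>}) a1" "smooth_on ({-R1<..<R1} \<times> UNIV \<times> {-\<tau><..<\<tau>}) a2"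
    and grad_a: "\<bar>r\<bar> < R1 \<Longrightarrow> \<bar>t\<bar> < \<tau> \<Longrightarrow> qx F (pol 0 r \<theta>, t) = r * a1 (r, \<theta>, t)"
      "\<bar>r\<bar> < R1 \<Longrightarrow> \<bar>t\<bar> < \<tau> \<Longrightarrow> qy F (pol 0 r \<theta>, t) = r * a2 (r, \<theta>, t)"

lemma (in umbilic_deformation) smooth_pol_param:
  assumes "ball 0 R1 \<subseteq> U" "smooth_on (U \<times> {-\<tau><..<\<tau>}) G"
  shows "smooth_on ({-R1<..<R1} \<times> UNIV \<times> {-\<tau><..<\<tau>}) (\<lambda>x. G (pol_param x))"
proof (rule smooth_on_compose[OF assms(2) _ open_dom])
  have o: "open ({-R1<..<R1} \<times> (UNIV :: real set) \<times> {-\<tau><..<\<tau>})" by (intro open_Times) auto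
  then show "open ({-R1<..<R1} \<times> (UNIV :: real set) \<times> {-\<tau><..<\<tau>})" .
  show "smooth_on ({-R1<..<R1} \<times> (UNIV :: real set) \<times> {-\<tau><..<\<tau>}) pol_param"
    unfolding pol_param_def[abs_def] by (intro smooth_intros o)
  fix x :: "real \<times> real \<times> real" assume x: "x \<in> {-R1<..<R1} \<times> UNIV \<times> {-\<tau><..<\<tau>}"
  obtain r \<theta> t where [simp]: "x = (r, \<theta>, t)" by (cases x)
  have "pol 0 r \<theta> \<in> ball 0 R1" using x by (simp add: norm_pol abs_less_iff)
  then have "pol 0 r \<theta> \<in> U" using assms(1) by blast
  then show "pol_param x \<in> U \<times> {-\<tau><..<\<tau>}" using x by (simp add: pol_param_simp)
qed

lemma (in umbilic_deformation) blowup_ex: "\<exists>R1 a1 a2. umbilic_blowup F U \<tau> \<rho> a b c l m R1 a1 a2"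
proof -
  obtain R1 where R1: "R1 > 0" "ball 0 R1 \<subseteq> U" using openU U0 open_contains_ball by metis
  have Z: "open ((UNIV :: real set) \<times> {-\<tau><..<\<tau>})" by (intro open_Times) auto
  have div: "\<exists>g. smooth_on ({-R1<..<R1} \<times> UNIV \<times> {-\<tau><..<\<tau>}) g \<and>
      (\<forall>r \<theta> t. \<bar>r\<bar> < R1 \<longrightarrow> \<bar>t\<bar> < \<tau> \<longrightarrow> G (pol 0 r \<theta>, t) = r * g (r, \<theta>, t))"
    if G: "smooth_on (U \<times> {-\<tau><..<\<tau>}) G" "\<And>t. \<bar>t\<bar> < \<tau> \<Longrightarrow> G (0, t) = 0" for G :: "(real \<times> real) \<times> real \<Rightarrow> real"
  proof -
    have z: "G (pol_param (0, z)) = 0" if z: "z \<in> UNIV \<times> {-\<tau><..<\<tau>}" for z :: "real \<times> real"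
    proof -
      obtain \<theta> t where [simp]: "z = (\<theta>, t)" by (cases z)
      show ?thesis using G(2)[of t] z by (simp add: pol_param_simp pol_0 abs_less_iff)
    qed
    obtain g where g: "smooth_on ({-R1<..<R1} \<times> UNIV \<times> {-\<tau><..<\<tau>}) g"
      "\<forall>r z. \<bar>r\<bar> < R1 \<longrightarrow> z \<in> UNIV \<times> {-\<tau><..<\<tau>} \<longrightarrow> G (pol_param (r, z)) = r * g (r, z)"
      using hadamard_division[OF Z smooth_pol_param[OF R1(2) G(1)] z] by blast
    have "G (pol 0 r \<theta>, t) = r * g (r, \<theta>, t)" if "\<bar>r\<bar> < R1" "\<bar>t\<bar> < \<tau>" for r \<theta> t
      using g(2)[rule_format, of r "(\<theta>, t)"] that by (simp add: pol_param_simp abs_less_iff)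
    then show ?thesis using g(1) by blast
  qed
  obtain a1 where a1: "smooth_on ({-R1<..<R1} \<times> UNIV \<times> {-\<tau><..<\<tau>}) a1"
      "\<And>r \<theta> t. \<bar>r\<bar> < R1 \<Longrightarrow> \<bar>t\<bar> < \<tau> \<Longrightarrow> qx F (pol 0 r \<theta>, t) = r * a1 (r, \<theta>, t)"
    using div[OF smooth_partials(1) grad0(1)] by blast
  obtain a2 where a2: "smooth_on ({-R1<..<R1} \<times> UNIV \<times> {-\<tau><..<\<tau>}) a2"
      "\<And>r \<theta> t. \<bar>r\<bar> < R1 \<Longrightarrow> \<bar>t\<bar> < \<tau> \<Longrightarrow> qy F (pol 0 r \<theta>, t) = r * a2 (r, \<theta>, t)"
    using div[OF smooth_partials(2) grad0(2)] by blast
  have "umbilic_blowup F U \<tau> \<rho> a b c l m R1 a1 a2"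
    by unfold_locales (use R1 a1 a2 in blast)+
  then show ?thesis by blast
qed

context umbilic_blowup
begin

abbreviation cyl :: "(real \<times> real \<times> real) set" where "cyl \<equiv> {-R1<..<R1} \<times> UNIV \<times> {-\<tau><..<\<tau>}"

lemma open_cyl: "open cyl" by (intro open_Times) auto

lemma cyl_iff: "(r, \<theta>, t) \<in> cyl \<longleftrightarrow> \<bar>r\<bar> < R1 \<and> \<bar>t\<bar> < \<tau>" by (auto simp: abs_less_iff)

text \<open>The vertex polynomial in polar coordinates, divided by \<open>r\<^sup>4\<close>.\<close>

definition W :: "real \<times> real \<times> real \<Rightarrow> real" where
  "W x = vertex_poly (fst x) (a1 x) (a2 x)
     (qx (qx F) (pol_param x)) (qx (qy F) (pol_param x)) (qy (qy F) (pol_param x))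
     (qx (qx (qx F)) (pol_param x)) (qx (qx (qy F)) (pol_param x))
     (qx (qy (qy F)) (pol_param x)) (qy (qy (qy F)) (pol_param x))"

lemma smooth_W: "smooth_on cyl W"
  unfolding W_def[abs_def] vertex_poly_defs
  by (intro smooth_intros open_cyl smooth_a smooth_pol_param[OF ball] smooth_partials)

lemma pol_in_U: "\<bar>r\<bar> < R1 \<Longrightarrow> pol 0 r \<theta> \<in> U"
  by (rule subsetD[OF ball]) (simp add: norm_pol)

lemma vertex_fun_W:
  assumes "\<forall>q\<in>U. h q = F (q, t)" "\<bar>t\<bar> < \<tau>" "\<bar>r\<bar> < R1"
  shows "vertex_fun h (pol 0 r \<theta>) = r ^ 4 * W (r, \<theta>, t)"
  unfolding vertex_fun_def partials_slice[OF assms(1,2) pol_in_U[OF assms(3)]]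
    grad_a[OF assms(3,2)] vertex_poly_scale W_def fst_conv snd_conv pol_param_simp
  by (rule refl)

text \<open>Both coordinates describe the same point, and \<open>r\<^sup>4\<close> is even.\<close>

lemma W_sym:
  assumes "\<bar>r\<bar> < R1" "\<bar>t\<bar> < \<tau>" "r \<noteq> 0"
  shows "W (- r, \<theta> + pi, t) = W (r, \<theta>, t)"
proof -
  have "(- r) ^ 4 * W (- r, \<theta> + pi, t) = r ^ 4 * W (r, \<theta>, t)"
    using vertex_fun_W[of "\<lambda>p. F (p, t)" t "- r" "\<theta> + pi"] vertex_fun_W[of "\<lambda>p. F (p, t)" t r \<theta>] assms
    by (simp add: pol_neg)
  then show ?thesis using assms(3) by simp
qed

lemma deriv_along:
  fixes G :: "real \<times> real \<times> real \<Rightarrow> real"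
  assumes "smooth_on cyl G" "\<bar>t\<bar> < \<tau>" "\<bar>r\<bar> < R1"
  shows "((\<lambda>s. G (s, \<theta>, t)) has_real_derivative dd (1, 0, 0) G (r, \<theta>, t)) (at r)"
    "((\<lambda>s. G (r, \<theta>, s)) has_real_derivative dd (0, 0, 1) G (r, \<theta>, t)) (at t)"
proof -
  have x: "(r, \<theta>, t) \<in> cyl" using assms(2,3) by (simp only: cyl_iff)
  have v: "((\<lambda>s. (s, \<theta>, t)) has_vector_derivative (1, 0, 0)) (at r)" "((\<lambda>s. (r, \<theta>, s)) has_vector_derivative (0, 0, 1)) (at t)"
    by (intro has_vector_derivative_Pair has_vector_derivative_const has_vector_derivative_id)+
  show "((\<lambda>s. G (s, \<theta>, t)) has_real_derivative dd (1, 0, 0) G (r, \<theta>, t)) (at r)"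
    by (rule smooth_on_chain_real[OF assms(1) v(1) x])
  show "((\<lambda>s. G (r, \<theta>, s)) has_real_derivative dd (0, 0, 1) G (r, \<theta>, t)) (at t)"
    by (rule smooth_on_chain_real[OF assms(1) v(2) x])
qed

lemma isCont_along:
  fixes G :: "real \<times> real \<times> real \<Rightarrow> real"
  assumes "smooth_on cyl G" "\<bar>t\<bar> < \<tau>" "\<bar>r\<bar> < R1"
  shows "isCont (\<lambda>s. G (s, \<theta>, t)) r" "isCont (\<lambda>s. G (r, \<theta>, s)) t"
  by (rule DERIV_isCont[OF deriv_along(1)[OF assms]], rule DERIV_isCont[OF deriv_along(2)[OF assms]])

lemma radial_deriv:
  assumes "smooth_on (U \<times> {-\<tau><..<\<tau>}) G" "\<bar>t\<bar> < \<tau>"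
  shows "((\<lambda>r. G (pol 0 r \<theta>, t)) has_real_derivative cos \<theta> * qx G (0, t) + sin \<theta> * qy G (0, t)) (at 0)"
proof -
  have v: "((\<lambda>r. (pol 0 r \<theta>, t)) has_vector_derivative ((cos \<theta>, sin \<theta>), 0)) (at 0)"
    unfolding pol_def add_0
    by (intro has_vector_derivative_Pair has_vector_derivative_const)
      (auto intro!: derivative_eq_intros simp: has_real_derivative_iff_has_vector_derivative[symmetric])
  have x: "(pol 0 0 \<theta>, t) \<in> U \<times> {-\<tau><..<\<tau>}" using dom0[OF assms(2)] by (simp add: pol_0)
  have "((cos \<theta>, sin \<theta>), 0) = cos \<theta> *\<^sub>R ((1, 0), 0) + sin \<theta> *\<^sub>R ((0, 1), 0 :: real)" by simp
  then have "dd ((cos \<theta>, sin \<theta>), 0) G (pol 0 0 \<theta>, t) = dd (cos \<theta> *\<^sub>R ((1, 0), 0) + sin \<theta> *\<^sub>R ((0, 1), 0)) G (pol 0 0 \<theta>, t)"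
    by (rule arg_cong)
  also have "\<dots> = cos \<theta> * qx G (pol 0 0 \<theta>, t) + sin \<theta> * qy G (pol 0 0 \<theta>, t)"
    by (simp only: dd_add[OF assms(1) x] dd_scaleR[OF assms(1) x] real_scaleR_def)
  finally have "dd ((cos \<theta>, sin \<theta>), 0) G (pol 0 0 \<theta>, t) = cos \<theta> * qx G (0, t) + sin \<theta> * qy G (0, t)" by (simp only: pol_0)
  then show ?thesis using smooth_on_chain_real[OF assms(1) v x] by simp
qed

lemma a_0:
  assumes "\<bar>t\<bar> < \<tau>"
  shows "a1 (0, \<theta>, t) = cos \<theta> * qx (qx F) (0, t) + sin \<theta> * qx (qy F) (0, t)"
    "a2 (0, \<theta>, t) = cos \<theta> * qx (qy F) (0, t) + sin \<theta> * qy (qy F) (0, t)"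
proof -
  have R0: "\<bar>0\<bar> < R1" using R1 by simp
  note q = quotient_at_0[OF radial_deriv[OF _ assms] _ R1]
  have "a1 (0, \<theta>, t) = cos \<theta> * qx (qx F) (0, t) + sin \<theta> * qy (qx F) (0, t)"
    by (rule q[OF smooth_partials(1) _ grad_a(1)[OF _ assms] isCont_along(1)[OF smooth_a(1) assms R0]])
      (simp_all add: pol_0 grad0 assms)
  moreover have "qy (qx F) (0, t) = qx (qy F) (0, t)" by (rule dd_commute[OF open_dom smooth_F dom0[OF assms]])
  ultimately show "a1 (0, \<theta>, t) = cos \<theta> * qx (qx F) (0, t) + sin \<theta> * qx (qy F) (0, t)" by (simp only:)
  show "a2 (0, \<theta>, t) = cos \<theta> * qx (qy F) (0, t) + sin \<theta> * qy (qy F) (0, t)"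
    by (rule q[OF smooth_partials(2) _ grad_a(2)[OF _ assms] isCont_along(1)[OF smooth_a(2) assms R0]])
      (simp_all add: pol_0 grad0 assms)
qed

lemma tau0': "\<bar>0\<bar> < \<tau>" using tau by simp
lemma R10: "\<bar>0\<bar> < R1" using R1 by simp

lemma a_00: "a1 (0, \<theta>, 0) = 2 * \<rho> * cos \<theta>" "a2 (0, \<theta>, 0) = 2 * \<rho> * sin \<theta>"
  unfolding a_0[OF tau0'] hess0 by simp_all

text \<open>At an umbilic point the Hessian is a multiple of the identity, so it vanishes on orthogonal
  vectors.\<close>

lemma W_00: "W (0, \<theta>, 0) = 0"
  unfolding W_def vertex_poly_defs fst_conv pol_param_simp pol_0 hess0 by simp

lemma hess_deriv:
  "((\<lambda>r. qx (qx F) (pol 0 r \<theta>, 0)) has_real_derivative 6 * a * cos \<theta> + 2 * b * sin \<theta>) (at 0)"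
  "((\<lambda>r. qx (qy F) (pol 0 r \<theta>, 0)) has_real_derivative 2 * b * cos \<theta> + 2 * a * sin \<theta>) (at 0)"
  "((\<lambda>r. qy (qy F) (pol 0 r \<theta>, 0)) has_real_derivative 2 * a * cos \<theta> + 6 * c * sin \<theta>) (at 0)"
proof -
  note sw = dd_swap2[OF open_dom smooth_F dom0[OF tau0']]
  have m: "qy (qx (qx F)) (0, 0) = qx (qx (qy F)) (0, 0)" by (rule trans[OF sw(2) sw(1)])
  have m': "qy (qx (qy F)) (0, 0) = qx (qy (qy F)) (0, 0)" by (rule sw(2))
  show "((\<lambda>r. qx (qx F) (pol 0 r \<theta>, 0)) has_real_derivative 6 * a * cos \<theta> + 2 * b * sin \<theta>) (at 0)"
    using radial_deriv[OF smooth_partials(3) tau0', of \<theta>] unfolding m third0 by (simp add: mult_ac)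
  show "((\<lambda>r. qx (qy F) (pol 0 r \<theta>, 0)) has_real_derivative 2 * b * cos \<theta> + 2 * a * sin \<theta>) (at 0)"
    using radial_deriv[OF smooth_partials(4) tau0', of \<theta>] unfolding m' third0 by (simp add: mult_ac)
  show "((\<lambda>r. qy (qy F) (pol 0 r \<theta>, 0)) has_real_derivative 2 * a * cos \<theta> + 6 * c * sin \<theta>) (at 0)"
    using radial_deriv[OF smooth_partials(5) tau0', of \<theta>] unfolding third0 by (simp add: mult_ac)
qed

text \<open>With \<open>e = (cos \<theta>, sin \<theta>)\<close>, the field \<open>(a1, a2)\<close> is \<open>2 \<rho> e\<close> at the origin. The first summand of the vertex
  polynomial contributes the cubic form at the rotated vector, and the second one the derivative of the Hessian.
  The multiples of \<open>x\<^sup>2 + y\<^sup>2\<close> in the cubic form cancel, leaving its harmonic part, which is proportional to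
  \<open>b - c\<close>.\<close>

lemma W_deriv_r:
  "((\<lambda>r. W (r, \<theta>, 0)) has_real_derivative - 192 * \<rho> ^ 5 * (b - c) * cos (3 * \<theta>)) (at 0)"
proof -
  define C S where "C = cos \<theta>" and "S = sin \<theta>"
  have CS: "S\<^sup>2 = 1 - C\<^sup>2" by (simp add: C_def S_def sin_squared_eq)
  have sa: "isCont (\<lambda>r. a1 (r, \<theta>, 0)) 0" "isCont (\<lambda>r. a2 (r, \<theta>, 0)) 0"
    by (rule isCont_along(1)[OF smooth_a(1) tau0' R10], rule isCont_along(1)[OF smooth_a(2) tau0' R10])
  have sh: "isCont (\<lambda>r. G (pol 0 r \<theta>, 0)) 0" if "smooth_on (U \<times> {-\<tau><..<\<tau>}) G" for G :: "(real \<times> real) \<times> real \<Rightarrow> real"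
    by (rule DERIV_isCont[OF radial_deriv[OF that tau0']])
  define TT where "TT r = hess_tt (a1 (r, \<theta>, 0)) (a2 (r, \<theta>, 0)) (qx (qx F) (pol 0 r \<theta>, 0)) (qx (qy F) (pol 0 r \<theta>, 0)) (qy (qy F) (pol 0 r \<theta>, 0))" for r
  define TN where "TN r = hess_tn (a1 (r, \<theta>, 0)) (a2 (r, \<theta>, 0)) (qx (qx F) (pol 0 r \<theta>, 0)) (qx (qy F) (pol 0 r \<theta>, 0)) (qy (qy F) (pol 0 r \<theta>, 0))" for r
  define X where "X r = ((a1 (r, \<theta>, 0))\<^sup>2 + (a2 (r, \<theta>, 0))\<^sup>2) * third_ttt (a1 (r, \<theta>, 0)) (a2 (r, \<theta>, 0))
    (qx (qx (qx F)) (pol 0 r \<theta>, 0)) (qx (qx (qy F)) (pol 0 r \<theta>, 0)) (qx (qy (qy F)) (pol 0 r \<theta>, 0)) (qy (qy (qy F)) (pol 0 r \<theta>, 0))" for r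
  have W: "W (r, \<theta>, 0) = X r * r - 3 * TT r * TN r" for r
    by (simp add: W_def vertex_poly_def X_def TT_def TN_def pol_param_simp)
  have cX: "isCont X 0" unfolding X_def[abs_def] third_ttt_def by (intro continuous_intros sa sh smooth_partials)
  have cT: "isCont (\<lambda>r. 3 * TT r) 0" unfolding TT_def[abs_def] hess_tt_def by (intro continuous_intros sa sh smooth_partials)
  have X0: "X 0 = 192 * \<rho> ^ 5 * (- a * S ^ 3 + b * S\<^sup>2 * C - a * S * C\<^sup>2 + c * C ^ 3)"
  proof -
    have "X 0 = (4 * \<rho>\<^sup>2 * (C\<^sup>2 + S\<^sup>2)) * (8 * \<rho> ^ 3 * (- 6 * a * S ^ 3 + 6 * b * S\<^sup>2 * C - 6 * a * S * C\<^sup>2 + 6 * c * C ^ 3))"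
      unfolding X_def third_ttt_def pol_0 a_00 third0 C_def[symmetric] S_def[symmetric]
      by (simp add: power2_eq_square power3_eq_cube algebra_simps)
    then show ?thesis unfolding CS by (simp add: power2_eq_square power3_eq_cube algebra_simps power_numeral_reduce)
  qed
  have T0: "3 * TT 0 = 24 * \<rho> ^ 3"
  proof -
    have "3 * TT 0 = 24 * \<rho> ^ 3 * (C\<^sup>2 + S\<^sup>2)"
      unfolding TT_def hess_tt_def pol_0 a_00 hess0 C_def[symmetric] S_def[symmetric]
      by (simp add: power2_eq_square power3_eq_cube algebra_simps)
    then show ?thesis unfolding CS by simp
  qed
  define DN where "DN = (2 * \<rho> * C) * (2 * \<rho> * S) * ((2 * a * C + 6 * c * S) - (6 * a * C + 2 * b * S))
    + ((2 * \<rho> * C)\<^sup>2 - (2 * \<rho> * S)\<^sup>2) * (2 * b * C + 2 * a * S)"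
  have dN: "(TN has_real_derivative DN) (at 0)"
  proof -
    have 1: "((\<lambda>r. (a1 (r, \<theta>, 0) * a2 (r, \<theta>, 0)) * (qy (qy F) (pol 0 r \<theta>, 0) - qx (qx F) (pol 0 r \<theta>, 0)))
      has_real_derivative (a1 (0, \<theta>, 0) * a2 (0, \<theta>, 0)) * ((2 * a * C + 6 * c * S) - (6 * a * C + 2 * b * S))) (at 0)"
      unfolding C_def S_def
      by (rule deriv_mult_zero[where u="\<lambda>r. a1 (r, \<theta>, 0) * a2 (r, \<theta>, 0)", OF _ DERIV_diff[OF hess_deriv(3,1)]])
        (intro continuous_intros sa, simp add: pol_0 hess0)
    have 2: "((\<lambda>r. ((a1 (r, \<theta>, 0))\<^sup>2 - (a2 (r, \<theta>, 0))\<^sup>2) * qx (qy F) (pol 0 r \<theta>, 0))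
      has_real_derivative ((a1 (0, \<theta>, 0))\<^sup>2 - (a2 (0, \<theta>, 0))\<^sup>2) * (2 * b * C + 2 * a * S)) (at 0)"
      unfolding C_def S_def
      by (rule deriv_mult_zero[where u="\<lambda>r. (a1 (r, \<theta>, 0))\<^sup>2 - (a2 (r, \<theta>, 0))\<^sup>2", OF _ hess_deriv(2)])
        (intro continuous_intros sa, simp add: pol_0 hess0)
    have "(\<lambda>r. (a1 (r, \<theta>, 0) * a2 (r, \<theta>, 0)) * (qy (qy F) (pol 0 r \<theta>, 0) - qx (qx F) (pol 0 r \<theta>, 0))
      + ((a1 (r, \<theta>, 0))\<^sup>2 - (a2 (r, \<theta>, 0))\<^sup>2) * qx (qy F) (pol 0 r \<theta>, 0)) = TN"
      by (rule ext) (simp add: TN_def hess_tn_def)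
    then show ?thesis using DERIV_add[OF 1 2] unfolding a_00 DN_def C_def S_def by simp
  qed
  have N0: "TN 0 = 0" unfolding TN_def hess_tn_def pol_0 hess0 by simp
  have "((\<lambda>r. X r * r - 3 * TT r * TN r) has_real_derivative X 0 * 1 - 3 * TT 0 * DN) (at 0)"
    by (rule DERIV_diff[OF deriv_mult_zero[OF cX DERIV_ident] deriv_mult_zero[OF cT dN N0]]) simp
  moreover have "X 0 * 1 - 3 * TT 0 * DN = - 192 * \<rho> ^ 5 * (b - c) * cos (3 * \<theta>)"
  proof -
    have S3: "S ^ 3 = S * (1 - C\<^sup>2)" unfolding CS[symmetric] by (simp add: power2_eq_square power3_eq_cube)
    have x: "X 0 = 192 * \<rho> ^ 5 * (- a * S + b * C + (c - b) * C ^ 3)"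
      unfolding X0 S3 CS by (simp add: power2_eq_square power3_eq_cube algebra_simps)
    have "DN = 4 * \<rho>\<^sup>2 * (- 2 * a * S * C\<^sup>2 - 2 * a * S ^ 3 + (6 * c - 4 * b) * C * S\<^sup>2 + 2 * b * C ^ 3)"
      unfolding DN_def by (simp add: power2_eq_square power3_eq_cube algebra_simps)
    also have "\<dots> = 4 * \<rho>\<^sup>2 * (- 2 * a * S + (6 * c - 4 * b) * C + (6 * b - 6 * c) * C ^ 3)"
      unfolding S3 CS by (simp add: power2_eq_square power3_eq_cube algebra_simps)
    finally have n: "DN = 4 * \<rho>\<^sup>2 * (- 2 * a * S + (6 * c - 4 * b) * C + (6 * b - 6 * c) * C ^ 3)" .
    have p5: "\<rho> ^ 3 * \<rho>\<^sup>2 = \<rho> ^ 5" by (simp flip: power_add)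
    have "3 * TT 0 * DN = 96 * (\<rho> ^ 3 * \<rho>\<^sup>2) * (- 2 * a * S + (6 * c - 4 * b) * C + (6 * b - 6 * c) * C ^ 3)"
      unfolding T0 n by simp
    then have "X 0 * 1 - 3 * TT 0 * DN = - 192 * \<rho> ^ 5 * (b - c) * (4 * C ^ 3 - 3 * C)"
      unfolding p5 x by (simp add: algebra_simps)
    then show ?thesis unfolding C_def cos_treble_cos .
  qed
  ultimately show ?thesis unfolding W by simp
qed

text \<open>For \<open>r = 0\<close> only the Hessian remains, and to first order in \<open>t\<close> only its trace-free part, whose coordinates are
  \<open>\<lambda>\<close> and \<open>\<mu>\<close>, is seen by the mixed value on two orthogonal vectors.\<close>

lemma W_deriv_t:
  "((\<lambda>t. W (0, \<theta>, t)) has_real_derivative - 192 * \<rho> ^ 5 * (m * cos (2 * \<theta>) - l * sin (2 * \<theta>))) (at 0)"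
proof -
  define C S where "C = cos \<theta>" and "S = sin \<theta>"
  have sa: "isCont (\<lambda>t. a1 (0, \<theta>, t)) 0" "isCont (\<lambda>t. a2 (0, \<theta>, t)) 0"
    by (rule isCont_along(2)[OF smooth_a(1) tau0' R10], rule isCont_along(2)[OF smooth_a(2) tau0' R10])
  have sh: "isCont (\<lambda>t. G (0, t)) 0" if G: "smooth_on (U \<times> {-\<tau><..<\<tau>}) G" for G :: "(real \<times> real) \<times> real \<Rightarrow> real"
    using isCont_along(2)[OF smooth_pol_param[OF ball G] tau0' R10, of 0] by (simp add: pol_param_simp pol_0)
  define TT where "TT t = hess_tt (a1 (0, \<theta>, t)) (a2 (0, \<theta>, t)) (qx (qx F) (0, t)) (qx (qy F) (0, t)) (qy (qy F) (0, t))" for t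
  define TN where "TN t = hess_tn (a1 (0, \<theta>, t)) (a2 (0, \<theta>, t)) (qx (qx F) (0, t)) (qx (qy F) (0, t)) (qy (qy F) (0, t))" for t
  have W: "W (0, \<theta>, t) = - 3 * TT t * TN t" for t
    by (simp add: W_def vertex_poly_def TT_def TN_def pol_param_simp pol_0)
  have cT: "isCont (\<lambda>t. - 3 * TT t) 0" unfolding TT_def[abs_def] hess_tt_def by (intro continuous_intros sa sh smooth_partials)
  have T0: "- 3 * TT 0 = - 24 * \<rho> ^ 3"
  proof -
    have "- 3 * TT 0 = - 24 * \<rho> ^ 3 * (C\<^sup>2 + S\<^sup>2)"
      unfolding TT_def hess_tt_def a_00 hess0 C_def[symmetric] S_def[symmetric]
      by (simp add: power2_eq_square power3_eq_cube algebra_simps)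
    then show ?thesis by (simp add: C_def S_def)
  qed
  have dN: "(TN has_real_derivative 8 * \<rho>\<^sup>2 * (m * cos (2 * \<theta>) - l * sin (2 * \<theta>))) (at 0)"
  proof -
    have 1: "((\<lambda>t. (- (a1 (0, \<theta>, t) * a2 (0, \<theta>, t))) * (qx (qx F) (0, t) - qy (qy F) (0, t)))
      has_real_derivative (- (a1 (0, \<theta>, 0) * a2 (0, \<theta>, 0))) * (4 * l)) (at 0)"
      by (rule deriv_mult_zero[where u="\<lambda>t. - (a1 (0, \<theta>, t) * a2 (0, \<theta>, t))", OF _ diag])
        (intro continuous_intros sa, simp add: hess0)
    have 2: "((\<lambda>t. ((a1 (0, \<theta>, t))\<^sup>2 - (a2 (0, \<theta>, t))\<^sup>2) * qx (qy F) (0, t))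
      has_real_derivative ((a1 (0, \<theta>, 0))\<^sup>2 - (a2 (0, \<theta>, 0))\<^sup>2) * (2 * m)) (at 0)"
      by (rule deriv_mult_zero[where u="\<lambda>t. (a1 (0, \<theta>, t))\<^sup>2 - (a2 (0, \<theta>, t))\<^sup>2", OF _ mixed])
        (intro continuous_intros sa, simp add: hess0)
    have eq: "(\<lambda>t. (- (a1 (0, \<theta>, t) * a2 (0, \<theta>, t))) * (qx (qx F) (0, t) - qy (qy F) (0, t))
      + ((a1 (0, \<theta>, t))\<^sup>2 - (a2 (0, \<theta>, t))\<^sup>2) * qx (qy F) (0, t)) = TN"
      by (rule ext) (simp add: TN_def hess_tn_def algebra_simps)
    have "(- (a1 (0, \<theta>, 0) * a2 (0, \<theta>, 0))) * (4 * l) + ((a1 (0, \<theta>, 0))\<^sup>2 - (a2 (0, \<theta>, 0))\<^sup>2) * (2 * m)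
      = 8 * \<rho>\<^sup>2 * (m * cos (2 * \<theta>) - l * sin (2 * \<theta>))"
      unfolding a_00 cos_double sin_double by (simp add: power2_eq_square algebra_simps)
    then show ?thesis using DERIV_add[OF 1 2] unfolding eq by simp
  qed
  have N0: "TN 0 = 0" unfolding TN_def hess_tn_def hess0 by simp
  have "((\<lambda>t. - 3 * TT t * TN t) has_real_derivative - 3 * TT 0 * (8 * \<rho>\<^sup>2 * (m * cos (2 * \<theta>) - l * sin (2 * \<theta>)))) (at 0)"
    by (rule deriv_mult_zero[OF cT dN N0])
  moreover have "- 3 * TT 0 * (8 * \<rho>\<^sup>2 * (m * cos (2 * \<theta>) - l * sin (2 * \<theta>))) = - 192 * \<rho> ^ 5 * (m * cos (2 * \<theta>) - l * sin (2 * \<theta>))"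
  proof -
    have "\<rho> ^ 3 * \<rho>\<^sup>2 = \<rho> ^ 5" by (simp flip: power_add)
    then show ?thesis unfolding T0 by simp
  qed
  ultimately show ?thesis unfolding W by (simp only:)
qed

lemma W_split_ex:
  "\<exists>A B. smooth_on ({-R1<..<R1} \<times> UNIV) A \<and> smooth_on cyl B \<and>
    (\<forall>r \<theta> t. \<bar>r\<bar> < R1 \<longrightarrow> \<bar>t\<bar> < \<tau> \<longrightarrow> W (r, \<theta>, t) = r * A (r, \<theta>) + t * B (r, \<theta>, t)) \<and>
    (\<forall>\<theta>. A (0, \<theta>) = - 192 * \<rho> ^ 5 * (b - c) * cos (3 * \<theta>)) \<and>
    (\<forall>\<theta>. B (0, \<theta>, 0) = - 192 * \<rho> ^ 5 * (m * cos (2 * \<theta>) - l * sin (2 * \<theta>)))"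
proof -
  have oZ: "open ({-R1<..<R1} \<times> (UNIV :: real set))" by (intro open_Times) auto
  have sW0: "smooth_on ({-R1<..<R1} \<times> UNIV) (\<lambda>x. W (fst x, snd x, 0))"
    by (rule smooth_on_compose[OF smooth_W oZ open_cyl]) (use tau in \<open>auto intro!: smooth_intros oZ\<close>)
  obtain A where A: "smooth_on ({-R1<..<R1} \<times> UNIV) A" "\<And>r \<theta>. \<bar>r\<bar> < R1 \<Longrightarrow> W (r, \<theta>, 0) = r * A (r, \<theta>)"
    using hadamard_division[OF open_UNIV sW0] by (auto simp: W_00)
  have o1: "open ({-\<tau><..<\<tau>} \<times> {-R1<..<R1} \<times> (UNIV :: real set))" by (intro open_Times) auto
  have sW1: "smooth_on ({-\<tau><..<\<tau>} \<times> {-R1<..<R1} \<times> UNIV) (\<lambda>x. W (fst (snd x), snd (snd x), fst x) - W (fst (snd x), snd (snd x), 0))"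
    by (intro smooth_on_diff o1 smooth_on_compose[OF smooth_W o1 open_cyl])
      (use tau in \<open>auto intro!: smooth_intros o1\<close>)
  obtain B' where B': "smooth_on ({-\<tau><..<\<tau>} \<times> {-R1<..<R1} \<times> UNIV) B'"
    "\<forall>t z. \<bar>t\<bar> < \<tau> \<longrightarrow> z \<in> {-R1<..<R1} \<times> UNIV \<longrightarrow> W (fst z, snd z, t) - W (fst z, snd z, 0) = t * B' (t, z)"
    using hadamard_division[OF oZ sW1] by auto
  define B where "B x = B' (snd (snd x), fst x, fst (snd x))" for x
  have sB: "smooth_on cyl B" unfolding B_def[abs_def]
    by (rule smooth_on_compose[OF B'(1) open_cyl o1]) (auto intro!: smooth_intros open_cyl)
  have WB: "W (r, \<theta>, t) - W (r, \<theta>, 0) = t * B (r, \<theta>, t)" if "\<bar>r\<bar> < R1" "\<bar>t\<bar> < \<tau>" for r \<theta> t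
    using B'(2)[rule_format, of t "(r, \<theta>)"] that by (simp add: B_def abs_less_iff)
  have "W (r, \<theta>, t) = r * A (r, \<theta>) + t * B (r, \<theta>, t)" if "\<bar>r\<bar> < R1" "\<bar>t\<bar> < \<tau>" for r \<theta> t
    using WB[OF that, of \<theta>] A(2)[OF that(1), of \<theta>] by simp
  moreover have "A (0, \<theta>) = - 192 * \<rho> ^ 5 * (b - c) * cos (3 * \<theta>)" for \<theta>
  proof (rule quotient_at_0[OF W_deriv_r W_00 R1 A(2)])
    have x: "(0, \<theta>) \<in> {-R1<..<R1} \<times> UNIV" using R1 by simp
    have v: "((\<lambda>s. (s, \<theta>)) has_vector_derivative (1, 0)) (at 0)"
      by (intro has_vector_derivative_Pair has_vector_derivative_const has_vector_derivative_id)
    show "isCont (\<lambda>s. A (s, \<theta>)) 0" by (rule DERIV_isCont[OF smooth_on_chain_real[OF A(1) v x]])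
  qed
  moreover have "B (0, \<theta>, 0) = - 192 * \<rho> ^ 5 * (m * cos (2 * \<theta>) - l * sin (2 * \<theta>))" for \<theta>
    by (rule quotient_at_0[OF W_deriv_t W_00 tau _ isCont_along(2)[OF sB tau0' R10]])
      (use WB[OF R10] W_00 in simp)
  ultimately show ?thesis using A(1) sB by blast
qed

text \<open>The field \<open>(a1, a2)\<close> has norm \<open>2 \<bar>\<rho>\<bar>\<close> on the exceptional fibre, so it has no zeros nearby; one period
  of angles suffices.\<close>

lemma regular_ex:
  "\<exists>d>0. d \<le> R1 \<and> d \<le> \<tau> \<and>
    (\<forall>r \<theta> t. r \<noteq> 0 \<longrightarrow> \<bar>r\<bar> < d \<longrightarrow> \<bar>t\<bar> < d \<longrightarrow> qx F (pol 0 r \<theta>, t) \<noteq> 0 \<or> qy F (pol 0 r \<theta>, t) \<noteq> 0)"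
proof -
  let ?h = "\<lambda>r \<theta> t. (a1 (r, \<theta>, t))\<^sup>2 + (a2 (r, \<theta>, t))\<^sup>2"
  have cont: "continuous_on cyl (\<lambda>x. ?h (fst x) (fst (snd x)) (snd (snd x)))"
    by (simp, intro continuous_intros smooth_on_continuous smooth_a)
  have in0: "(0, \<theta>, 0) \<in> cyl" for \<theta> using R1 tau by simp
  have pos: "?h 0 \<theta> 0 > 0" for \<theta>
  proof -
    have "(2 * \<rho> * x)\<^sup>2 + (2 * \<rho> * y)\<^sup>2 = 4 * \<rho>\<^sup>2 * (x\<^sup>2 + y\<^sup>2)" for x y
      by (simp add: power_mult_distrib distrib_left)
    then have "?h 0 \<theta> 0 = 4 * \<rho>\<^sup>2 * ((cos \<theta>)\<^sup>2 + (sin \<theta>)\<^sup>2)" unfolding a_00 .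
    then show ?thesis using rho by simp
  qed
  have pi2: "(0::real) \<le> 2 * pi" by simp
  obtain e d where d: "e > 0" "d > 0" "\<And>r \<theta> t. \<bar>r\<bar> < d \<Longrightarrow> 0 - d < \<theta> \<Longrightarrow> \<theta> < 2 * pi + d \<Longrightarrow> \<bar>t\<bar> < d \<Longrightarrow>
      (r, \<theta>, t) \<in> cyl \<and> ?h r \<theta> t > e"
    by (rule segment_tube[where h="?h", OF open_cyl cont pi2 in0 pos]) blast
  define d' where "d' = min d (min R1 \<tau>)"
  have "qx F (pol 0 r \<theta>, t) \<noteq> 0 \<or> qy F (pol 0 r \<theta>, t) \<noteq> 0" if r: "r \<noteq> 0" "\<bar>r\<bar> < d'" "\<bar>t\<bar> < d'" for r \<theta> t
  proof -
    obtain \<psi> where \<psi>: "0 \<le> \<psi>" "\<psi> < 2 * pi" "cos \<theta> = cos \<psi>" "sin \<theta> = sin \<psi>"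
      by (rule sincos_total_2pi[of "cos \<theta>" "sin \<theta>"]) simp_all
    have eq: "pol 0 r \<theta> = pol 0 r \<psi>" by (simp add: pol_def \<psi>)
    have lt: "\<bar>r\<bar> < R1" "\<bar>t\<bar> < \<tau>" "\<bar>r\<bar> < d" "\<bar>t\<bar> < d" using r by (simp_all add: d'_def)
    have "?h r \<psi> t > 0" using d(3)[OF lt(3) _ _ lt(4), of \<psi>] d(1,2) \<psi>(1,2) by simp
    then have "a1 (r, \<psi>, t) \<noteq> 0 \<or> a2 (r, \<psi>, t) \<noteq> 0" by auto
    then show ?thesis unfolding eq grad_a[OF lt(1,2)] using r(1) by simp
  qed
  moreover have "d' > 0" "d' \<le> R1" "d' \<le> \<tau>" using d(2) R1 tau by (simp_all add: d'_def)
  ultimately show ?thesis by blast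
qed

lemma vertex_set_iff:
  assumes "\<forall>q\<in>U. h q = F (q, t)" "\<bar>t\<bar> < \<tau>" "\<bar>r\<bar> < R1" "r \<noteq> 0"
    and "qx F (pol 0 r \<theta>, t) \<noteq> 0 \<or> qy F (pol 0 r \<theta>, t) \<noteq> 0"
  shows "pol 0 r \<theta> \<in> vertex_set h \<longleftrightarrow> W (r, \<theta>, t) = 0"
proof -
  have sh: "smooth_on U h"
  proof (rule smooth_on_cong[OF openU])
    show "smooth_on U (\<lambda>q. F (q, t))"
      by (rule smooth_on_compose[OF smooth_F openU open_dom])
        (use assms(2) in \<open>auto intro!: smooth_intros openU simp: abs_less_iff\<close>)
  qed (use assms(1) in simp)
  note ps = partials_slice[OF assms(1,2) pol_in_U[OF assms(3)]]
  have "pol 0 r \<theta> \<noteq> 0" using assms(4) by (simp add: pol_eq_0_iff)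
  then have "pol 0 r \<theta> \<in> vertex_set h \<longleftrightarrow> level_curve_vertex h (pol 0 r \<theta>)" by (simp add: vertex_set_def)
  also have "\<dots> \<longleftrightarrow> vertex_fun h (pol 0 r \<theta>) = 0"
    by (rule level_curve_vertex_iff[OF openU sh pol_in_U[OF assms(3)]]) (simp only: ps assms(5))
  also have "\<dots> \<longleftrightarrow> W (r, \<theta>, t) = 0" unfolding vertex_fun_W[OF assms(1-3)] using assms(4) by simp
  finally show ?thesis .
qed

text \<open>Rotating by \<open>\<beta>\<close> and dividing both \<open>A\<close> and \<open>B\<close> by the constant \<open>K\<close> that normalizes \<open>A (0, \<cdot>)\<close> to \<open>cos (3 \<phi>)\<close> leaves
  the zero set of \<open>r A + t B\<close> as it is.\<close>

lemma family_ex: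
  assumes g: "\<And>t. \<bar>t\<bar> < \<tau> \<Longrightarrow> \<forall>q\<in>U. g t q = F (q, t)" and g0: "\<forall>q\<in>U. g0 q = F (q, 0)"
  shows "\<exists>A B R0 \<tau>0 P Q \<beta>. umbilic_family A B R0 \<tau>0 P Q \<beta> (vertex_set g0) (\<lambda>t. vertex_set (g t))"
proof -
  obtain A B where smooth: "smooth_on ({-R1<..<R1} \<times> UNIV) A" "smooth_on cyl B"
    and W: "\<And>r \<theta> t. \<bar>r\<bar> < R1 \<Longrightarrow> \<bar>t\<bar> < \<tau> \<Longrightarrow> W (r, \<theta>, t) = r * A (r, \<theta>) + t * B (r, \<theta>, t)"
    and A0: "\<And>\<theta>. A (0, \<theta>) = - 192 * \<rho> ^ 5 * (b - c) * cos (3 * \<theta>)"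
    and B0: "\<And>\<theta>. B (0, \<theta>, 0) = - 192 * \<rho> ^ 5 * (m * cos (2 * \<theta>) - l * sin (2 * \<theta>))"
    using W_split_ex by blast
  obtain d where d: "d > 0" "d \<le> R1" "d \<le> \<tau>"
    and reg: "\<And>r \<theta> t. r \<noteq> 0 \<Longrightarrow> \<bar>r\<bar> < d \<Longrightarrow> \<bar>t\<bar> < d \<Longrightarrow> qx F (pol 0 r \<theta>, t) \<noteq> 0 \<or> qy F (pol 0 r \<theta>, t) \<noteq> 0"
    using regular_ex by blast
  have "b - c \<noteq> 0" using bc by simp
  then have "m / (b - c) \<noteq> 0" "m / (b - c) \<noteq> sqrt 3 * (l / (b - c))" "m / (b - c) \<noteq> - sqrt 3 * (l / (b - c))"
    using transverse bc by (simp_all only: times_divide_eq_right divide_cancel_right divide_eq_0_iff right_minus_eq) blast+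
  from rotation_ex[OF this] obtain \<beta> \<sigma> where \<sigma>: "\<sigma> = 1 \<or> \<sigma> = - 1"
    and c3: "\<And>\<phi>. cos (3 * (\<beta> + \<phi>)) = \<sigma> * cos (3 * \<phi>)"
    and PQ: "\<sigma> * (m / (b - c) * cos (2 * \<beta>) - l / (b - c) * sin (2 * \<beta>))
      > sqrt 3 * \<bar>\<sigma> * (m / (b - c) * sin (2 * \<beta>) + l / (b - c) * cos (2 * \<beta>))\<bar>"
    by blast
  define K where "K = - 192 * \<rho> ^ 5 * (b - c) * \<sigma>"
  have K: "K \<noteq> 0" using rho bc \<sigma> by (auto simp: K_def)
  define P where "P = \<sigma> * (m / (b - c) * cos (2 * \<beta>) - l / (b - c) * sin (2 * \<beta>))"
  define Q where "Q = - (\<sigma> * (m / (b - c) * sin (2 * \<beta>) + l / (b - c) * cos (2 * \<beta>)))"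
  define A1 where "A1 x = A (fst x, \<beta> + snd x) / K" for x :: "real \<times> real"
  define B1 where "B1 x = B (fst x, \<beta> + fst (snd x), snd (snd x)) / K" for x :: "real \<times> real \<times> real"
  have A10: "A1 (0, \<phi>) = cos (3 * \<phi>)" for \<phi>
  proof -
    have "A (0, \<beta> + \<phi>) = K * cos (3 * \<phi>)" unfolding A0 c3 K_def by simp
    then show ?thesis using K by (simp add: A1_def)
  qed
  have B10: "B1 (0, \<phi>, 0) = P * cos (2 * \<phi>) + Q * sin (2 * \<phi>)" for \<phi>
  proof -
    have e: "2 * (\<beta> + \<phi>) = 2 * \<beta> + 2 * \<phi>" by simp
    have s1: "\<sigma> * \<sigma> = 1" using \<sigma> by auto
    have bc1: "(b - c) * (m / (b - c) * x - l / (b - c) * y) = m * x - l * y"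
      "(b - c) * (m / (b - c) * x + l / (b - c) * y) = m * x + l * y" for x y
      using bc by (simp_all add: distrib_left right_diff_distrib)
    have "K * P = - 192 * \<rho> ^ 5 * ((\<sigma> * \<sigma>) * ((b - c) * (m / (b - c) * cos (2 * \<beta>) - l / (b - c) * sin (2 * \<beta>))))"
      unfolding K_def P_def by (simp only: mult_ac)
    then have "K * P = - 192 * \<rho> ^ 5 * ((\<sigma> * \<sigma>) * (m * cos (2 * \<beta>) - l * sin (2 * \<beta>)))" unfolding bc1 .
    moreover have "K * Q = - 192 * \<rho> ^ 5 * (- ((\<sigma> * \<sigma>) * ((b - c) * (m / (b - c) * sin (2 * \<beta>) + l / (b - c) * cos (2 * \<beta>)))))"
      unfolding K_def Q_def by (simp only: mult_minus_right mult_minus_left mult_ac)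
    then have "K * Q = - 192 * \<rho> ^ 5 * (- ((\<sigma> * \<sigma>) * (m * sin (2 * \<beta>) + l * cos (2 * \<beta>))))" unfolding bc1 .
    ultimately have KPQ: "K * P = - 192 * \<rho> ^ 5 * (m * cos (2 * \<beta>) - l * sin (2 * \<beta>))"
      "K * Q = - 192 * \<rho> ^ 5 * (- (m * sin (2 * \<beta>) + l * cos (2 * \<beta>)))" unfolding s1 by simp_all
    have "B (0, \<beta> + \<phi>, 0) = (K * P) * cos (2 * \<phi>) + (K * Q) * sin (2 * \<phi>)"
      unfolding B0 KPQ e cos_add sin_add by (simp add: algebra_simps)
    also have "\<dots> = K * (P * cos (2 * \<phi>) + Q * sin (2 * \<phi>))" by (simp add: distrib_left mult.assoc)
    finally show ?thesis using K by (simp add: B1_def)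
  qed
  have rot: "pol \<beta> r \<phi> = pol 0 r (\<beta> + \<phi>)" for r \<phi> by (simp add: pol_def)
  have WK: "W (r, \<beta> + \<phi>, t) = K * (r * A1 (r, \<phi>) + t * B1 (r, \<phi>, t))" if "\<bar>r\<bar> < R1" "\<bar>t\<bar> < \<tau>" for r \<phi> t
    using K unfolding W[OF that] by (simp add: A1_def B1_def distrib_left)
  have oA: "open ({-d<..<d} \<times> (UNIV :: real set))" "open ({-R1<..<R1} \<times> (UNIV :: real set))" by (auto intro: open_Times)
  have oB: "open ({-d<..<d} \<times> (UNIV :: real set) \<times> {-d<..<d})" by (intro open_Times) auto
  have "umbilic_family A1 B1 d d P Q \<beta> (vertex_set g0) (\<lambda>t. vertex_set (g t))"
  proof (unfold_locales)
    show "smooth_on ({-d<..<d} \<times> UNIV) A1"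
      unfolding A1_def[abs_def]
    proof (rule smooth_on_divide[OF oA(1) _ smooth_on_const[OF oA(1)] K])
      show "smooth_on ({-d<..<d} \<times> UNIV) (\<lambda>x. A (fst x, \<beta> + snd x))"
        by (rule smooth_on_compose[OF smooth(1) oA]) (use d in \<open>auto intro!: smooth_intros oA(1)\<close>)
    qed
    show "smooth_on ({-d<..<d} \<times> UNIV \<times> {-d<..<d}) B1"
      unfolding B1_def[abs_def]
    proof (rule smooth_on_divide[OF oB _ smooth_on_const[OF oB] K])
      show "smooth_on ({-d<..<d} \<times> UNIV \<times> {-d<..<d}) (\<lambda>x. B (fst x, \<beta> + fst (snd x), snd (snd x)))"
        by (rule smooth_on_compose[OF smooth(2) oB open_cyl]) (use d in \<open>auto intro!: smooth_intros oB\<close>)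
    qed
    show "A1 (0, \<phi>) = cos (3 * \<phi>)" for \<phi> by (rule A10)
    show "B1 (0, \<phi>, 0) = P * cos (2 * \<phi>) + Q * sin (2 * \<phi>)" for \<phi> by (rule B10)
    show "P > sqrt 3 * \<bar>Q\<bar>" using PQ unfolding P_def Q_def abs_minus_cancel .
    show "A1 (- r, \<phi> + pi) = - A1 (r, \<phi>)" if r: "\<bar>r\<bar> < d" for r \<phi>
    proof (cases "r = 0")
      case True
      have "cos (3 * (\<phi> + pi)) = - cos (3 * \<phi>)"
        using cos_periodic_pi[of "3 * \<phi>"] cos_periodic[of "3 * \<phi> + pi"] by (simp add: algebra_simps)
      then show ?thesis using True by (simp add: A10)
    next
      case False
      have rR: "\<bar>r\<bar> < R1" "\<bar>- r\<bar> < R1" using r d by simp_all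
      have "W (- r, \<beta> + (\<phi> + pi), 0) = W (r, \<beta> + \<phi>, 0)"
        using W_sym[OF rR(1) tau0' False, of "\<beta> + \<phi>"] by (simp add: add.assoc)
      then have "K * (- r * A1 (- r, \<phi> + pi)) = K * (r * A1 (r, \<phi>))"
        unfolding WK[OF rR(1) tau0'] WK[OF rR(2) tau0'] by simp
      then have "- r * A1 (- r, \<phi> + pi) = r * A1 (r, \<phi>)" using K mult_left_cancel by blast
      then have "r * A1 (- r, \<phi> + pi) = r * (- A1 (r, \<phi>))" by simp
      then show ?thesis using False mult_left_cancel by blast
    qed
    show "0 \<in> vertex_set g0" "0 \<in> vertex_set (g t)" for t by (simp_all add: vertex_set_def)
    show "pol \<beta> r \<phi> \<in> vertex_set g0 \<longleftrightarrow> A1 (r, \<phi>) = 0" if r: "r \<noteq> 0" "\<bar>r\<bar> < d" for r \<phi>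
    proof -
      have lt: "\<bar>r\<bar> < R1" "\<bar>0\<bar> < d" using r d by simp_all
      show ?thesis
        unfolding rot vertex_set_iff[OF g0 tau0' lt(1) r(1) reg[OF r lt(2)]] WK[OF lt(1) tau0']
        using K r(1) by simp
    qed
    show "pol \<beta> r \<phi> \<in> vertex_set (g t) \<longleftrightarrow> r * A1 (r, \<phi>) + t * B1 (r, \<phi>, t) = 0"
      if r: "r \<noteq> 0" "\<bar>r\<bar> < d" "t \<noteq> 0" "\<bar>t\<bar> < d" for r \<phi> t
    proof -
      have lt: "\<bar>r\<bar> < R1" "\<bar>t\<bar> < \<tau>" using r d by simp_all
      show ?thesis
        unfolding rot vertex_set_iff[OF g[OF lt(2)] lt(2,1) r(1) reg[OF r(1,2,4)]] WK[OF lt]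
        using K by simp
    qed
  qed (use d in simp_all)
  then show ?thesis by blast
qed

end

section \<open>From the deformation to its Taylor data\<close>

lemma hom_part_2_umbilic:
  assumes "open U" "smooth_on U g" "0 \<in> U" and q: "\<And>x y. hom_part 2 g (x, y) = \<alpha> * x\<^sup>2 + \<beta> * x * y + \<gamma> * y\<^sup>2"
  shows "px (px g) 0 = 2 * \<alpha>" "px (py g) 0 = \<beta>" "py (py g) 0 = 2 * \<gamma>"
proof -
  have e: "(x\<^sup>2 * px (px g) 0 + 2 * x * y * px (py g) 0 + y\<^sup>2 * py (py g) 0) / 2 = \<alpha> * x\<^sup>2 + \<beta> * x * y + \<gamma> * y\<^sup>2" for x y
    using hom_part_plane(2)[OF assms(1-3), of "(x, y)"] unfolding q by simp
  show "px (px g) 0 = 2 * \<alpha>" "py (py g) 0 = 2 * \<gamma>" using e[of 1 0] e[of 0 1] by simp_all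
  then show "px (py g) 0 = \<beta>" using e[of 1 1] by simp
qed

lemma hom_part_3_coeffs:
  assumes "open U" "smooth_on U g" "0 \<in> U"
    and q: "\<And>x y. hom_part 3 g (x, y) = a * x ^ 3 + b * x\<^sup>2 * y + a' * x * y\<^sup>2 + c * y ^ 3"
  shows "px (px (px g)) 0 = 6 * a" "px (px (py g)) 0 = 2 * b" "px (py (py g)) 0 = 2 * a'" "py (py (py g)) 0 = 6 * c"
proof -
  have e: "(x ^ 3 * px (px (px g)) 0 + 3 * x\<^sup>2 * y * px (px (py g)) 0 + 3 * x * y\<^sup>2 * px (py (py g)) 0 + y ^ 3 * py (py (py g)) 0) / 6
    = a * x ^ 3 + b * x\<^sup>2 * y + a' * x * y\<^sup>2 + c * y ^ 3" for x y
    using hom_part_plane(3)[OF assms(1-3), of "(x, y)"] unfolding q by simp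
  show 1: "px (px (px g)) 0 = 6 * a" "py (py (py g)) 0 = 6 * c" using e[of 1 0] e[of 0 1] by simp_all
  have "3 * px (px (py g)) 0 + 3 * px (py (py g)) 0 = 6 * b + 6 * a'" using e[of 1 1] 1 by simp
  moreover have "3 * px (py (py g)) 0 - 3 * px (px (py g)) 0 = 6 * a' - 6 * b" using e[of 1 "- 1"] 1 by simp
  ultimately show "px (px (py g)) 0 = 2 * b" "px (py (py g)) 0 = 2 * a'" by simp_all
qed

theorem theorem4:
  fixes f0 :: "real \<times> real \<Rightarrow> real"
    and R :: "(real \<times> real) \<times> real \<Rightarrow> real"
    and f :: "real \<Rightarrow> real \<times> real \<Rightarrow> real"
    and U :: "(real \<times> real) set"
    and \<tau> a b c :: real
    and lm :: "real \<Rightarrow> real \<times> real"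
    and V :: "real \<Rightarrow> (real \<times> real) set"
  assumes "open U" and "0 \<in> U" and "0 < \<tau>"
    and "smooth_on U f0"
    and "generic_umbilic f0"
    and "\<And>x y. hom_part 3 f0 (x, y) = a * x ^ 3 + b * x\<^sup>2 * y + a * x * y\<^sup>2 + c * y ^ 3"
    and "smooth_on (U \<times> {-\<tau><..<\<tau>}) R"
    and "\<And>p. p \<in> U \<Longrightarrow> R (p, 0) = 0"
    and "\<And>t. \<bar>t\<bar> < \<tau> \<Longrightarrow> R (0, t) = 0"
    and "\<And>t v. \<bar>t\<bar> < \<tau> \<Longrightarrow> hom_part 1 (\<lambda>p. R (p, t)) v = 0"
    and "\<And>t p. f t p = f0 p + R (p, t)"
    and "\<And>t. \<bar>t\<bar> < \<tau> \<Longrightarrow> projects_to (hom_part 2 f0) (hom_part 2 (f t)) (lm t)"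
    and "transversal_at_0 lm {(l, m). m = 0}"
    and "transversal_at_0 lm {(l, m). m = sqrt 3 * l}"
    and "transversal_at_0 lm {(l, m). m = - sqrt 3 * l}"
    and "\<And>t. V t = vertex_set (f t)"
  shows "\<exists>r0>0. \<forall>r. 0 < r \<and> r < r0 \<longrightarrow>
    (\<exists>\<gamma>1 \<gamma>2 \<gamma>3. labelled_branches r (vertex_set f0) \<gamma>1 \<gamma>2 \<gamma>3 \<and>
       nonorigin_branch_deforms r V (at_left 0) (half_pos \<gamma>1 \<union> half_pos \<gamma>2)) \<and>
    (\<forall>\<gamma>1 \<gamma>2 \<gamma>3. labelled_branches r (vertex_set f0) \<gamma>1 \<gamma>2 \<gamma>3 \<and>
       nonorigin_branch_deforms r V (at_left 0) (half_pos \<gamma>1 \<union> half_pos \<gamma>2) \<longrightarrow>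
       nonorigin_branch_deforms r V (at_right 0) (half_neg \<gamma>1 \<union> half_neg \<gamma>2))"
proof -
  note U = assms(1,2) and tau = assms(3) and sf0 = assms(4) and cubic = assms(6) and sR = assms(7)
    and R0 = assms(8) and R1 = assms(10) and f = assms(11) and proj = assms(12)
  define F where "F x = f0 (fst x) + R x" for x
  have fF: "f t p = F (p, t)" for t p by (simp add: F_def f)
  have f0F: "f0 p = F (p, 0)" if "p \<in> U" for p using R0[OF that] by (simp add: F_def)
  have oUI: "open (U \<times> {-\<tau><..<\<tau>})" using U(1) by (simp add: open_Times)
  have sF: "smooth_on (U \<times> {-\<tau><..<\<tau>}) F"
    unfolding F_def[abs_def]
    by (intro smooth_on_add oUI sR smooth_on_compose[OF sf0 oUI U(1)])
      (auto intro: smooth_on_bounded_linear bounded_linear_fst oUI)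
  have slice: "smooth_on U (\<lambda>p. G (p, t))" if "smooth_on (U \<times> {-\<tau><..<\<tau>}) G" "\<bar>t\<bar> < \<tau>" for G :: "(real \<times> real) \<times> real \<Rightarrow> real" and t
    by (rule smooth_on_compose[OF that(1) U(1) oUI])
      (use that(2) in \<open>auto intro!: smooth_intros U(1) simp: abs_less_iff\<close>)
  have sft: "smooth_on U (f t)" if "\<bar>t\<bar> < \<tau>" for t
    using slice[OF sF that] by (simp add: fF[symmetric])
  obtain \<rho> where \<rho>: "\<rho> \<noteq> 0" "\<And>x y. hom_part 2 f0 (x, y) = \<rho> * (x\<^sup>2 + y\<^sup>2)"
    and lin0: "\<And>v. hom_part 1 f0 v = 0"
    and nodiv: "\<And>\<alpha> \<beta>. \<not> (\<forall>x y. hom_part 3 f0 (x, y) = (\<alpha> * x + \<beta> * y) * hom_part 2 f0 (x, y))"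
    using assms(5) unfolding generic_umbilic_def by blast
  \<comment> \<open>Otherwise the cubic part is \<open>(a x + c y) (x\<^sup>2 + y\<^sup>2)\<close>.\<close>
  have bc: "b \<noteq> c"
  proof
    assume "b = c"
    then have "hom_part 3 f0 (x, y) = (a / \<rho> * x + c / \<rho> * y) * hom_part 2 f0 (x, y)" for x y
      using \<rho>(1) unfolding cubic \<rho>(2) by (simp add: field_simps power2_eq_square power3_eq_cube)
    then show False using nodiv by blast
  qed
  obtain v where v: "(lm has_vector_derivative v) (at 0)" "v \<notin> {(l, m). m = 0}"
    using assms(13) unfolding transversal_at_0_def by blast
  obtain v' where v': "(lm has_vector_derivative v') (at 0)" "v' \<notin> {(l, m). m = sqrt 3 * l}"
    using assms(14) unfolding transversal_at_0_def by blast
  obtain v'' where v'': "(lm has_vector_derivative v'') (at 0)" "v'' \<notin> {(l, m). m = - sqrt 3 * l}"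
    using assms(15) unfolding transversal_at_0_def by blast
  have vv: "v' = v" "v'' = v" by (rule vector_derivative_unique_at[OF v'(1) v(1)], rule vector_derivative_unique_at[OF v''(1) v(1)])
  have tv: "snd v \<noteq> 0" "snd v \<noteq> sqrt 3 * fst v" "snd v \<noteq> - sqrt 3 * fst v"
    using v(2) v'(2) v''(2) unfolding vv by (auto simp: case_prod_beta)
  have t0: "\<bar>0\<bar> < \<tau>" using tau by simp
  have tI: "t \<in> {-\<tau><..<\<tau>}" if "\<bar>t\<bar> < \<tau>" for t using that by (simp add: abs_less_iff)
  have dF: "smooth_on (U \<times> {-\<tau><..<\<tau>}) (dd w F)" for w by (rule smooth_on_frechet[OF sF])
  have ddF: "smooth_on (U \<times> {-\<tau><..<\<tau>}) (dd w' (dd w F))" for w w' by (rule smooth_on_frechet[OF dF])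
  have partial1: "dd u h p = dd (u, 0) F (p, t)"
    if "\<And>q. q \<in> U \<Longrightarrow> h q = F (q, t)" "\<bar>t\<bar> < \<tau>" "p \<in> U" for u h p t
    by (rule dd_slice[OF U(1) that(1) sF that(3) tI[OF that(2)]])
  have partial2: "dd w (dd u h) p = dd (w, 0) (dd (u, 0) F) (p, t)"
    if h: "\<And>q. q \<in> U \<Longrightarrow> h q = F (q, t)" "\<bar>t\<bar> < \<tau>" "p \<in> U" for u w h p t
    by (rule dd_slice[OF U(1) partial1[OF h(1,2)] dF h(3) tI[OF h(2)]])
  have partial3: "dd z (dd w (dd u h)) p = dd (z, 0) (dd (w, 0) (dd (u, 0) F)) (p, t)"
    if h: "\<And>q. q \<in> U \<Longrightarrow> h q = F (q, t)" "\<bar>t\<bar> < \<tau>" "p \<in> U" for u w z h p t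
    by (rule dd_slice[OF U(1) partial2[OF h(1,2)] ddF h(3) tI[OF h(2)]])
  have grad: "dd (u, 0) F (0, t) = 0" if t: "\<bar>t\<bar> < \<tau>" for u t
  proof -
    have d1: "(f0 has_derivative frechet_derivative f0 (at 0)) (at 0)"
      by (rule smooth_on_has_derivative[OF sf0 U(2)])
    have d2: "((\<lambda>p. R (p, t)) has_derivative frechet_derivative (\<lambda>p. R (p, t)) (at 0)) (at 0)"
      by (rule smooth_on_has_derivative[OF slice[OF sR t] U(2)])
    have "((\<lambda>p. f0 p + R (p, t)) has_derivative (\<lambda>h. frechet_derivative f0 (at 0) h + frechet_derivative (\<lambda>p. R (p, t)) (at 0) h)) (at 0)"
      by (rule has_derivative_add[OF d1 d2])
    then have "(f t has_derivative (\<lambda>h. frechet_derivative f0 (at 0) h + frechet_derivative (\<lambda>p. R (p, t)) (at 0) h)) (at 0)"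
      unfolding f[symmetric] .
    from frechet_derivative_at[OF this] have "dd u (f t) 0 = dd u f0 0 + dd u (\<lambda>p. R (p, t)) 0" by metis
    moreover have "dd u f0 0 = 0" "dd u (\<lambda>p. R (p, t)) 0 = 0"
      using lin0[of u] R1[OF t, of u] by (simp_all add: hom_part_def)
    ultimately show ?thesis using partial1[OF fF t U(2), of u] by simp
  qed
  have hess: "\<exists>s. qx (qx F) (0, t) = 2 * (\<rho> + fst (lm t) + s) \<and> qx (qy F) (0, t) = 2 * snd (lm t) \<and>
      qy (qy F) (0, t) = 2 * (\<rho> - fst (lm t) + s)" if t: "\<bar>t\<bar> < \<tau>" for t
  proof -
    obtain s where s: "\<And>x y. hom_part 2 (f t) (x, y) =
        (hom_part 2 f0 (x, y) + fst (lm t) * (x\<^sup>2 - y\<^sup>2) + snd (lm t) * (2 * x * y)) + s * (x\<^sup>2 + y\<^sup>2)"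
      using proj[OF t] unfolding projects_to_def by blast
    have q: "hom_part 2 (f t) (x, y) = (\<rho> + fst (lm t) + s) * x\<^sup>2 + (2 * snd (lm t)) * x * y + (\<rho> - fst (lm t) + s) * y\<^sup>2" for x y
      unfolding s \<rho>(2) by (simp add: algebra_simps)
    show ?thesis
      using hom_part_2_umbilic[OF U(1) sft[OF t] U(2) q] unfolding partial2[OF fF t U(2)] by blast
  qed
  have q0: "hom_part 2 f0 (x, y) = \<rho> * x\<^sup>2 + 0 * x * y + \<rho> * y\<^sup>2" for x y
    unfolding \<rho>(2) by (simp add: distrib_left)
  have p2: "dd w (dd u f0) 0 = dd (w, 0) (dd (u, 0) F) (0, 0)" for u w by (rule partial2[OF f0F t0 U(2)])
  have p3: "dd z (dd w (dd u f0)) 0 = dd (z, 0) (dd (w, 0) (dd (u, 0) F)) (0, 0)" for u w z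
    by (rule partial3[OF f0F t0 U(2)])
  note h0 = hom_part_2_umbilic[OF U(1) sf0 U(2) q0, unfolded p2]
  note k0 = hom_part_3_coeffs[OF U(1) sf0 U(2) cubic, unfolded p3]
  note lmd = has_real_derivative_fst_snd[OF v(1)]
  have ball: "0 \<in> {-\<tau><..<\<tau>}" "open {-\<tau><..<\<tau>}" using tau by simp_all
  have diag: "((\<lambda>t. qx (qx F) (0, t) - qy (qy F) (0, t)) has_real_derivative 4 * fst v) (at 0)"
  proof (rule has_field_derivative_transform_within_open[OF DERIV_cmult[OF lmd(1), of 4] ball(2,1)])
    fix t assume "t \<in> {-\<tau><..<\<tau>}"
    then have "\<bar>t\<bar> < \<tau>" by (simp add: abs_less_iff)
    then show "4 * fst (lm t) = qx (qx F) (0, t) - qy (qy F) (0, t)" using hess by fastforce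
  qed
  have mixed: "((\<lambda>t. qx (qy F) (0, t)) has_real_derivative 2 * snd v) (at 0)"
  proof (rule has_field_derivative_transform_within_open[OF DERIV_cmult[OF lmd(2), of 2] ball(2,1)])
    fix t assume "t \<in> {-\<tau><..<\<tau>}"
    then have "\<bar>t\<bar> < \<tau>" by (simp add: abs_less_iff)
    then show "2 * snd (lm t) = qx (qy F) (0, t)" using hess by fastforce
  qed
  have "umbilic_deformation F U \<tau> \<rho> a b c (fst v) (snd v)"
    by (unfold_locales; (rule U tau sF h0 \<rho>(1) k0 bc diag mixed tv | erule grad))
  then obtain R1 a1 a2 where "umbilic_blowup F U \<tau> \<rho> a b c (fst v) (snd v) R1 a1 a2"
    using umbilic_deformation.blowup_ex by blast
  then interpret B: umbilic_blowup F U \<tau> \<rho> a b c "fst v" "snd v" R1 a1 a2 .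
  have "\<forall>q\<in>U. f t q = F (q, t)" for t using fF by blast
  moreover have "\<forall>q\<in>U. f0 q = F (q, 0)" using f0F by blast
  ultimately obtain A B R0 \<tau>0 P Q \<beta> where fam: "umbilic_family A B R0 \<tau>0 P Q \<beta> (vertex_set f0) (\<lambda>t. vertex_set (f t))"
    using B.family_ex[of f f0] by blast
  have "umbilic_polar A B R0 \<tau>0 P Q" using fam by (rule umbilic_family.axioms(1))
  then obtain R' \<tau>' th where "umbilic_sectors A B R0 \<tau>0 P Q R' \<tau>' th" using umbilic_polar.sectors_ex by blast
  then obtain \<rho>' \<tau>1 c1 C1 where chart: "umbilic_chart A B R0 \<tau>0 P Q R' \<tau>' th \<rho>' \<tau>1 c1 C1"
    using umbilic_sectors.chart_ex by blast
  have VV: "V = (\<lambda>t. vertex_set (f t))" by (rule ext) (rule assms(16))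
  interpret umbilic_all A B R0 \<tau>0 P Q R' \<tau>' th \<rho>' \<tau>1 c1 C1 \<beta> "vertex_set f0" V
    unfolding VV by (rule umbilic_all.intro[OF chart fam])
  have "\<rho>' > 0" using rho by simp
  then show ?thesis using branches_swap by blast
qed

end
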